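(* Let $\Phi:[0,\infty)\to[0,\infty)$ be a Young's function such that $$\Psi(t)=\frac{t\log(e+t)}{\Phi(t)}\to\infty\quad\text{as } t\to\infty .$$ Then there exists a function $\Omega\in \Phi(L)(\mathbb S^1)$ with $\int_{\mathbb S^1}\Omega(\theta)\,d\theta=0$ such that, for $1<p<\infty$, the rough singular integral operator $T_\Omega$ is bounded on $L^p(\mathbb R^2)$ if and only if $p=2$. In particular, $T_\Omega$ does not map $L^1(\mathbb R^2)$ to $L^{1,\infty}(\mathbb R^2)$ (that is, $T_\Omega$ is not of weak type $(1,1)$).
   Context: Young's function: a function $\Phi:[0,\infty)\to[0,\infty)$ for which there exists an increasing and left continuous function $\phi:[0,\infty)\to[0,\infty)$ with $\phi(0)=0$ such that $\Phi(t)=\int_0^t\phi(u)\,du$, and $\frac{\Phi(t)}{t}\to\infty$ as $t\to\infty$. The class $\Phi(L)(\mathbb S^1)$: a (measurable, real-valued) function $\Omega$ on the unit circle $\mathbb S^1\subset\mathbb R^2$ belongs to $\Phi(L)(\mathbb S^1)$ if $\int_{\mathbb S^1}\Phi(|\Omega(\theta)|)\,d\theta<\infty$, where $d\theta$ is the arc length measure on $\mathbb S^1$. Rough singular integral: for $\Omega\in L^1(\mathbb S^1)$ with $\int_{\mathbb S^1}\Omega(\theta)\,d\theta=0$, $$T_\Omega f(x)=\mathrm{p.v.}\int_{\mathbb R^2}\frac{1}{|x-y|^2}\,\Omega\Bigl(\frac{x-y}{|x-y|}\Bigr)f(y)\,dy ,$$ defined initially on nice functions $f$ (e.g. $f\in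 C_c^\infty(\mathbb R^2)$). "$T_\Omega$ is bounded on $L^p(\mathbb R^2)$" means that there is a constant $C$ with $\|T_\Omega f\|_{L^p}\le C\|f\|_{L^p}$ for all such $f$; "$T_\Omega$ maps $L^1(\mathbb R^2)$ to $L^{1,\infty}(\mathbb R^2)$" means that there is a constant $C$ with $|\{x:|T_\Omega f(x)|>\lambda\}|\le C\lambda^{-1}\|f\|_{L^1}$ for all such $f$ and all $\lambda>0$. *)

theory Defs
  imports "HOL-Analysis.Analysis"
begin

text \<open>"Increasing" is read in the weak sense. A function on \<open>[0,\<infinity>)\<close> is represented by a
  function on all reals whose values at negative arguments are irrelevant.\<close>

definition young_function :: "(real \<Rightarrow> real) \<Rightarrow> bool" where
  "young_function \<Phi> \<longleftrightarrow>
     (\<exists>\<phi>::real \<Rightarrow> real.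
        (\<forall>u\<ge>0. \<phi> u \<ge> 0) \<and> mono_on {0..} \<phi> \<and>
        (\<forall>u>0. continuous (at_left u) \<phi>) \<and> \<phi> 0 = 0 \<and>
        (\<forall>t\<ge>0. \<Phi> t = integral {0..t} \<phi>)) \<and>
     filterlim (\<lambda>t. \<Phi> t / t) at_top at_top"

abbreviation unit_circle :: "(real^2) set" where
  "unit_circle \<equiv> sphere 0 1"

definition arc_length :: "(real^2) measure" where
  "arc_length =
     distr (restrict_space lborel {0..<2*pi}) (restrict_space borel unit_circle)
       (\<lambda>\<theta>. vector [cos \<theta>, sin \<theta>])"

definition class_\<Phi>L :: "(real \<Rightarrow> real) \<Rightarrow> (real^2 \<Rightarrow> real) set" where
  "class_\<Phi>L \<Phi> =
     {\<Omega>. \<Omega> \<in> borel_measurable arc_length \<and>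
         (\<integral>\<^sup>+\<theta>. ennreal (\<Phi> \<bar>\<Omega> \<theta>\<bar>) \<partial>arc_length) < \<infinity>}"

text \<open>The truncated integrals are absolutely convergent and the principal value exists at every
  point when \<open>\<Omega>\<close> is integrable with mean zero over the circle and \<open>f\<close> is a test function.\<close>

definition rough_T :: "(real^2 \<Rightarrow> real) \<Rightarrow> (real^2 \<Rightarrow> complex) \<Rightarrow> real^2 \<Rightarrow> complex" where
  "rough_T \<Omega> f x =
     Lim (at_right 0)
       (\<lambda>\<epsilon>. LINT y:{y. norm (x - y) > \<epsilon>}|lborel.
              (1 / (norm (x - y))\<^sup>2 * \<Omega> ((x - y) /\<^sub>R norm (x - y))) *\<^sub>R f y)"

primrec Ck :: "nat \<Rightarrow> ('a::real_normed_vector \<Rightarrow> 'b::real_normed_vector) \<Rightarrow> bool" where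
  "Ck 0 f \<longleftrightarrow> continuous_on UNIV f"
| "Ck (Suc k) f \<longleftrightarrow>
     (\<forall>x. f differentiable (at x)) \<and> (\<forall>v. Ck k (\<lambda>x. frechet_derivative f (at x) v))"

definition test_functions :: "(real^2 \<Rightarrow> complex) set" where
  "test_functions = {f. (\<forall>k. Ck k f) \<and> compact (closure {x. f x \<noteq> 0})}"

definition Lp_space :: "real \<Rightarrow> (real^2 \<Rightarrow> complex) set" where
  "Lp_space p =
     {f. f \<in> borel_measurable lborel \<and> integrable lborel (\<lambda>x. norm (f x) powr p)}"

definition Lp_norm :: "real \<Rightarrow> (real^2 \<Rightarrow> complex) \<Rightarrow> real" where
  "Lp_norm p f = (LINT x|lborel. norm (f x) powr p) powr (1 / p)"

text \<open>Membership in \<open>L\<^sup>p\<close> is required explicitly because \<^const>\<open>Lp_norm\<close> is real-valued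
  and vanishes on functions that are not \<open>p\<close>-integrable.\<close>

definition bounded_on_Lp ::
    "((real^2 \<Rightarrow> complex) \<Rightarrow> real^2 \<Rightarrow> complex) \<Rightarrow> real \<Rightarrow> bool" where
  "bounded_on_Lp T p \<longleftrightarrow>
     (\<exists>C::real. \<forall>f\<in>test_functions. T f \<in> Lp_space p \<and> Lp_norm p (T f) \<le> C * Lp_norm p f)"

definition weak_type_1_1 :: "((real^2 \<Rightarrow> complex) \<Rightarrow> real^2 \<Rightarrow> complex) \<Rightarrow> bool" where
  "weak_type_1_1 T \<longleftrightarrow>
     (\<exists>C::real. \<forall>f\<in>test_functions. \<forall>s>0.
        emeasure lborel {x. norm (T f x) > s} \<le> ennreal (C / s * Lp_norm 1 f))"

end

theory Submission
  imports Defs "HOL-Real_Asymp.Real_Asymp"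
begin

text \<open>The kernel is supported on a sector and described in slope coordinates \<open>y = r (1, \<tau>)\<close> by a
  density \<open>g\<close> on \<open>[0, 1]\<close> of mean zero. Up to a constant, the multiplier of the operator in the
  direction \<open>(-t, 1)\<close> is the convolution of \<open>g\<close> at \<open>t\<close> with \<open>- ln \<bar>\<cdot>\<bar>\<close> plus a bounded function, so a
  uniform bound for the logarithmic potential of \<open>\<bar>g\<bar>\<close> gives boundedness on \<open>L\<^sup>2\<close>.
  A spike of width \<open>d\<close> and mass \<open>m\<close> moves the multiplier at its foot by about \<open>m ln (1 / d)\<close>. At the
  stage \<open>j\<close> the density has spikes at \<open>N = 2 ^ (2 j\<^sup>2 + 1)\<close> equally spaced slopes, with Rudin-Shapiro signs
  and with masses that make this effect exactly \<open>2 ^ (- j)\<close>; since \<open>\<Phi>(t) = o(t ln t)\<close>, the spikes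
  contribute to the \<open>\<Phi>\<close>-modular as little as desired when they are thin enough. By transference to
  trigonometric polynomials, a weak type \<open>(p, p)\<close> bound would hold uniformly for multiplication of
  the coefficients by \<open>\<kappa> + 2 ^ (- j) \<epsilon>(n)\<close>, \<open>\<epsilon>\<close> being the Rudin-Shapiro signs. That map exchanges
  the Dirichlet kernel with the flat Rudin-Shapiro polynomial, so for \<open>p \<noteq> 2\<close> its norm grows like
  \<open>2 ^ (- j)\<close> times a positive power of \<open>N\<close>, which is unbounded.\<close>

section \<open>Slope coordinates in the plane\<close>

text \<open>L log L is the exact threshold because of the balance of one spike. For width d and mass
  m the height is m/d, the effect on the multiplier is about m ln(1/d), and the L log L modular d
  (m/d) ln(m/d) is of the same order once the effect is prescribed. Any gain over t ln t thus makes
  the modular of N spikes of fixed effect small, provided that N is fixed first and d chosen last.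
  The obstacle is to destroy all p other than 2 with one density and yet keep L2. The spikes of a
  stage have a fixed gap while their masses tend to 0 with d, so any point feels at most one of them
  through the logarithm: a stage costs O(2^-j) on L2, however many spikes it has. The nodes of a
  stage fill an interval so short, compared with its distance to the other stages, that the latter
  contribute nearly a constant there, the number \<kappa>. Errors must be below 2^-j / N and not
  merely small, because N frequencies are summed afterwards. The refuted property is of weak type
  throughout, which puts p = 1 on the same footing as the other exponents.\<close>

abbreviation lborel2 :: "(real \<times> real) measure" where
  "lborel2 \<equiv> lborel \<Otimes>\<^sub>M lborel"

definition pt :: "real \<Rightarrow> real \<Rightarrow> real^2" where
  "pt a b = vector [a, b]"

lemma pt_nth [simp]: "pt a b $ 1 = a" "pt a b $ 2 = b"
  by (simp_all add: pt_def)

lemma vec2_eq_iff: "(x::real^2) = y \<longleftrightarrow> x $ 1 = y $ 1 \<and> x $ 2 = y $ 2"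
  by (auto simp: vec_eq_iff forall_2)

lemma pt_eta [simp]: "pt (x $ 1) (x $ 2) = x"
  by (simp add: vec2_eq_iff)

lemma inner_vec2: "(x::real^2) \<bullet> y = x $ 1 * y $ 1 + x $ 2 * y $ 2"
  by (simp add: inner_vec_def UNIV_2)

lemma norm_vec2: "norm (x::real^2) = sqrt ((x $ 1)\<^sup>2 + (x $ 2)\<^sup>2)"
  by (simp add: norm_eq_sqrt_inner inner_vec2 power2_eq_square)

lemma norm_pt: "norm (pt a b) = sqrt (a\<^sup>2 + b\<^sup>2)"
  by (simp add: norm_vec2)

lemma pt_scaleR: "r *\<^sub>R pt a b = pt (r * a) (r * b)"
  by (simp add: vec2_eq_iff)

lemma pt_eq: "pt a b = a *\<^sub>R axis 1 1 + b *\<^sub>R axis 2 1"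
  by (simp add: vec2_eq_iff axis_def)

lemma continuous_on_pt [continuous_intros]:
  "continuous_on S f \<Longrightarrow> continuous_on S g \<Longrightarrow> continuous_on S (\<lambda>x. pt (f x) (g x))"
  unfolding pt_eq by (intro continuous_intros)

lemma borel_measurable_pt [measurable (raw)]:
  assumes "f \<in> borel_measurable M" "g \<in> borel_measurable M"
  shows "(\<lambda>x. pt (f x) (g x)) \<in> borel_measurable M"
  unfolding pt_eq using assms by measurable

lemma borel_measurable_vec2_nth [measurable]: "(\<lambda>x::real^2. x $ i) \<in> borel_measurable borel"
  by (intro borel_measurable_continuous_onI continuous_intros)

lemma Basis_vec2: "(Basis :: (real^2) set) = {axis 1 1, axis 2 1}"
  by (auto simp: Basis_vec_def UNIV_2)

lemma axis_12_neq: "axis 1 (1::real) \<noteq> (axis 2 1 :: real^2)"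
  by (simp add: axis_eq_axis)

text \<open>Fubini and the slope coordinates work on pairs of reals, while the problem lives on
  \<open>real^2\<close>. A measure is Lebesgue measure as soon as it is right on open boxes.\<close>

lemma lborel_pt:
  "distr lborel2 borel (\<lambda>(a, b). pt a b) = (lborel :: (real^2) measure)"
proof (rule lborel_eqI[symmetric])
  fix l u :: "real^2"
  assume *: "\<And>b. b \<in> Basis \<Longrightarrow> l \<bullet> b \<le> u \<bullet> b"
  have le: "l $ 1 \<le> u $ 1" "l $ 2 \<le> u $ 2"
    using *[of "axis 1 1"] *[of "axis 2 1"] by (simp_all add: Basis_vec2 inner_axis)
  have pre: "(\<lambda>(a, b). pt a b) -` box l u = {l$1<..<u$1} \<times> {l$2<..<u$2}"
    by (auto simp: mem_box Basis_vec2 inner_axis)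
  have "emeasure (distr lborel2 borel (\<lambda>(a, b). pt a b)) (box l u)
      = emeasure lborel2 ((\<lambda>(a, b). pt a b) -` box l u)"
    by (subst emeasure_distr) (auto simp: space_pair_measure)
  also have "\<dots> = ennreal ((u$1 - l$1) * (u$2 - l$2))"
    unfolding pre using le by (simp add: lborel.emeasure_pair_measure_Times ennreal_mult)
  also have "(u$1 - l$1) * (u$2 - l$2) = prod ((\<bullet>) (u - l)) Basis"
    using axis_12_neq by (simp add: Basis_vec2 inner_axis)
  finally show "emeasure (distr lborel2 borel (\<lambda>(a, b). pt a b)) (box l u)
      = ennreal (prod ((\<bullet>) (u - l)) Basis)" .
qed simp

lemma nn_integral_pt:
  assumes [measurable]: "F \<in> borel_measurable borel"
  shows "(\<integral>\<^sup>+x. F x \<partial>(lborel :: (real^2) measure)) = (\<integral>\<^sup>+a. \<integral>\<^sup>+b. F (pt a b) \<partial>lborel \<partial>lborel)"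
proof -
  have "(\<integral>\<^sup>+x. F x \<partial>(lborel :: (real^2) measure))
      = (\<integral>\<^sup>+z. F (case z of (a, b) \<Rightarrow> pt a b) \<partial>lborel2)"
    by (subst lborel_pt[symmetric], subst nn_integral_distr) auto
  also have "\<dots> = (\<integral>\<^sup>+a. \<integral>\<^sup>+b. F (pt a b) \<partial>lborel \<partial>lborel)"
    by (subst lborel.nn_integral_fst[symmetric]) auto
  finally show ?thesis .
qed

text \<open>The weight is the Jacobian of \<open>(r, \<tau>) \<mapsto> (r, r * \<tau>)\<close>, cut
  off to the half plane \<open>r > 0\<close>.\<close>

definition slope_measure :: "(real \<times> real) measure" where
  "slope_measure = density lborel2 (\<lambda>z. ennreal (if 0 < fst z then fst z else 0))"

lemma slope_measure_distr:
  "distr slope_measure borel (\<lambda>(r, \<tau>). pt r (r * \<tau>)) = density lborel (indicator {y. 0 < y $ 1})"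
proof (rule measure_eqI)
  fix A :: "(real^2) set"
  assume "A \<in> sets (distr slope_measure borel (\<lambda>(r, \<tau>). pt r (r * \<tau>)))"
  then have [measurable]: "A \<in> sets borel" by simp
  have "emeasure (distr slope_measure borel (\<lambda>(r, \<tau>). pt r (r * \<tau>))) A
      = (\<integral>\<^sup>+y. indicator A y \<partial>distr slope_measure borel (\<lambda>(r, \<tau>). pt r (r * \<tau>)))"
    by simp
  also have "\<dots> = (\<integral>\<^sup>+z. ennreal (if 0 < fst z then fst z else 0) * indicator A (pt (fst z) (fst z * snd z))
                        \<partial>lborel2)"
    unfolding slope_measure_def
    by (subst nn_integral_distr, simp, measurable)
       (subst nn_integral_density, simp_all add: case_prod_beta)
  also have "\<dots> = (\<integral>\<^sup>+r. \<integral>\<^sup>+\<tau>. ennreal (if 0 < r then r else 0) * indicator A (pt r (r * \<tau>)) \<partial>lborel \<partial>lborel)"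
    by (subst lborel.nn_integral_fst[symmetric]) (simp_all cong: if_cong)
  also have "\<dots> = (\<integral>\<^sup>+r. \<integral>\<^sup>+b. indicator {y. 0 < y $ 1} (pt r b) * indicator A (pt r b) \<partial>lborel \<partial>lborel)"
  proof (rule nn_integral_cong)
    fix r :: real
    show "(\<integral>\<^sup>+\<tau>. ennreal (if 0 < r then r else 0) * indicator A (pt r (r * \<tau>)) \<partial>lborel)
        = (\<integral>\<^sup>+b. indicator {y. 0 < y $ 1} (pt r b) * indicator A (pt r b) \<partial>lborel)"
    proof (cases "0 < r")
      case True
      \<comment> \<open>For fixed \<open>r > 0\<close> the substitution
        \<open>b = r * \<tau>\<close> in the second coordinate produces the Jacobian.\<close>
      then have "(\<integral>\<^sup>+b. indicator A (pt r b) \<partial>lborel) = ennreal r * (\<integral>\<^sup>+\<tau>. indicator A (pt r (r * \<tau>)) \<partial>lborel)"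
        by (subst nn_integral_real_affine[where c=r and t=0]) auto
      with True show ?thesis by (simp add: nn_integral_cmult)
    qed simp
  qed
  also have "\<dots> = (\<integral>\<^sup>+y. indicator {y. 0 < y $ 1} y * indicator A y \<partial>lborel)"
    by (subst nn_integral_pt) auto
  also have "\<dots> = emeasure (density lborel (indicator {y. 0 < y $ 1})) A"
    by (subst emeasure_density) auto
  finally show "emeasure (distr slope_measure borel (\<lambda>(r, \<tau>). pt r (r * \<tau>))) A
    = emeasure (density lborel (indicator {y. 0 < y $ 1})) A" .
qed (simp add: slope_measure_def)

lemma integral_slope:
  fixes F :: "real^2 \<Rightarrow> 'a::{banach, second_countable_topology}"
  assumes [measurable]: "F \<in> borel_measurable borel" and 0: "\<And>y. y $ 1 \<le> 0 \<Longrightarrow> F y = 0"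
  shows "(LINT y|lborel. F y)
       = (LINT z|lborel2. (if 0 < fst z then fst z else 0) *\<^sub>R F (pt (fst z) (fst z * snd z)))"
proof -
  have "(LINT y|lborel. F y) = (LINT y|lborel. indicator {y. 0 < y $ 1} y *\<^sub>R F y)"
    by (rule Bochner_Integration.integral_cong) (auto simp: indicator_def 0)
  also have "\<dots> = (LINT y|density lborel (\<lambda>y. ennreal (indicator {y. 0 < y $ 1} y)). F y)"
    by (subst integral_density) auto
  also have "density lborel (\<lambda>y. ennreal (indicator {y. 0 < y $ 1} y))
       = distr slope_measure borel (\<lambda>(r, \<tau>). pt r (r * \<tau>))"
    unfolding slope_measure_distr ennreal_indicator ..
  also have "(LINT y|\<dots>. F y) = (LINT z|slope_measure. F (pt (fst z) (fst z * snd z)))"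
    by (subst integral_distr) (auto simp: slope_measure_def case_prod_beta)
  also have "\<dots> = (LINT z|lborel2. (if 0 < fst z then fst z else 0) *\<^sub>R F (pt (fst z) (fst z * snd z)))"
    unfolding slope_measure_def by (subst integral_density) (auto simp: case_prod_beta)
  finally show ?thesis .
qed

lemma integral_reflect:
  fixes G :: "real^2 \<Rightarrow> 'a::{banach, second_countable_topology}"
  assumes [measurable]: "G \<in> borel_measurable borel"
  shows "(LINT y|lborel. G y) = (LINT y|lborel. G (x - y))"
proof -
  have 1: "(lborel :: (real^2) measure) = distr lborel borel (\<lambda>y. x - y)"
    using lborel_affine[of "-1" x] by (simp add: density_1)
  show ?thesis
    by (subst 1, subst integral_distr) auto
qed

lemma integral_fst_snd:
  fixes a b :: "real \<Rightarrow> 'a::{real_normed_field, banach, second_countable_topology}"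
  assumes a: "integrable lborel a" and b: "integrable lborel b"
  shows "integrable lborel2 (\<lambda>z. a (fst z) * b (snd z))"
    and "(LINT z|lborel2. a (fst z) * b (snd z)) = (LINT x|lborel. a x) * (LINT y|lborel. b y)"
proof -
  have [measurable]: "a \<in> borel_measurable borel" "b \<in> borel_measurable borel"
    using assms by auto
  show int: "integrable lborel2 (\<lambda>z. a (fst z) * b (snd z))"
  proof (rule lborel_pair.Fubini_integrable)
    show "(\<lambda>z. a (fst z) * b (snd z)) \<in> borel_measurable lborel2" by measurable
    show "integrable lborel (\<lambda>x. LINT y|lborel. norm (a (fst (x, y)) * b (snd (x, y))))"
      using assms by (simp add: norm_mult)
    show "AE x in lborel. integrable lborel (\<lambda>y. a (fst (x, y)) * b (snd (x, y)))"
      using assms by simp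
  qed
  show "(LINT z|lborel2. a (fst z) * b (snd z)) = (LINT x|lborel. a x) * (LINT y|lborel. b y)"
    using lborel_pair.integral_fst'[OF int] assms by simp
qed

lemma integral_inverse_interval:
  fixes a b :: real
  assumes "0 < a" "a \<le> b"
  shows "integrable lborel (\<lambda>r. indicator {a..b} r / r)"
    and "(LINT r|lborel. indicator {a..b} r / r) = ln (b / a)"
proof -
  have *: "set_integrable lborel {a..b} (\<lambda>r. 1 / r)"
    unfolding set_integrable_def using assms
    by (intro borel_integrable_compact) (auto intro!: continuous_intros)
  then show "integrable lborel (\<lambda>r. indicator {a..b} r / r)"
    by (simp add: set_integrable_def)
  have "((\<lambda>r. 1 / r) has_integral (ln b - ln a)) {a..b}"
    using assms
    by (intro fundamental_theorem_of_calculus)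
       (auto intro!: derivative_eq_intros simp: has_real_derivative_iff_has_vector_derivative[symmetric])
  then have "(LINT r:{a..b}|lborel. 1 / r) = ln b - ln a"
    using set_borel_integral_eq_integral(2)[OF *] by (simp add: integral_unique)
  then show "(LINT r|lborel. indicator {a..b} r / r) = ln (b / a)"
    using assms by (simp add: set_lebesgue_integral_def ln_div)
qed

section \<open>The singular integral with a slope density\<close>

text \<open>This is the regularity at which the principal value converges absolutely. Both constants
  are explicit parameters because they appear in the dominating functions.\<close>

definition lipschitz_bounded_support :: "(real^2 \<Rightarrow> complex) \<Rightarrow> real \<Rightarrow> real \<Rightarrow> bool" where
  "lipschitz_bounded_support f C K \<longleftrightarrow> 0 \<le> C \<and> 0 \<le> K \<and>
     (\<forall>x y. norm (f x - f y) \<le> C * norm (x - y)) \<and> (\<forall>x. K \<le> norm x \<longrightarrow> f x = 0)"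

lemma lipschitz_bounded_support_continuous:
  assumes "lipschitz_bounded_support f C K"
  shows "continuous_on S f"
proof -
  have "C-lipschitz_on S f"
    using assms by (auto simp: lipschitz_bounded_support_def lipschitz_on_def dist_norm)
  then show ?thesis by (rule lipschitz_on_continuous_on)
qed

lemma lipschitz_bounded_support_measurable:
  "lipschitz_bounded_support f C K \<Longrightarrow> f \<in> borel_measurable borel"
  by (intro borel_measurable_continuous_onI lipschitz_bounded_support_continuous)

text \<open>Inside the ball of radius \<open>K\<close> the point \<open>x\<close> is compared with
  \<open>pt K 0\<close>, where \<open>f\<close> vanishes; their distance is at most
  \<open>2 * K\<close>.\<close>

lemma lipschitz_bounded_support_bound:
  assumes "lipschitz_bounded_support f C K"
  shows "norm (f x) \<le> 2 * C * K"
proof (cases "K \<le> norm x")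
  case True
  then show ?thesis using assms by (simp add: lipschitz_bounded_support_def)
next
  case False
  have n: "norm (pt K 0) = K" using assms by (simp add: norm_pt lipschitz_bounded_support_def)
  then have "f (pt K 0) = 0" using assms by (simp add: lipschitz_bounded_support_def)
  then have "norm (f x) \<le> C * norm (x - pt K 0)"
    using assms unfolding lipschitz_bounded_support_def by (metis diff_zero)
  also have "\<dots> \<le> C * (K + K)"
    using assms False n norm_triangle_ineq4[of x "pt K 0"]
    by (intro mult_left_mono) (auto simp: lipschitz_bounded_support_def)
  finally show ?thesis by simp
qed

text \<open>For slopes in [0, 1] the parameter \<open>r\<close> of
  \<open>r *\<^sub>R pt 1 \<tau>\<close> and its norm differ by a factor between 1 and 2, so
  truncating in one or in the other makes a difference of a bounded logarithm only.\<close>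

lemma norm_pt_1_ge: "1 \<le> norm (pt 1 \<tau>)"
  by (simp add: norm_pt)

lemma norm_pt_1_le: "\<tau> \<in> {0..1} \<Longrightarrow> norm (pt 1 \<tau>) \<le> 2"
  unfolding norm_pt by (rule real_le_lsqrt) (auto simp: power2_eq_square intro: order_trans[OF mult_mono[of \<tau> 1 \<tau> 1]])

locale slope_kernel =
  fixes g :: "real \<Rightarrow> real"
  assumes g_integrable: "integrable lborel g"
    and g_support: "\<And>\<tau>. \<tau> \<notin> {0..1} \<Longrightarrow> g \<tau> = 0"
    and g_mean: "(LINT \<tau>|lborel. g \<tau>) = 0"
begin

lemma g_measurable [measurable]: "g \<in> borel_measurable borel"
  using g_integrable by auto

text \<open>The factor \<open>1 + \<tau>\<^sup>2\<close> cancels the one in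
  \<open>(norm y)\<^sup>2 = r\<^sup>2 * (1 + \<tau>\<^sup>2)\<close>: together with the Jacobian
  \<open>r\<close> the kernel becomes \<open>g \<tau> / r\<close>. The same factor turns arc length
  into Lebesgue measure in \<tau>, so that mean zero of \<open>g\<close> is mean zero on the
  circle.\<close>

definition Omega :: "real^2 \<Rightarrow> real" where
  "Omega v = (if 0 < v $ 1 then (1 + (v $ 2 / v $ 1)\<^sup>2) * g (v $ 2 / v $ 1) else 0)"

lemma Omega_measurable [measurable]: "Omega \<in> borel_measurable borel"
  unfolding Omega_def by measurable

text \<open>The multiple of \<open>f x\<close> subtracted for \<open>r < 1\<close> integrates to zero because \<open>g\<close> has mean zero; it
  makes the integral absolutely convergent.\<close>

definition pv_integrand :: "(real^2 \<Rightarrow> complex) \<Rightarrow> real^2 \<Rightarrow> real \<times> real \<Rightarrow> complex" where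
  "pv_integrand f x z =
     (if 0 < fst z
      then (g (snd z) / fst z) *\<^sub>R (f (x - fst z *\<^sub>R pt 1 (snd z)) - (if fst z < 1 then f x else 0))
      else 0)"

definition pv :: "(real^2 \<Rightarrow> complex) \<Rightarrow> real^2 \<Rightarrow> complex" where
  "pv f x = (LINT z|lborel2. pv_integrand f x z)"

text \<open>The profile \<open>\<rho>\<close> unifies two truncations: \<open>\<rho> = 1\<close>
  cuts at \<open>r = \<epsilon>\<close>, which suits the L2 estimate, and
  \<open>\<rho> \<tau> = sqrt (1 + \<tau>\<^sup>2)\<close> cuts at Euclidean distance
  \<open>\<epsilon>\<close>, as \<open>rough_T\<close> does.\<close>

definition pv_trunc :: "(real \<Rightarrow> real) \<Rightarrow> real \<Rightarrow> (real^2 \<Rightarrow> complex) \<Rightarrow> real^2 \<Rightarrow> complex" where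
  "pv_trunc \<rho> \<epsilon> f x =
     (LINT z|lborel2. (if 0 < fst z \<and> \<epsilon> < fst z * \<rho> (snd z)
        then (g (snd z) / fst z) *\<^sub>R f (x - fst z *\<^sub>R pt 1 (snd z)) else 0))"

lemma pv_integrand_measurable [measurable]:
  assumes [measurable]: "f \<in> borel_measurable borel"
  shows "(\<lambda>(x, z). pv_integrand f x z) \<in> borel_measurable (borel \<Otimes>\<^sub>M lborel2)"
  unfolding pv_integrand_def case_prod_beta by measurable

lemma pv_integrand_measurable':
  assumes [measurable]: "f \<in> borel_measurable borel"
  shows "pv_integrand f x \<in> borel_measurable lborel2"
  unfolding pv_integrand_def by measurable

lemma pv_measurable:
  assumes [measurable]: "f \<in> borel_measurable borel"
  shows "pv f \<in> borel_measurable borel"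
  unfolding pv_def
  by (rule sigma_finite_measure.borel_measurable_lebesgue_integral) 
     (auto intro: pv_integrand_measurable[OF assms] lborel_pair.sigma_finite_measure_axioms)

text \<open>Three ranges of \<open>r\<close>: below 1 the Lipschitz bound absorbs the factor
  \<open>1 / r\<close>; up to \<open>K + norm x + 1\<close> the supremum of \<open>f\<close>
  suffices; beyond, \<open>x - r *\<^sub>R pt 1 \<tau>\<close> has left the support because
  \<open>norm (pt 1 \<tau>) \<ge> 1\<close>.\<close>

lemma pv_integrand_bound:
  assumes f: "lipschitz_bounded_support f C K"
  shows "norm (pv_integrand f x z)
    \<le> ((2 * C + 2 * C * K) * indicator {0..K + norm x + 1} (fst z)) * \<bar>g (snd z)\<bar>"
proof (cases "0 < fst z \<and> snd z \<in> {0..1}")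
  case False
  then show ?thesis
    using f g_support[of "snd z"] by (auto simp: pv_integrand_def lipschitz_bounded_support_def)
next
  case True
  obtain r \<tau> where z: "z = (r, \<tau>)" by (cases z)
  have r: "0 < r" and \<tau>: "\<tau> \<in> {0..1}" using True z by auto
  have CK: "0 \<le> C" "0 \<le> K" using f by (auto simp: lipschitz_bounded_support_def)
  define d where "d = f (x - r *\<^sub>R pt 1 \<tau>) - (if r < 1 then f x else 0)"
  have "norm d \<le> r * ((2 * C + 2 * C * K) * indicator {0..K + norm x + 1} r)"
  proof (cases "r < 1")
    case True
    have "norm d \<le> C * norm ((x - r *\<^sub>R pt 1 \<tau>) - x)"
    proof -
      have "norm (f (x - v) - f x) \<le> C * norm ((x - v) - x)" for v
        using f unfolding lipschitz_bounded_support_def by blast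
      from this[of "r *\<^sub>R pt 1 \<tau>"] show ?thesis using True by (simp add: d_def)
    qed
    also have "\<dots> = C * (r * norm (pt 1 \<tau>))" using r by simp
    also have "\<dots> \<le> C * (r * 2)"
      using norm_pt_1_le[OF \<tau>] r CK by (intro mult_left_mono) auto
    also have "\<dots> \<le> r * (2 * C + 2 * C * K)"
      using CK r by (simp add: algebra_simps)
    finally have "norm d \<le> r * (2 * C + 2 * C * K)" .
    moreover have "r \<le> K + norm x + 1" using True CK norm_ge_zero[of x] by linarith
    ultimately show ?thesis using r by simp
  next
    case False
    show ?thesis
    proof (cases "r \<le> K + norm x + 1")
      case True
      have "norm d \<le> 2 * C * K" 
        using False lipschitz_bounded_support_bound[OF f] by (simp add: d_def)
      also have "\<dots> \<le> 1 * (2 * C + 2 * C * K)" using CK by simp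
      also have "\<dots> \<le> r * (2 * C + 2 * C * K)"
        using False CK by (intro mult_right_mono) auto
      finally show ?thesis using True r by simp
    next
      case False2: False
      have "r * 1 \<le> r * norm (pt 1 \<tau>)" using r norm_pt_1_ge by (intro mult_left_mono) auto
      then have "r \<le> norm (r *\<^sub>R pt 1 \<tau>)" using r by simp
      then have "K \<le> norm (x - r *\<^sub>R pt 1 \<tau>)"
        using norm_triangle_ineq2[of "r *\<^sub>R pt 1 \<tau>" x] r False2 norm_minus_commute[of x "r *\<^sub>R pt 1 \<tau>"] by linarith
      then show ?thesis using False False2 f by (simp add: d_def lipschitz_bounded_support_def)
    qed
  qed
  then have "\<bar>g \<tau>\<bar> / r * norm d \<le> \<bar>g \<tau>\<bar> / r * (r * ((2 * C + 2 * C * K) * indicator {0..K + norm x + 1} r))"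
    using r by (intro mult_left_mono) auto
  then show ?thesis using r by (simp add: z pv_integrand_def d_def abs_mult mult_ac)
qed

lemma pv_dominating_integrable:
  "integrable lborel2 (\<lambda>z. (D * indicator {0..R} (fst z)) * \<bar>g (snd z)\<bar>)"
  using g_integrable by (intro integral_fst_snd(1)) (auto intro!: integrable_real_indicator simp: emeasure_lborel_Icc_eq)

lemma pv_integrand_integrable:
  assumes f: "lipschitz_bounded_support f C K"
  shows "integrable lborel2 (pv_integrand f x)"
  by (rule Bochner_Integration.integrable_bound[OF pv_dominating_integrable[of "2 * C + 2 * C * K" "K + norm x + 1"]])
     (auto intro!: AE_I2 order_trans[OF pv_integrand_bound[OF f]] pv_integrand_measurable'
        lipschitz_bounded_support_measurable[OF f] simp del: split_paired_All)

text \<open>For fixed \<tau> the integral of \<open>1 / r\<close> from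
  \<open>\<epsilon> / \<rho> \<tau>\<close> to 1 is
  \<open>ln (\<rho> \<tau>) - ln \<epsilon>\<close>. The divergent part does not depend on \<tau>
  and is annihilated by the mean zero of \<open>g\<close>, so the value is the same for every
  \<open>\<epsilon>\<close>.\<close>

lemma integral_g_log:
  assumes [measurable]: "\<rho> \<in> borel_measurable borel"
    and \<rho>: "\<And>\<tau>. \<tau> \<in> {0..1} \<Longrightarrow> 1 \<le> \<rho> \<tau> \<and> \<rho> \<tau> \<le> 2" and \<epsilon>: "0 < \<epsilon>" "\<epsilon> < 1"
  defines "k \<equiv> \<lambda>z. if 0 < fst z \<and> \<epsilon> < fst z * \<rho> (snd z) \<and> fst z < 1 then g (snd z) / fst z else 0"
  shows "integrable lborel2 k" "(LINT z|lborel2. k z) = (LINT \<tau>|lborel. g \<tau> * ln (\<rho> \<tau>))"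
proof -
  have kb: "norm (k z) \<le> (2 / \<epsilon> * indicator {0..1} (fst z)) * \<bar>g (snd z)\<bar>" for z
  proof (cases "0 < fst z \<and> \<epsilon> < fst z * \<rho> (snd z) \<and> fst z < 1 \<and> snd z \<in> {0..1}")
    case True
    then have "fst z * \<rho> (snd z) \<le> fst z * 2" using \<rho>[of "snd z"] by (intro mult_left_mono) auto
    then have "\<epsilon> \<le> fst z * 2" using True by linarith
    then have "1 / fst z \<le> 2 / \<epsilon>" using True \<epsilon> by (simp add: field_simps)
    then have "1 / fst z * \<bar>g (snd z)\<bar> \<le> 2 / \<epsilon> * \<bar>g (snd z)\<bar>" by (intro mult_right_mono) auto
    then show ?thesis using True by (simp add: k_def)
  qed (use \<epsilon> g_support[of "snd z"] in \<open>auto simp: k_def\<close>)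
  have km [measurable]: "k \<in> borel_measurable lborel2" unfolding k_def by measurable
  show int: "integrable lborel2 k"
    by (rule Bochner_Integration.integrable_bound[OF pv_dominating_integrable[of "2 / \<epsilon>" 1] km])
       (use \<epsilon> in \<open>auto intro!: AE_I2 order_trans[OF kb[unfolded real_norm_def]] simp del: split_paired_All\<close>)
  have inner: "(LINT r|lborel. k (r, \<tau>)) = g \<tau> * ln (\<rho> \<tau>) - ln \<epsilon> * g \<tau>" for \<tau>
  proof (cases "\<tau> \<in> {0..1}")
    case True
    have e: "0 < \<epsilon> / \<rho> \<tau>" "\<epsilon> / \<rho> \<tau> \<le> 1" using \<rho>[OF True] \<epsilon> by (auto simp: field_simps)
    have "(LINT r|lborel. k (r, \<tau>)) = (LINT r|lborel. g \<tau> * (indicator {\<epsilon> / \<rho> \<tau>..1} r / r))"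
    proof (rule integral_cong_AE)
      have "AE r in lborel. r \<noteq> \<epsilon> / \<rho> \<tau>" "AE r in lborel. r \<noteq> (1::real)"
        by (auto intro: AE_lborel_singleton)
      then show "AE r in lborel. k (r, \<tau>) = g \<tau> * (indicator {\<epsilon> / \<rho> \<tau>..1} r / r)"
      proof eventually_elim
        case (elim r)
        have "\<epsilon> < r * \<rho> \<tau> \<longleftrightarrow> \<epsilon> / \<rho> \<tau> < r" using \<rho>[OF True] by (simp add: field_simps)
        moreover have "\<epsilon> / \<rho> \<tau> < r \<Longrightarrow> 0 < r" using e by linarith
        ultimately show ?case using elim by (auto simp: k_def indicator_def)
      qed
    qed auto
    also have "\<dots> = g \<tau> * ln (1 / (\<epsilon> / \<rho> \<tau>))"
      unfolding integral_mult_right_zero integral_inverse_interval(2)[OF e] ..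
    also have "\<dots> = g \<tau> * ln (\<rho> \<tau>) - ln \<epsilon> * g \<tau>"
      using \<rho>[OF True] \<epsilon> by (simp add: ln_div algebra_simps)
    finally show ?thesis .
  next
    case False
    then have "k (r, \<tau>) = 0" for r by (simp add: k_def g_support)
    then show ?thesis using False by (simp add: g_support)
  qed
  have gl: "integrable lborel (\<lambda>\<tau>. g \<tau> * ln (\<rho> \<tau>))"
  proof (rule Bochner_Integration.integrable_bound[OF g_integrable])
    show "AE \<tau> in lborel. norm (g \<tau> * ln (\<rho> \<tau>)) \<le> norm (g \<tau>)"
    proof (rule AE_I2)
      fix \<tau> 
      show "norm (g \<tau> * ln (\<rho> \<tau>)) \<le> norm (g \<tau>)"
      proof (cases "\<tau> \<in> {0..1}")
        case True
        then have "0 \<le> ln (\<rho> \<tau>)" "ln (\<rho> \<tau>) \<le> 1"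
          using \<rho>[OF True] ln_le_minus_one[of "\<rho> \<tau>"] by auto
        then show ?thesis by (simp add: abs_mult mult_left_le)
      qed (simp add: g_support)
    qed
  qed simp
  have "(LINT z|lborel2. k z) = (LINT \<tau>|lborel. LINT r|lborel. k (r, \<tau>))"
    using lborel_pair.integral_snd[of "\<lambda>r \<tau>. k (r, \<tau>)"] int by simp
  also have "\<dots> = (LINT \<tau>|lborel. g \<tau> * ln (\<rho> \<tau>)) - ln \<epsilon> * (LINT \<tau>|lborel. g \<tau>)"
    unfolding inner using gl g_integrable by simp
  finally show "(LINT z|lborel2. k z) = (LINT \<tau>|lborel. g \<tau> * ln (\<rho> \<tau>))" by (simp add: g_mean)
qed

text \<open>The truncated integrand is the cut-off of the absolutely convergent
  \<open>pv_integrand\<close>, plus the multiple of \<open>f x\<close> that was subtracted for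
  \<open>r < 1\<close>. The first part converges by domination, the second has an integral
  independent of \<open>\<epsilon>\<close>.\<close>

lemma pv_trunc_tendsto:
  assumes f: "lipschitz_bounded_support f C K"
    and [measurable]: "\<rho> \<in> borel_measurable borel"
    and \<rho>: "\<And>\<tau>. \<tau> \<in> {0..1} \<Longrightarrow> 1 \<le> \<rho> \<tau> \<and> \<rho> \<tau> \<le> 2"
  shows "((\<lambda>\<epsilon>. pv_trunc \<rho> \<epsilon> f x) \<longlongrightarrow> pv f x + (LINT \<tau>|lborel. g \<tau> * ln (\<rho> \<tau>)) *\<^sub>R f x) (at_right 0)"
proof (rule tendsto_at_right_sequentially)
  show "(0::real) < 1" by simp
  fix \<epsilon> :: "nat \<Rightarrow> real"
  assume \<epsilon>: "\<And>n. 0 < \<epsilon> n" "\<And>n. \<epsilon> n < 1" "\<epsilon> \<longlonglongrightarrow> 0"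
  note [measurable] = lipschitz_bounded_support_measurable[OF f] pv_integrand_measurable'
  define h where "h n z = (if \<epsilon> n < fst z * \<rho> (snd z) then pv_integrand f x z else 0)" for n z
  define k where "k n z = (if 0 < fst z \<and> \<epsilon> n < fst z * \<rho> (snd z) \<and> fst z < 1 then g (snd z) / fst z else 0)" for n z
  have [measurable]: "h n \<in> borel_measurable lborel2" for n
    unfolding h_def by measurable
  have hint: "integrable lborel2 (h n)" for n
    by (rule Bochner_Integration.integrable_bound[OF pv_integrand_integrable[OF f, of x]]) (auto simp: h_def)
  have eq: "pv_trunc \<rho> (\<epsilon> n) f x = (LINT z|lborel2. h n z) + (LINT \<tau>|lborel. g \<tau> * ln (\<rho> \<tau>)) *\<^sub>R f x" for n
  proof -
    note K = integral_g_log[OF \<open>\<rho> \<in> borel_measurable borel\<close> \<rho> \<epsilon>(1)[of n] \<epsilon>(2)[of n], folded k_def]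
    have "pv_trunc \<rho> (\<epsilon> n) f x = (LINT z|lborel2. h n z + k n z *\<^sub>R f x)"
      unfolding pv_trunc_def
      by (rule Bochner_Integration.integral_cong)
         (auto simp: h_def k_def pv_integrand_def algebra_simps)
    also have "\<dots> = (LINT z|lborel2. h n z) + (LINT z|lborel2. k n z) *\<^sub>R f x"
      using hint K(1) by simp
    finally show ?thesis using K(2) by simp
  qed
  have "(\<lambda>n. LINT z|lborel2. h n z) \<longlonglongrightarrow> (LINT z|lborel2. pv_integrand f x z)"
  proof (rule integral_dominated_convergence[OF _ _ integrable_norm[OF pv_integrand_integrable[OF f, of x]]])
    show "AE z in lborel2. (\<lambda>n. h n z) \<longlonglongrightarrow> pv_integrand f x z"
    proof (rule AE_I2)
      fix z
      show "(\<lambda>n. h n z) \<longlonglongrightarrow> pv_integrand f x z"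
      proof (cases "0 < fst z \<and> snd z \<in> {0..1}")
        case True
        then have "0 < fst z * \<rho> (snd z)" using \<rho>[of "snd z"] by (intro mult_pos_pos) auto
        then have "eventually (\<lambda>n. \<epsilon> n < fst z * \<rho> (snd z)) sequentially"
          using \<epsilon>(3) by (simp add: order_tendsto_iff)
        then have "eventually (\<lambda>n. h n z = pv_integrand f x z) sequentially"
          by (rule eventually_mono) (simp add: h_def)
        then show ?thesis by (rule tendsto_eventually)
      next
        case False
        then have 0: "pv_integrand f x z = 0" by (auto simp: pv_integrand_def g_support)
        then have "h n z = 0" for n by (simp add: h_def)
        then show ?thesis by (simp add: 0)
      qed
    qed
  qed (auto simp: h_def)
  then show "(\<lambda>n. pv_trunc \<rho> (\<epsilon> n) f x) \<longlonglongrightarrow> pv f x + (LINT \<tau>|lborel. g \<tau> * ln (\<rho> \<tau>)) *\<^sub>R f x"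
    unfolding eq pv_def by (intro tendsto_add tendsto_const)
qed

text \<open>The truncation of \<open>rough_T\<close> is at \<open>r * sqrt (1 + \<tau>\<^sup>2) = \<epsilon>\<close> rather than at \<open>r = \<epsilon>\<close>; the
  difference is the multiple \<open>c_g\<close> of the identity.\<close>

definition c_g :: real where
  "c_g = (LINT \<tau>|lborel. g \<tau> * ln (sqrt (1 + \<tau>\<^sup>2)))"

lemma rough_T_truncation:
  assumes [measurable]: "f \<in> borel_measurable borel"
  shows "(LINT y:{y. norm (x - y) > \<epsilon>}|lborel.
              (1 / (norm (x - y))\<^sup>2 * Omega ((x - y) /\<^sub>R norm (x - y))) *\<^sub>R f y)
       = pv_trunc (\<lambda>\<tau>. sqrt (1 + \<tau>\<^sup>2)) \<epsilon> f x"
proof -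
  define F where "F y = (if \<epsilon> < norm y then (1 / (norm y)\<^sup>2 * Omega (y /\<^sub>R norm y)) *\<^sub>R f (x - y) else 0)" for y
  have [measurable]: "F \<in> borel_measurable borel" unfolding F_def by measurable
  have "(LINT y:{y. norm (x - y) > \<epsilon>}|lborel.
              (1 / (norm (x - y))\<^sup>2 * Omega ((x - y) /\<^sub>R norm (x - y))) *\<^sub>R f y) = (LINT y|lborel. F (x - y))"
    unfolding set_lebesgue_integral_def
    by (rule Bochner_Integration.integral_cong) (auto simp: F_def)
  also have "\<dots> = (LINT y|lborel. F y)" by (rule integral_reflect[symmetric]) simp
  also have "\<dots> = (LINT z|lborel2. (if 0 < fst z then fst z else 0) *\<^sub>R F (pt (fst z) (fst z * snd z)))"
  proof (rule integral_slope)
    fix y :: "real^2" assume y: "y $ 1 \<le> 0"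
    then have "\<not> 0 < (y /\<^sub>R norm y) $ 1"
      by (simp add: mult_le_0_iff not_less)
    then show "F y = 0" by (simp add: F_def Omega_def)
  qed simp
  also have "\<dots> = pv_trunc (\<lambda>\<tau>. sqrt (1 + \<tau>\<^sup>2)) \<epsilon> f x"
    unfolding pv_trunc_def
  proof (rule Bochner_Integration.integral_cong[OF refl])
    fix z :: "real \<times> real"
    obtain r \<tau> where z: "z = (r, \<tau>)" by (cases z)
    show "(if 0 < fst z then fst z else 0) *\<^sub>R F (pt (fst z) (fst z * snd z))
      = (if 0 < fst z \<and> \<epsilon> < fst z * sqrt (1 + (snd z)\<^sup>2)
          then (g (snd z) / fst z) *\<^sub>R f (x - fst z *\<^sub>R pt 1 (snd z)) else 0)"
    proof (cases "0 < r")
      case True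
      have n: "norm (pt r (r * \<tau>)) = r * sqrt (1 + \<tau>\<^sup>2)"
      proof -
        have "r\<^sup>2 + (r * \<tau>)\<^sup>2 = r\<^sup>2 * (1 + \<tau>\<^sup>2)" by (simp add: algebra_simps power_mult_distrib)
        then show ?thesis using True by (simp add: norm_pt real_sqrt_mult)
      qed
      have pos: "0 < 1 + \<tau>\<^sup>2" by (simp add: add_pos_nonneg)
      have np: "0 < norm (pt r (r * \<tau>))" using n True pos by simp
      have O: "Omega (pt r (r * \<tau>) /\<^sub>R norm (pt r (r * \<tau>))) = (1 + \<tau>\<^sup>2) * g \<tau>"
        using np True by (simp add: Omega_def)
      have sq: "(norm (pt r (r * \<tau>)))\<^sup>2 = r\<^sup>2 * (1 + \<tau>\<^sup>2)"
        unfolding n using pos by (simp add: power_mult_distrib)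
      have "r * (1 / (r\<^sup>2 * (1 + \<tau>\<^sup>2)) * ((1 + \<tau>\<^sup>2) * g \<tau>)) = g \<tau> / r"
      proof -
        have "1 + \<tau>\<^sup>2 \<noteq> 0" using pos by simp
        then have "1 / (r\<^sup>2 * (1 + \<tau>\<^sup>2)) * ((1 + \<tau>\<^sup>2) * g \<tau>) = g \<tau> / r\<^sup>2" by simp
        then show ?thesis using True by (simp add: power2_eq_square)
      qed
      then have rF: "r *\<^sub>R F (pt r (r * \<tau>))
          = (if \<epsilon> < r * sqrt (1 + \<tau>\<^sup>2) then (g \<tau> / r) *\<^sub>R f (x - pt r (r * \<tau>)) else 0)"
        unfolding F_def O sq unfolding n by (simp only: scaleR_scaleR scaleR_zero_right if_distrib[of "scaleR r"])
      then show ?thesis using True by (simp add: z pt_scaleR)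
    qed (simp add: z)
  qed
  finally show ?thesis .
qed

lemma rough_T_Omega:
  assumes f: "lipschitz_bounded_support f C K"
  shows "rough_T Omega f x = pv f x + c_g *\<^sub>R f x"
proof -
  have \<rho>: "1 \<le> sqrt (1 + \<tau>\<^sup>2) \<and> sqrt (1 + \<tau>\<^sup>2) \<le> 2" if "\<tau> \<in> {0..1}" for \<tau> :: real
    using norm_pt_1_ge[of \<tau>] norm_pt_1_le[OF that] by (simp add: norm_pt)
  show ?thesis
    unfolding rough_T_def rough_T_truncation[OF lipschitz_bounded_support_measurable[OF f]] c_g_def
    by (rule tendsto_Lim) (use \<rho> in \<open>auto intro!: pv_trunc_tendsto[OF f]\<close>)
qed

end

section \<open>Superpositions of translations on L2\<close>

lemma lebesgue_integral_norm_bound: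
  fixes f :: "'m \<Rightarrow> 'a::{banach, second_countable_topology}"
  assumes "integrable M f" "integrable M g" "\<And>x. norm (f x) \<le> g x"
  shows "norm (LINT x|M. f x) \<le> (LINT x|M. g x)"
  using assms by (intro order_trans[OF integral_norm_bound integral_mono]) auto

section \<open>Trigonometric polynomials on a square and their density\<close>

definition planar_exp :: "real \<Rightarrow> int \<times> int \<Rightarrow> real^2 \<Rightarrow> complex" where
  "planar_exp \<omega> k x = cis (\<omega> * (of_int (fst k) * x $ 1 + of_int (snd k) * x $ 2))"

text \<open>Generated by monomials and sums, so that closure under products, and with it the passage
  from polynomial functions on the torus, goes by induction.\<close>

inductive planar_trig_poly :: "real \<Rightarrow> (real^2 \<Rightarrow> complex) \<Rightarrow> bool" for \<omega> where
  monom: "planar_trig_poly \<omega> (\<lambda>x. c * planar_exp \<omega> k x)"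
| add: "planar_trig_poly \<omega> P \<Longrightarrow> planar_trig_poly \<omega> Q \<Longrightarrow> planar_trig_poly \<omega> (\<lambda>x. P x + Q x)"

lemma planar_exp_mult: "planar_exp \<omega> k x * planar_exp \<omega> l x = planar_exp \<omega> (k + l) x"
  by (simp add: planar_exp_def cis_mult algebra_simps)

lemma planar_trig_poly_mult:
  assumes "planar_trig_poly \<omega> P" "planar_trig_poly \<omega> Q"
  shows "planar_trig_poly \<omega> (\<lambda>x. P x * Q x)"
  using assms(1)
proof induction
  case (monom c k)
  show ?case using assms(2)
  proof induction
    case (monom d l)
    have "(\<lambda>x. c * planar_exp \<omega> k x * (d * planar_exp \<omega> l x)) = (\<lambda>x. (c * d) * planar_exp \<omega> (k + l) x)"
      by (simp add: planar_exp_mult[symmetric] mult_ac)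
    then show ?case by (simp only: planar_trig_poly.monom)
  next
    case (add Q1 Q2)
    then show ?case using planar_trig_poly.add by (simp add: distrib_left)
  qed
next
  case (add P1 P2)
  then show ?case using planar_trig_poly.add by (simp add: distrib_right)
qed

lemma planar_trig_poly_const: "planar_trig_poly \<omega> (\<lambda>x. c)"
  using planar_trig_poly.monom[of \<omega> c 0] by (simp add: planar_exp_def)

lemma planar_trig_poly_cmult: "planar_trig_poly \<omega> P \<Longrightarrow> planar_trig_poly \<omega> (\<lambda>x. c * P x)"
  by (intro planar_trig_poly_mult planar_trig_poly_const)

lemma planar_trig_poly_cos_sin:
  shows "planar_trig_poly \<omega> (\<lambda>x. complex_of_real (cos (\<omega> * x $ 1)))" (is ?A)
    and "planar_trig_poly \<omega> (\<lambda>x. complex_of_real (sin (\<omega> * x $ 1)))" (is ?B)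
    and "planar_trig_poly \<omega> (\<lambda>x. complex_of_real (cos (\<omega> * x $ 2)))" (is ?C)
    and "planar_trig_poly \<omega> (\<lambda>x. complex_of_real (sin (\<omega> * x $ 2)))" (is ?D)
proof -
  have c: "complex_of_real (cos t) = (1/2) * cis t + (1/2) * cis (- t)"
    and s: "complex_of_real (sin t) = (- \<i>/2) * cis t + (\<i>/2) * cis (- t)" for t
    by (simp_all add: complex_eq_iff)
  note I = planar_trig_poly.intros(2)[OF planar_trig_poly.intros(1) planar_trig_poly.intros(1)]
  show ?A unfolding c using I[of \<omega> "1/2" "(1,0)" "1/2" "(-1,0)"] by (simp add: planar_exp_def)
  show ?B unfolding s using I[of \<omega> "- \<i>/2" "(1,0)" "\<i>/2" "(-1,0)"] by (simp add: planar_exp_def)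
  show ?C unfolding c using I[of \<omega> "1/2" "(0,1)" "1/2" "(0,-1)"] by (simp add: planar_exp_def)
  show ?D unfolding s using I[of \<omega> "- \<i>/2" "(0,1)" "\<i>/2" "(0,-1)"] by (simp add: planar_exp_def)
qed

text \<open>On the torus a real linear functional is a combination of the sines and cosines of the
  two angles. Sums and products of trigonometric polynomials stay in the class, so the induction
  over polynomial functions goes through.\<close>

lemma planar_trig_poly_of_real_polynomial:
  fixes G :: "complex \<times> complex \<Rightarrow> real"
  assumes "real_polynomial_function G"
  shows "planar_trig_poly \<omega> (\<lambda>x. complex_of_real (G (cis (\<omega> * x $ 1), cis (\<omega> * x $ 2))))"
  using assms
proof induction
  case (linear f)
  then interpret bounded_linear f .
  have dec: "(cis a, cis b) = cos a *\<^sub>R (1, 0) + sin a *\<^sub>R (\<i>, 0) + cos b *\<^sub>R (0, 1) + sin b *\<^sub>R (0, \<i>)" for a b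
    by (auto simp: complex_eq_iff)
  have "f (cis a, cis b) = f (1, 0) * cos a + f (\<i>, 0) * sin a + f (0, 1) * cos b + f (0, \<i>) * sin b" for a b
    unfolding dec[of a b] add scaleR by (simp add: mult.commute)
  then have eq: "complex_of_real (f (cis a, cis b)) = of_real (f (1, 0)) * of_real (cos a) + of_real (f (\<i>, 0)) * of_real (sin a)
      + of_real (f (0, 1)) * of_real (cos b) + of_real (f (0, \<i>)) * of_real (sin b)" for a b
    by simp
  show ?case unfolding eq
    by (intro planar_trig_poly.add planar_trig_poly_cmult planar_trig_poly_cos_sin)
next
  case (const c)
  then show ?case by (rule planar_trig_poly_const)
next
  case (add f g)
  then show ?case using planar_trig_poly.add by simp
next
  case (mult f g)
  then show ?case using planar_trig_poly_mult by simp
qed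

text \<open>The Parseval identity needs distinct frequencies, so coinciding ones are merged by
  adding coefficients over the union of the index sets.\<close>

lemma planar_trig_poly_sum:
  assumes "planar_trig_poly \<omega> P"
  shows "\<exists>I c. finite I \<and> P = (\<lambda>x. \<Sum>k\<in>I. c k * planar_exp \<omega> k x)"
  using assms
proof induction
  case (monom c k)
  show ?case by (rule exI[of _ "{k}"], rule exI[of _ "\<lambda>_. c"]) simp
next
  case (add P Q)
  obtain I c where I: "finite I" "P = (\<lambda>x. \<Sum>k\<in>I. c k * planar_exp \<omega> k x)"
    using add.IH(1) by (elim exE conjE) (rule that)
  obtain J d where J: "finite J" "Q = (\<lambda>x. \<Sum>k\<in>J. d k * planar_exp \<omega> k x)"
    using add.IH(2) by (elim exE conjE) (rule that)
  define e where "e k = (if k \<in> I then c k else 0) + (if k \<in> J then d k else 0)" for k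
  have "P x + Q x = (\<Sum>k\<in>I \<union> J. e k * planar_exp \<omega> k x)" for x
  proof -
    have "P x = (\<Sum>k\<in>I \<union> J. (if k \<in> I then c k else 0) * planar_exp \<omega> k x)"
      unfolding I(2) using I(1) J(1) by (intro sum.mono_neutral_cong_left) auto
    moreover have "Q x = (\<Sum>k\<in>I \<union> J. (if k \<in> J then d k else 0) * planar_exp \<omega> k x)"
      unfolding J(2) using I(1) J(1) by (intro sum.mono_neutral_cong_left) auto
    ultimately show ?thesis by (simp add: e_def distrib_right sum.distrib)
  qed
  then show ?case
    using I(1) J(1) by (intro exI[of _ "I \<union> J"] exI[of _ e]) (simp add: fun_eq_iff)
qed

definition open_square :: "real \<Rightarrow> (real^2) set" where
  "open_square A = {x. \<bar>x $ 1\<bar> < A \<and> \<bar>x $ 2\<bar> < A}"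

lemma open_square_borel [measurable]: "open_square A \<in> sets borel"
  unfolding open_square_def by measurable

text \<open>The condition \<open>K * \<omega> < pi\<close> puts the support of \<open>f\<close>
  inside a period square. The periodic extension is a function on the torus, read off through
  \<open>Arg\<close>; the jump of \<open>Arg\<close> at the negative axis is harmless since
  \<open>f\<close> vanishes at the corresponding points. Stone-Weierstrass on the torus provides the
  approximation.\<close>

lemma planar_trig_poly_approx:
  assumes f: "lipschitz_bounded_support f C K" and \<omega>: "0 < \<omega>" "K * \<omega> < pi" and e: "0 < e"
  shows "\<exists>P. planar_trig_poly \<omega> P \<and> (\<forall>x\<in>open_square (pi / \<omega>). norm (f x - P x) < e)"
proof -
  define S where "S = sphere (0::complex) 1 \<times> sphere (0::complex) 1"
  define F where "F p = f (pt (Arg (fst p) / \<omega>) (Arg (snd p) / \<omega>))" for p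
  have K: "0 \<le> K" using f by (simp add: lipschitz_bounded_support_def)
  have fcont: "continuous_on UNIV f" using f by (rule lipschitz_bounded_support_continuous)
  have neg: "cos (K * \<omega>) > -1"
    using cos_monotone_0_pi[of "K * \<omega>" pi] K \<omega> by simp
  \<comment> \<open>A point of the unit circle to the left of \<open>cos (K * \<omega>)\<close> has
    an angle beyond \<open>K * \<omega>\<close>, that is, it encodes a coordinate outside the
    support.\<close>
  have big: "K \<le> \<bar>Arg z\<bar> / \<omega>" if "norm z = 1" "Re z < cos (K * \<omega>)" for z
  proof (rule ccontr)
    assume "\<not> K \<le> \<bar>Arg z\<bar> / \<omega>"
    then have "\<bar>Arg z\<bar> \<le> K * \<omega>" using \<omega> by (simp add: field_simps)
    then have "cos (K * \<omega>) \<le> cos \<bar>Arg z\<bar>" using \<omega> K by (intro cos_monotone_0_pi_le) auto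
    also have "cos \<bar>Arg z\<bar> = Re z"
    proof -
      have "z \<noteq> 0" using that(1) by auto
      then have "cis (Arg z) = z" using that(1) by (simp add: cis_Arg sgn_div_norm)
      then have "Re z = cos (Arg z)" by (metis cis.simps(1))
      then show ?thesis by simp
    qed
    finally show False using that(2) by simp
  qed
  have F0: "F p = 0" if "p \<in> S" "Re (fst p) < cos (K * \<omega>) \<or> Re (snd p) < cos (K * \<omega>)" for p
  proof -
    have "K \<le> \<bar>Arg (fst p) / \<omega>\<bar> \<or> K \<le> \<bar>Arg (snd p) / \<omega>\<bar>"
      using that big[of "fst p"] big[of "snd p"] \<omega> by (auto simp: S_def)
    moreover have ab: "\<bar>a\<bar> \<le> norm (pt a b)" "\<bar>b\<bar> \<le> norm (pt a b)" for a b
      using component_le_norm_cart[of "pt a b" 1] component_le_norm_cart[of "pt a b" 2] by simp_all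
    ultimately have "K \<le> norm (pt (Arg (fst p) / \<omega>) (Arg (snd p) / \<omega>))"
      using ab(1)[of "Arg (fst p) / \<omega>" "Arg (snd p) / \<omega>"] ab(2)[of "Arg (snd p) / \<omega>" "Arg (fst p) / \<omega>"]
      by linarith
    then show ?thesis using f by (simp add: F_def lipschitz_bounded_support_def)
  qed
  have "continuous_on S F"
    unfolding continuous_on_eq_continuous_within
  proof
    fix p assume p: "p \<in> S"
    show "continuous (at p within S) F"
    proof (cases "Re (fst p) < cos (K * \<omega>) \<or> Re (snd p) < cos (K * \<omega>)")
      case True
      \<comment> \<open>On the part of \<open>U\<close> in the torus \<open>F\<close> is identically
        zero, so continuity at \<open>p\<close> holds even where \<open>Arg\<close> jumps.\<close>
      define U where "U = {q. Re (fst q) < cos (K * \<omega>) \<or> Re (snd q) < cos (K * \<omega>)}"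
      have "open U" unfolding U_def
        by (intro open_Collect_disj open_Collect_less continuous_intros)
      then have "eventually (\<lambda>q. q \<in> U) (at p within S)"
        using True by (intro eventually_at_topological[THEN iffD2] exI[of _ U]) (auto simp: U_def)
      moreover have "eventually (\<lambda>q. q \<in> S) (at p within S)" by (simp add: eventually_at_filter)
      ultimately have "eventually (\<lambda>q. F q = F p) (at p within S)"
        by eventually_elim (use F0 p True in \<open>auto simp: U_def\<close>)
      then show ?thesis unfolding continuous_within by (rule tendsto_eventually)
    next
      case False
      have nn: "z \<notin> \<real>\<^sub>\<le>\<^sub>0" if "norm z = 1" "\<not> Re z < cos (K * \<omega>)" for z
      proof
        assume "z \<in> \<real>\<^sub>\<le>\<^sub>0"
        then have "Im z = 0" "Re z \<le> 0" by (auto simp: complex_nonpos_Reals_iff)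
        then have "Re z = -1" using that(1) by (auto simp: cmod_def)
        then show False using that(2) neg by simp
      qed
      have "continuous (at p within S) (\<lambda>p. pt (Arg (fst p) / \<omega>) (Arg (snd p) / \<omega>))"
        unfolding pt_eq divide_inverse using False p
        by (intro continuous_intros continuous_within_compose3[where g=Arg and f=fst, unfolded o_def]
            continuous_within_compose3[where g=Arg and f=snd, unfolded o_def] continuous_at_Arg nn)
           (auto simp: S_def)
      moreover have "isCont f y" for y using fcont by (simp add: continuous_on_eq_continuous_at)
      ultimately show ?thesis unfolding F_def by (rule continuous_within_compose3[rotated])
    qed
  qed
  moreover have "compact S" by (simp add: S_def compact_Times)
  ultimately obtain G where G: "polynomial_function G" "\<And>p. p \<in> S \<Longrightarrow> norm (F p - G p) < e"
    using Stone_Weierstrass_polynomial_function[of S F e] e by blast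
  have RI: "real_polynomial_function (Re \<circ> G)" "real_polynomial_function (Im \<circ> G)"
    using G(1) unfolding polynomial_function_def by (auto intro: bounded_linear_Re bounded_linear_Im)
  define P where "P x = G (cis (\<omega> * x $ 1), cis (\<omega> * x $ 2))" for x :: "real^2"
  have P: "P = (\<lambda>x. complex_of_real ((Re \<circ> G) (cis (\<omega> * x $ 1), cis (\<omega> * x $ 2)))
       + \<i> * complex_of_real ((Im \<circ> G) (cis (\<omega> * x $ 1), cis (\<omega> * x $ 2))))"
    by (simp add: P_def fun_eq_iff complex_eq_iff)
  have "planar_trig_poly \<omega> P"
    unfolding P by (intro planar_trig_poly.add planar_trig_poly_cmult planar_trig_poly_of_real_polynomial RI)
  moreover have "norm (f x - P x) < e" if x: "x \<in> open_square (pi / \<omega>)" for x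
  proof -
    have A: "Arg (cis (\<omega> * x $ i)) = \<omega> * x $ i" if "i = 1 \<or> i = 2" for i :: 2
    proof -
      have "\<bar>x $ i\<bar> < pi / \<omega>" using x that by (auto simp: open_square_def)
      then have "\<bar>\<omega> * x $ i\<bar> < pi" using \<omega> by (simp add: abs_mult field_simps)
      then have "- pi < \<omega> * x $ i" "\<omega> * x $ i \<le> pi" by auto
      then show ?thesis by (intro Arg_cis) auto
    qed
    have "F (cis (\<omega> * x $ 1), cis (\<omega> * x $ 2)) = f x"
      unfolding F_def using A \<omega> by simp
    moreover have "(cis (\<omega> * x $ 1), cis (\<omega> * x $ 2)) \<in> S" by (simp add: S_def)
    ultimately show ?thesis using G(2)[of "(cis (\<omega> * x $ 1), cis (\<omega> * x $ 2))"] by (simp add: P_def)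
  qed
  ultimately show ?thesis by blast
qed

section \<open>Orthogonality of the exponentials and the Parseval identity on a square\<close>

lemma has_vector_derivative_cis_mult:
  "((\<lambda>r. cis (s * r)) has_vector_derivative \<i> * of_real s * cis (s * r)) (at r within T)"
  using exp_scaleR_has_vector_derivative_right[of "\<i> * of_real s" r T]
  by (simp add: cis_conv_exp scaleR_conv_of_real mult_ac)

lemma integral_cis_period:
  assumes \<omega>: "0 < \<omega>"
  shows "integrable lborel (\<lambda>a. indicator {- (pi / \<omega>)<..<pi / \<omega>} a *\<^sub>R cis (\<omega> * (of_int m * a)))" (is ?A)
    and "(LINT a|lborel. indicator {- (pi / \<omega>)<..<pi / \<omega>} a *\<^sub>R cis (\<omega> * (of_int m * a)))
       = (if m = 0 then of_real (2 * pi / \<omega>) else 0)" (is ?B)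
proof -
  have 1: "set_integrable lborel {- (pi / \<omega>)..pi / \<omega>} (\<lambda>a. cis (\<omega> * (of_int m * a)))"
    unfolding set_integrable_def using \<omega>
    by (intro borel_integrable_compact) (auto intro!: continuous_intros)
  have "((\<lambda>a. cis (\<omega> * (of_int m * a))) has_integral (if m = 0 then of_real (2 * pi / \<omega>) else 0)) {- (pi / \<omega>)..pi / \<omega>}"
  proof (cases "m = 0")
    case True
    then show ?thesis using has_integral_const_real[of "1::complex" "- (pi / \<omega>)" "pi / \<omega>"] \<omega>
      by (simp add: scaleR_conv_of_real)
  next
    case False
    define G where "G a = cis (\<omega> * (of_int m * a)) / (\<i> * of_real (\<omega> * of_int m))" for a
    have "((\<lambda>a. cis (\<omega> * (of_int m * a))) has_integral (G (pi / \<omega>) - G (- (pi / \<omega>)))) {- (pi / \<omega>)..pi / \<omega>}"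
    proof (rule fundamental_theorem_of_calculus)
      fix a
      have "((\<lambda>a. cis ((\<omega> * of_int m) * a)) has_vector_derivative \<i> * of_real (\<omega> * of_int m) * cis ((\<omega> * of_int m) * a))
          (at a within {- (pi / \<omega>)..pi / \<omega>})"
        by (rule has_vector_derivative_cis_mult)
      from has_vector_derivative_mult_right[OF this, of "1 / (\<i> * of_real (\<omega> * of_int m))"]
      show "(G has_vector_derivative cis (\<omega> * (of_int m * a))) (at a within {- (pi / \<omega>)..pi / \<omega>})"
        using \<omega> False by (simp add: G_def[abs_def] mult.assoc)
    qed (use \<omega> in auto)
    moreover have "cis (\<omega> * (of_int m * (pi / \<omega>))) = cis (\<omega> * (of_int m * - (pi / \<omega>)))"
    proof -
      have "cis (of_int m * pi) = cis (- (of_int m * pi) + 2 * pi * of_int m)" by (simp add: algebra_simps)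
      also have "\<dots> = cis (- (of_int m * pi))" 
        unfolding cis_mult[symmetric] by (simp add: cis_multiple_2pi)
      finally show ?thesis using \<omega> by simp
    qed
    ultimately show ?thesis using False by (simp add: G_def)
  qed
  then have 2: "(LINT a:{- (pi / \<omega>)..pi / \<omega>}|lborel. cis (\<omega> * (of_int m * a))) = (if m = 0 then of_real (2 * pi / \<omega>) else 0)"
    using set_borel_integral_eq_integral(2)[OF 1] by (simp add: integral_unique)
  \<comment> \<open>The integral was computed over the closed interval; the open one, which fits
    \<open>open_square\<close>, differs by two points.\<close>
  have ae: "AE a in lborel. indicator {- (pi / \<omega>)<..<pi / \<omega>} a *\<^sub>R cis (\<omega> * (of_int m * a))
      = indicator {- (pi / \<omega>)..pi / \<omega>} a *\<^sub>R cis (\<omega> * (of_int m * a))"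
    using AE_lborel_singleton[of "pi / \<omega>"] AE_lborel_singleton[of "- (pi / \<omega>)"]
    by eventually_elim (auto simp: indicator_def)
  have m: "(\<lambda>a. cis (\<omega> * (of_int m * a))) \<in> borel_measurable borel"
    by (intro borel_measurable_continuous_onI continuous_intros)
  show ?A using 1[unfolded set_integrable_def] m by (subst integrable_cong_AE[OF _ _ ae]) auto
  show ?B using 2[unfolded set_lebesgue_integral_def] m by (subst integral_cong_AE[OF _ _ ae]) auto
qed

lemma planar_exp_measurable [measurable]: "planar_exp \<omega> k \<in> borel_measurable borel"
  unfolding planar_exp_def[abs_def] by (intro borel_measurable_continuous_onI continuous_intros)

lemma integral_planar_exp:
  assumes \<omega>: "0 < \<omega>"
  shows "integrable lborel (\<lambda>x. indicator (open_square (pi / \<omega>)) x *\<^sub>R planar_exp \<omega> k x)" (is ?A)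
    and "(LINT x|lborel. indicator (open_square (pi / \<omega>)) x *\<^sub>R planar_exp \<omega> k x)
       = (if k = 0 then of_real ((2 * pi / \<omega>)\<^sup>2) else 0)" (is ?B)
proof -
  define e where "e m a = indicator {- (pi / \<omega>)<..<pi / \<omega>} a *\<^sub>R cis (\<omega> * (of_int m * a))" for m :: int and a :: real
  have eq: "indicator (open_square (pi / \<omega>)) (pt a b) *\<^sub>R planar_exp \<omega> k (pt a b) = e (fst k) a * e (snd k) b" for a b
  proof -
    have "planar_exp \<omega> k (pt a b) = cis (\<omega> * (of_int (fst k) * a)) * cis (\<omega> * (of_int (snd k) * b))"
      by (simp add: planar_exp_def cis_mult distrib_left)
    moreover have "indicator (open_square (pi / \<omega>)) (pt a b)
       = (indicator {- (pi / \<omega>)<..<pi / \<omega>} a :: real) * indicator {- (pi / \<omega>)<..<pi / \<omega>} b"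
      by (auto simp: open_square_def indicator_def)
    ultimately show ?thesis by (simp add: e_def)
  qed
  have F: "integrable lborel2 (\<lambda>z. e (fst k) (fst z) * e (snd k) (snd z))"
    "(LINT z|lborel2. e (fst k) (fst z) * e (snd k) (snd z))
      = (if k = 0 then of_real ((2 * pi / \<omega>)\<^sup>2) else 0)"
    unfolding e_def integral_fst_snd(2)[OF integral_cis_period(1)[OF \<omega>] integral_cis_period(1)[OF \<omega>]]
      integral_cis_period(2)[OF \<omega>]
    by (rule integral_fst_snd(1)[OF integral_cis_period(1)[OF \<omega>] integral_cis_period(1)[OF \<omega>]])
       (auto simp: prod_eq_iff power2_eq_square)
  let ?G = "\<lambda>x. indicator (open_square (pi / \<omega>)) x *\<^sub>R planar_exp \<omega> k x"
  have G: "?G \<in> borel_measurable borel" by measurable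
  have p: "(\<lambda>(a, b). pt a b) \<in> measurable lborel2 borel" by measurable
  have "integrable (distr lborel2 borel (\<lambda>(a, b). pt a b)) ?G"
    unfolding integrable_distr_eq[OF p G] using F(1) by (simp add: case_prod_beta eq)
  then show ?A unfolding lborel_pt .
  have "integral\<^sup>L (distr lborel2 borel (\<lambda>(a, b). pt a b)) ?G
      = (if k = 0 then of_real ((2 * pi / \<omega>)\<^sup>2) else 0)"
    unfolding integral_distr[OF p G] using F(2) by (simp add: case_prod_beta eq)
  then show ?B unfolding lborel_pt .
qed

lemma planar_parseval:
  assumes \<omega>: "0 < \<omega>" and I: "finite I"
  shows "(LINT x|lborel. indicator (open_square (pi / \<omega>)) x * (norm (\<Sum>k\<in>I. c k * planar_exp \<omega> k x))\<^sup>2)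
       = (2 * pi / \<omega>)\<^sup>2 * (\<Sum>k\<in>I. (norm (c k))\<^sup>2)"
proof -
  have expand: "complex_of_real (indicator (open_square (pi / \<omega>)) x * (norm (\<Sum>k\<in>I. c k * planar_exp \<omega> k x))\<^sup>2)
    = (\<Sum>k\<in>I. \<Sum>l\<in>I. (c k * cnj (c l)) * (indicator (open_square (pi / \<omega>)) x *\<^sub>R planar_exp \<omega> (k - l) x))" for x
  proof -
    have e: "planar_exp \<omega> k x * cnj (planar_exp \<omega> l x) = planar_exp \<omega> (k - l) x" for k l
      by (simp add: planar_exp_def cis_cnj cis_mult algebra_simps)
    have *: "complex_of_real ((norm (\<Sum>k\<in>I. c k * planar_exp \<omega> k x))\<^sup>2)
       = (\<Sum>k\<in>I. \<Sum>l\<in>I. (c k * planar_exp \<omega> k x) * cnj (c l * planar_exp \<omega> l x))"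
      by (simp only: complex_norm_square cnj_sum sum_product)
    have **: "(c k * planar_exp \<omega> k x) * cnj (c l * planar_exp \<omega> l x)
       = (c k * cnj (c l)) * planar_exp \<omega> (k - l) x" for k l
      unfolding e[symmetric] by simp
    show ?thesis
    proof (cases "x \<in> open_square (pi / \<omega>)")
      case True
      then show ?thesis using * unfolding ** by simp
    qed simp
  qed
  define h where "h k l x = (c k * cnj (c l)) * (indicator (open_square (pi / \<omega>)) x *\<^sub>R planar_exp \<omega> (k - l) x)" for k l x
  have hint: "integrable lborel (h k l)" for k l
    unfolding h_def by (intro integrable_mult_right integral_planar_exp \<omega>)
  have "complex_of_real (LINT x|lborel. indicator (open_square (pi / \<omega>)) x * (norm (\<Sum>k\<in>I. c k * planar_exp \<omega> k x))\<^sup>2)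
     = (LINT x|lborel. (\<Sum>k\<in>I. \<Sum>l\<in>I. h k l x))"
    unfolding integral_complex_of_real[symmetric] expand h_def ..
  also have "\<dots> = (\<Sum>k\<in>I. LINT x|lborel. (\<Sum>l\<in>I. h k l x))"
    by (rule Bochner_Integration.integral_sum) (intro Bochner_Integration.integrable_sum hint)
  also have "\<dots> = (\<Sum>k\<in>I. \<Sum>l\<in>I. LINT x|lborel. h k l x)"
    by (intro sum.cong refl Bochner_Integration.integral_sum hint)
  also have "\<dots> = (\<Sum>k\<in>I. \<Sum>l\<in>I. (c k * cnj (c l)) * (if k - l = 0 then of_real ((2 * pi / \<omega>)\<^sup>2) else 0))"
    unfolding h_def integral_mult_right_zero integral_planar_exp(2)[OF \<omega>] ..
  also have "\<dots> = (\<Sum>k\<in>I. of_real ((norm (c k))\<^sup>2) * of_real ((2 * pi / \<omega>)\<^sup>2))"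
  proof (rule sum.cong[OF refl])
    fix k assume "k \<in> I"
    then show "(\<Sum>l\<in>I. (c k * cnj (c l)) * (if k - l = 0 then of_real ((2 * pi / \<omega>)\<^sup>2) else 0))
        = of_real ((norm (c k))\<^sup>2) * of_real ((2 * pi / \<omega>)\<^sup>2)"
    proof -
      have "(\<Sum>l\<in>I. (c k * cnj (c l)) * (if k - l = 0 then of_real ((2 * pi / \<omega>)\<^sup>2) else 0))
          = (\<Sum>l\<in>I. if k = l then (c k * cnj (c l)) * of_real ((2 * pi / \<omega>)\<^sup>2) else 0)"
        by (intro sum.cong refl) simp
      also have "\<dots> = (c k * cnj (c k)) * of_real ((2 * pi / \<omega>)\<^sup>2)"
        using I \<open>k \<in> I\<close> by simp
      finally show ?thesis unfolding complex_norm_square .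
    qed
  qed
  also have "\<dots> = complex_of_real ((2 * pi / \<omega>)\<^sup>2 * (\<Sum>k\<in>I. (norm (c k))\<^sup>2))"
    by (simp only: of_real_mult of_real_sum sum_distrib_left) (simp only: mult.commute)
  finally show ?thesis by (simp only: of_real_eq_iff)
qed

text \<open>The \<open>L\<^sup>2\<close> bound for superpositions of translations avoids the Fourier transform: \<open>f\<close> is
  approximated by trigonometric polynomials on a square larger than its support, where the Parseval
  identity applies.\<close>

locale translation_superposition =
  fixes M :: "'m measure" and w :: "'m \<Rightarrow> real" and Y :: "'m \<Rightarrow> real^2" and R B :: real
  assumes w_integrable: "integrable M w"
    and Y_measurable [measurable]: "Y \<in> borel_measurable M"
    and Y_bound: "\<And>z. w z \<noteq> 0 \<Longrightarrow> norm (Y z) \<le> R"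
    and R_nonneg: "0 \<le> R"
    and multiplier_bound: "\<And>\<xi>. norm (LINT z|M. w z *\<^sub>R cis (- (\<xi> \<bullet> Y z))) \<le> B"
begin

lemma w_measurable [measurable]: "w \<in> borel_measurable M"
  using w_integrable by auto

definition super :: "(real^2 \<Rightarrow> complex) \<Rightarrow> real^2 \<Rightarrow> complex" where
  "super f x = (LINT z|M. w z *\<^sub>R f (x - Y z))"

lemma cis_borel_measurable [measurable (raw)]:
  "h \<in> borel_measurable N \<Longrightarrow> (\<lambda>z. cis (h z)) \<in> borel_measurable N" for N :: "'n measure"
  unfolding cis_conv_exp by measurable

lemma super_exp:
  "integrable M (\<lambda>z. w z *\<^sub>R planar_exp \<omega> k (x - Y z))"
  "super (planar_exp \<omega> k) x =
     (LINT z|M. w z *\<^sub>R cis (- (pt (\<omega> * of_int (fst k)) (\<omega> * of_int (snd k)) \<bullet> Y z))) * planar_exp \<omega> k x"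
proof -
  let ?\<xi> = "pt (\<omega> * of_int (fst k)) (\<omega> * of_int (snd k))"
  have eq: "w z *\<^sub>R planar_exp \<omega> k (x - Y z) = (w z *\<^sub>R cis (- (?\<xi> \<bullet> Y z))) * planar_exp \<omega> k x" for z
    by (simp add: planar_exp_def inner_vec2 cis_mult algebra_simps)
  show "super (planar_exp \<omega> k) x = (LINT z|M. w z *\<^sub>R cis (- (?\<xi> \<bullet> Y z))) * planar_exp \<omega> k x"
    unfolding super_def eq by (rule integral_mult_left_zero)
  show "integrable M (\<lambda>z. w z *\<^sub>R planar_exp \<omega> k (x - Y z))"
    by (rule Bochner_Integration.integrable_bound[OF w_integrable]) (auto simp: planar_exp_def)
qed

text \<open>Translations act diagonally on exponentials: each coefficient is multiplied by the
  multiplier at its frequency, of modulus at most \<open>B\<close>, and the Parseval identity is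
  applied to both sides.\<close>

lemma super_trig_poly:
  assumes "planar_trig_poly \<omega> P" and \<omega>: "0 < \<omega>"
  shows "super P \<in> borel_measurable borel"
    and "P \<in> borel_measurable borel"
    and "integrable M (\<lambda>z. w z *\<^sub>R P (x - Y z))"
    and "(LINT x|lborel. indicator (open_square (pi / \<omega>)) x * (norm (super P x))\<^sup>2)
       \<le> B\<^sup>2 * (LINT x|lborel. indicator (open_square (pi / \<omega>)) x * (norm (P x))\<^sup>2)"
    and "\<exists>E. \<forall>x. norm (super P x) \<le> E"
proof -
  obtain I c where I: "finite I" and P: "P = (\<lambda>x. \<Sum>k\<in>I. c k * planar_exp \<omega> k x)"
    using planar_trig_poly_sum[OF assms(1)] by (elim exE conjE) (rule that)
  define m where "m k = (LINT z|M. w z *\<^sub>R cis (- (pt (\<omega> * of_int (fst k)) (\<omega> * of_int (snd k)) \<bullet> Y z)))" for k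
  have e: "w z *\<^sub>R P (x - Y z) = (\<Sum>k\<in>I. c k * (w z *\<^sub>R planar_exp \<omega> k (x - Y z)))" for z x
    unfolding P by (simp add: scaleR_sum_right)
  have SP: "super P = (\<lambda>x. \<Sum>k\<in>I. (c k * m k) * planar_exp \<omega> k x)"
  proof
    fix x
    have "super P x = (\<Sum>k\<in>I. c k * super (planar_exp \<omega> k) x)"
      unfolding super_def[of P] e
      by (subst Bochner_Integration.integral_sum)
         (auto intro!: integrable_mult_right super_exp(1) simp only: integral_mult_right_zero super_def)
    then show "super P x = (\<Sum>k\<in>I. (c k * m k) * planar_exp \<omega> k x)"
      by (simp add: super_exp(2) m_def mult.assoc)
  qed
  have "norm (super P x) \<le> (\<Sum>k\<in>I. norm (c k * m k))" for x
    unfolding SP by (rule order_trans[OF norm_sum]) (simp add: planar_exp_def norm_mult)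
  then show "\<exists>E. \<forall>x. norm (super P x) \<le> E" by blast
  show "super P \<in> borel_measurable borel" unfolding SP by measurable
  show "P \<in> borel_measurable borel" unfolding P by measurable
  show "integrable M (\<lambda>z. w z *\<^sub>R P (x - Y z))"
    unfolding e by (intro Bochner_Integration.integrable_sum integrable_mult_right super_exp)
  have "(\<Sum>k\<in>I. (norm (c k * m k))\<^sup>2) \<le> (\<Sum>k\<in>I. B\<^sup>2 * (norm (c k))\<^sup>2)"
  proof (rule sum_mono)
    fix k
    have "(norm (m k))\<^sup>2 \<le> B\<^sup>2" unfolding m_def by (intro power_mono multiplier_bound) simp
    then have "(norm (m k))\<^sup>2 * (norm (c k))\<^sup>2 \<le> B\<^sup>2 * (norm (c k))\<^sup>2" by (intro mult_right_mono) auto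
    then show "(norm (c k * m k))\<^sup>2 \<le> B\<^sup>2 * (norm (c k))\<^sup>2"
      by (simp add: norm_mult power_mult_distrib mult.commute)
  qed
  then have "(2 * pi / \<omega>)\<^sup>2 * (\<Sum>k\<in>I. (norm (c k * m k))\<^sup>2) \<le> (2 * pi / \<omega>)\<^sup>2 * (B\<^sup>2 * (\<Sum>k\<in>I. (norm (c k))\<^sup>2))"
    by (intro mult_left_mono) (simp_all add: sum_distrib_left)
  then show "(LINT x|lborel. indicator (open_square (pi / \<omega>)) x * (norm (super P x))\<^sup>2)
       \<le> B\<^sup>2 * (LINT x|lborel. indicator (open_square (pi / \<omega>)) x * (norm (P x))\<^sup>2)"
    unfolding SP planar_parseval[OF \<omega> I] by (simp only: P planar_parseval[OF \<omega> I] mult.left_commute)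
qed

lemma integrable_indicator_open_square:
  "integrable lborel (\<lambda>x. indicator (open_square A) x * (c::real))"
proof -
  have "open_square A \<subseteq> cbox (pt (- A) (- A)) (pt A A)"
    by (auto simp: open_square_def mem_box Basis_vec2 inner_axis)
  then have "emeasure lborel (open_square A) \<le> emeasure lborel (cbox (pt (- A) (- A)) (pt A A))"
    by (rule emeasure_mono) simp
  also have "\<dots> < \<infinity>" by (rule emeasure_lborel_cbox_finite)
  finally show ?thesis by (intro integrable_mult_left integrable_real_indicator) auto
qed

lemma super_L2_bound:
  assumes f: "lipschitz_bounded_support f C K" and A: "0 < A"
  shows "(LINT x|lborel. indicator (open_square A) x * (norm (super f x))\<^sup>2) \<le> B\<^sup>2 * (LINT x|lborel. (norm (f x))\<^sup>2)"
    and "integrable lborel (\<lambda>x. indicator (open_square A) x * (norm (super f x))\<^sup>2)"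
proof -
  have K: "0 \<le> K" "0 \<le> C" using f by (simp_all add: lipschitz_bounded_support_def)
  note [measurable] = lipschitz_bounded_support_measurable[OF f]
  \<comment> \<open>Half the side of the period square is \<open>A + R + K + 1\<close>: it contains
    the square of half side \<open>A\<close>, the translates of that square by vectors of length at
    most \<open>R\<close>, and the support of \<open>f\<close>.\<close>
  define \<omega> where "\<omega> = pi / (A + R + K + 1)"
  have \<omega>: "0 < \<omega>" and size: "pi / \<omega> = A + R + K + 1" using A R_nonneg K by (auto simp: \<omega>_def)
  have "K * \<omega> < (A + R + K + 1) * \<omega>" using \<omega> A R_nonneg by (intro mult_strict_right_mono) auto
  also have "\<dots> = pi" using A R_nonneg K by (simp add: \<omega>_def)
  finally have K\<omega>: "K * \<omega> < pi" .
  have "\<forall>n. \<exists>P. planar_trig_poly \<omega> P \<and> (\<forall>x\<in>open_square (pi / \<omega>). norm (f x - P x) < inverse (real (Suc n)))"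
    using planar_trig_poly_approx[OF f \<omega> K\<omega>] by simp
  then obtain P where P: "\<And>n. planar_trig_poly \<omega> (P n)"
    and close: "\<And>n x. x \<in> open_square (pi / \<omega>) \<Longrightarrow> norm (f x - P n x) < inverse (real (Suc n))"
    by metis
  define Q where "Q = open_square (pi / \<omega>)"
  note [measurable] = super_trig_poly(1,2)[OF P \<omega>]
  have Qm [measurable]: "Q \<in> sets borel" by (simp add: Q_def)
  have sub: "open_square A \<subseteq> Q"
    using R_nonneg K by (auto simp: Q_def open_square_def size)
  have shift: "x - Y z \<in> Q" if "x \<in> open_square A" "w z \<noteq> 0" for x z
  proof -
    have "\<bar>(Y z) $ i\<bar> \<le> R" for i
      using component_le_norm_cart[of "Y z" i] Y_bound[OF that(2)] by linarith
    from this[of 1] this[of 2] show ?thesis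
      using that(1) K by (auto simp: Q_def open_square_def size)
  qed
  have inv_le: "inverse (real (Suc n)) \<le> 1" for n by (simp add: field_simps)
  have fb: "norm (f x) \<le> 2 * C * K" for x by (rule lipschitz_bounded_support_bound[OF f])
  have Pb: "norm (P n x) \<le> 2 * C * K + 1" if "x \<in> Q" for n x
    using close[of x n] that fb[of x] inv_le[of n] norm_triangle_ineq2[of "P n x" "f x"]
    by (simp add: Q_def norm_minus_commute)
  have fP: "(\<lambda>n. P n x) \<longlonglongrightarrow> f x" if "x \<in> Q" for x
  proof (rule LIM_zero_cancel, rule Lim_null_comparison)
    show "eventually (\<lambda>n. norm (P n x - f x) \<le> inverse (real (Suc n))) sequentially"
      using close[of x] that by (auto simp: Q_def norm_minus_commute less_imp_le)
    show "(\<lambda>n. inverse (real (Suc n))) \<longlonglongrightarrow> 0" by (rule LIMSEQ_inverse_real_of_nat)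
  qed
  have fint: "integrable M (\<lambda>z. w z *\<^sub>R f (x - Y z))" for x
    by (rule Bochner_Integration.integrable_bound[OF integrable_mult_left[OF w_integrable, of "2 * C * K"]])
       (use fb K in \<open>auto simp: abs_mult intro!: AE_I2 mult_left_mono\<close>)
  define W where "W = (LINT z|M. \<bar>w z\<bar>)"
  have W0: "0 \<le> W" by (simp add: W_def)
  have Sdiff: "norm (super (P n) x - super f x) \<le> inverse (real (Suc n)) * W" if x: "x \<in> open_square A" for n x
  proof -
    have "super (P n) x - super f x = (LINT z|M. w z *\<^sub>R P n (x - Y z) - w z *\<^sub>R f (x - Y z))"
      unfolding super_def using super_trig_poly(3)[OF P \<omega>] fint by simp
    also have "norm (LINT z|M. w z *\<^sub>R P n (x - Y z) - w z *\<^sub>R f (x - Y z)) \<le> (LINT z|M. inverse (real (Suc n)) * \<bar>w z\<bar>)"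
    proof (rule lebesgue_integral_norm_bound)
      fix z
      show "norm (w z *\<^sub>R P n (x - Y z) - w z *\<^sub>R f (x - Y z)) \<le> inverse (real (Suc n)) * \<bar>w z\<bar>"
      proof (cases "w z = 0")
        case False
        then have "norm (P n (x - Y z) - f (x - Y z)) \<le> inverse (real (Suc n))"
          using close[of "x - Y z" n] shift[OF x] by (simp add: Q_def norm_minus_commute)
        then have "\<bar>w z\<bar> * norm (P n (x - Y z) - f (x - Y z)) \<le> \<bar>w z\<bar> * inverse (real (Suc n))"
          by (intro mult_left_mono) auto
        then show ?thesis by (simp add: scaleR_diff_right[symmetric] mult.commute)
      qed simp
    qed (use super_trig_poly(3)[OF P \<omega>] fint w_integrable in auto)
    finally show ?thesis by (simp add: W_def)
  qed
  have SP_lim: "(\<lambda>n. super (P n) x) \<longlonglongrightarrow> super f x" if "x \<in> open_square A" for x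
  proof (rule LIM_zero_cancel, rule Lim_null_comparison)
    show "eventually (\<lambda>n. norm (super (P n) x - super f x) \<le> inverse (real (Suc n)) * W) sequentially"
      using Sdiff that by auto
    show "(\<lambda>n. inverse (real (Suc n)) * W) \<longlonglongrightarrow> 0"
      using tendsto_mult_right[OF LIMSEQ_inverse_real_of_nat, of W] by simp
  qed
  have Sfb: "norm (super f x) \<le> W * (2 * C * K)" for x
  proof -
    have "norm (super f x) \<le> (LINT z|M. \<bar>w z\<bar> * (2 * C * K))"
      unfolding super_def
      by (rule lebesgue_integral_norm_bound[OF fint])
         (use w_integrable fb in \<open>auto intro!: mult_left_mono\<close>)
    then show ?thesis by (simp add: W_def)
  qed
  define D where "D = W * (2 * C * K) + W"
  have SPb: "norm (super (P n) x) \<le> D" if "x \<in> open_square A" for n x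
  proof -
    have "norm (super (P n) x) \<le> norm (super f x) + inverse (real (Suc n)) * W"
      using Sdiff[OF that, of n] norm_triangle_ineq2[of "super (P n) x" "super f x"] by linarith
    also have "\<dots> \<le> W * (2 * C * K) + 1 * W"
      using W0 inv_le[of n] by (intro add_mono mult_right_mono Sfb) auto
    finally show ?thesis by (simp add: D_def)
  qed
  have lim1p: "(\<lambda>n. indicator (open_square A) x * (norm (super (P n) x))\<^sup>2)
      \<longlonglongrightarrow> indicator (open_square A) x * (norm (super f x))\<^sup>2" for x
    by (cases "x \<in> open_square A") (auto intro!: tendsto_intros SP_lim)
  have m1 [measurable]: "(\<lambda>x. indicator (open_square A) x * (norm (super f x))\<^sup>2) \<in> borel_measurable borel"
    by (rule borel_measurable_LIMSEQ_real[OF lim1p]) measurable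
  have *: "integrable lborel (\<lambda>x. indicator (open_square A) x * (norm (super f x))\<^sup>2)
    \<and> (\<lambda>n. LINT x|lborel. indicator (open_square A) x * (norm (super (P n) x))\<^sup>2)
      \<longlonglongrightarrow> (LINT x|lborel. indicator (open_square A) x * (norm (super f x))\<^sup>2)"
  proof -
    have b: "AE x in lborel. norm (indicator (open_square A) x * (norm (super (P n) x))\<^sup>2) \<le> indicator (open_square A) x * D\<^sup>2" for n
      by (rule AE_I2) (auto simp: indicator_def intro!: power_mono SPb)
    have m1': "(\<lambda>x. indicator (open_square A) x * (norm (super f x))\<^sup>2) \<in> borel_measurable lborel" using m1 by simp
    have m2: "(\<lambda>x. indicator (open_square A) x * (norm (super (P n) x))\<^sup>2) \<in> borel_measurable lborel" for n by measurable
    have l: "AE x in lborel. (\<lambda>n. indicator (open_square A) x * (norm (super (P n) x))\<^sup>2)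
      \<longlonglongrightarrow> indicator (open_square A) x * (norm (super f x))\<^sup>2" using lim1p by simp
    note dc = m1' m2 integrable_indicator_open_square[of A "D\<^sup>2"] l b
    show ?thesis
      by (intro conjI integrable_dominated_convergence[OF dc] integral_dominated_convergence[OF dc])
  qed
  from * show "integrable lborel (\<lambda>x. indicator (open_square A) x * (norm (super f x))\<^sup>2)" by simp
  from * have lim1: "(\<lambda>n. LINT x|lborel. indicator (open_square A) x * (norm (super (P n) x))\<^sup>2)
      \<longlonglongrightarrow> (LINT x|lborel. indicator (open_square A) x * (norm (super f x))\<^sup>2)" by simp
  have lim2p: "(\<lambda>n. indicator Q x * (norm (P n x))\<^sup>2) \<longlonglongrightarrow> indicator Q x * (norm (f x))\<^sup>2" for x
    by (cases "x \<in> Q") (auto intro!: tendsto_intros fP)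
  have lim2: "(\<lambda>n. LINT x|lborel. indicator Q x * (norm (P n x))\<^sup>2) \<longlonglongrightarrow> (LINT x|lborel. indicator Q x * (norm (f x))\<^sup>2)"
  proof (rule integral_dominated_convergence[OF _ _ integrable_indicator_open_square[of "pi / \<omega>" "(2 * C * K + 1)\<^sup>2"]])
    show "AE x in lborel. norm (indicator Q x * (norm (P n x))\<^sup>2) \<le> indicator (open_square (pi / \<omega>)) x * (2 * C * K + 1)\<^sup>2" for n
      by (rule AE_I2) (auto simp: indicator_def Q_def[symmetric] intro!: power_mono Pb)
  qed (use lim2p in auto)
  have "(LINT x|lborel. indicator (open_square A) x * (norm (super f x))\<^sup>2) \<le> B\<^sup>2 * (LINT x|lborel. indicator Q x * (norm (f x))\<^sup>2)"
  proof (rule LIMSEQ_le[OF lim1 tendsto_mult_left[OF lim2]], intro exI allI impI)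
    fix n
    \<comment> \<open>Parseval needs a full period on both sides; enlarging the square on the left
      is free because the integrand is nonnegative.\<close>
    have "(LINT x|lborel. indicator (open_square A) x * (norm (super (P n) x))\<^sup>2) \<le> (LINT x|lborel. indicator Q x * (norm (super (P n) x))\<^sup>2)"
    proof (rule integral_mono_AE')
      obtain E where E: "\<And>x. norm (super (P n) x) \<le> E" using super_trig_poly(5)[OF P \<omega>] by blast
      show "integrable lborel (\<lambda>x. indicator Q x * (norm (super (P n) x))\<^sup>2)"
        by (rule Bochner_Integration.integrable_bound[OF integrable_indicator_open_square[of "pi / \<omega>" "E\<^sup>2"]])
           (auto simp: indicator_def Q_def[symmetric] intro!: power_mono E)
    qed (use sub in \<open>auto simp: indicator_def\<close>)
    also have "\<dots> \<le> B\<^sup>2 * (LINT x|lborel. indicator Q x * (norm (P n x))\<^sup>2)"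
      unfolding Q_def by (rule super_trig_poly(4)[OF P \<omega>])
    finally show "(LINT x|lborel. indicator (open_square A) x * (norm (super (P n) x))\<^sup>2) \<le> B\<^sup>2 * (LINT x|lborel. indicator Q x * (norm (P n x))\<^sup>2)" .
  qed
  also have "(LINT x|lborel. indicator Q x * (norm (f x))\<^sup>2) = (LINT x|lborel. (norm (f x))\<^sup>2)"
  proof (rule Bochner_Integration.integral_cong[OF refl])
    fix x
    show "indicator Q x * (norm (f x))\<^sup>2 = (norm (f x))\<^sup>2"
    proof (cases "x \<in> Q")
      case False
      then have "K \<le> \<bar>x $ 1\<bar> \<or> K \<le> \<bar>x $ 2\<bar>" using A R_nonneg by (auto simp: Q_def open_square_def size)
      then have "K \<le> norm x" using component_le_norm_cart[of x 1] component_le_norm_cart[of x 2] by auto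
      then show ?thesis using f by (simp add: lipschitz_bounded_support_def)
    qed simp
  qed
  finally show "(LINT x|lborel. indicator (open_square A) x * (norm (super f x))\<^sup>2) \<le> B\<^sup>2 * (LINT x|lborel. (norm (f x))\<^sup>2)" .
qed

end

section \<open>Boundedness on L2 from a logarithmic potential\<close>

lemma has_vector_derivative_of_real_inverse:
  assumes "r \<noteq> 0"
  shows "((\<lambda>r. complex_of_real (1 / r)) has_vector_derivative complex_of_real (- (1 / r\<^sup>2))) (at r within T)"
  by (rule has_vector_derivative_of_real)
     (use assms in \<open>auto intro!: derivative_eq_intros simp: has_real_derivative_iff_has_vector_derivative[symmetric] power2_eq_square field_simps\<close>)

lemma cis_set_integrable:
  assumes "continuous_on UNIV \<psi>" "0 < a"
  shows "set_integrable lborel {a..b} (\<lambda>r. (1 / r) *\<^sub>R (cis (s * r) * \<psi> r))"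
  unfolding set_integrable_def using assms
  by (intro borel_integrable_compact) (auto intro!: continuous_intros continuous_on_subset[OF assms(1)])

text \<open>One integration by parts against \<open>cis (s * r)\<close>. The two boundary terms and
  the derivative of \<open>1 / r\<close> cost \<open>C / (a * \<bar>s\<bar>)\<close> each, the
  derivative of \<open>\<psi>\<close> costs
  \<open>D * (b - a) / (a * \<bar>s\<bar>)\<close>.\<close>

lemma oscillatory_integral_bound:
  fixes \<psi> \<psi>' :: "real \<Rightarrow> complex"
  assumes der: "\<And>r. (\<psi> has_vector_derivative \<psi>' r) (at r)" and cont': "continuous_on UNIV \<psi>'"
    and ab: "0 < a" "a \<le> b" and s: "s \<noteq> 0"
    and C: "\<And>r. a \<le> r \<Longrightarrow> r \<le> b \<Longrightarrow> norm (\<psi> r) \<le> C"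
    and D: "\<And>r. a \<le> r \<Longrightarrow> r \<le> b \<Longrightarrow> norm (\<psi>' r) \<le> D"
  shows "norm (LINT r:{a..b}|lborel. (1 / r) *\<^sub>R (cis (s * r) * \<psi> r)) \<le> (3 * C + D * (b - a)) / (a * \<bar>s\<bar>)"
proof -
  have cont: "continuous_on UNIV \<psi>"
    using der by (auto intro!: continuous_at_imp_continuous_on has_vector_derivative_continuous)
  define k where "k = 1 / (\<i> * complex_of_real s)"
  have nk: "norm k = 1 / \<bar>s\<bar>" by (simp add: k_def norm_divide norm_mult)
  define G where "G r = k * (cis (s * r) * (\<psi> r * complex_of_real (1 / r)))" for r
  define H where "H r = k * (cis (s * r) * (\<psi>' r * complex_of_real (1 / r) - \<psi> r * complex_of_real (1 / r\<^sup>2)))" for r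
  have "((\<lambda>r. (1 / r) *\<^sub>R (cis (s * r) * \<psi> r) + H r) has_integral (G b - G a)) {a..b}"
  proof (rule fundamental_theorem_of_calculus)
    fix r assume "r \<in> {a..b}"
    then have r: "r \<noteq> 0" using ab by auto
    have d1: "((\<lambda>r. \<psi> r * complex_of_real (1 / r)) has_vector_derivative
        (\<psi> r * complex_of_real (- (1 / r\<^sup>2)) + \<psi>' r * complex_of_real (1 / r))) (at r within {a..b})"
      by (rule has_vector_derivative_mult[OF has_vector_derivative_at_within[OF der] has_vector_derivative_of_real_inverse[OF r]])
    have "(G has_vector_derivative k * (cis (s * r) * (\<psi> r * complex_of_real (- (1 / r\<^sup>2)) + \<psi>' r * complex_of_real (1 / r))
        + (\<i> * of_real s * cis (s * r)) * (\<psi> r * complex_of_real (1 / r)))) (at r within {a..b})"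
      unfolding G_def[abs_def]
      by (rule has_vector_derivative_mult_right[OF has_vector_derivative_mult[OF has_vector_derivative_cis_mult d1]])
    moreover have "k * (\<i> * of_real s * cis (s * r) * (\<psi> r * complex_of_real (1 / r))) = (1 / r) *\<^sub>R (cis (s * r) * \<psi> r)"
      using s by (simp add: k_def scaleR_conv_of_real)
    ultimately show "(G has_vector_derivative (1 / r) *\<^sub>R (cis (s * r) * \<psi> r) + H r) (at r within {a..b})"
      by (simp add: H_def algebra_simps)
  qed (use ab in auto)
  moreover have Hint: "H integrable_on {a..b}"
    unfolding H_def[abs_def] using ab
    by (intro integrable_continuous_real)
       (auto intro!: continuous_intros continuous_on_subset[OF cont] continuous_on_subset[OF cont'])
  moreover have Fint: "(\<lambda>r. (1 / r) *\<^sub>R (cis (s * r) * \<psi> r)) integrable_on {a..b}"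
    using ab by (intro integrable_continuous_real) (auto intro!: continuous_intros continuous_on_subset[OF cont])
  ultimately have eq: "integral {a..b} (\<lambda>r. (1 / r) *\<^sub>R (cis (s * r) * \<psi> r)) = G b - G a - integral {a..b} H"
    using Henstock_Kurzweil_Integration.integral_add[OF Fint Hint] by (simp add: integral_unique algebra_simps)
  have GB: "norm (G r) \<le> C / (a * \<bar>s\<bar>)" if "a \<le> r" "r \<le> b" for r
  proof -
    have "norm (G r) = norm (\<psi> r) / r / \<bar>s\<bar>"
      using ab that by (simp add: G_def norm_mult nk norm_divide)
    also have "\<dots> \<le> C / a / \<bar>s\<bar>"
      using ab that C[of r] order_trans[OF norm_ge_zero C[of r]] by (intro divide_right_mono frac_le) auto
    finally show ?thesis by simp
  qed
  have C0: "0 \<le> C" using order_trans[OF norm_ge_zero C[of a]] ab by simp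
  have D0: "0 \<le> D" using order_trans[OF norm_ge_zero D[of a]] ab by simp
  have hi0: "((\<lambda>r. D / a + C * (1 / r\<^sup>2)) has_integral ((D / a * b - C / b) - (D / a * a - C / a))) {a..b}"
    using ab
    by (intro fundamental_theorem_of_calculus)
       (auto intro!: derivative_eq_intros simp: has_real_derivative_iff_has_vector_derivative[symmetric] power2_eq_square)
  have hi: "((\<lambda>r. (D / a + C * (1 / r\<^sup>2)) / \<bar>s\<bar>) has_integral ((D / a * b - C / b) - (D / a * a - C / a)) / \<bar>s\<bar>) {a..b}"
    using has_integral_mult_left[OF hi0, of "1 / \<bar>s\<bar>"] by simp
  have "norm (integral {a..b} H) \<le> integral {a..b} (\<lambda>r. (D / a + C * (1 / r\<^sup>2)) / \<bar>s\<bar>)"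
  proof (rule integral_norm_bound_integral[OF Hint])
    show "(\<lambda>r. (D / a + C * (1 / r\<^sup>2)) / \<bar>s\<bar>) integrable_on {a..b}" using hi by (rule has_integral_integrable)
    fix r assume r: "r \<in> {a..b}"
    have "norm (H r) = norm (\<psi>' r * complex_of_real (1 / r) - \<psi> r * complex_of_real (1 / r\<^sup>2)) / \<bar>s\<bar>"
      by (simp add: H_def norm_mult nk)
    also have "\<dots> \<le> (D / a + C * (1 / r\<^sup>2)) / \<bar>s\<bar>"
    proof (rule divide_right_mono)
      have "norm (\<psi>' r * complex_of_real (1 / r)) \<le> D / a"
        using ab r D[of r] D0 by (auto simp: norm_mult norm_divide intro!: frac_le)
      moreover have "norm (\<psi> r * complex_of_real (1 / r\<^sup>2)) \<le> C * (1 / r\<^sup>2)"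
        using ab r C[of r] by (auto simp: norm_mult norm_divide norm_power intro!: divide_right_mono)
      ultimately show "norm (\<psi>' r * complex_of_real (1 / r) - \<psi> r * complex_of_real (1 / r\<^sup>2)) \<le> D / a + C * (1 / r\<^sup>2)"
        by (intro order_trans[OF norm_triangle_ineq4] add_mono)
    qed simp
    finally show "norm (H r) \<le> (D / a + C * (1 / r\<^sup>2)) / \<bar>s\<bar>" .
  qed
  also have "\<dots> = ((D * (b - a) + C) / a - C / b) / \<bar>s\<bar>"
    unfolding integral_unique[OF hi] by (simp add: right_diff_distrib diff_divide_distrib add_divide_distrib)
  also have "\<dots> \<le> ((D * (b - a) + C) / a) / \<bar>s\<bar>"
    using C0 ab by (intro divide_right_mono) auto
  finally have HB: "norm (integral {a..b} H) \<le> (D * (b - a) + C) / (a * \<bar>s\<bar>)" by simp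
  have "norm (G b - G a - integral {a..b} H) \<le> C / (a * \<bar>s\<bar>) + C / (a * \<bar>s\<bar>) + (D * (b - a) + C) / (a * \<bar>s\<bar>)"
    using GB[of a] GB[of b] HB ab
    by (intro order_trans[OF norm_triangle_ineq4] add_mono order_trans[OF norm_triangle_ineq4]) auto
  also have "\<dots> = (3 * C + D * (b - a)) / (a * \<bar>s\<bar>)"
    by (simp add: add_divide_distrib[symmetric])
  finally show ?thesis
    using set_borel_integral_eq_integral(2)[OF cis_set_integrable[OF cont ab(1), of b s]] eq by simp
qed

lemma cis_minus_one_bound: "norm (cis t - 1) \<le> \<bar>t\<bar>"
proof -
  have "norm (cis t - 1) = norm (exp (\<i> * of_real t) - exp (\<i> * of_real 0))" by (simp add: cis_conv_exp)
  also have "\<dots> \<le> \<bar>t\<bar>"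
  proof -
    have "norm (cis t - cis 0) \<le> 1 * norm (t - 0)"
    proof (rule differentiable_bound[of UNIV])
      fix x :: real
      show "(cis has_derivative (\<lambda>h. h *\<^sub>R (\<i> * cis x))) (at x within UNIV)"
        using has_vector_derivative_cis_mult[of 1 x UNIV] by (simp add: has_vector_derivative_def)
      show "onorm (\<lambda>h. h *\<^sub>R (\<i> * cis x)) \<le> 1"
        by (rule onorm_le) (simp add: norm_mult)
    qed auto
    then show ?thesis by (simp add: cis_conv_exp)
  qed
  finally show ?thesis .
qed

text \<open>The integrand of the principal value along one ray, at frequency \<open>s\<close>. The
  cutoff of the subtracted value is \<open>1 / L\<close>, with \<open>L\<close> a bound for the
  frequencies of all rays, so that the subtracted part is the same on all of them and cancels
  against the mean zero of \<open>g\<close>.\<close>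

definition slope_integrand :: "(real \<Rightarrow> complex) \<Rightarrow> complex \<Rightarrow> real \<Rightarrow> real \<Rightarrow> real \<Rightarrow> complex" where
  "slope_integrand \<psi> u L s r = (1 / r) *\<^sub>R (cis (s * r) * \<psi> r - (if r < 1 / L then u else 0))"

text \<open>The ray is cut at \<open>1 / L\<close> and at \<open>1 / \<bar>s\<bar>\<close>. On the
  first piece \<open>cis (s * r) * \<psi> r\<close> is close to \<open>u\<close>; on the second
  there is no cancellation, which costs the logarithm; on the third the oscillation takes over. The
  upper limit enters only through \<open>D * b\<close>, which stays bounded for a function varying
  at the scale of \<open>b\<close>.\<close>

lemma slope_integral_bound:
  fixes \<psi> \<psi>' :: "real \<Rightarrow> complex"
  assumes der: "\<And>r. (\<psi> has_vector_derivative \<psi>' r) (at r)" and cont': "continuous_on UNIV \<psi>'"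
    and ab: "0 \<le> a" "a \<le> b" and s: "s \<noteq> 0" "\<bar>s\<bar> \<le> L"
    and C: "\<And>r. norm (\<psi> r) \<le> C"
    and D: "\<And>r. norm (\<psi>' r) \<le> D" and u: "\<And>r. 0 \<le> r \<Longrightarrow> norm (\<psi> r - u) \<le> D * r"
  shows "set_integrable lborel {a..b} (slope_integrand \<psi> u L s)"
    and "norm (LINT r:{a..b}|lborel. slope_integrand \<psi> u L s r) \<le> 4 * C + D / L + D * b + C * ln (L / \<bar>s\<bar>)"
proof -
  have cont: "continuous_on UNIV \<psi>"
    using der by (auto intro!: continuous_at_imp_continuous_on has_vector_derivative_continuous)
  have [measurable]: "\<psi> \<in> borel_measurable borel" using cont by (rule borel_measurable_continuous_onI)
  have cism [measurable]: "(\<lambda>r. cis (s * r)) \<in> borel_measurable borel"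
    by (intro borel_measurable_continuous_onI continuous_intros)
  have L: "0 < L" using s by auto
  have C0: "0 \<le> C" using order_trans[OF norm_ge_zero C] .
  have D0: "0 \<le> D" using order_trans[OF norm_ge_zero D] .
  have Ls: "1 / L \<le> 1 / \<bar>s\<bar>" using s L by (simp add: frac_le)
  define h where "h = slope_integrand \<psi> u L s"
  have [measurable]: "h \<in> borel_measurable borel" unfolding h_def slope_integrand_def[abs_def] by measurable
  define h1 where "h1 r = indicator ({a..b} \<inter> {..<1 / L}) r *\<^sub>R h r" for r
  define h2 where "h2 r = indicator ({a..b} \<inter> {1 / L..<1 / \<bar>s\<bar>}) r *\<^sub>R h r" for r
  define h3 where "h3 r = indicator ({a..b} \<inter> {1 / \<bar>s\<bar>..}) r *\<^sub>R h r" for r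
  have [measurable]: "h1 \<in> borel_measurable borel" "h2 \<in> borel_measurable borel" "h3 \<in> borel_measurable borel"
    unfolding h1_def[abs_def] h2_def[abs_def] h3_def[abs_def] by measurable
  have split: "indicator {a..b} r *\<^sub>R h r = h1 r + h2 r + h3 r" for r
    using Ls by (auto simp: h1_def h2_def h3_def indicator_def)
  have b1: "norm (h1 r) \<le> indicator {0..1 / L} r * (L * C + D)" for r
  proof (cases "a \<le> r \<and> r \<le> b \<and> r < 1 / L \<and> r \<noteq> 0")
    case True
    then have r: "0 < r" using ab by auto
    have "norm (cis (s * r) * \<psi> r - u) = norm ((cis (s * r) - 1) * \<psi> r + (\<psi> r - u))" by (simp add: algebra_simps)
    also have "\<dots> \<le> \<bar>s * r\<bar> * C + D * r"
      using r C0 by (intro norm_triangle_le add_mono u) (auto simp: norm_mult intro!: mult_mono cis_minus_one_bound C)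
    also have "\<dots> \<le> (L * r) * C + D * r"
      using r s C0 by (intro add_mono mult_right_mono) (auto simp: abs_mult)
    finally have "norm (cis (s * r) * \<psi> r - u) \<le> r * (L * C + D)" by (simp add: algebra_simps)
    moreover have "norm (h r) = norm (cis (s * r) * \<psi> r - u) / r"
      using True r by (simp add: h_def slope_integrand_def)
    ultimately have "norm (h r) \<le> L * C + D" using r by (simp add: divide_le_eq mult.commute)
    then show ?thesis using True r by (simp add: h1_def)
  next
    case False
    then show ?thesis using C0 D0 L by (auto simp: h1_def h_def slope_integrand_def indicator_def)
  qed
  have i1': "integrable lborel (\<lambda>r. indicator {0..1 / L} r * (L * C + D))"
    by (intro integrable_mult_left integrable_real_indicator) (auto simp: emeasure_lborel_Icc_eq)
  have i1: "integrable lborel h1"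
    by (rule Bochner_Integration.integrable_bound[OF i1']) (auto intro!: AE_I2 order_trans[OF b1])
  have "norm (LINT r|lborel. h1 r) \<le> (LINT r|lborel. indicator {0..1 / L} r * (L * C + D))"
    by (rule lebesgue_integral_norm_bound[OF i1 i1' b1])
  also have "\<dots> = C + D / L" using L by (simp add: field_simps)
  finally have n1: "norm (LINT r|lborel. h1 r) \<le> C + D / L" .
  have b2: "norm (h2 r) \<le> C * (indicator {1 / L..1 / \<bar>s\<bar>} r / r)" for r
  proof (cases "r \<in> {a..b} \<and> r \<in> {1 / L..<1 / \<bar>s\<bar>}")
    case True
    then have "0 < r" "\<not> r < 1 / L" using L by (auto intro: less_le_trans[of _ "1 / L"])
    then show ?thesis using True C[of r]
      by (auto simp: h2_def h_def slope_integrand_def norm_mult intro!: divide_right_mono)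
  qed (use C0 L in \<open>auto simp: h2_def indicator_def intro!: divide_nonneg_nonneg intro: order_trans[of 0 "1 / L"]\<close>)
  have e2: "0 < 1 / L" using L by simp
  note inv = integral_inverse_interval[OF e2 Ls]
  have i2: "integrable lborel h2"
  proof (rule Bochner_Integration.integrable_bound[OF integrable_mult_right[OF inv(1), of C]])
    show "AE r in lborel. norm (h2 r) \<le> norm (C * (indicator {1 / L..1 / \<bar>s\<bar>} r / r))"
      using order_trans[OF b2 abs_ge_self] by (intro AE_I2) (simp only: real_norm_def)
  qed simp
  have "norm (LINT r|lborel. h2 r) \<le> (LINT r|lborel. C * (indicator {1 / L..1 / \<bar>s\<bar>} r / r))"
    by (rule lebesgue_integral_norm_bound[OF i2 integrable_mult_right[OF inv(1)] b2])
  also have "\<dots> = C * ln (L / \<bar>s\<bar>)"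
    unfolding integral_mult_right_zero inv(2) by simp
  finally have n2: "norm (LINT r|lborel. h2 r) \<le> C * ln (L / \<bar>s\<bar>)" .
  \<comment> \<open>From \<open>c\<close> on the oscillation is effective:
    \<open>1 \<le> c * \<bar>s\<bar>\<close> removes the denominator of the oscillatory
    bound.\<close>
  define c where "c = max a (1 / \<bar>s\<bar>)"
  have c: "0 < c" "a \<le> c" "1 \<le> c * \<bar>s\<bar>"
  proof -
    show "0 < c" using s by (auto simp: c_def less_max_iff_disj)
    show "a \<le> c" by (simp add: c_def)
    have "1 / \<bar>s\<bar> * \<bar>s\<bar> \<le> c * \<bar>s\<bar>" by (intro mult_right_mono) (auto simp: c_def)
    then show "1 \<le> c * \<bar>s\<bar>" using s by simp
  qed
  have h3: "h3 r = indicator {c..b} r *\<^sub>R ((1 / r) *\<^sub>R (cis (s * r) * \<psi> r))" for r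
    using Ls by (auto simp: h3_def h_def slope_integrand_def c_def indicator_def)
  have i3: "integrable lborel h3"
    using cis_set_integrable[OF cont c(1), of b s] unfolding set_integrable_def h3[abs_def] .
  have n3: "norm (LINT r|lborel. h3 r) \<le> 3 * C + D * b"
  proof (cases "c \<le> b")
    case True
    have "norm (LINT r|lborel. h3 r) \<le> (3 * C + D * (b - c)) / (c * \<bar>s\<bar>)"
      using oscillatory_integral_bound[OF der cont' c(1) True s(1) C D]
      unfolding set_lebesgue_integral_def h3 .
    also have "\<dots> \<le> (3 * C + D * (b - c)) / 1"
      using c C0 D0 True by (intro divide_left_mono) auto
    also have "\<dots> \<le> 3 * C + D * b" using D0 c by (simp add: mult_left_mono)
    finally show ?thesis .
  next
    case False
    then show ?thesis using C0 D0 ab by (simp add: h3)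
  qed
  show "set_integrable lborel {a..b} (slope_integrand \<psi> u L s)"
    unfolding set_integrable_def h_def[symmetric] split using i1 i2 i3 by auto
  have "(LINT r:{a..b}|lborel. slope_integrand \<psi> u L s r) = (LINT r|lborel. h1 r) + (LINT r|lborel. h2 r) + (LINT r|lborel. h3 r)"
    unfolding set_lebesgue_integral_def h_def[symmetric] split using i1 i2 i3 by simp
  also have "norm \<dots> \<le> (C + D / L) + C * ln (L / \<bar>s\<bar>) + (3 * C + D * b)"
    using n1 n2 n3 by (intro order_trans[OF norm_triangle_ineq] add_mono) auto
  finally show "norm (LINT r:{a..b}|lborel. slope_integrand \<psi> u L s r) \<le> 4 * C + D / L + D * b + C * ln (L / \<bar>s\<bar>)"
    by simp
qed

text \<open>A majorant of \<open>- ln \<bar>x\<bar>\<close> that is nonnegative on the whole line.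
  At 0, where the quotient is 0, the value is 0; this affects single points only.\<close>

definition log_weight :: "real \<Rightarrow> real" where
  "log_weight x = ln (1 + 1 / \<bar>x\<bar>)"

lemma log_weight_nonneg: "0 \<le> log_weight x"
  by (simp add: log_weight_def)

lemma log_weight_measurable [measurable]: "log_weight \<in> borel_measurable borel"
  unfolding log_weight_def[abs_def] by measurable

lemma log_weight_ge: "x \<noteq> 0 \<Longrightarrow> - ln \<bar>x\<bar> \<le> log_weight x"
proof -
  assume "x \<noteq> 0"
  then have "- ln \<bar>x\<bar> = ln (1 / \<bar>x\<bar>)" by (simp add: ln_div)
  also have "\<dots> \<le> log_weight x" using \<open>x \<noteq> 0\<close> unfolding log_weight_def
    by (subst ln_le_cancel_iff) (auto intro: add_pos_pos)
  finally show ?thesis .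
qed

text \<open>Integrability is a separate assumption because the integral of a nonintegrable function
  is 0, so that \<open>log_bound\<close> would hold for it without any content.\<close>

locale log_slope_kernel = slope_kernel +
  fixes \<Lambda> :: real
  assumes log_integrable: "\<And>t. integrable lborel (\<lambda>\<tau>. \<bar>g \<tau>\<bar> * log_weight (\<tau> - t))"
    and log_bound: "\<And>t. (LINT \<tau>|lborel. \<bar>g \<tau>\<bar> * log_weight (\<tau> - t)) \<le> \<Lambda>"
begin

text \<open>The 6 is the 4 of \<open>slope_integral_bound\<close> with \<open>\<psi> = 1\<close>
  plus the 2 of \<open>log_slope_bound\<close>.\<close>

definition L2_const :: real where
  "L2_const = 6 * (LINT \<tau>|lborel. \<bar>g \<tau>\<bar>) + \<Lambda>"

text \<open>The slope \<open>- \<xi> $ 1 / \<xi> $ 2\<close> is that of the line orthogonal to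
  \<open>\<xi>\<close>. If \<open>\<xi> $ 2\<close> is at most half of \<open>\<xi> $ 1\<close> in
  modulus, the phase is comparable to \<open>\<xi>\<close> on all of [0, 1] and the logarithm is at
  most \<open>ln 3\<close>. Otherwise the phase is \<open>\<xi> $ 2\<close> times the distance to
  that slope, and 3 bounds the remaining ratio.\<close>

lemma log_slope_bound:
  fixes \<xi> :: "real^2"
  assumes \<tau>: "\<tau> \<in> {0..1}" and s: "\<xi> $ 1 + \<xi> $ 2 * \<tau> \<noteq> 0"
  shows "ln ((\<bar>\<xi> $ 1\<bar> + \<bar>\<xi> $ 2\<bar>) / \<bar>\<xi> $ 1 + \<xi> $ 2 * \<tau>\<bar>) \<le> 2 + log_weight (\<tau> - (- \<xi> $ 1 / \<xi> $ 2))"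
proof -
  define a b where "a = \<xi> $ 1" and "b = \<xi> $ 2"
  have ln3: "ln 3 \<le> (2::real)" using ln_le_minus_one[of "3::real"] by simp
  have s': "a + b * \<tau> \<noteq> 0" using s by (simp add: a_def b_def)
  have ab: "0 < \<bar>a\<bar> + \<bar>b\<bar>" using s' by (cases "a = 0"; cases "b = 0") auto
  have "ln ((\<bar>a\<bar> + \<bar>b\<bar>) / \<bar>a + b * \<tau>\<bar>) \<le> 2 + log_weight (\<tau> - (- a / b))"
  proof (cases "\<bar>b\<bar> \<le> \<bar>a\<bar> / 2")
    case True
    have "\<bar>b * \<tau>\<bar> \<le> \<bar>b\<bar> * 1" unfolding abs_mult using \<tau> by (intro mult_left_mono) auto
    moreover have "\<bar>a\<bar> \<le> \<bar>a + b * \<tau>\<bar> + \<bar>b * \<tau>\<bar>" by linarith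
    ultimately have "\<bar>a\<bar> + \<bar>b\<bar> \<le> 3 * \<bar>a + b * \<tau>\<bar>" using True by linarith
    then have "(\<bar>a\<bar> + \<bar>b\<bar>) / \<bar>a + b * \<tau>\<bar> \<le> 3" using s' by (simp add: field_simps)
    then have "ln ((\<bar>a\<bar> + \<bar>b\<bar>) / \<bar>a + b * \<tau>\<bar>) \<le> ln 3" using s' ab by (subst ln_le_cancel_iff) auto
    then show ?thesis using ln3 log_weight_nonneg[of "\<tau> - (- a / b)"] by linarith
  next
    case False
    then have b: "b \<noteq> 0" by auto
    then have e: "a + b * \<tau> = b * (\<tau> - (- a / b))" by (simp add: field_simps)
    have nz: "\<tau> - (- a / b) \<noteq> 0" using s' unfolding e by auto
    have "(\<bar>a\<bar> + \<bar>b\<bar>) / \<bar>a + b * \<tau>\<bar> \<le> (3 * \<bar>b\<bar>) / \<bar>a + b * \<tau>\<bar>"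
      using False by (intro divide_right_mono) auto
    also have "\<dots> = 3 / \<bar>\<tau> - (- a / b)\<bar>" unfolding e abs_mult using b by simp
    finally have "ln ((\<bar>a\<bar> + \<bar>b\<bar>) / \<bar>a + b * \<tau>\<bar>) \<le> ln (3 / \<bar>\<tau> - (- a / b)\<bar>)"
      using s' ab nz by (subst ln_le_cancel_iff) auto
    also have "\<dots> = ln 3 + - ln \<bar>\<tau> - (- a / b)\<bar>" using nz by (subst ln_div) auto
    finally show ?thesis using ln3 log_weight_ge[OF nz] by linarith
  qed
  then show ?thesis by (simp add: a_def b_def)
qed

definition trunc_weight :: "real \<Rightarrow> real \<Rightarrow> real \<times> real \<Rightarrow> real" where
  "trunc_weight \<eta> R z = (if \<eta> < fst z \<and> fst z \<le> R then g (snd z) / fst z else 0)"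

lemma trunc_weight_integrable:
  assumes "0 < \<eta>"
  shows "integrable lborel2 (trunc_weight \<eta> R)"
proof (rule Bochner_Integration.integrable_bound[OF pv_dominating_integrable[of "1 / \<eta>" R]])
  show "trunc_weight \<eta> R \<in> borel_measurable lborel2" unfolding trunc_weight_def[abs_def] by measurable
  show "AE z in lborel2. norm (trunc_weight \<eta> R z) \<le> norm (1 / \<eta> * indicator {0..R} (fst z) * \<bar>g (snd z)\<bar>)"
    using assms by (intro AE_I2) (auto simp: trunc_weight_def indicator_def field_simps intro!: mult_right_mono)
qed

text \<open>Since \<open>g\<close> has mean zero, a constant \<open>J0\<close> may be subtracted
  from the ray integrals \<open>J \<tau>\<close>. With the cutoff \<open>1 / L\<close> in
  \<open>J0\<close> what remains is at most \<open>4 + ln (L / \<bar>s \<tau>\<bar>)\<close>,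
  uniformly in both truncations, and integrating the logarithm against \<open>\<bar>g\<bar>\<close>
  gives the logarithmic potential at the slope orthogonal to \<open>\<xi>\<close>.\<close>

lemma multiplier_bound:
  fixes \<xi> :: "real^2"
  assumes \<eta>: "0 < \<eta>" "\<eta> \<le> R"
  shows "norm (LINT z|lborel2. trunc_weight \<eta> R z *\<^sub>R cis (- (\<xi> \<bullet> (fst z *\<^sub>R pt 1 (snd z))))) \<le> L2_const"
proof -
  define s where "s \<tau> = - (\<xi> $ 1 + \<xi> $ 2 * \<tau>)" for \<tau>
  define L where "L = \<bar>\<xi> $ 1\<bar> + \<bar>\<xi> $ 2\<bar>"
  define J where "J \<tau> = (LINT r:{\<eta>..R}|lborel. (1 / r) *\<^sub>R cis (s \<tau> * r))" for \<tau>
  \<comment> \<open>For \<open>\<xi> = 0\<close> all ray integrals coincide and subtracting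
    \<open>J 0\<close> leaves nothing; \<open>L\<close> would be 0 in this case.\<close>
  define J0 where "J0 = (if \<xi> = 0 then J 0 else (LINT r:{\<eta>..R}|lborel. (1 / r) *\<^sub>R (if r < 1 / L then 1 else 0 :: complex)))"
  have cism [measurable]: "cis \<in> borel_measurable borel"
    by (intro borel_measurable_continuous_onI continuous_intros)
  have ph: "\<xi> \<bullet> pt 1 \<tau> = - s \<tau>" for \<tau>
    by (simp add: inner_vec2 s_def)
  have int: "integrable lborel2 (\<lambda>z. trunc_weight \<eta> R z *\<^sub>R cis (- (\<xi> \<bullet> (fst z *\<^sub>R pt 1 (snd z)))))"
    by (rule Bochner_Integration.integrable_bound[OF trunc_weight_integrable[OF \<eta>(1), of R]])
       (auto simp: trunc_weight_def)
  have inner: "(LINT r|lborel. trunc_weight \<eta> R (r, \<tau>) *\<^sub>R cis (- (\<xi> \<bullet> (r *\<^sub>R pt 1 \<tau>)))) = g \<tau> *\<^sub>R J \<tau>" for \<tau>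
  proof -
    have "(LINT r|lborel. trunc_weight \<eta> R (r, \<tau>) *\<^sub>R cis (- (\<xi> \<bullet> (r *\<^sub>R pt 1 \<tau>))))
      = (LINT r|lborel. g \<tau> *\<^sub>R (indicator {\<eta>..R} r *\<^sub>R ((1 / r) *\<^sub>R cis (s \<tau> * r))))"
    proof (rule integral_cong_AE)
      show "AE r in lborel. trunc_weight \<eta> R (r, \<tau>) *\<^sub>R cis (- (\<xi> \<bullet> (r *\<^sub>R pt 1 \<tau>)))
         = g \<tau> *\<^sub>R (indicator {\<eta>..R} r *\<^sub>R ((1 / r) *\<^sub>R cis (s \<tau> * r)))"
        using AE_lborel_singleton[of \<eta>] by eventually_elim (auto simp: trunc_weight_def indicator_def ph mult.commute)
    qed (simp_all add: trunc_weight_def ph cong: if_cong)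
    then show ?thesis unfolding J_def set_lebesgue_integral_def by (simp only: integral_scaleR_right)
  qed
  define h where "h z = trunc_weight \<eta> R z *\<^sub>R cis (- (\<xi> \<bullet> (fst z *\<^sub>R pt 1 (snd z))))" for z
  have inner': "(LINT r|lborel. h (r, \<tau>)) = g \<tau> *\<^sub>R J \<tau>" for \<tau>
    using inner[of \<tau>] by (simp only: h_def fst_conv snd_conv)
  have int': "integrable lborel2 h" using int by (simp only: h_def[abs_def])
  have fub: "(LINT z|lborel2. h z) = (LINT \<tau>|lborel. g \<tau> *\<^sub>R J \<tau>)"
    and gJ: "integrable lborel (\<lambda>\<tau>. g \<tau> *\<^sub>R J \<tau>)"
    using lborel_pair.integral_snd[of "\<lambda>r \<tau>. h (r, \<tau>)"] lborel_pair.integrable_snd[of "\<lambda>r \<tau>. h (r, \<tau>)"] int'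
    by (simp_all add: inner')
  have gi: "integrable lborel (\<lambda>\<tau>. 6 * \<bar>g \<tau>\<bar>)" using g_integrable by simp
  have gJ0: "integrable lborel (\<lambda>\<tau>. g \<tau> *\<^sub>R J0)" using g_integrable by simp
  have "(LINT \<tau>|lborel. g \<tau> *\<^sub>R J0) = 0" using g_integrable by (simp add: g_mean)
  then have "(LINT \<tau>|lborel. g \<tau> *\<^sub>R J \<tau>) = (LINT \<tau>|lborel. g \<tau> *\<^sub>R J \<tau> - g \<tau> *\<^sub>R J0)"
    using gJ gJ0 by simp
  also have "norm \<dots> \<le> (LINT \<tau>|lborel. norm (g \<tau> *\<^sub>R J \<tau> - g \<tau> *\<^sub>R J0))"
    by (rule integral_norm_bound)
  also have "\<dots> \<le> (LINT \<tau>|lborel. 6 * \<bar>g \<tau>\<bar> + \<bar>g \<tau>\<bar> * log_weight (\<tau> - (- \<xi> $ 1 / \<xi> $ 2)))"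
  proof (rule integral_mono_AE)
    show "integrable lborel (\<lambda>\<tau>. norm (g \<tau> *\<^sub>R J \<tau> - g \<tau> *\<^sub>R J0))" using gJ gJ0 by auto
    show "integrable lborel (\<lambda>\<tau>. 6 * \<bar>g \<tau>\<bar> + \<bar>g \<tau>\<bar> * log_weight (\<tau> - (- \<xi> $ 1 / \<xi> $ 2)))"
      by (rule Bochner_Integration.integrable_add[OF gi log_integrable])
    show "AE \<tau> in lborel. norm (g \<tau> *\<^sub>R J \<tau> - g \<tau> *\<^sub>R J0) \<le> 6 * \<bar>g \<tau>\<bar> + \<bar>g \<tau>\<bar> * log_weight (\<tau> - (- \<xi> $ 1 / \<xi> $ 2))"
      using AE_lborel_singleton[of "- \<xi> $ 1 / \<xi> $ 2"]
    proof eventually_elim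
      case (elim \<tau>)
      show ?case
      proof (cases "\<tau> \<in> {0..1} \<and> \<xi> \<noteq> 0")
        case True
        have L: "0 < L" using True by (auto simp: L_def vec2_eq_iff intro: add_pos_nonneg add_nonneg_pos)
        have s0: "s \<tau> \<noteq> 0"
        proof
          assume "s \<tau> = 0"
          then have *: "\<xi> $ 1 + \<xi> $ 2 * \<tau> = 0" by (simp add: s_def)
          then have "\<xi> $ 2 \<noteq> 0" using True by (auto simp: vec2_eq_iff)
          then have "\<tau> = - \<xi> $ 1 / \<xi> $ 2" using * by (simp add: field_simps)
          then show False using elim by simp
        qed
        have "\<bar>\<xi> $ 2 * \<tau>\<bar> \<le> \<bar>\<xi> $ 2\<bar> * 1" unfolding abs_mult using True by (intro mult_left_mono) auto
        then have sL: "\<bar>s \<tau>\<bar> \<le> L" unfolding s_def L_def by linarith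
        have "J \<tau> - J0 = (LINT r:{\<eta>..R}|lborel. slope_integrand (\<lambda>_. 1) 1 L (s \<tau>) r)"
        proof -
          have X: "set_integrable lborel {\<eta>..R} (\<lambda>r. (1 / r) *\<^sub>R cis (s \<tau> * r))"
            using cis_set_integrable[of "\<lambda>_. 1" \<eta> R "s \<tau>"] \<eta> by simp
          have Y: "set_integrable lborel {\<eta>..R} (\<lambda>r. (1 / r) *\<^sub>R (if r < 1 / L then 1 else 0 :: complex))"
            unfolding set_integrable_def
            by (rule Bochner_Integration.integrable_bound[OF integral_inverse_interval(1)[OF \<eta>]])
               (auto simp: indicator_def)
          have "J0 = (LINT r:{\<eta>..R}|lborel. (1 / r) *\<^sub>R (if r < 1 / L then 1 else 0 :: complex))"
            using True by (simp add: J0_def)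
          then show ?thesis
            unfolding J_def slope_integrand_def scaleR_diff_right mult_1_right
            by (simp only: set_integral_diff(2)[OF X Y])
        qed
        also have "norm \<dots> \<le> 4 * 1 + 0 / L + 0 * R + 1 * ln (L / \<bar>s \<tau>\<bar>)"
          by (rule slope_integral_bound(2)[where \<psi>' = "\<lambda>_. 0"]) (use \<eta> s0 sL in auto)
        also have "\<dots> \<le> 4 + (2 + log_weight (\<tau> - (- \<xi> $ 1 / \<xi> $ 2)))"
        proof -
          have "\<bar>s \<tau>\<bar> = \<bar>\<xi> $ 1 + \<xi> $ 2 * \<tau>\<bar>" unfolding s_def by (rule abs_minus_cancel)
          moreover have "\<xi> $ 1 + \<xi> $ 2 * \<tau> \<noteq> 0" using s0 by (simp add: s_def)
          ultimately have "ln (L / \<bar>s \<tau>\<bar>) \<le> 2 + log_weight (\<tau> - (- \<xi> $ 1 / \<xi> $ 2))"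
            using log_slope_bound[of \<tau> \<xi>] True unfolding L_def by presburger
          then show ?thesis by linarith
        qed
        finally have "\<bar>g \<tau>\<bar> * norm (J \<tau> - J0) \<le> \<bar>g \<tau>\<bar> * (6 + log_weight (\<tau> - (- \<xi> $ 1 / \<xi> $ 2)))"
          by (intro mult_left_mono) auto
        moreover have "g \<tau> *\<^sub>R J \<tau> - g \<tau> *\<^sub>R J0 = g \<tau> *\<^sub>R (J \<tau> - J0)" by (simp only: scaleR_diff_right)
        ultimately show ?thesis by (simp only: norm_scaleR distrib_left mult.commute[of _ 6])
      next
        case False
        show ?thesis
        proof (cases "\<xi> = 0")
          case True
          have "J \<tau> = J0" using True by (simp add: J0_def J_def s_def)
          then show ?thesis using log_weight_nonneg by simp
        next
          case False2: False
          then have "g \<tau> = 0" using False g_support[of \<tau>] by auto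
          then show ?thesis by simp
        qed
      qed
    qed
  qed
  also have "\<dots> = 6 * (LINT \<tau>|lborel. \<bar>g \<tau>\<bar>) + (LINT \<tau>|lborel. \<bar>g \<tau>\<bar> * log_weight (\<tau> - (- \<xi> $ 1 / \<xi> $ 2)))"
    by (simp only: Bochner_Integration.integral_add[OF gi log_integrable] integral_mult_right_zero)
  also have "\<dots> \<le> L2_const" unfolding L2_const_def by (intro add_left_mono log_bound)
  finally show ?thesis unfolding fub[unfolded h_def] .
qed

lemma trunc_superposition:
  assumes "0 < \<eta>" "\<eta> \<le> R"
  shows "translation_superposition lborel2 (trunc_weight \<eta> R) (\<lambda>z. fst z *\<^sub>R pt 1 (snd z)) (R * 2) L2_const"
proof
  show "integrable lborel2 (trunc_weight \<eta> R)" by (rule trunc_weight_integrable[OF assms(1)])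
  show "0 \<le> R * 2" using assms by simp
  show "norm (LINT z|lborel2. trunc_weight \<eta> R z *\<^sub>R cis (- (\<xi> \<bullet> fst z *\<^sub>R pt 1 (snd z)))) \<le> L2_const" for \<xi>
    by (rule multiplier_bound[OF assms])
  fix z assume "trunc_weight \<eta> R z \<noteq> 0"
  then have z: "\<eta> < fst z" "fst z \<le> R" "g (snd z) \<noteq> 0" by (auto simp: trunc_weight_def split: if_splits)
  then have "snd z \<in> {0..1}" using g_support[of "snd z"] by auto
  then have "norm (pt 1 (snd z)) \<le> 2" by (rule norm_pt_1_le)
  then show "norm (fst z *\<^sub>R pt 1 (snd z)) \<le> R * 2"
    using z assms mult_mono[of "fst z" R "norm (pt 1 (snd z))" 2] by simp
qed measurable

text \<open>Fatou's lemma along truncations \<open>\<eta> k\<close> tending to 0 and growing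
  squares; the superposition estimate is uniform in both.\<close>

lemma pv_L2:
  assumes f: "lipschitz_bounded_support f C K"
  shows "(\<integral>\<^sup>+x. ennreal ((norm (pv f x))\<^sup>2) \<partial>lborel) \<le> ennreal (L2_const\<^sup>2 * (LINT x|lborel. (norm (f x))\<^sup>2))"
proof -
  have K: "0 \<le> K" using f by (simp add: lipschitz_bounded_support_def)
  define \<eta> where "\<eta> k = 1 / real (k + 2)" for k
  define A where "A k = real (k + 1)" for k
  define F where "F k x = indicator (open_square (A k)) x * (norm (pv_trunc (\<lambda>_. 1) (\<eta> k) f x))\<^sup>2" for k x
  have \<eta>: "0 < \<eta> k" "\<eta> k < 1" for k by (auto simp: \<eta>_def)
  have F: "integrable lborel (F k)" "(LINT x|lborel. F k x) \<le> L2_const\<^sup>2 * (LINT x|lborel. (norm (f x))\<^sup>2)" for k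
  proof -
    \<comment> \<open>So large that \<open>x - r *\<^sub>R pt 1 \<tau>\<close> is outside the
      support of \<open>f\<close> for \<open>x\<close> in the square and \<open>r > R\<close>. The
      outer truncation of \<open>trunc_weight\<close>, which makes the superposition one of bounded
      translations, is then invisible.\<close>
    define R where "R = K + 2 * A k + 1"
    have R: "\<eta> k \<le> R" using \<eta>[of k] K by (simp add: R_def A_def)
    interpret T: translation_superposition lborel2 "trunc_weight (\<eta> k) R" "\<lambda>z. fst z *\<^sub>R pt 1 (snd z)" "R * 2" L2_const
      by (rule trunc_superposition[OF \<eta>(1) R])
    have eq: "T.super f x = pv_trunc (\<lambda>_. 1) (\<eta> k) f x" if x: "x \<in> open_square (A k)" for x
      unfolding T.super_def pv_trunc_def
    proof (rule Bochner_Integration.integral_cong[OF refl])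
      fix z :: "real \<times> real"
      have "norm x \<le> \<bar>x $ 1\<bar> + \<bar>x $ 2\<bar>"
        unfolding norm_vec2 by (rule sqrt_sum_squares_le_sum_abs)
      then have nx: "norm x \<le> 2 * A k" using x by (auto simp: open_square_def)
      show "trunc_weight (\<eta> k) R z *\<^sub>R f (x - fst z *\<^sub>R pt 1 (snd z))
        = (if 0 < fst z \<and> \<eta> k < fst z * 1 then (g (snd z) / fst z) *\<^sub>R f (x - fst z *\<^sub>R pt 1 (snd z)) else 0)"
      proof (cases "\<eta> k < fst z \<and> R < fst z")
        case True
        then have r: "0 < fst z" using \<eta>(1)[of k] by linarith
        have "fst z * 1 \<le> fst z * norm (pt 1 (snd z))" using r norm_pt_1_ge by (intro mult_left_mono) auto
        moreover have "norm (fst z *\<^sub>R pt 1 (snd z)) = fst z * norm (pt 1 (snd z))" using r by simp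
        ultimately have "R \<le> norm (fst z *\<^sub>R pt 1 (snd z))" using True by linarith
        then have "K \<le> norm (x - fst z *\<^sub>R pt 1 (snd z))"
          using norm_triangle_ineq2[of "fst z *\<^sub>R pt 1 (snd z)" x] nx norm_minus_commute[of x "fst z *\<^sub>R pt 1 (snd z)"]
          unfolding R_def by linarith
        then have "f (x - fst z *\<^sub>R pt 1 (snd z)) = 0" using f by (simp add: lipschitz_bounded_support_def)
        then show ?thesis by simp
      next
        case False
        then show ?thesis using \<eta>(1)[of k] by (auto simp: trunc_weight_def)
      qed
    qed
    have Feq: "F k = (\<lambda>x. indicator (open_square (A k)) x * (norm (T.super f x))\<^sup>2)"
      by (auto simp: F_def eq indicator_def)
    have A0: "0 < A k" by (simp add: A_def)
    show "integrable lborel (F k)" unfolding Feq by (rule T.super_L2_bound(2)[OF f A0])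
    show "(LINT x|lborel. F k x) \<le> L2_const\<^sup>2 * (LINT x|lborel. (norm (f x))\<^sup>2)"
      unfolding Feq by (rule T.super_L2_bound(1)[OF f A0])
  qed
  have \<eta>0: "filterlim \<eta> (at_right 0) sequentially"
  proof -
    have "\<eta> \<longlonglongrightarrow> 0" unfolding \<eta>_def using LIMSEQ_ignore_initial_segment[OF lim_1_over_n[where 'a=real], of 2] by simp
    then show ?thesis using \<eta>(1) by (intro tendsto_imp_filterlim_at_right always_eventually) auto
  qed
  have lim: "(\<lambda>k. ennreal (F k x)) \<longlonglongrightarrow> ennreal ((norm (pv f x))\<^sup>2)" for x
  proof -
    have "((\<lambda>\<epsilon>. pv_trunc (\<lambda>_. 1) \<epsilon> f x) \<longlongrightarrow> pv f x) (at_right 0)"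
      using pv_trunc_tendsto[OF f, of "\<lambda>_. 1" x] by simp
    then have l: "(\<lambda>k. pv_trunc (\<lambda>_. 1) (\<eta> k) f x) \<longlonglongrightarrow> pv f x"
      using \<eta>0 by (rule filterlim_compose)
    have ev: "eventually (\<lambda>k. (norm (pv_trunc (\<lambda>_. 1) (\<eta> k) f x))\<^sup>2 = F k x) sequentially"
    proof -
      obtain n :: nat where n: "\<bar>x $ 1\<bar> + \<bar>x $ 2\<bar> < real n" using reals_Archimedean2 by blast
      show ?thesis
        unfolding eventually_sequentially
      proof (intro exI allI impI)
        fix k assume "n \<le> k"
        then have "real n \<le> real k" by simp
        then have "x \<in> open_square (A k)" using n by (auto simp: open_square_def A_def)
        then show "(norm (pv_trunc (\<lambda>_. 1) (\<eta> k) f x))\<^sup>2 = F k x" by (simp add: F_def)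
      qed
    qed
    have "(\<lambda>k. F k x) \<longlonglongrightarrow> (norm (pv f x))\<^sup>2"
      by (rule Lim_transform_eventually[OF tendsto_power[OF tendsto_norm[OF l]] ev])
    then show ?thesis by (rule tendsto_ennrealI)
  qed
  have "(\<integral>\<^sup>+x. ennreal ((norm (pv f x))\<^sup>2) \<partial>lborel) = (\<integral>\<^sup>+x. liminf (\<lambda>k. ennreal (F k x)) \<partial>lborel)"
    by (intro nn_integral_cong lim_imp_Liminf[OF _ lim, symmetric]) simp
  also have "\<dots> \<le> liminf (\<lambda>k. \<integral>\<^sup>+x. ennreal (F k x) \<partial>lborel)"
    using F(1) by (intro nn_integral_liminf) auto
  also have "\<dots> = liminf (\<lambda>k. ennreal (LINT x|lborel. F k x))"
    using F(1) by (subst nn_integral_eq_integral) (auto simp: F_def)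
  also have "\<dots> \<le> liminf (\<lambda>k::nat. ennreal (L2_const\<^sup>2 * (LINT x|lborel. (norm (f x))\<^sup>2)))"
    using F(2) by (intro Liminf_mono always_eventually allI ennreal_leI)
  also have "\<dots> = ennreal (L2_const\<^sup>2 * (LINT x|lborel. (norm (f x))\<^sup>2))"
    by (simp add: Liminf_const)
  finally show ?thesis .
qed

lemma lipschitz_square_integrable:
  assumes f: "lipschitz_bounded_support f C K"
  shows "integrable lborel (\<lambda>x. (norm (f x))\<^sup>2)"
proof (rule Bochner_Integration.integrable_bound)
  have K: "0 \<le> K" using f by (simp add: lipschitz_bounded_support_def)
  have "emeasure lborel (cball (0::real^2) K) < \<infinity>" by (rule emeasure_lborel_cball_finite)
  then show "integrable lborel (\<lambda>x::real^2. indicator (cball 0 K) x * (2 * C * K)\<^sup>2)"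
    by (intro integrable_mult_left integrable_real_indicator) auto
  show "(\<lambda>x. (norm (f x))\<^sup>2) \<in> borel_measurable lborel"
    using lipschitz_bounded_support_measurable[OF f] by measurable
  show "AE x in lborel. norm ((norm (f x))\<^sup>2) \<le> norm (indicator (cball 0 K) x * (2 * C * K)\<^sup>2)"
  proof (rule AE_I2)
    fix x
    show "norm ((norm (f x))\<^sup>2) \<le> norm (indicator (cball 0 K) x * (2 * C * K)\<^sup>2)"
    proof (cases "K \<le> norm x")
      case True
      then have "f x = 0" using f by (simp add: lipschitz_bounded_support_def)
      then show ?thesis by simp
    next
      case False
      then show ?thesis
        using power_mono[OF lipschitz_bounded_support_bound[OF f] norm_ge_zero, of x 2] by simp
    qed
  qed
qed

lemma rough_T_L2:
  assumes f: "lipschitz_bounded_support f C K"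
  shows "rough_T Omega f \<in> borel_measurable borel"
    and "integrable lborel (\<lambda>x. (norm (rough_T Omega f x))\<^sup>2)"
    and "(LINT x|lborel. (norm (rough_T Omega f x))\<^sup>2) \<le> 2 * (L2_const\<^sup>2 + c_g\<^sup>2) * (LINT x|lborel. (norm (f x))\<^sup>2)"
proof -
  note [measurable] = lipschitz_bounded_support_measurable[OF f] pv_measurable[OF lipschitz_bounded_support_measurable[OF f]]
  have T: "rough_T Omega f = (\<lambda>x. pv f x + c_g *\<^sub>R f x)"
    using rough_T_Omega[OF f] by auto
  show m: "rough_T Omega f \<in> borel_measurable borel" unfolding T by measurable
  have pvi: "integrable lborel (\<lambda>x. (norm (pv f x))\<^sup>2)"
    using le_less_trans[OF pv_L2[OF f] ennreal_less_top] by (intro integrableI_bounded) auto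
  have pvb: "(LINT x|lborel. (norm (pv f x))\<^sup>2) \<le> L2_const\<^sup>2 * (LINT x|lborel. (norm (f x))\<^sup>2)"
    using pv_L2[OF f] nn_integral_eq_integral[OF pvi] by (simp add: ennreal_le_iff)
  note fi = lipschitz_square_integrable[OF f]
  have b: "(norm (rough_T Omega f x))\<^sup>2 \<le> 2 * (norm (pv f x))\<^sup>2 + 2 * c_g\<^sup>2 * (norm (f x))\<^sup>2" for x
  proof -
    have "(norm (rough_T Omega f x))\<^sup>2 \<le> (norm (pv f x) + \<bar>c_g\<bar> * norm (f x))\<^sup>2"
      unfolding T by (intro power_mono order_trans[OF norm_triangle_ineq]) auto
    also have "\<dots> \<le> 2 * (norm (pv f x))\<^sup>2 + 2 * (\<bar>c_g\<bar> * norm (f x))\<^sup>2"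
      using zero_le_power2[of "norm (pv f x) - \<bar>c_g\<bar> * norm (f x)"] by (simp add: power2_sum power2_diff)
    finally show ?thesis by (simp add: power_mult_distrib)
  qed
  have bi: "integrable lborel (\<lambda>x. 2 * (norm (pv f x))\<^sup>2 + 2 * c_g\<^sup>2 * (norm (f x))\<^sup>2)"
    using pvi fi by auto
  show i: "integrable lborel (\<lambda>x. (norm (rough_T Omega f x))\<^sup>2)"
    by (rule Bochner_Integration.integrable_bound[OF bi]) (use m b in \<open>auto intro!: AE_I2 intro: order_trans[OF _ abs_ge_self]\<close>)
  have "(LINT x|lborel. (norm (rough_T Omega f x))\<^sup>2) \<le> (LINT x|lborel. 2 * (norm (pv f x))\<^sup>2 + 2 * c_g\<^sup>2 * (norm (f x))\<^sup>2)"
    by (rule integral_mono[OF i bi b])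
  also have "\<dots> = 2 * (LINT x|lborel. (norm (pv f x))\<^sup>2) + 2 * c_g\<^sup>2 * (LINT x|lborel. (norm (f x))\<^sup>2)"
    using pvi fi by simp
  finally show "(LINT x|lborel. (norm (rough_T Omega f x))\<^sup>2) \<le> 2 * (L2_const\<^sup>2 + c_g\<^sup>2) * (LINT x|lborel. (norm (f x))\<^sup>2)"
    using pvb by (simp add: algebra_simps)
qed

end

section \<open>The multiplier\<close>

lemma set_integral_Icc_split:
  fixes f :: "real \<Rightarrow> complex"
  assumes f: "set_integrable lborel {a..b} f" and c: "a \<le> c" "c \<le> b"
  shows "(LINT r:{a..b}|lborel. f r) = (LINT r:{a..c}|lborel. f r) + (LINT r:{c..b}|lborel. f r)"
proof -
  have 1: "set_integrable lborel {a..c} f" and 2: "set_integrable lborel {c..b} f"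
    using c by (auto intro!: set_integrable_subset[OF f])
  show ?thesis
    using Henstock_Kurzweil_Integration.integral_combine[OF c set_borel_integral_eq_integral(1)[OF f]]
    by (simp add: set_borel_integral_eq_integral(2)[OF f] set_borel_integral_eq_integral(2)[OF 1]
        set_borel_integral_eq_integral(2)[OF 2])
qed

section \<open>The ray integral up to infinity and its logarithm\<close>

definition exp_integral :: "real \<Rightarrow> real \<Rightarrow> complex" where
  "exp_integral s \<rho> = (LINT r:{0..\<rho>}|lborel. slope_integrand (\<lambda>_. 1) 1 1 s r)"

lemma slope_integrand_one_integrable:
  assumes "s \<noteq> 0" "0 \<le> \<rho>"
  shows "set_integrable lborel {0..\<rho>} (slope_integrand (\<lambda>_. 1) 1 1 s)"
proof -
  have m [measurable]: "(\<lambda>r. cis (s * r)) \<in> borel_measurable borel"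
    by (intro borel_measurable_continuous_onI continuous_intros)
  have i: "integrable lborel (\<lambda>r. indicator {0..\<rho>} r * (\<bar>s\<bar> + 2))"
    by (intro integrable_mult_left integrable_real_indicator) (auto simp: emeasure_lborel_Icc_eq)
  show ?thesis
    unfolding set_integrable_def
  proof (rule Bochner_Integration.integrable_bound[OF i])
    show "(\<lambda>r. indicator {0..\<rho>} r *\<^sub>R slope_integrand (\<lambda>_. 1) 1 1 s r) \<in> borel_measurable lborel"
      unfolding slope_integrand_def by measurable
    show "AE r in lborel. norm (indicator {0..\<rho>} r *\<^sub>R slope_integrand (\<lambda>_. 1) 1 1 s r) \<le> norm (indicator {0..\<rho>} r * (\<bar>s\<bar> + 2))"
    proof (rule AE_I2)
      fix r :: real
      have "norm (slope_integrand (\<lambda>_. 1) 1 1 s r) \<le> \<bar>s\<bar> + 2" if "0 \<le> r"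
      proof (cases "r = 0")
        case False
        then have r: "0 < r" using that by simp
        show ?thesis
        proof (cases "r < 1")
          case True
          have "norm (slope_integrand (\<lambda>_. 1) 1 1 s r) = norm (cis (s * r) - 1) / r"
            using r True by (simp add: slope_integrand_def)
          also have "\<dots> \<le> \<bar>s * r\<bar> / r" using r by (intro divide_right_mono cis_minus_one_bound) auto
          also have "\<dots> = \<bar>s\<bar>" using r by (simp add: abs_mult)
          finally show ?thesis by simp
        next
          case False
          then have "norm (slope_integrand (\<lambda>_. 1) 1 1 s r) = 1 / r" using r by (simp add: slope_integrand_def)
          also have "\<dots> \<le> 1" using False by simp
          finally show ?thesis by simp
        qed
      qed (simp add: slope_integrand_def)
      then show "norm (indicator {0..\<rho>} r *\<^sub>R slope_integrand (\<lambda>_. 1) 1 1 s r) \<le> norm (indicator {0..\<rho>} r * (\<bar>s\<bar> + 2))"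
        by (auto simp: indicator_def)
    qed
  qed
qed

lemma slope_integrand_tail:
  assumes "1 \<le> \<rho>"
  shows "(LINT r:{\<rho>..b}|lborel. slope_integrand \<psi> u 1 s r) = (LINT r:{\<rho>..b}|lborel. (1 / r) *\<^sub>R (cis (s * r) * \<psi> r))"
  using assms by (intro set_lebesgue_integral_cong) (auto simp: slope_integrand_def)

lemma exp_integral_cauchy:
  assumes s: "s \<noteq> 0" and \<rho>: "1 \<le> \<rho>" "\<rho> \<le> \<rho>'"
  shows "norm (exp_integral s \<rho>' - exp_integral s \<rho>) \<le> 3 / (\<rho> * \<bar>s\<bar>)"
proof -
  have "exp_integral s \<rho>' - exp_integral s \<rho> = (LINT r:{\<rho>..\<rho>'}|lborel. (1 / r) *\<^sub>R (cis (s * r) * 1))"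
    unfolding exp_integral_def slope_integrand_tail[OF \<rho>(1), symmetric, where u=1]
    using set_integral_Icc_split[OF slope_integrand_one_integrable[OF s, of \<rho>'], of \<rho>] \<rho> by simp
  also have "norm \<dots> \<le> (3 * 1 + 0 * (\<rho>' - \<rho>)) / (\<rho> * \<bar>s\<bar>)"
    by (rule oscillatory_integral_bound[where \<psi>' = "\<lambda>_. 0"]) (use \<rho> s in auto)
  finally show ?thesis by simp
qed

text \<open>Substituting \<open>u = \<bar>s\<bar> * r\<close> reduces the frequency to its sign but
  moves the cutoff of the subtracted constant from 1 to \<open>1 / \<bar>s\<bar>\<close>. The
  integral of \<open>1 / r\<close> between the two cutoffs is the logarithm.\<close>

lemma exp_integral_scale:
  assumes s: "s \<noteq> 0" and \<rho>: "1 \<le> \<rho>" "1 \<le> \<rho> * \<bar>s\<bar>"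
  shows "exp_integral s \<rho> = exp_integral (sgn s) (\<rho> * \<bar>s\<bar>) - of_real (ln \<bar>s\<bar>)"
proof -
  define q where "q = 1 / \<bar>s\<bar>"
  have q: "0 < q" "q \<le> \<rho>" using s \<rho> by (auto simp: q_def field_simps)
  have sg: "sgn s \<noteq> 0" using s by (simp add: sgn_zero_iff)
  define F where "F r = indicator {0..\<rho>} r *\<^sub>R slope_integrand (\<lambda>_. 1) 1 1 s r" for r
  define G where "G u = indicator {0..\<rho> * \<bar>s\<bar>} u *\<^sub>R slope_integrand (\<lambda>_. 1) 1 1 (sgn s) u" for u
  \<comment> \<open>At least one of \<open>I 1 q\<close> and \<open>I q 1\<close> vanishes almost
    everywhere, so their difference is the signed integrand from 1 to \<open>q\<close> without a
    case distinction.\<close>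
  define I where "I a b r = indicator {a..b} r / r" for a b r :: real
  have Fi: "integrable lborel F" using slope_integrand_one_integrable[OF s, of \<rho>] \<rho>
    by (simp add: F_def[abs_def] set_integrable_def)
  have Gi: "integrable lborel G" using slope_integrand_one_integrable[OF sg, of "\<rho> * \<bar>s\<bar>"] \<rho>
    by (simp add: G_def[abs_def] set_integrable_def)
  have Gi': "integrable lborel (\<lambda>r. \<bar>s\<bar> *\<^sub>R G (\<bar>s\<bar> * r))"
    using lborel_integrable_real_affine[OF Gi, of "\<bar>s\<bar>" 0] s by simp
  have Geq: "(LINT u|lborel. G u) = (LINT r|lborel. \<bar>s\<bar> *\<^sub>R G (\<bar>s\<bar> * r))"
    using lborel_integral_real_affine[of "\<bar>s\<bar>" G 0] s by simp
  have inv: "integrable lborel (I q 1)" "integrable lborel (I 1 q)"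
    "(LINT r|lborel. I 1 q r - I q 1 r) = ln q"
  proof -
    have c: "integrable lborel (I a b) \<and> (LINT r|lborel. I a b r) = (if a \<le> b then ln (b / a) else 0)"
      if "0 < a" for a b
      using integral_inverse_interval[of a b] that by (cases "a \<le> b") (auto simp: I_def[abs_def])
    show "integrable lborel (I q 1)" "integrable lborel (I 1 q)" using c[of q 1] c[of 1 q] q by auto
    then show "(LINT r|lborel. I 1 q r - I q 1 r) = ln q"
      using c[of q 1] c[of 1 q] q by (auto simp: ln_div)
  qed
  have ae: "AE r in lborel. F r - \<bar>s\<bar> *\<^sub>R G (\<bar>s\<bar> * r) = of_real (I 1 q r - I q 1 r)"
    using AE_lborel_singleton[of q] AE_lborel_singleton[of 1]
  proof eventually_elim
    case (elim r)
    show ?case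
    proof (cases "0 < r \<and> r \<le> \<rho>")
      case True
      have "\<bar>s\<bar> * r \<le> \<rho> * \<bar>s\<bar>" using True by (simp add: mult.commute[of "\<bar>s\<bar>"] mult_right_mono)
      moreover have "\<bar>s\<bar> * r < 1 \<longleftrightarrow> r < q" using s by (simp add: q_def field_simps)
      moreover have "cis (sgn s * (\<bar>s\<bar> * r)) = cis (s * r)" by (simp add: mult.assoc[symmetric] sgn_mult_abs)
      ultimately have "\<bar>s\<bar> *\<^sub>R G (\<bar>s\<bar> * r) = (1 / r) *\<^sub>R (cis (s * r) - (if r < q then 1 else 0))"
        using True s by (simp add: G_def slope_integrand_def)
      moreover have "F r = (1 / r) *\<^sub>R (cis (s * r) - (if r < 1 then 1 else 0))"
        using True by (simp add: F_def slope_integrand_def)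
      ultimately have "F r - \<bar>s\<bar> *\<^sub>R G (\<bar>s\<bar> * r) = (1 / r) *\<^sub>R ((if r < q then 1 else 0) - (if r < 1 then 1 else 0))"
        by (simp only: scaleR_diff_right[symmetric]) simp
      also have "\<dots> = of_real (I 1 q r - I q 1 r)"
        using True elim by (auto simp: I_def indicator_def scaleR_conv_of_real)
      finally show ?thesis .
    next
      case False
      have "\<not> (0 \<le> \<bar>s\<bar> * r \<and> \<bar>s\<bar> * r \<le> \<rho> * \<bar>s\<bar>) \<or> r = 0"
        using False s by (auto simp: mult.commute zero_le_mult_iff)
      moreover have "I 1 q r = 0" "I q 1 r = 0" using False q \<rho> by (auto simp: I_def indicator_def)
      ultimately show ?thesis using False by (auto simp: F_def G_def slope_integrand_def indicator_def)
    qed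
  qed
  have "(LINT r|lborel. F r) - (LINT u|lborel. G u) = (LINT r|lborel. F r - \<bar>s\<bar> *\<^sub>R G (\<bar>s\<bar> * r))"
    unfolding Geq using Fi Gi' by simp
  also have "\<dots> = (LINT r|lborel. complex_of_real (I 1 q r - I q 1 r))"
    by (rule integral_cong_AE[OF _ _ ae]) (use Fi Gi' inv in \<open>auto simp del: of_real_diff\<close>)
  also have "\<dots> = of_real (ln q)" unfolding integral_complex_of_real inv(3) ..
  finally show ?thesis using s
    by (simp add: exp_integral_def set_lebesgue_integral_def F_def G_def q_def ln_div algebra_simps)
qed

text \<open>For \<sigma> = 1 or -1 the classical value is
  \<open>- \<gamma> + \<sigma> * \<i> * pi / 2\<close> with Euler's constant \<gamma>. It is kept
  abstract; its norm enters the constants.\<close>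

definition exp_integral_lim :: "real \<Rightarrow> complex" where
  "exp_integral_lim \<sigma> = lim (\<lambda>n. exp_integral \<sigma> (real n))"

lemma exp_integral_lim_bound:
  assumes \<sigma>: "\<bar>\<sigma>\<bar> = 1" and \<rho>: "1 \<le> \<rho>"
  shows "norm (exp_integral \<sigma> \<rho> - exp_integral_lim \<sigma>) \<le> 3 / \<rho>"
proof -
  have s: "\<sigma> \<noteq> 0" using \<sigma> by auto
  have "Cauchy (\<lambda>n. exp_integral \<sigma> (real n))"
  proof (rule metric_CauchyI)
    fix e :: real assume e: "0 < e"
    obtain M :: nat where M: "3 / e < real M" using reals_Archimedean2 by blast
    have M0: "0 < real M" using M e by (meson divide_pos_pos less_trans zero_less_numeral)
    have *: "dist (exp_integral \<sigma> (real n)) (exp_integral \<sigma> (real m)) < e" if "M \<le> m" "m \<le> n" for m n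
    proof -
      have "1 \<le> real m" "real m \<le> real n" using M0 that by auto
      then have "norm (exp_integral \<sigma> (real n) - exp_integral \<sigma> (real m)) \<le> 3 / (real m * \<bar>\<sigma>\<bar>)"
        by (rule exp_integral_cauchy[OF s])
      also have "\<dots> \<le> 3 / real M" using \<sigma> that M0 by (simp add: frac_le)
      also have "\<dots> < e" using M M0 e by (simp add: field_simps)
      finally show ?thesis by (simp add: dist_norm)
    qed
    show "\<exists>M. \<forall>m\<ge>M. \<forall>n\<ge>M. dist (exp_integral \<sigma> (real m)) (exp_integral \<sigma> (real n)) < e"
    proof (intro exI allI impI)
      fix m n assume "M \<le> m" "M \<le> n"
      then show "dist (exp_integral \<sigma> (real m)) (exp_integral \<sigma> (real n)) < e"
        using *[of m n] *[of n m] by (cases "m \<le> n") (auto simp: dist_commute)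
    qed
  qed
  then have "(\<lambda>n. exp_integral \<sigma> (real n)) \<longlonglongrightarrow> exp_integral_lim \<sigma>"
    unfolding exp_integral_lim_def Cauchy_convergent_iff convergent_LIMSEQ_iff .
  then have lim: "(\<lambda>n. norm (exp_integral \<sigma> (real n) - exp_integral \<sigma> \<rho>)) \<longlonglongrightarrow> norm (exp_integral_lim \<sigma> - exp_integral \<sigma> \<rho>)"
    by (intro tendsto_intros)
  obtain N :: nat where N: "\<rho> < real N" using reals_Archimedean2 by blast
  have "norm (exp_integral_lim \<sigma> - exp_integral \<sigma> \<rho>) \<le> 3 / (\<rho> * \<bar>\<sigma>\<bar>)"
  proof (rule LIMSEQ_le_const2[OF lim], intro exI allI impI)
    fix n assume "N \<le> n"
    then have "\<rho> \<le> real n" using N by linarith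
    then show "norm (exp_integral \<sigma> (real n) - exp_integral \<sigma> \<rho>) \<le> 3 / (\<rho> * \<bar>\<sigma>\<bar>)"
      by (rule exp_integral_cauchy[OF s \<rho>])
  qed
  then show ?thesis using \<sigma> by (simp add: norm_minus_commute)
qed

text \<open>The limit of \<open>\<integral> (cis (s r) - [r < 1]) / r dr\<close> over \<open>{0..\<rho>}\<close> as \<open>\<rho> \<rightarrow> \<infinity>\<close>; at \<open>s = 0\<close>, where the
  integral diverges, the value is a junk value.\<close>

definition mult_kernel :: "real \<Rightarrow> complex" where
  "mult_kernel s = exp_integral_lim (sgn s) - of_real (ln \<bar>s\<bar>)"

lemma exp_integral_mult_kernel:
  assumes s: "s \<noteq> 0" and \<rho>: "1 \<le> \<rho>" "1 \<le> \<rho> * \<bar>s\<bar>"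
  shows "norm (exp_integral s \<rho> - mult_kernel s) \<le> 3 / (\<rho> * \<bar>s\<bar>)"
  using exp_integral_lim_bound[of "sgn s" "\<rho> * \<bar>s\<bar>"] \<rho> s
  by (simp add: exp_integral_scale[OF assms] mult_kernel_def abs_sgn_eq)

definition mult_kernel_const :: real where
  "mult_kernel_const = norm (exp_integral_lim 1) + norm (exp_integral_lim (- 1))"

lemma mult_kernel_bound:
  assumes "s \<noteq> 0" "\<bar>s\<bar> \<le> 1"
  shows "norm (mult_kernel s) \<le> mult_kernel_const + log_weight s"
proof -
  have "norm (exp_integral_lim (sgn s)) \<le> mult_kernel_const"
    using assms by (cases "0 < s") (auto simp: mult_kernel_const_def sgn_if)
  moreover have "norm (complex_of_real (ln \<bar>s\<bar>)) = - ln \<bar>s\<bar>" using assms by simp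
  then have "norm (complex_of_real (ln \<bar>s\<bar>)) \<le> log_weight s" using log_weight_ge[OF assms(1)] by simp
  ultimately show ?thesis
    unfolding mult_kernel_def by (intro order_trans[OF norm_triangle_ineq4] add_mono)
qed

lemma mult_kernel_measurable [measurable]: "mult_kernel \<in> borel_measurable borel"
proof -
  have "mult_kernel = (\<lambda>s. (if s > 0 then exp_integral_lim 1 else if s < 0 then exp_integral_lim (- 1) else exp_integral_lim 0) - of_real (ln \<bar>s\<bar>))"
    by (auto simp: mult_kernel_def sgn_if fun_eq_iff)
  also have "\<dots> \<in> borel_measurable borel" by measurable
  finally show ?thesis .
qed

lemma slope_integral_approx:
  fixes \<psi> \<psi>' :: "real \<Rightarrow> complex"
  assumes der: "\<And>r. (\<psi> has_vector_derivative \<psi>' r) (at r)" and cont': "continuous_on UNIV \<psi>'"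
    and s: "s \<noteq> 0" "\<bar>s\<bar> \<le> 1" and \<rho>: "1 \<le> \<rho>" "1 \<le> \<rho> * \<bar>s\<bar>" "\<rho> \<le> b"
    and C: "\<And>r. norm (\<psi> r) \<le> C"
    and D: "\<And>r. norm (\<psi>' r) \<le> D" and u: "\<And>r. 0 \<le> r \<Longrightarrow> norm (\<psi> r - u) \<le> D * r"
  shows "norm ((LINT r:{0..b}|lborel. slope_integrand \<psi> u 1 s r) - u * mult_kernel s)
     \<le> D * \<rho> + (6 * C + D * b) / (\<rho> * \<bar>s\<bar>)"
proof -
  have cont: "continuous_on UNIV \<psi>"
    using der by (auto intro!: continuous_at_imp_continuous_on has_vector_derivative_continuous)
  have D0: "0 \<le> D" using order_trans[OF norm_ge_zero D] .
  have uC: "norm u \<le> C" using u[of 0] C[of 0] by simp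
  have b0: "0 \<le> b" "0 \<le> \<rho>" using \<rho> by auto
  note int = slope_integral_bound(1)[OF der cont' _ _ s C D u]
  have i1: "set_integrable lborel {0..\<rho>} (slope_integrand \<psi> u 1 s)" using int b0 by simp
  have i2: "set_integrable lborel {0..\<rho>} (\<lambda>r. u * slope_integrand (\<lambda>_. 1) 1 1 s r)"
    using slope_integrand_one_integrable[OF s(1) b0(2)] by simp
  have "(LINT r:{0..b}|lborel. slope_integrand \<psi> u 1 s r)
     = (LINT r:{0..\<rho>}|lborel. slope_integrand \<psi> u 1 s r) + (LINT r:{\<rho>..b}|lborel. (1 / r) *\<^sub>R (cis (s * r) * \<psi> r))"
    using set_integral_Icc_split[OF int, of 0 b \<rho>] b0 \<rho> slope_integrand_tail[OF \<rho>(1)] by simp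
  then have dec: "(LINT r:{0..b}|lborel. slope_integrand \<psi> u 1 s r) - u * mult_kernel s
     = ((LINT r:{0..\<rho>}|lborel. slope_integrand \<psi> u 1 s r) - u * exp_integral s \<rho>)
       + (LINT r:{\<rho>..b}|lborel. (1 / r) *\<^sub>R (cis (s * r) * \<psi> r)) + u * (exp_integral s \<rho> - mult_kernel s)"
    by (simp add: right_diff_distrib)
  have "(LINT r:{0..\<rho>}|lborel. slope_integrand \<psi> u 1 s r) - u * exp_integral s \<rho>
     = (LINT r:{0..\<rho>}|lborel. slope_integrand \<psi> u 1 s r - u * slope_integrand (\<lambda>_. 1) 1 1 s r)"
    using set_integral_diff(2)[OF i1 i2] by (simp add: exp_integral_def)
  also have "norm \<dots> \<le> (LINT r|lborel. indicator {0..\<rho>} r * D)"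
    unfolding set_lebesgue_integral_def
  proof (rule lebesgue_integral_norm_bound)
    show "integrable lborel (\<lambda>r. indicator {0..\<rho>} r *\<^sub>R (slope_integrand \<psi> u 1 s r - u * slope_integrand (\<lambda>_. 1) 1 1 s r))"
      using set_integral_diff(1)[OF i1 i2] by (simp add: set_integrable_def)
    show "integrable lborel (\<lambda>r. indicator {0..\<rho>} r * D)"
      by (intro integrable_mult_left integrable_real_indicator) (auto simp: emeasure_lborel_Icc_eq)
    fix r
    show "norm (indicator {0..\<rho>} r *\<^sub>R (slope_integrand \<psi> u 1 s r - u * slope_integrand (\<lambda>_. 1) 1 1 s r)) \<le> indicator {0..\<rho>} r * D"
    proof (cases "r \<in> {0..\<rho>} \<and> r \<noteq> 0")
      case True
      have "slope_integrand \<psi> u 1 s r - u * slope_integrand (\<lambda>_. 1) 1 1 s r = (1 / r) *\<^sub>R (cis (s * r) * (\<psi> r - u))"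
        by (simp add: slope_integrand_def scaleR_conv_of_real algebra_simps)
      also have "norm \<dots> = norm (\<psi> r - u) / r" using True by (simp add: norm_mult)
      also have "\<dots> \<le> D * r / r" using True by (intro divide_right_mono u) auto
      finally show ?thesis using True by simp
    qed (use D0 in \<open>auto simp: slope_integrand_def indicator_def\<close>)
  qed
  also have "\<dots> = D * \<rho>" using b0 by simp
  finally have n1: "norm ((LINT r:{0..\<rho>}|lborel. slope_integrand \<psi> u 1 s r) - u * exp_integral s \<rho>) \<le> D * \<rho>" .
  have n2: "norm (LINT r:{\<rho>..b}|lborel. (1 / r) *\<^sub>R (cis (s * r) * \<psi> r)) \<le> (3 * C + D * b) / (\<rho> * \<bar>s\<bar>)"
  proof -
    have "0 < \<rho>" using \<rho> by simp
    then have "norm (LINT r:{\<rho>..b}|lborel. (1 / r) *\<^sub>R (cis (s * r) * \<psi> r)) \<le> (3 * C + D * (b - \<rho>)) / (\<rho> * \<bar>s\<bar>)"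
      by (rule oscillatory_integral_bound[OF der cont' _ \<rho>(3) s(1) C D])
    also have "\<dots> \<le> (3 * C + D * b) / (\<rho> * \<bar>s\<bar>)"
      using D0 b0 by (intro divide_right_mono add_left_mono mult_left_mono) auto
    finally show ?thesis .
  qed
  have n3: "norm (u * (exp_integral s \<rho> - mult_kernel s)) \<le> C * (3 / (\<rho> * \<bar>s\<bar>))"
    unfolding norm_mult using order_trans[OF norm_ge_zero uC]
    by (intro mult_mono uC exp_integral_mult_kernel s \<rho>) auto
  have "norm ((LINT r:{0..b}|lborel. slope_integrand \<psi> u 1 s r) - u * mult_kernel s)
     \<le> D * \<rho> + (3 * C + D * b) / (\<rho> * \<bar>s\<bar>) + C * (3 / (\<rho> * \<bar>s\<bar>))"
    unfolding dec using n1 n2 n3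
    by (intro order_trans[OF norm_triangle_ineq] add_mono order_trans[OF norm_triangle_ineq add_mono]) auto
  also have "\<dots> = D * \<rho> + (6 * C + D * b) / (\<rho> * \<bar>s\<bar>)"
    by (simp add: add_divide_distrib)
  finally show ?thesis .
qed

text \<open>The derivative is an explicit parameter because it is integrated along rays. Continuity
  is required for each direction separately, which is the form in which \<open>Ck\<close> provides
  it.\<close>

definition smooth_bounded_support ::
    "(real^2 \<Rightarrow> complex) \<Rightarrow> (real^2 \<Rightarrow> real^2 \<Rightarrow> complex) \<Rightarrow> real \<Rightarrow> real \<Rightarrow> bool" where
  "smooth_bounded_support f f' C K \<longleftrightarrow> 0 \<le> C \<and> 0 \<le> K \<and>
     (\<forall>x. (f has_derivative f' x) (at x)) \<and> (\<forall>v. continuous_on UNIV (\<lambda>x. f' x v)) \<and>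
     (\<forall>x v. norm (f' x v) \<le> C * norm v) \<and> (\<forall>x. K \<le> norm x \<longrightarrow> f x = 0)"

lemma smooth_imp_lipschitz_bounded_support:
  assumes "smooth_bounded_support f f' C K"
  shows "lipschitz_bounded_support f C K"
proof -
  have "norm (f x - f y) \<le> C * norm (x - y)" for x y
  proof (rule differentiable_bound[of UNIV f f'])
    fix z
    show "(f has_derivative f' z) (at z within UNIV)" using assms by (simp add: smooth_bounded_support_def)
    show "onorm (f' z) \<le> C" using assms by (intro onorm_bound) (auto simp: smooth_bounded_support_def)
  qed auto
  then show ?thesis using assms by (simp add: lipschitz_bounded_support_def smooth_bounded_support_def)
qed

text \<open>The frequency \<open>pt (- t) 1\<close> is orthogonal to the ray of slope
  \<open>t\<close>. Along \<open>x - r *\<^sub>R pt 1 \<tau>\<close> the phase therefore grows at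
  the rate \<open>t - \<tau>\<close> and is stationary exactly on the ray of slope
  \<open>t\<close>.\<close>

definition modulated :: "real \<Rightarrow> real \<Rightarrow> (real^2 \<Rightarrow> complex) \<Rightarrow> real^2 \<Rightarrow> complex" where
  "modulated t \<epsilon> \<phi> x = cis (pt (- t) 1 \<bullet> x) * \<phi> (\<epsilon> *\<^sub>R x)"

lemma cis_diff_bound: "norm (cis a - cis b) \<le> \<bar>a - b\<bar>"
proof -
  have "cis a - cis b = cis b * (cis (a - b) - 1)" by (simp add: right_diff_distrib cis_mult)
  then show ?thesis using cis_minus_one_bound[of "a - b"] by (simp add: norm_mult)
qed

lemma modulated_lipschitz:
  assumes \<phi>: "lipschitz_bounded_support \<phi> C K" and \<epsilon>: "0 < \<epsilon>"
  shows "lipschitz_bounded_support (modulated t \<epsilon> \<phi>) (norm (pt (- t) 1) * (2 * C * K) + C * \<epsilon>) (K / \<epsilon>)"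
  unfolding lipschitz_bounded_support_def
proof (intro conjI allI impI)
  have CK: "0 \<le> C" "0 \<le> K" using \<phi> by (auto simp: lipschitz_bounded_support_def)
  show "0 \<le> norm (pt (- t) 1) * (2 * C * K) + C * \<epsilon>" "0 \<le> K / \<epsilon>" using CK \<epsilon> by auto
  fix x y :: "real^2"
  define \<xi> where "\<xi> = pt (- t) 1"
  have "modulated t \<epsilon> \<phi> x - modulated t \<epsilon> \<phi> y
      = (cis (\<xi> \<bullet> x) - cis (\<xi> \<bullet> y)) * \<phi> (\<epsilon> *\<^sub>R x) + cis (\<xi> \<bullet> y) * (\<phi> (\<epsilon> *\<^sub>R x) - \<phi> (\<epsilon> *\<^sub>R y))"
    by (simp add: modulated_def \<xi>_def algebra_simps)
  also have "norm \<dots> \<le> (norm \<xi> * norm (x - y)) * (2 * C * K) + 1 * (C * (\<epsilon> * norm (x - y)))"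
  proof (rule order_trans[OF norm_triangle_ineq], unfold norm_mult, intro add_mono mult_mono)
    have "\<bar>\<xi> \<bullet> x - \<xi> \<bullet> y\<bar> \<le> norm \<xi> * norm (x - y)"
      unfolding inner_diff_right[symmetric] by (rule Cauchy_Schwarz_ineq2)
    then show "norm (cis (\<xi> \<bullet> x) - cis (\<xi> \<bullet> y)) \<le> norm \<xi> * norm (x - y)"
      using cis_diff_bound[of "\<xi> \<bullet> x" "\<xi> \<bullet> y"] by linarith
    show "norm (\<phi> (\<epsilon> *\<^sub>R x)) \<le> 2 * C * K" by (rule lipschitz_bounded_support_bound[OF \<phi>])
    have "norm (\<phi> (\<epsilon> *\<^sub>R x) - \<phi> (\<epsilon> *\<^sub>R y)) \<le> C * norm (\<epsilon> *\<^sub>R x - \<epsilon> *\<^sub>R y)"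
      using \<phi> by (simp add: lipschitz_bounded_support_def)
    then show "norm (\<phi> (\<epsilon> *\<^sub>R x) - \<phi> (\<epsilon> *\<^sub>R y)) \<le> C * (\<epsilon> * norm (x - y))"
      using \<epsilon> by (simp only: scaleR_diff_right[symmetric] norm_scaleR abs_of_pos)
  qed auto
  finally show "norm (modulated t \<epsilon> \<phi> x - modulated t \<epsilon> \<phi> y)
      \<le> (norm (pt (- t) 1) * (2 * C * K) + C * \<epsilon>) * norm (x - y)"
    by (simp add: \<xi>_def algebra_simps)
next
  fix x :: "real^2" assume "K / \<epsilon> \<le> norm x"
  then have "K \<le> norm (\<epsilon> *\<^sub>R x)" using \<epsilon> by (simp add: field_simps)
  then show "modulated t \<epsilon> \<phi> x = 0" using \<phi> by (simp add: modulated_def lipschitz_bounded_support_def)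
qed

lemma line_derivative:
  assumes "smooth_bounded_support \<phi> \<phi>' C K"
  shows "((\<lambda>r. \<phi> (X - (\<epsilon> * r) *\<^sub>R p)) has_vector_derivative \<phi>' (X - (\<epsilon> * r) *\<^sub>R p) (- \<epsilon> *\<^sub>R p)) (at r)"
proof -
  have d: "(\<phi> has_derivative \<phi>' y) (at y)" for y using assms by (simp add: smooth_bounded_support_def)
  interpret bounded_linear "\<phi>' (X - (\<epsilon> * r) *\<^sub>R p)" by (rule has_derivative_bounded_linear[OF d])
  have "((\<lambda>r. X - (\<epsilon> * r) *\<^sub>R p) has_derivative (\<lambda>h. h *\<^sub>R (- \<epsilon> *\<^sub>R p))) (at r)"
    by (auto intro!: derivative_eq_intros simp: fun_eq_iff mult.commute)
  from has_derivative_compose[OF this d]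
  show ?thesis by (simp only: has_vector_derivative_def scaleR)
qed

context log_slope_kernel
begin

text \<open>The Fourier multiplier at the frequency \<open>pt (- t) 1\<close>, identified through
  the action of the operator on modulated bumps instead of a Fourier transform. The constant
  \<open>c_g\<close> comes from the Euclidean truncation.\<close>

definition multiplier :: "real \<Rightarrow> complex" where
  "multiplier t = of_real c_g + (LINT \<tau>|lborel. g \<tau> *\<^sub>R mult_kernel (t - \<tau>))"

lemma log_weight_commute: "log_weight (a - b) = log_weight (b - a)"
  by (simp add: log_weight_def abs_minus_commute)

lemma g_mult_kernel_bound:
  assumes t: "t \<in> {0..1}"
  shows "AE \<tau> in lborel. norm (g \<tau> *\<^sub>R mult_kernel (t - \<tau>)) \<le> \<bar>g \<tau>\<bar> * mult_kernel_const + \<bar>g \<tau>\<bar> * log_weight (\<tau> - t)"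
  using AE_lborel_singleton[of t]
proof eventually_elim
  case (elim \<tau>)
  show ?case
  proof (cases "\<tau> \<in> {0..1}")
    case True
    have "\<bar>g \<tau>\<bar> * norm (mult_kernel (t - \<tau>)) \<le> \<bar>g \<tau>\<bar> * (mult_kernel_const + log_weight (t - \<tau>))"
      using elim True t by (intro mult_left_mono mult_kernel_bound) auto
    then show ?thesis by (simp add: distrib_left log_weight_commute)
  qed (simp add: g_support)
qed

lemma g_const_log_integrable: "integrable lborel (\<lambda>\<tau>. \<bar>g \<tau>\<bar> * c + \<bar>g \<tau>\<bar> * d * log_weight (\<tau> - t))"
proof -
  have "integrable lborel (\<lambda>\<tau>. d * (\<bar>g \<tau>\<bar> * log_weight (\<tau> - t)))"
    by (intro integrable_mult_right log_integrable)
  then have "integrable lborel (\<lambda>\<tau>. \<bar>g \<tau>\<bar> * d * log_weight (\<tau> - t))" by (simp only: mult_ac)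
  moreover have "integrable lborel (\<lambda>\<tau>. \<bar>g \<tau>\<bar> * c)" using g_integrable by simp
  ultimately show ?thesis by (rule Bochner_Integration.integrable_add[rotated])
qed

lemma g_mult_kernel_integrable:
  assumes t: "t \<in> {0..1}"
  shows "integrable lborel (\<lambda>\<tau>. g \<tau> *\<^sub>R mult_kernel (t - \<tau>))"
proof (rule Bochner_Integration.integrable_bound[OF g_const_log_integrable[of mult_kernel_const 1 t]])
  show "AE \<tau> in lborel. norm (g \<tau> *\<^sub>R mult_kernel (t - \<tau>)) \<le> norm (\<bar>g \<tau>\<bar> * mult_kernel_const + \<bar>g \<tau>\<bar> * 1 * log_weight (\<tau> - t))"
    using g_mult_kernel_bound[OF t] by eventually_elim simp
qed measurable

text \<open>At the rescaled point \<open>X /\<^sub>R \<epsilon>\<close> the wave factors out and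
  leaves on each ray the integral of \<open>slope_integrand\<close> with frequency
  \<open>t - \<tau>\<close> and \<open>L = 1\<close>. Past the upper limit, of order
  \<open>1 / \<epsilon>\<close>, the profile \<open>\<phi>\<close> vanishes.\<close>

lemma pv_modulated:
  fixes X :: "real^2"
  assumes \<phi>: "smooth_bounded_support \<phi> \<phi>' C K" and \<epsilon>: "0 < \<epsilon>" "\<epsilon> \<le> 1" and t: "t \<in> {0..1}"
  defines "I \<equiv> \<lambda>\<tau>. LINT r:{0..(K + norm X + 1) / \<epsilon>}|lborel.
      slope_integrand (\<lambda>r. \<phi> (X - (\<epsilon> * r) *\<^sub>R pt 1 \<tau>)) (\<phi> X) 1 (t - \<tau>) r"
  shows "integrable lborel (\<lambda>\<tau>. g \<tau> *\<^sub>R I \<tau>)"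
    and "pv (modulated t \<epsilon> \<phi>) (X /\<^sub>R \<epsilon>) = cis (pt (- t) 1 \<bullet> (X /\<^sub>R \<epsilon>)) * (LINT \<tau>|lborel. g \<tau> *\<^sub>R I \<tau>)"
proof -
  define x where "x = X /\<^sub>R \<epsilon>"
  have ex: "\<epsilon> *\<^sub>R x = X" using \<epsilon> by (simp add: x_def)
  define e where "e = cis (pt (- t) 1 \<bullet> x)"
  have e0: "e \<noteq> 0" by (simp add: e_def)
  define f where "f = modulated t \<epsilon> \<phi>"
  define b where "b = (K + norm X + 1) / \<epsilon>"
  note lip = smooth_imp_lipschitz_bounded_support[OF \<phi>]
  have K: "0 \<le> K" using \<phi> by (simp add: smooth_bounded_support_def)
  have b1: "1 \<le> b"
  proof -
    have "1 * \<epsilon> \<le> K + norm X + 1" using \<epsilon> K norm_ge_zero[of X] by linarith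
    then show ?thesis using \<epsilon> by (simp add: b_def field_simps)
  qed
  have flip: "lipschitz_bounded_support f (norm (pt (- t) 1) * (2 * C * K) + C * \<epsilon>) (K / \<epsilon>)"
    unfolding f_def by (rule modulated_lipschitz[OF lip \<epsilon>(1)])
  have ev: "pv_integrand f x (r, \<tau>) = (e * of_real (g \<tau>)) * (indicator {0..b} r *\<^sub>R
       slope_integrand (\<lambda>r. \<phi> (X - (\<epsilon> * r) *\<^sub>R pt 1 \<tau>)) (\<phi> X) 1 (t - \<tau>) r)" for r \<tau>
  proof (cases "0 < r \<and> \<tau> \<in> {0..1}")
    case True
    then have r: "0 < r" by simp
    have ph: "pt (- t) 1 \<bullet> (x - r *\<^sub>R pt 1 \<tau>) = pt (- t) 1 \<bullet> x + (t - \<tau>) * r"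
      by (simp add: inner_vec2 algebra_simps)
    have ar: "\<epsilon> *\<^sub>R (x - r *\<^sub>R pt 1 \<tau>) = X - (\<epsilon> * r) *\<^sub>R pt 1 \<tau>"
      by (simp only: scaleR_diff_right ex scaleR_scaleR)
    have f1: "f (x - r *\<^sub>R pt 1 \<tau>) = e * (cis ((t - \<tau>) * r) * \<phi> (X - (\<epsilon> * r) *\<^sub>R pt 1 \<tau>))"
      unfolding f_def modulated_def ph ar e_def cis_mult[symmetric] by (simp only: mult.assoc)
    have f2: "f x = e * \<phi> X" unfolding f_def modulated_def ex e_def ..
    show ?thesis
    proof (cases "r \<le> b")
      case True
      have "pv_integrand f x (r, \<tau>) = (g \<tau> / r) *\<^sub>R (e * (cis ((t - \<tau>) * r) * \<phi> (X - (\<epsilon> * r) *\<^sub>R pt 1 \<tau>)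
          - (if r < 1 then \<phi> X else 0)))"
        using r by (simp add: pv_integrand_def f1 f2 right_diff_distrib)
      then show ?thesis using True r by (simp add: slope_integrand_def scaleR_conv_of_real)
    next
      case False
      have "K + norm X + 1 < \<epsilon> * r" using False \<epsilon> by (simp add: b_def field_simps)
      also have "\<epsilon> * r * 1 \<le> \<epsilon> * r * norm (pt 1 \<tau>)" using \<epsilon> r norm_pt_1_ge by (intro mult_left_mono) auto
      then have "\<epsilon> * r \<le> norm ((\<epsilon> * r) *\<^sub>R pt 1 \<tau>)" using \<epsilon> r by (simp add: abs_mult)
      finally have "K \<le> norm (X - (\<epsilon> * r) *\<^sub>R pt 1 \<tau>)"
        using norm_triangle_ineq2[of "(\<epsilon> * r) *\<^sub>R pt 1 \<tau>" X] norm_minus_commute[of X "(\<epsilon> * r) *\<^sub>R pt 1 \<tau>"]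
        by linarith
      then have "\<phi> (X - (\<epsilon> * r) *\<^sub>R pt 1 \<tau>) = 0" using \<phi> by (simp add: smooth_bounded_support_def)
      moreover have "\<not> r < 1" using False b1 by simp
      ultimately show ?thesis using False r by (simp add: pv_integrand_def f1)
    qed
  next
    case False
    then show ?thesis
    proof (cases "\<tau> \<in> {0..1}")
      case True
      then have "r \<le> 0" using False by simp
      then show ?thesis by (cases "r = 0") (auto simp: pv_integrand_def slope_integrand_def)
    next
      case False
      then show ?thesis by (simp add: pv_integrand_def g_support)
    qed
  qed
  have inner: "(LINT r|lborel. pv_integrand f x (r, \<tau>)) = e * (g \<tau> *\<^sub>R I \<tau>)" for \<tau>
    unfolding ev I_def set_lebesgue_integral_def integral_mult_right_zero b_def[symmetric]
    by (simp add: scaleR_conv_of_real)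
  have int: "integrable lborel2 (pv_integrand f x)" by (rule pv_integrand_integrable[OF flip])
  have "integrable lborel (\<lambda>\<tau>. e * (g \<tau> *\<^sub>R I \<tau>))"
    using lborel_pair.integrable_snd[of "\<lambda>r \<tau>. pv_integrand f x (r, \<tau>)"] int by (simp add: inner)
  then have "integrable lborel (\<lambda>\<tau>. inverse e * (e * (g \<tau> *\<^sub>R I \<tau>)))" by (rule integrable_mult_right)
  moreover have "inverse e * (e * y) = y" for y :: complex using e0 by (simp add: mult.assoc[symmetric])
  ultimately show "integrable lborel (\<lambda>\<tau>. g \<tau> *\<^sub>R I \<tau>)" by simp
  have "pv f x = (LINT \<tau>|lborel. e * (g \<tau> *\<^sub>R I \<tau>))"
    using lborel_pair.integral_snd[of "\<lambda>r \<tau>. pv_integrand f x (r, \<tau>)"] int by (simp add: inner pv_def)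
  also have "\<dots> = e * (LINT \<tau>|lborel. g \<tau> *\<^sub>R I \<tau>)" by (rule integral_mult_right_zero)
  finally show "pv (modulated t \<epsilon> \<phi>) (X /\<^sub>R \<epsilon>) = cis (pt (- t) 1 \<bullet> (X /\<^sub>R \<epsilon>)) * (LINT \<tau>|lborel. g \<tau> *\<^sub>R I \<tau>)"
    by (simp only: f_def x_def e_def)
qed

text \<open>Widely dilated modulated profiles are asymptotic eigenfunctions. For each \<tau> other
  than \<open>t\<close> the ray integral converges by \<open>slope_integral_approx\<close>. The
  majorant, logarithmic in the distance of the slopes and integrable against
  \<open>\<bar>g\<bar>\<close>, comes from \<open>slope_integral_bound\<close>: derivatives of order
  \<epsilon> on rays of length of order 1/\<epsilon> keep \<open>D * b\<close> bounded.\<close>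

lemma pv_modulated_limit:
  fixes X :: "real^2"
  assumes \<phi>: "smooth_bounded_support \<phi> \<phi>' C K" and \<epsilon>: "\<And>n. 0 < \<epsilon> n" "\<And>n. \<epsilon> n \<le> 1" "\<epsilon> \<longlonglongrightarrow> 0"
    and t: "t \<in> {0..1}"
  shows "(\<lambda>n. cis (- (pt (- t) 1 \<bullet> (X /\<^sub>R \<epsilon> n))) * pv (modulated t (\<epsilon> n) \<phi>) (X /\<^sub>R \<epsilon> n))
     \<longlonglongrightarrow> \<phi> X * (LINT \<tau>|lborel. g \<tau> *\<^sub>R mult_kernel (t - \<tau>))"
proof -
  note lip = smooth_imp_lipschitz_bounded_support[OF \<phi>]
  have CK: "0 \<le> C" "0 \<le> K" using \<phi> by (auto simp: smooth_bounded_support_def)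
  define b where "b n = (K + norm X + 1) / \<epsilon> n" for n
  define I where "I n \<tau> = (LINT r:{0..b n}|lborel.
      slope_integrand (\<lambda>r. \<phi> (X - (\<epsilon> n * r) *\<^sub>R pt 1 \<tau>)) (\<phi> X) 1 (t - \<tau>) r)" for n \<tau>
  note P = pv_modulated[where X=X, OF \<phi> \<epsilon>(1) \<epsilon>(2) t, folded b_def, folded I_def]
  have cc: "cis (- a) * (cis a * z) = z" for a z
    by (simp add: mult.assoc[symmetric] cis_mult)
  have eq: "cis (- (pt (- t) 1 \<bullet> (X /\<^sub>R \<epsilon> n))) * pv (modulated t (\<epsilon> n) \<phi>) (X /\<^sub>R \<epsilon> n) = (LINT \<tau>|lborel. g \<tau> *\<^sub>R I n \<tau>)" for n
    unfolding P(2) cc ..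
  define C0 where "C0 = 2 * C * K"
  define E where "E = 2 * C * (K + norm X + 1)"
  have E0: "0 \<le> E" "0 \<le> C0" using CK by (auto simp: E_def C0_def)
  have \<psi>: "norm (\<phi> y) \<le> C0" for y unfolding C0_def by (rule lipschitz_bounded_support_bound[OF lip])
  have D: "norm (\<phi>' y (- \<epsilon> n *\<^sub>R pt 1 \<tau>)) \<le> 2 * C * \<epsilon> n" if "\<tau> \<in> {0..1}" for y n \<tau>
  proof -
    have "norm (\<phi>' y (- \<epsilon> n *\<^sub>R pt 1 \<tau>)) \<le> C * norm (- \<epsilon> n *\<^sub>R pt 1 \<tau>)"
      using \<phi> unfolding smooth_bounded_support_def by blast
    also have "\<dots> = C * (\<epsilon> n * norm (pt 1 \<tau>))" using \<epsilon>(1)[of n] by simp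
    also have "\<dots> \<le> C * (\<epsilon> n * 2)" 
      using CK \<epsilon>(1)[of n] norm_pt_1_le[OF that] by (intro mult_left_mono) auto
    finally show ?thesis by simp
  qed
  have u: "norm (\<phi> (X - (\<epsilon> n * r) *\<^sub>R pt 1 \<tau>) - \<phi> X) \<le> 2 * C * \<epsilon> n * r" if "\<tau> \<in> {0..1}" "0 \<le> r" for n \<tau> r
  proof -
    have "norm (\<phi> (X - (\<epsilon> n * r) *\<^sub>R pt 1 \<tau>) - \<phi> X) \<le> C * norm ((X - (\<epsilon> n * r) *\<^sub>R pt 1 \<tau>) - X)"
      using lip unfolding lipschitz_bounded_support_def by blast
    also have "\<dots> = C * (\<epsilon> n * r * norm (pt 1 \<tau>))" using \<epsilon>(1)[of n] that by (simp add: abs_mult)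
    also have "\<dots> \<le> C * (\<epsilon> n * r * 2)"
      using CK \<epsilon>(1)[of n] norm_pt_1_le[OF that(1)] that by (intro mult_left_mono) auto
    finally show ?thesis by simp
  qed
  have cont: "continuous_on UNIV (\<lambda>r. \<phi>' (X - (\<epsilon> n * r) *\<^sub>R p) (- \<epsilon> n *\<^sub>R p))" for n p
  proof -
    have "continuous_on UNIV (\<lambda>y. \<phi>' y (- \<epsilon> n *\<^sub>R p))" using \<phi> by (simp add: smooth_bounded_support_def)
    then show ?thesis
      by (rule continuous_on_compose2) (auto intro!: continuous_intros)
  qed
  have Db: "2 * C * \<epsilon> n * b n = E" for n using \<epsilon>(1)[of n] by (simp add: b_def E_def)
  have b1: "1 / \<epsilon> n \<le> b n" "0 \<le> b n" for n
    using \<epsilon>(1)[of n] CK by (auto simp: b_def intro!: divide_right_mono)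
  have bound: "norm (g \<tau> *\<^sub>R I n \<tau>) \<le> \<bar>g \<tau>\<bar> * (4 * C0 + 2 * C + E) + \<bar>g \<tau>\<bar> * C0 * log_weight (\<tau> - t)" if "\<tau> \<noteq> t" for n \<tau>
  proof (cases "\<tau> \<in> {0..1}")
    case True
    have s: "t - \<tau> \<noteq> 0" "\<bar>t - \<tau>\<bar> \<le> 1" using that True t by auto
    have "norm (I n \<tau>) \<le> 4 * C0 + 2 * C * \<epsilon> n / 1 + 2 * C * \<epsilon> n * b n + C0 * ln (1 / \<bar>t - \<tau>\<bar>)"
      unfolding I_def
      by (rule slope_integral_bound(2)[OF line_derivative[OF \<phi>] cont _ _ s \<psi> D[OF True] u[OF True]]) (use b1 in auto)
    also have "\<dots> \<le> 4 * C0 + 2 * C + E + C0 * log_weight (\<tau> - t)"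
    proof -
      have "ln (1 / \<bar>t - \<tau>\<bar>) \<le> log_weight (\<tau> - t)"
        using log_weight_ge[OF s(1)] s by (simp add: ln_div log_weight_commute)
      then have "C0 * ln (1 / \<bar>t - \<tau>\<bar>) \<le> C0 * log_weight (\<tau> - t)" using E0 by (intro mult_left_mono)
      moreover have "2 * C * \<epsilon> n \<le> 2 * C * 1" using CK \<epsilon>(2)[of n] by (intro mult_left_mono) auto
      ultimately show ?thesis unfolding Db by simp
    qed
    finally have "\<bar>g \<tau>\<bar> * norm (I n \<tau>) \<le> \<bar>g \<tau>\<bar> * (4 * C0 + 2 * C + E + C0 * log_weight (\<tau> - t))"
      by (intro mult_left_mono) auto
    then show ?thesis by (simp add: distrib_left mult.assoc)
  qed (simp add: g_support)
  have lim: "(\<lambda>n. g \<tau> *\<^sub>R I n \<tau>) \<longlonglongrightarrow> g \<tau> *\<^sub>R (\<phi> X * mult_kernel (t - \<tau>))" if "\<tau> \<noteq> t" for \<tau>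
  proof (cases "\<tau> \<in> {0..1}")
    case True
    have s: "t - \<tau> \<noteq> 0" "\<bar>t - \<tau>\<bar> \<le> 1" using that True t by auto
    define a where "a = \<bar>t - \<tau>\<bar>"
    have a: "0 < a" using s by (simp add: a_def)
    have "(\<lambda>n. I n \<tau>) \<longlonglongrightarrow> \<phi> X * mult_kernel (t - \<tau>)"
    proof (rule LIM_zero_cancel, rule Lim_null_comparison)
      have "eventually (\<lambda>n. \<epsilon> n < a\<^sup>2) sequentially"
        using \<epsilon>(3) a by (simp add: order_tendsto_iff)
      then show "eventually (\<lambda>n. norm (I n \<tau> - \<phi> X * mult_kernel (t - \<tau>)) \<le> (2 * C + (6 * C0 + E) / a) * sqrt (\<epsilon> n)) sequentially"
      proof eventually_elim
        case (elim n)
        \<comment> \<open>The errors are of order \<open>\<epsilon> n * \<rho>\<close> and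
          \<open>1 / \<rho>\<close>; this choice makes both of order
          \<open>sqrt (\<epsilon> n)\<close>. The condition \<open>\<epsilon> n < a\<^sup>2\<close>
          guarantees \<open>1 \<le> \<rho> * a\<close>.\<close>
        define \<rho> where "\<rho> = 1 / sqrt (\<epsilon> n)"
        have sq: "0 < sqrt (\<epsilon> n)" "sqrt (\<epsilon> n) \<le> 1" "sqrt (\<epsilon> n) * sqrt (\<epsilon> n) = \<epsilon> n"
          using \<epsilon>(1)[of n] \<epsilon>(2)[of n] by auto
        have \<rho>1: "1 \<le> \<rho>" using sq by (simp add: \<rho>_def)
        have "sqrt (\<epsilon> n) \<le> sqrt (a\<^sup>2)" using elim by (intro real_sqrt_le_mono) simp
        then have "sqrt (\<epsilon> n) \<le> a" using a by simp
        then have \<rho>2: "1 \<le> \<rho> * \<bar>t - \<tau>\<bar>" using sq by (simp add: \<rho>_def a_def[symmetric])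
        have "\<rho> \<le> 1 / \<epsilon> n"
        proof -
          have "\<epsilon> n \<le> sqrt (\<epsilon> n)" using mult_left_mono[OF sq(2), of "sqrt (\<epsilon> n)"] sq by simp
          then show ?thesis unfolding \<rho>_def using \<epsilon>(1)[of n] by (intro frac_le) auto
        qed
        then have \<rho>3: "\<rho> \<le> b n" using b1(1)[of n] by linarith
        have "norm (I n \<tau> - \<phi> X * mult_kernel (t - \<tau>)) \<le> 2 * C * \<epsilon> n * \<rho> + (6 * C0 + 2 * C * \<epsilon> n * b n) / (\<rho> * \<bar>t - \<tau>\<bar>)"
          unfolding I_def
          by (rule slope_integral_approx[OF line_derivative[OF \<phi>] cont s \<rho>1 \<rho>2 \<rho>3 \<psi> D[OF True] u[OF True]])
        also have "2 * C * \<epsilon> n * \<rho> = 2 * C * sqrt (\<epsilon> n)"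
        proof -
          have "\<epsilon> n * \<rho> = sqrt (\<epsilon> n)" using real_div_sqrt[of "\<epsilon> n"] \<epsilon>(1)[of n] by (simp add: \<rho>_def)
          then show ?thesis by (simp add: mult.assoc)
        qed
        also have "(6 * C0 + 2 * C * \<epsilon> n * b n) / (\<rho> * \<bar>t - \<tau>\<bar>) = (6 * C0 + E) / a * sqrt (\<epsilon> n)"
          unfolding Db a_def[symmetric] by (simp add: \<rho>_def)
        finally show ?case by (simp add: distrib_right)
      qed
      have "(\<lambda>n. (2 * C + (6 * C0 + E) / a) * sqrt (\<epsilon> n)) \<longlonglongrightarrow> (2 * C + (6 * C0 + E) / a) * sqrt 0"
        by (intro tendsto_intros \<epsilon>(3))
      then show "(\<lambda>n. (2 * C + (6 * C0 + E) / a) * sqrt (\<epsilon> n)) \<longlonglongrightarrow> 0" by simp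
    qed
    then show ?thesis by (rule tendsto_scaleR[OF tendsto_const])
  qed (simp add: g_support)
  have "(\<lambda>n. LINT \<tau>|lborel. g \<tau> *\<^sub>R I n \<tau>) \<longlonglongrightarrow> (LINT \<tau>|lborel. g \<tau> *\<^sub>R (\<phi> X * mult_kernel (t - \<tau>)))"
  proof (rule integral_dominated_convergence[OF _ _ g_const_log_integrable[of "4 * C0 + 2 * C + E" C0 t]])
    show "(\<lambda>\<tau>. g \<tau> *\<^sub>R (\<phi> X * mult_kernel (t - \<tau>))) \<in> borel_measurable lborel" by measurable
    show "(\<lambda>\<tau>. g \<tau> *\<^sub>R I n \<tau>) \<in> borel_measurable lborel" for n
      using P(1)[of n] by (rule borel_measurable_integrable)
    show "AE \<tau> in lborel. (\<lambda>n. g \<tau> *\<^sub>R I n \<tau>) \<longlonglongrightarrow> g \<tau> *\<^sub>R (\<phi> X * mult_kernel (t - \<tau>))"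
      using AE_lborel_singleton[of t] by eventually_elim (rule lim)
    show "AE \<tau> in lborel. norm (g \<tau> *\<^sub>R I n \<tau>) \<le> \<bar>g \<tau>\<bar> * (4 * C0 + 2 * C + E) + \<bar>g \<tau>\<bar> * C0 * log_weight (\<tau> - t)" for n
      using AE_lborel_singleton[of t] by eventually_elim (rule bound)
  qed
  also have "(LINT \<tau>|lborel. g \<tau> *\<^sub>R (\<phi> X * mult_kernel (t - \<tau>))) = \<phi> X * (LINT \<tau>|lborel. g \<tau> *\<^sub>R mult_kernel (t - \<tau>))"
    unfolding mult_scaleR_right[symmetric] by (rule integral_mult_right_zero)
  finally show ?thesis unfolding eq .
qed

end

section \<open>Test functions\<close>

text \<open>The standard flat function exp(-1/x), extended by 0. The powers in the denominator make
  the family stable under differentiation.\<close>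

definition flat_exp :: "nat \<Rightarrow> real \<Rightarrow> real" where
  "flat_exp m x = (if 0 < x then exp (- (1 / x)) / x ^ m else 0)"

lemma flat_exp_tendsto_0: "(flat_exp m \<longlongrightarrow> 0) (at 0)"
proof (rule filterlim_split_at)
  have "eventually (\<lambda>x. flat_exp m x = 0) (at_left (0::real))"
    by (auto simp: eventually_at_filter flat_exp_def)
  then show "(flat_exp m \<longlongrightarrow> 0) (at_left 0)" by (rule tendsto_eventually)
  have "((\<lambda>x. (inverse x) ^ m / exp (inverse x)) \<longlongrightarrow> 0) (at_right (0::real))"
    by (rule filterlim_compose[OF tendsto_power_div_exp_0 filterlim_inverse_at_top_right])
  moreover have "eventually (\<lambda>x. (inverse x) ^ m / exp (inverse x) = flat_exp m x) (at_right (0::real))"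
    by (auto simp: eventually_at_filter flat_exp_def exp_minus field_simps)
  ultimately show "(flat_exp m \<longlongrightarrow> 0) (at_right 0)" by (rule Lim_transform_eventually)
qed

lemma flat_exp_has_derivative:
  "(flat_exp m has_real_derivative - real m * flat_exp (Suc m) x + flat_exp (Suc (Suc m)) x) (at x)"
proof -
  consider "x < 0" | "x = 0" | "0 < x" by linarith
  then show ?thesis
  proof cases
    case 1
    have "((\<lambda>_. 0) has_real_derivative 0) (at x)" by simp
    then have "(flat_exp m has_real_derivative 0) (at x)"
      by (rule has_field_derivative_transform_within_open[of _ _ _ "{..<0}"]) (use 1 in \<open>auto simp: flat_exp_def\<close>)
    then show ?thesis using 1 by (simp add: flat_exp_def)
  next
    case 2
    \<comment> \<open>At 0 the difference quotient is itself the next member of the family, whose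
      limit is known.\<close>
    have "eventually (\<lambda>h. flat_exp (Suc m) h = (flat_exp m (0 + h) - flat_exp m 0) / h) (at (0::real))"
      by (auto simp: eventually_at_filter flat_exp_def mult.commute)
    with flat_exp_tendsto_0[of "Suc m"] have "((\<lambda>h. (flat_exp m (0 + h) - flat_exp m 0) / h) \<longlongrightarrow> 0) (at 0)"
      by (rule Lim_transform_eventually)
    then show ?thesis using 2 by (simp add: DERIV_def flat_exp_def)
  next
    case 3
    have d1: "((\<lambda>x. inverse (x ^ m)) has_real_derivative - real m * inverse (x ^ Suc m)) (at x)"
    proof (cases m)
      case (Suc k)
      show ?thesis unfolding Suc
        by (rule DERIV_cong[OF DERIV_inverse_fun[OF DERIV_pow[of "Suc k" x UNIV]]]) (use 3 in \<open>auto simp: field_simps\<close>)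
    qed simp
    have d2: "((\<lambda>x. exp (- (1 / x))) has_real_derivative exp (- (1 / x)) * (1 / x\<^sup>2)) (at x)"
      using 3 by (auto intro!: derivative_eq_intros simp: power2_eq_square)
    have "((\<lambda>x. exp (- (1 / x)) * inverse (x ^ m)) has_real_derivative
       (exp (- (1 / x)) * (1 / x\<^sup>2)) * inverse (x ^ m) + exp (- (1 / x)) * (- real m * inverse (x ^ Suc m))) (at x)"
      using DERIV_mult[OF d2 d1] by (simp only: mult.commute add.commute mult.left_commute)
    then have "(flat_exp m has_real_derivative
       (exp (- (1 / x)) * (1 / x\<^sup>2)) * inverse (x ^ m) + exp (- (1 / x)) * (- real m * inverse (x ^ Suc m))) (at x)"
      by (rule has_field_derivative_transform_within_open[of _ _ _ "{0<..}"]) (use 3 in \<open>auto simp: flat_exp_def field_simps\<close>)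
    moreover have "(exp (- (1 / x)) * (1 / x\<^sup>2)) * inverse (x ^ m) + exp (- (1 / x)) * (- real m * inverse (x ^ Suc m))
       = - real m * flat_exp (Suc m) x + flat_exp (Suc (Suc m)) x"
      using 3 by (simp add: flat_exp_def field_simps power2_eq_square)
    ultimately show ?thesis by simp
  qed
qed

text \<open>A class of functions that is closed under directional derivatives, so that all its members are
  smooth, and that contains a modulated bump.\<close>

inductive elementary_smooth :: "(real^2 \<Rightarrow> complex) \<Rightarrow> bool" where
  const: "elementary_smooth (\<lambda>x. c)"
| exp: "elementary_smooth (\<lambda>x. cis (\<xi> \<bullet> x))"
| flat: "elementary_smooth (\<lambda>x. of_real (flat_exp m (a + \<xi> \<bullet> x)))"
| add: "elementary_smooth f \<Longrightarrow> elementary_smooth h \<Longrightarrow> elementary_smooth (\<lambda>x. f x + h x)"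
| mult: "elementary_smooth f \<Longrightarrow> elementary_smooth h \<Longrightarrow> elementary_smooth (\<lambda>x. f x * h x)"

lemma elementary_smooth_derivative:
  assumes "elementary_smooth f"
  shows "\<exists>f'. (\<forall>x. (f has_derivative f' x) (at x)) \<and> (\<forall>v. elementary_smooth (\<lambda>x. f' x v))"
  using assms
proof induction
  case (const c)
  show ?case
    by (rule exI[of _ "\<lambda>x v. 0"]) (auto intro: elementary_smooth.const)
next
  case (exp \<xi>)
  have "((\<lambda>x. cis (\<xi> \<bullet> x)) has_derivative (\<lambda>v. (\<i> * of_real (\<xi> \<bullet> v)) * cis (\<xi> \<bullet> x))) (at x)" for x
  proof -
    have "((\<lambda>x. \<xi> \<bullet> x) has_derivative (\<lambda>v. \<xi> \<bullet> v)) (at x)" by (auto intro!: derivative_eq_intros)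
    moreover have "(cis has_derivative (\<lambda>h. h *\<^sub>R (\<i> * cis y))) (at y)" for y
      using has_vector_derivative_cis_mult[of 1 y UNIV] by (simp add: has_vector_derivative_def)
    ultimately have "((\<lambda>x. cis (\<xi> \<bullet> x)) has_derivative (\<lambda>v. (\<xi> \<bullet> v) *\<^sub>R (\<i> * cis (\<xi> \<bullet> x)))) (at x)"
      by (rule has_derivative_compose)
    then show ?thesis by (simp add: scaleR_conv_of_real mult_ac)
  qed
  then show ?case
    by (intro exI[of _ "\<lambda>x v. (\<i> * of_real (\<xi> \<bullet> v)) * cis (\<xi> \<bullet> x)"] conjI allI
        elementary_smooth.mult elementary_smooth.const elementary_smooth.exp)
next
  case (flat m a \<xi>)
  have "((\<lambda>x. complex_of_real (flat_exp m (a + \<xi> \<bullet> x))) has_derivative (\<lambda>v. of_real (\<xi> \<bullet> v) *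
     (of_real (- real m) * of_real (flat_exp (Suc m) (a + \<xi> \<bullet> x)) + of_real (flat_exp (Suc (Suc m)) (a + \<xi> \<bullet> x))))) (at x)" for x
  proof -
    have "((\<lambda>x. a + \<xi> \<bullet> x) has_derivative (\<lambda>v. \<xi> \<bullet> v)) (at x)" by (auto intro!: derivative_eq_intros)
    from has_derivative_compose[OF this flat_exp_has_derivative[unfolded has_field_derivative_def]]
    have "((\<lambda>x. flat_exp m (a + \<xi> \<bullet> x)) has_derivative
      (\<lambda>v. (- real m * flat_exp (Suc m) (a + \<xi> \<bullet> x) + flat_exp (Suc (Suc m)) (a + \<xi> \<bullet> x)) * (\<xi> \<bullet> v))) (at x)" .
    then have "((\<lambda>x. flat_exp m (a + \<xi> \<bullet> x)) has_derivative
      (\<lambda>v. (\<xi> \<bullet> v) * (- real m * flat_exp (Suc m) (a + \<xi> \<bullet> x) + flat_exp (Suc (Suc m)) (a + \<xi> \<bullet> x)))) (at x)"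
      by (subst mult.commute)
    from has_derivative_of_real[OF this] show ?thesis by (simp only: of_real_mult of_real_add)
  qed
  then show ?case
    by (intro exI[of _ "\<lambda>x v. of_real (\<xi> \<bullet> v) *
       (of_real (- real m) * of_real (flat_exp (Suc m) (a + \<xi> \<bullet> x)) + of_real (flat_exp (Suc (Suc m)) (a + \<xi> \<bullet> x)))"]
        conjI allI elementary_smooth.mult elementary_smooth.add elementary_smooth.const elementary_smooth.flat)
next
  case (add f h)
  then obtain f' h' where f': "\<And>x. (f has_derivative f' x) (at x)" "\<And>v. elementary_smooth (\<lambda>x. f' x v)"
    and h': "\<And>x. (h has_derivative h' x) (at x)" "\<And>v. elementary_smooth (\<lambda>x. h' x v)" by auto
  then show ?case
    by (intro exI[of _ "\<lambda>x v. f' x v + h' x v"] conjI allI has_derivative_add elementary_smooth.add)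
next
  case (mult f h)
  then obtain f' h' where f': "\<And>x. (f has_derivative f' x) (at x)" "\<And>v. elementary_smooth (\<lambda>x. f' x v)"
    and h': "\<And>x. (h has_derivative h' x) (at x)" "\<And>v. elementary_smooth (\<lambda>x. h' x v)" by auto
  then show ?case using mult.hyps
    by (intro exI[of _ "\<lambda>x v. f x * h' x v + f' x v * h x"] conjI allI has_derivative_mult
        elementary_smooth.add elementary_smooth.mult)
qed

lemma elementary_smooth_Ck: "elementary_smooth f \<Longrightarrow> Ck k f"
proof (induction k arbitrary: f)
  case 0
  from elementary_smooth_derivative[OF 0] obtain f' where "\<And>x. (f has_derivative f' x) (at x)" by auto
  then have "continuous_on UNIV f"
    by (auto intro!: continuous_at_imp_continuous_on has_derivative_continuous)
  then show ?case by simp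
next
  case (Suc k)
  from elementary_smooth_derivative[OF Suc.prems] obtain f'
    where f': "\<And>x. (f has_derivative f' x) (at x)" "\<And>v. elementary_smooth (\<lambda>x. f' x v)" by auto
  have "frechet_derivative f (at x) = f' x" for x using frechet_derivative_at[OF f'(1)[of x]] ..
  then show ?case using f' Suc.IH by (auto simp: differentiable_def)
qed

lemma elementary_smooth_sum:
  fixes n :: nat
  shows "(\<And>k. k < n \<Longrightarrow> elementary_smooth (F k)) \<Longrightarrow> elementary_smooth (\<lambda>x. \<Sum>k<n. F k x)"
proof (induction n)
  case 0
  show ?case using elementary_smooth.const[of 0] by simp
next
  case (Suc n)
  have "elementary_smooth (\<lambda>x. (\<Sum>k<n. F k x) + F n x)"
    using Suc by (intro elementary_smooth.add) auto
  then show ?case by simp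
qed

lemma test_functionI:
  assumes "elementary_smooth f" and "\<And>x. K \<le> norm x \<Longrightarrow> f x = 0"
  shows "f \<in> test_functions"
proof -
  have "{x. f x \<noteq> 0} \<subseteq> cball 0 K"
  proof
    fix x assume "x \<in> {x. f x \<noteq> 0}"
    then have "\<not> K \<le> norm x" using assms(2)[of x] by auto
    then show "x \<in> cball 0 K" by simp
  qed
  then have "closure {x. f x \<noteq> 0} \<subseteq> cball 0 K" by (rule closure_minimal) simp
  then have "compact (closure {x. f x \<noteq> 0})"
    by (metis bounded_cball bounded_subset closed_closure compact_eq_bounded_closed)
  then show ?thesis using elementary_smooth_Ck[OF assms(1)] by (simp add: test_functions_def)
qed

text \<open>Each directional derivative is continuous and vanishes off a compact set, hence is
  bounded. By linearity the bounds for the two coordinate directions give one constant for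
  all.\<close>

lemma test_function_smooth_bounded_support:
  assumes "f \<in> test_functions"
  shows "\<exists>f' C K. smooth_bounded_support f f' C K"
proof -
  define S where "S = closure {x. f x \<noteq> 0}"
  have S: "compact S" using assms by (simp add: test_functions_def S_def)
  have "Ck 1 f" using assms by (simp add: test_functions_def)
  then have diff: "\<And>x. f differentiable (at x)" and cont: "\<And>v. continuous_on UNIV (\<lambda>x. frechet_derivative f (at x) v)"
    by auto
  define f' where "f' x = frechet_derivative f (at x)" for x
  have f': "(f has_derivative f' x) (at x)" for x
    unfolding f'_def using diff[of x] by (simp add: frechet_derivative_works)
  have off: "f x = 0" if "x \<notin> S" for x using that closure_subset[of "{x. f x \<noteq> 0}"] by (auto simp: S_def)
  have off': "f' x = (\<lambda>v. 0)" if "x \<notin> S" for x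
  proof -
    have "((\<lambda>x. 0) has_derivative (\<lambda>v. 0)) (at x)" by simp
    then have "(f has_derivative (\<lambda>v. 0)) (at x)"
      by (rule has_derivative_transform_within_open[of _ _ _ _ "- S"]) (use that S off in \<open>auto simp: compact_imp_closed open_Compl\<close>)
    with f' show ?thesis by (rule has_derivative_unique)
  qed
  have "\<exists>M. 0 \<le> M \<and> (\<forall>x. norm (f' x v) \<le> M)" for v
  proof -
    have "compact ((\<lambda>x. f' x v) ` S)"
      using cont[of v] S unfolding f'_def by (intro compact_continuous_image continuous_on_subset[OF cont]) auto
    then have "bounded ((\<lambda>x. f' x v) ` S)" by (rule compact_imp_bounded)
    then obtain M where M: "0 < M" "\<forall>y\<in>(\<lambda>x. f' x v) ` S. norm y \<le> M" unfolding bounded_pos by auto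
    then have "norm (f' x v) \<le> M" for x using off'[of x] by (cases "x \<in> S") auto
    then show ?thesis using M(1) by (intro exI[of _ M]) auto
  qed
  then obtain M where M: "\<And>v. 0 \<le> M v" "\<And>v x. norm (f' x v) \<le> M v" by metis
  define C where "C = M (axis 1 1) + M (axis 2 1)"
  have bnd: "norm (f' x v) \<le> C * norm v" for x v
  proof -
    interpret bounded_linear "f' x" by (rule has_derivative_bounded_linear[OF f'])
    have v: "v = (v $ 1) *\<^sub>R axis 1 1 + (v $ 2) *\<^sub>R axis 2 1"
      using pt_eq[of "v $ 1" "v $ 2"] by simp
    have "f' x v = (v $ 1) *\<^sub>R f' x (axis 1 1) + (v $ 2) *\<^sub>R f' x (axis 2 1)"
      using arg_cong[OF v, of "f' x"] by (simp only: add scaleR)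
    also have "norm \<dots> \<le> norm v * M (axis 1 1) + norm v * M (axis 2 1)"
      using component_le_norm_cart[of v 1] component_le_norm_cart[of v 2]
      by (intro order_trans[OF norm_triangle_ineq] add_mono) (auto intro!: mult_mono M)
    finally show ?thesis by (simp add: C_def algebra_simps)
  qed
  obtain K where K: "0 < K" "\<And>x. x \<in> S \<Longrightarrow> norm x \<le> K"
    using compact_imp_bounded[OF S] unfolding bounded_pos by auto
  have "f x = 0" if "K + 1 \<le> norm x" for x using K(2)[of x] that off[of x] by fastforce
  then have "smooth_bounded_support f f' C (K + 1)"
    unfolding smooth_bounded_support_def
  proof (intro conjI allI impI)
    show "0 \<le> C" using M(1) by (simp add: C_def)
    show "0 \<le> K + 1" using K(1) by simp
    show "continuous_on UNIV (\<lambda>x. f' x v)" for v unfolding f'_def by (rule cont)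
  qed (rule f' bnd | assumption)+
  then show ?thesis by blast
qed

text \<open>Supported in the square from -1 to 2, which consists of 9 unit squares, and at least
  \<open>exp (- 4)\<close> on the unit square, each of the four factors being at least
  \<open>exp (- 1)\<close> there. These are the 9 and the \<open>exp (- 4)\<close> of the
  transference.\<close>

definition bump :: "real^2 \<Rightarrow> complex" where
  "bump x = of_real (flat_exp 0 (1 + x $ 1) * flat_exp 0 (2 - x $ 1) * flat_exp 0 (1 + x $ 2) * flat_exp 0 (2 - x $ 2))"

lemma flat_exp_0_bounds: "0 \<le> flat_exp 0 x" "flat_exp 0 x \<le> 1"
  by (auto simp: flat_exp_def)

lemma flat_exp_0_ge: "1 \<le> x \<Longrightarrow> exp (- 1) \<le> flat_exp 0 x"
  by (simp add: flat_exp_def)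

lemma bump_le_1: "norm (bump x) \<le> 1"
proof -
  have "flat_exp 0 (1 + x $ 1) * flat_exp 0 (2 - x $ 1) * flat_exp 0 (1 + x $ 2) * flat_exp 0 (2 - x $ 2) \<le> 1 * 1 * 1 * 1"
    by (intro mult_mono flat_exp_0_bounds mult_nonneg_nonneg) auto
  then show ?thesis unfolding bump_def norm_of_real by (simp add: flat_exp_0_bounds)
qed

lemma bump_support: "x $ i \<notin> {-1..<2} \<Longrightarrow> bump x = 0"
  using exhaust_2[of i] by (auto simp: bump_def flat_exp_def)

lemma bump_ge:
  assumes "x $ 1 \<in> {0..<1}" "x $ 2 \<in> {0..<1}"
  shows "exp (- 4) \<le> norm (bump x)"
proof -
  have "exp (- 1) * exp (- 1) * exp (- 1) * exp (- 1)
     \<le> flat_exp 0 (1 + x $ 1) * flat_exp 0 (2 - x $ 1) * flat_exp 0 (1 + x $ 2) * flat_exp 0 (2 - x $ 2)"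
    using assms by (intro mult_mono flat_exp_0_ge mult_nonneg_nonneg flat_exp_0_bounds) auto
  also have "exp (- 1) * exp (- 1) * exp (- 1) * exp (- 1) = exp (- 4 :: real)"
    by (simp add: exp_add[symmetric])
  finally show ?thesis unfolding bump_def norm_of_real by simp
qed

lemma bump_scaled_smooth: "elementary_smooth (\<lambda>x. bump (\<epsilon> *\<^sub>R x))"
proof -
  have 1: "1 + (\<epsilon> *\<^sub>R x) $ 1 = 1 + pt \<epsilon> 0 \<bullet> x" "2 - (\<epsilon> *\<^sub>R x) $ 1 = 2 + pt (- \<epsilon>) 0 \<bullet> x"
    "1 + (\<epsilon> *\<^sub>R x) $ 2 = 1 + pt 0 \<epsilon> \<bullet> x" "2 - (\<epsilon> *\<^sub>R x) $ 2 = 2 + pt 0 (- \<epsilon>) \<bullet> x" for x :: "real^2"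
    by (simp_all add: inner_vec2)
  show ?thesis unfolding bump_def 1 of_real_mult
    by (intro elementary_smooth.mult elementary_smooth.flat)
qed

lemma bump_norm_support: "3 \<le> norm x \<Longrightarrow> bump x = 0"
proof -
  assume *: "3 \<le> norm x"
  have "norm x \<le> \<bar>x $ 1\<bar> + \<bar>x $ 2\<bar>" unfolding norm_vec2 by (rule sqrt_sum_squares_le_sum_abs)
  moreover have "norm x < 3" if "\<bar>x $ 1\<bar> \<le> 2" "\<bar>x $ 2\<bar> \<le> 2"
  proof -
    have "(x $ 1)\<^sup>2 \<le> 2\<^sup>2" "(x $ 2)\<^sup>2 \<le> 2\<^sup>2"
      using that by (metis abs_ge_zero power2_abs power_mono)+
    then show ?thesis unfolding norm_vec2 by (intro real_less_lsqrt) auto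
  qed
  ultimately have "x $ 1 \<notin> {-1..<2} \<or> x $ 2 \<notin> {-1..<2}" using * by fastforce
  then show ?thesis using bump_support by blast
qed

lemma modulated_bump_smooth: "elementary_smooth (modulated t \<epsilon> bump)"
  unfolding modulated_def[abs_def] by (intro elementary_smooth.mult elementary_smooth.exp bump_scaled_smooth)

lemma bump_smooth_bounded_support: "\<exists>f' C K. smooth_bounded_support bump f' C K"
proof -
  have "bump \<in> test_functions"
    using bump_scaled_smooth[of 1] bump_norm_support by (intro test_functionI) auto
  then show ?thesis by (rule test_function_smooth_bounded_support)
qed

context log_slope_kernel
begin

lemma bounded_on_L2: "bounded_on_Lp (rough_T Omega) 2"
proof -
  define B where "B = sqrt (2 * (L2_const\<^sup>2 + c_g\<^sup>2))"
  have "rough_T Omega f \<in> Lp_space 2 \<and> Lp_norm 2 (rough_T Omega f) \<le> B * Lp_norm 2 f" if f: "f \<in> test_functions" for f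
  proof -
    obtain f' C K where "smooth_bounded_support f f' C K"
      using test_function_smooth_bounded_support[OF f] by auto
    then have lip: "lipschitz_bounded_support f C K" by (rule smooth_imp_lipschitz_bounded_support)
    note T = rough_T_L2[OF lip]
    have "sqrt (LINT x|lborel. (norm (rough_T Omega f x))\<^sup>2) \<le> sqrt (2 * (L2_const\<^sup>2 + c_g\<^sup>2) * (LINT x|lborel. (norm (f x))\<^sup>2))"
      using T(3) by (rule real_sqrt_le_mono)
    then have "sqrt (LINT x|lborel. (norm (rough_T Omega f x))\<^sup>2) \<le> B * sqrt (LINT x|lborel. (norm (f x))\<^sup>2)"
      unfolding B_def real_sqrt_mult[symmetric] .
    then show ?thesis using T(1,2)
      by (simp add: Lp_space_def Lp_norm_def powr_half_sqrt)
  qed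
  then show ?thesis unfolding bounded_on_Lp_def by blast
qed

end

section \<open>Transference to trigonometric polynomials\<close>

lemma nn_integral_periodic_interval:
  fixes G :: "real \<Rightarrow> ennreal"
  assumes [measurable]: "G \<in> borel_measurable borel" and per: "\<And>u. G (u + 1) = G u"
  shows "(\<integral>\<^sup>+u. indicator {real_of_int i..<real_of_int i + real n} u * G u \<partial>lborel)
       = of_nat n * (\<integral>\<^sup>+u. indicator {0..<1} u * G u \<partial>lborel)"
proof -
  have per_int: "G (real_of_int j + u) = G u" for j u
  proof (induction j rule: int_induct[of _ 0])
    case (step1 j)
    then show ?case using per[of "real_of_int j + u"] by (simp add: algebra_simps)
  next
    case (step2 j)
    then show ?case using per[of "real_of_int (j - 1) + u"] by (simp add: algebra_simps)
  qed simp
  have unit: "(\<integral>\<^sup>+u. indicator {real_of_int j..<real_of_int j + 1} u * G u \<partial>lborel)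
       = (\<integral>\<^sup>+u. indicator {0..<1} u * G u \<partial>lborel)" for j
    by (subst nn_integral_real_affine[where c=1 and t="real_of_int j"])
       (auto intro!: nn_integral_cong simp: per_int indicator_def)
  show ?thesis
  proof (induction n)
    case (Suc n)
    have "(\<integral>\<^sup>+u. indicator {real_of_int i..<real_of_int i + real (Suc n)} u * G u \<partial>lborel)
       = (\<integral>\<^sup>+u. indicator {real_of_int i..<real_of_int i + real n} u * G u
            + indicator {real_of_int (i + int n)..<real_of_int (i + int n) + 1} u * G u \<partial>lborel)"
      by (rule nn_integral_cong) (auto simp: indicator_def)
    also have "\<dots> = of_nat n * (\<integral>\<^sup>+u. indicator {0..<1} u * G u \<partial>lborel) + (\<integral>\<^sup>+u. indicator {0..<1} u * G u \<partial>lborel)"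
      by (subst nn_integral_add) (simp_all only: Suc.IH unit, measurable)
    finally show ?case by (simp add: algebra_simps)
  qed simp
qed

text \<open>Dilating by a positive integer preserves the mean of a 1-periodic function over
  intervals with integer end points exactly. In the transference this replaces an equidistribution
  limit.\<close>

lemma nn_integral_periodic_dilate:
  fixes G :: "real \<Rightarrow> ennreal"
  assumes [measurable]: "G \<in> borel_measurable borel" and per: "\<And>u. G (u + 1) = G u"
  shows "(\<integral>\<^sup>+y. indicator {real_of_int i..<real_of_int i + real n} y * G (real (Suc m) * y) \<partial>lborel)
       = of_nat n * (\<integral>\<^sup>+u. indicator {0..<1} u * G u \<partial>lborel)"
proof -
  define M where "M = Suc m"
  have M: "0 < real M" by (simp add: M_def)
  have "of_nat M * (\<integral>\<^sup>+y. indicator {real_of_int i..<real_of_int i + real n} y * G (real M * y) \<partial>lborel)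
     = ennreal \<bar>real M\<bar> * (\<integral>\<^sup>+y. indicator {real_of_int (int M * i)..<real_of_int (int M * i) + real (M * n)} (0 + real M * y) * G (0 + real M * y) \<partial>lborel)"
  proof -
    have "y \<in> {real_of_int i..<real_of_int i + real n} \<longleftrightarrow>
        real M * y \<in> {real_of_int (int M * i)..<real_of_int (int M * i) + real (M * n)}" for y
    proof -
      have "real_of_int (int M * i) + real (M * n) = real M * (real_of_int i + real n)" by (simp add: distrib_left)
      moreover have "real_of_int (int M * i) = real M * real_of_int i" by simp
      ultimately show ?thesis using M by (simp only: atLeastLessThan_iff mult_le_cancel_left_pos mult_less_cancel_left_pos)
    qed
    then have "indicator {real_of_int i..<real_of_int i + real n} y
      = (indicator {real_of_int (int M * i)..<real_of_int (int M * i) + real (M * n)} (0 + real M * y) :: ennreal)" for y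
      by (simp only: indicator_def add_0)
    then show ?thesis by (simp add: ennreal_of_nat_eq_real_of_nat)
  qed
  also have "\<dots> = (\<integral>\<^sup>+u. indicator {real_of_int (int M * i)..<real_of_int (int M * i) + real (M * n)} u * G u \<partial>lborel)"
    using M by (subst nn_integral_real_affine[where c="real M" and t=0, symmetric]) auto
  also have "\<dots> = of_nat M * (of_nat n * (\<integral>\<^sup>+u. indicator {0..<1} u * G u \<partial>lborel))"
    unfolding nn_integral_periodic_interval[OF assms] by (simp add: mult.assoc)
  finally show ?thesis
    by (subst (asm) ennreal_mult_cancel_left) (auto simp: M_def)
qed

lemma nn_integral_scale_vec2:
  fixes f :: "real^2 \<Rightarrow> ennreal"
  assumes [measurable]: "f \<in> borel_measurable borel" and \<epsilon>: "0 < \<epsilon>"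
  shows "(\<integral>\<^sup>+X. f (X /\<^sub>R \<epsilon>) \<partial>lborel) = ennreal (\<epsilon>\<^sup>2) * (\<integral>\<^sup>+x. f x \<partial>lborel)"
proof -
  have d: "(lborel :: (real^2) measure) = density (distr lborel borel (\<lambda>x. 0 + \<epsilon> *\<^sub>R x)) (\<lambda>_. ennreal (\<bar>\<epsilon>\<bar> ^ DIM(real^2)))"
    using lborel_affine[of \<epsilon> "0 :: real^2"] \<epsilon> by simp
  have "(\<integral>\<^sup>+X. f (X /\<^sub>R \<epsilon>) \<partial>lborel) = (\<integral>\<^sup>+x. ennreal (\<bar>\<epsilon>\<bar> ^ DIM(real^2)) * f ((0 + \<epsilon> *\<^sub>R x) /\<^sub>R \<epsilon>) \<partial>lborel)"
    by (subst d) (simp add: nn_integral_density nn_integral_distr)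
  also have "\<dots> = ennreal (\<epsilon>\<^sup>2) * (\<integral>\<^sup>+x. f x \<partial>lborel)"
    using \<epsilon> by (simp add: nn_integral_cmult)
  finally show ?thesis .
qed

lemma emeasure_eq_nn_integral:
  assumes "A \<in> sets M" and "\<And>x. x \<in> space M \<Longrightarrow> f x = indicator A x"
  shows "emeasure M A = (\<integral>\<^sup>+x. f x \<partial>M)"
  using assms(1) nn_integral_cong[of M f "indicator A", OF assms(2)] by simp

lemma ennreal_lebesgue_integral_le:
  assumes [measurable]: "f \<in> borel_measurable M" and nn: "\<And>x. 0 \<le> f x"
  shows "ennreal (LINT x|M. f x) \<le> (\<integral>\<^sup>+x. ennreal (f x) \<partial>M)"
proof (cases "integrable M f")
  case True
  then show ?thesis using nn by (simp add: nn_integral_eq_integral)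
qed (simp add: not_integrable_integral_eq)

context log_slope_kernel
begin

lemma pv_sum:
  assumes "\<And>k. k < (N::nat) \<Longrightarrow> \<exists>C K. lipschitz_bounded_support (f k) C K"
  shows "pv (\<lambda>x. \<Sum>k<N. c k * f k x) x = (\<Sum>k<N. c k * pv (f k) x)"
proof -
  have eq: "pv_integrand (\<lambda>x. \<Sum>k<N. c k * f k x) x z = (\<Sum>k<N. c k * pv_integrand (f k) x z)" for z
  proof (cases "0 < fst z")
    case True
    define y where "y = x - fst z *\<^sub>R pt 1 (snd z)"
    have "(\<Sum>k<N. c k * f k y) - (if fst z < 1 then \<Sum>k<N. c k * f k x else 0)
        = (\<Sum>k<N. c k * (f k y - (if fst z < 1 then f k x else 0)))"
      by (simp add: sum_subtractf right_diff_distrib)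
    then show ?thesis
      using True unfolding pv_integrand_def y_def[symmetric]
      by (simp only: if_True scaleR_sum_right mult_scaleR_right)
  qed (simp add: pv_integrand_def)
  have int: "integrable lborel2 (\<lambda>z. c k * pv_integrand (f k) x z)" if k: "k < N" for k
  proof -
    obtain C K where "lipschitz_bounded_support (f k) C K" using assms[OF k] by auto
    then show ?thesis by (intro integrable_mult_right pv_integrand_integrable)
  qed
  have "pv (\<lambda>x. \<Sum>k<N. c k * f k x) x = (LINT z|lborel2. (\<Sum>k<N. c k * pv_integrand (f k) x z))"
    unfolding pv_def eq[abs_def] ..
  also have "\<dots> = (\<Sum>k<N. LINT z|lborel2. c k * pv_integrand (f k) x z)"
    by (rule Bochner_Integration.integral_sum) (use int in auto)
  finally show ?thesis unfolding integral_mult_right_zero pv_def .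
qed

definition wave_packet :: "nat \<Rightarrow> (nat \<Rightarrow> complex) \<Rightarrow> (nat \<Rightarrow> real) \<Rightarrow> real \<Rightarrow> real^2 \<Rightarrow> complex" where
  "wave_packet N c t \<epsilon> x = (\<Sum>k<N. c k * modulated (t k) \<epsilon> bump x)"

lemma wave_packet_test_function:
  assumes "0 < \<epsilon>"
  shows "wave_packet N c t \<epsilon> \<in> test_functions"
proof (rule test_functionI)
  show "elementary_smooth (wave_packet N c t \<epsilon>)"
    unfolding wave_packet_def[abs_def]
    by (intro elementary_smooth_sum elementary_smooth.mult elementary_smooth.const modulated_bump_smooth)
  fix x :: "real^2" assume "3 / \<epsilon> \<le> norm x"
  then have "3 \<le> norm (\<epsilon> *\<^sub>R x)" using assms by (simp add: field_simps)
  then show "wave_packet N c t \<epsilon> x = 0" by (simp add: wave_packet_def modulated_def bump_norm_support)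
qed

text \<open>In the limit each modulated bump is multiplied by its own value of
  \<open>multiplier\<close>. The waves themselves have no limit at
  \<open>X /\<^sub>R \<epsilon> n\<close>, so convergence is stated for the difference.\<close>

lemma wave_packet_limit:
  fixes X :: "real^2"
  assumes \<epsilon>: "\<And>n. 0 < \<epsilon> n" "\<And>n. \<epsilon> n \<le> 1" "\<epsilon> \<longlonglongrightarrow> 0"
    and t: "\<And>k. k < N \<Longrightarrow> t k \<in> {0..1}"
  shows "(\<lambda>n. rough_T Omega (wave_packet N c t (\<epsilon> n)) (X /\<^sub>R \<epsilon> n)
      - bump X * (\<Sum>k<N. c k * multiplier (t k) * cis (pt (- t k) 1 \<bullet> (X /\<^sub>R \<epsilon> n)))) \<longlonglongrightarrow> 0"
proof -
  obtain b' Cb Kb where b: "smooth_bounded_support bump b' Cb Kb" using bump_smooth_bounded_support by auto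
  note blip = smooth_imp_lipschitz_bounded_support[OF b]
  define I where "I k = (LINT \<tau>|lborel. g \<tau> *\<^sub>R mult_kernel (t k - \<tau>))" for k
  define e where "e k n = cis (pt (- t k) 1 \<bullet> (X /\<^sub>R \<epsilon> n))" for k n
  define d where "d k n = cis (- (pt (- t k) 1 \<bullet> (X /\<^sub>R \<epsilon> n))) * pv (modulated (t k) (\<epsilon> n) bump) (X /\<^sub>R \<epsilon> n) - bump X * I k" for k n
  have ed: "pv (modulated (t k) (\<epsilon> n) bump) (X /\<^sub>R \<epsilon> n) - bump X * I k * e k n = e k n * d k n" for k n
    by (simp add: e_def d_def right_diff_distrib mult.assoc[symmetric] cis_mult mult.commute)
  have mlip: "\<exists>C K. lipschitz_bounded_support (modulated (t k) (\<epsilon> n) bump) C K" for k n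
    using modulated_lipschitz[OF blip \<epsilon>(1)] by blast
  have eq: "rough_T Omega (wave_packet N c t (\<epsilon> n)) (X /\<^sub>R \<epsilon> n)
      - bump X * (\<Sum>k<N. c k * multiplier (t k) * cis (pt (- t k) 1 \<bullet> (X /\<^sub>R \<epsilon> n))) = (\<Sum>k<N. c k * (e k n * d k n))" for n
  proof -
    obtain w' Cw Kw where "smooth_bounded_support (wave_packet N c t (\<epsilon> n)) w' Cw Kw"
      using test_function_smooth_bounded_support[OF wave_packet_test_function[OF \<epsilon>(1)]] by blast
    note wlip = smooth_imp_lipschitz_bounded_support[OF this]
    have "pv (wave_packet N c t (\<epsilon> n)) (X /\<^sub>R \<epsilon> n) = (\<Sum>k<N. c k * pv (modulated (t k) (\<epsilon> n) bump) (X /\<^sub>R \<epsilon> n))"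
      unfolding wave_packet_def[abs_def] by (rule pv_sum) (rule mlip)
    moreover have "wave_packet N c t (\<epsilon> n) (X /\<^sub>R \<epsilon> n) = (\<Sum>k<N. c k * (e k n * bump X))"
      using \<epsilon>(1)[of n] by (simp add: wave_packet_def modulated_def e_def)
    ultimately have "rough_T Omega (wave_packet N c t (\<epsilon> n)) (X /\<^sub>R \<epsilon> n)
      = (\<Sum>k<N. c k * pv (modulated (t k) (\<epsilon> n) bump) (X /\<^sub>R \<epsilon> n) + of_real c_g * (c k * (e k n * bump X)))"
      unfolding rough_T_Omega[OF wlip] by (simp add: scaleR_conv_of_real sum.distrib sum_distrib_left)
    moreover have "bump X * (\<Sum>k<N. c k * multiplier (t k) * cis (pt (- t k) 1 \<bullet> (X /\<^sub>R \<epsilon> n)))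
      = (\<Sum>k<N. c k * (bump X * I k * e k n) + of_real c_g * (c k * (e k n * bump X)))"
      unfolding sum_distrib_left e_def[symmetric] multiplier_def I_def[symmetric]
      by (intro sum.cong refl) (simp add: algebra_simps)
    ultimately show ?thesis
      unfolding ed[symmetric] right_diff_distrib by (simp add: sum_subtractf sum.distrib)
  qed
  have "(\<lambda>n. \<Sum>k<N. norm (c k) * norm (d k n)) \<longlonglongrightarrow> (\<Sum>k<N. norm (c k) * 0)"
  proof (intro tendsto_intros tendsto_norm_zero)
    fix k assume "k \<in> {..<N}"
    then have "t k \<in> {0..1}" using t by simp
    from pv_modulated_limit[OF b \<epsilon> this, of X, folded I_def]
    have "(\<lambda>n. d k n) \<longlonglongrightarrow> bump X * I k - bump X * I k"
      unfolding d_def by (intro tendsto_diff tendsto_const)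
    then show "d k \<longlonglongrightarrow> 0" by simp
  qed
  then have "(\<lambda>n. \<Sum>k<N. norm (c k) * norm (d k n)) \<longlonglongrightarrow> 0" by simp
  moreover have "norm (\<Sum>k<N. c k * (e k n * d k n)) \<le> (\<Sum>k<N. norm (c k) * norm (d k n))" for n
    by (rule order_trans[OF norm_sum]) (simp add: norm_mult e_def)
  then have "eventually (\<lambda>n. norm (\<Sum>k<N. c k * (e k n * d k n)) \<le> (\<Sum>k<N. norm (c k) * norm (d k n))) sequentially"
    by (intro always_eventually allI)
  ultimately show ?thesis unfolding eq by (rule Lim_null_comparison[rotated])
qed

text \<open>For equally spaced slopes the waves at \<open>X /\<^sub>R \<epsilon>\<close> are a
  common unimodular factor times exponentials in \<open>k * X $ 1\<close>. With
  \<open>\<epsilon> n = h / (2 * pi * real (Suc n))\<close> these are the exponentials of period one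
  at \<open>real (Suc n) * X $ 1\<close>. So the wave packet is the bump times a dilated
  trigonometric polynomial, and its image is, up to a vanishing error, the bump times the polynomial
  with multiplied coefficients. The weak type inequality is invariant under dilations and passes to
  the polynomials.\<close>

lemma transference:
  fixes c :: "nat \<Rightarrow> complex" and \<alpha> h p A s :: real
  assumes h: "0 < h" "h \<le> 1" and t: "\<And>k. k < N \<Longrightarrow> \<alpha> + real k * h \<in> {0..1}"
    and p: "0 < p" and A: "0 \<le> A" and s: "0 < s"
    and W: "\<And>f s. f \<in> test_functions \<Longrightarrow> 0 < s \<Longrightarrow>
        emeasure lborel {x. norm (rough_T Omega f x) > s} \<le> ennreal (A / s powr p * (LINT x|lborel. norm (f x) powr p))"
  shows "emeasure lborel {y \<in> {0..<1}. s < norm (\<Sum>k<N. c k * multiplier (\<alpha> + real k * h) * cis (- (2 * pi * (real k * y))))}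
    \<le> ennreal (A / (exp (- 4) * s / 2) powr p) * (9 *
        (\<integral>\<^sup>+y. indicator {0..<1} y * ennreal (norm (\<Sum>k<N. c k * cis (- (2 * pi * (real k * y)))) powr p) \<partial>lborel))"
proof -
  \<comment> \<open>The factor \<open>exp (- 4)\<close> is lost to the bump on the unit square, the
    factor 2 to the error \<open>d n\<close>.\<close>
  define S where "S = exp (- 4) * s / 2"
  have S: "0 < S" using s by (simp add: S_def)
  define \<epsilon> where "\<epsilon> n = h / (2 * pi * real (Suc n))" for n
  have \<epsilon>0: "0 < \<epsilon> n" for n using h by (simp add: \<epsilon>_def)
  have \<epsilon>1: "\<epsilon> n \<le> 1" for n
  proof -
    have "2 * pi * real (Suc n) \<ge> 1 * 1" using pi_gt3 by (intro mult_mono) auto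
    then show ?thesis using h by (simp add: \<epsilon>_def divide_le_eq)
  qed
  have \<epsilon>lim: "\<epsilon> \<longlonglongrightarrow> 0"
  proof -
    have "(\<lambda>n. (h / (2 * pi)) * inverse (real (Suc n))) \<longlonglongrightarrow> (h / (2 * pi)) * 0"
      by (intro tendsto_intros LIMSEQ_inverse_real_of_nat)
    then show ?thesis by (simp add: \<epsilon>_def[abs_def] field_simps)
  qed
  define tt where "tt k = \<alpha> + real k * h" for k
  define F where "F n = wave_packet N c tt (\<epsilon> n)" for n
  define q where "q y = (\<Sum>k<N. c k * cis (- (2 * pi * (real k * y))))" for y
  define Tq where "Tq y = (\<Sum>k<N. c k * multiplier (tt k) * cis (- (2 * pi * (real k * y))))" for y
  have cm [measurable]: "cis \<in> borel_measurable borel"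
    by (intro borel_measurable_continuous_onI continuous_intros)
  have [measurable]: "q \<in> borel_measurable borel" "Tq \<in> borel_measurable borel"
    unfolding q_def[abs_def] Tq_def[abs_def] by measurable
  define ph where "ph n X = cis ((X $ 2 - \<alpha> * X $ 1) / \<epsilon> n)" for n and X :: "real^2"
  have [measurable]: "ph n \<in> borel_measurable borel" for n unfolding ph_def[abs_def] by measurable
  have [measurable]: "bump \<in> borel_measurable borel"
  proof -
    obtain b' Cb Kb where "smooth_bounded_support bump b' Cb Kb" using bump_smooth_bounded_support by auto
    then show ?thesis by (intro lipschitz_bounded_support_measurable smooth_imp_lipschitz_bounded_support)
  qed
  have wave: "cis (pt (- tt k) 1 \<bullet> (X /\<^sub>R \<epsilon> n)) = ph n X * cis (- (2 * pi * (real k * (real (Suc n) * X $ 1))))" for k n X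
  proof -
    have "h / \<epsilon> n = 2 * pi * real (Suc n)" using h by (simp add: \<epsilon>_def)
    then have *: "real k * h * X $ 1 / \<epsilon> n = 2 * pi * (real k * (real (Suc n) * X $ 1))"
    proof -
      have "real k * h * X $ 1 / \<epsilon> n = real k * X $ 1 * (h / \<epsilon> n)" by simp
      then show ?thesis using \<open>h / \<epsilon> n = 2 * pi * real (Suc n)\<close> by simp
    qed
    have "pt (- tt k) 1 \<bullet> (X /\<^sub>R \<epsilon> n) = (X $ 2 - \<alpha> * X $ 1) / \<epsilon> n - real k * h * X $ 1 / \<epsilon> n"
      by (simp add: inner_vec2 tt_def divide_inverse algebra_simps)
    then show ?thesis unfolding * by (simp add: ph_def cis_mult)
  qed
  have F_eq: "F n (X /\<^sub>R \<epsilon> n) = bump X * (ph n X * q (real (Suc n) * X $ 1))" for n X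
  proof -
    have "\<epsilon> n *\<^sub>R (X /\<^sub>R \<epsilon> n) = X" using \<epsilon>0[of n] by simp
    then show ?thesis
      unfolding F_def wave_packet_def modulated_def wave q_def sum_distrib_left
      by (intro sum.cong refl) (simp only: mult_ac)
  qed
  have Tq_eq: "(\<Sum>k<N. c k * multiplier (tt k) * cis (pt (- tt k) 1 \<bullet> (X /\<^sub>R \<epsilon> n))) = ph n X * Tq (real (Suc n) * X $ 1)" for n X
    unfolding wave Tq_def sum_distrib_left by (intro sum.cong refl) (simp add: mult_ac)
  define d where "d n X = rough_T Omega (F n) (X /\<^sub>R \<epsilon> n) - bump X * (ph n X * Tq (real (Suc n) * X $ 1))" for n X
  have dlim: "(\<lambda>n. d n X) \<longlonglongrightarrow> 0" for X
    using wave_packet_limit[of \<epsilon> N tt c X, OF \<epsilon>0 \<epsilon>1 \<epsilon>lim t[folded tt_def]] unfolding d_def F_def Tq_eq .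
  have Ftest: "F n \<in> test_functions" for n unfolding F_def by (rule wave_packet_test_function[OF \<epsilon>0])
  have Flip: "\<exists>C K. lipschitz_bounded_support (F n) C K" for n
  proof -
    obtain b' Cb Kb where "smooth_bounded_support (F n) b' Cb Kb"
      using test_function_smooth_bounded_support[OF Ftest] by blast
    then show ?thesis using smooth_imp_lipschitz_bounded_support by blast
  qed
  have [measurable]: "F n \<in> borel_measurable borel" for n
    using Flip[of n] lipschitz_bounded_support_measurable by blast
  have [measurable]: "rough_T Omega (F n) \<in> borel_measurable borel" for n
    using Flip[of n] rough_T_L2(1) by blast
  have [measurable]: "d n \<in> borel_measurable borel" for n
    unfolding d_def[abs_def] by measurable
  define U where "U = {0..<1::real}"
  have [measurable]: "U \<in> sets borel" by (simp add: U_def)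
  have qper: "q (u + 1) = q u" "Tq (u + 1) = Tq u" for u
  proof -
    have "cis (- (2 * pi * (real k * (u + 1)))) = cis (- (2 * pi * (real k * u)))" for k
    proof -
      have "cis (- (2 * pi * (real k * (u + 1)))) = cis (- (2 * pi * (real k * u))) * cis (2 * pi * of_int (- int k))"
        by (simp add: cis_mult algebra_simps)
      moreover have "cis (2 * pi * of_int (- int k)) = 1" by (rule cis_multiple_2pi) simp
      ultimately show ?thesis by (simp only: mult_1_right)
    qed
    then show "q (u + 1) = q u" "Tq (u + 1) = Tq u" by (simp_all add: q_def Tq_def)
  qed
  define Q where "Q = (\<integral>\<^sup>+y. indicator U y * ennreal (norm (q y) powr p) \<partial>lborel)"
  have meas1: "emeasure lborel {X::real^2. X $ 1 \<in> U \<and> X $ 2 \<in> U \<and> s < norm (Tq (real (Suc n) * X $ 1))}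
     = emeasure lborel {y \<in> U. s < norm (Tq y)}" for n
  proof -
    define G where "G y = (indicator {y. s < norm (Tq y)} y :: ennreal)" for y
    have [measurable]: "G \<in> borel_measurable borel" unfolding G_def[abs_def] by measurable
    have "emeasure lborel {X::real^2. X $ 1 \<in> U \<and> X $ 2 \<in> U \<and> s < norm (Tq (real (Suc n) * X $ 1))}
      = (\<integral>\<^sup>+X. indicator U (X $ 1) * G (real (Suc n) * X $ 1) * indicator U (X $ 2) \<partial>(lborel :: (real^2) measure))"
      by (rule emeasure_eq_nn_integral, measurable) (auto simp: indicator_def G_def)
    also have "\<dots> = (\<integral>\<^sup>+a. \<integral>\<^sup>+b. indicator U a * G (real (Suc n) * a) * indicator U b \<partial>lborel \<partial>lborel)"
      by (subst nn_integral_pt) auto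
    also have "\<dots> = (\<integral>\<^sup>+a. indicator U a * G (real (Suc n) * a) \<partial>lborel)"
      by (subst nn_integral_cmult) (auto simp: U_def)
    also have "\<dots> = (\<integral>\<^sup>+u. indicator U u * G u \<partial>lborel)"
      using nn_integral_periodic_dilate[of G 0 1 n] by (simp add: U_def G_def indicator_def qper)
    also have "\<dots> = emeasure lborel {y \<in> U. s < norm (Tq y)}"
      by (rule emeasure_eq_nn_integral[symmetric], measurable) (auto simp: indicator_def G_def)
    finally show ?thesis .
  qed
  \<comment> \<open>The bump is at most 1 and lives on \<open>V\<close> times \<open>V\<close>. The
    first coordinate carries the periodic function over three units, the second contributes its
    length 3.\<close>
  have Fnorm: "ennreal ((\<epsilon> n)\<^sup>2) * (\<integral>\<^sup>+x. ennreal (norm (F n x) powr p) \<partial>lborel) \<le> 9 * Q" for n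
  proof -
    define V where "V = {-1..<2::real}"
    have [measurable]: "V \<in> sets borel" by (simp add: V_def)
    define G where "G y = ennreal (norm (q y) powr p)" for y
    have [measurable]: "G \<in> borel_measurable borel" unfolding G_def[abs_def] by measurable
    have per: "(\<integral>\<^sup>+a. indicator V a * G (real (Suc n) * a) \<partial>lborel) = 3 * Q"
      using nn_integral_periodic_dilate[of G "-1" 3 n] by (simp add: V_def Q_def U_def G_def qper)
    have "ennreal ((\<epsilon> n)\<^sup>2) * (\<integral>\<^sup>+x. ennreal (norm (F n x) powr p) \<partial>lborel)
       = (\<integral>\<^sup>+X. ennreal (norm (F n (X /\<^sub>R \<epsilon> n)) powr p) \<partial>lborel)"
      by (subst nn_integral_scale_vec2[OF _ \<epsilon>0]) auto
    also have "\<dots> \<le> (\<integral>\<^sup>+X. indicator V (X $ 1) * G (real (Suc n) * X $ 1) * indicator V (X $ 2) \<partial>(lborel :: (real^2) measure))"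
    proof (rule nn_integral_mono)
      fix X :: "real^2"
      show "ennreal (norm (F n (X /\<^sub>R \<epsilon> n)) powr p) \<le> indicator V (X $ 1) * G (real (Suc n) * X $ 1) * indicator V (X $ 2)"
      proof (cases "X $ 1 \<in> V \<and> X $ 2 \<in> V")
        case True
        have "norm (F n (X /\<^sub>R \<epsilon> n)) \<le> 1 * (1 * norm (q (real (Suc n) * X $ 1)))"
          unfolding F_eq norm_mult by (intro mult_mono bump_le_1) (auto simp: ph_def)
        then show ?thesis using True p by (auto simp: G_def intro!: powr_mono2 ennreal_leI)
      next
        case False
        then have "bump X = 0" using bump_support[of X 1] bump_support[of X 2] by (auto simp: V_def)
        then show ?thesis by (simp add: F_eq)
      qed
    qed
    also have "\<dots> = (\<integral>\<^sup>+a. \<integral>\<^sup>+b. indicator V a * G (real (Suc n) * a) * indicator V b \<partial>lborel \<partial>lborel)"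
      by (subst nn_integral_pt) auto
    also have "\<dots> = (\<integral>\<^sup>+a. indicator V a * G (real (Suc n) * a) * 3 \<partial>lborel)"
      by (subst nn_integral_cmult) (auto simp: V_def)
    also have "\<dots> = (\<integral>\<^sup>+a. indicator V a * G (real (Suc n) * a) \<partial>lborel) * 3"
      by (rule nn_integral_multc) measurable
    also have "\<dots> = (3 * 3) * Q" unfolding per by (simp only: mult_ac)
    also have "(3 * 3 :: ennreal) = 9" by simp
    finally show ?thesis .
  qed
  have first: "emeasure lborel {X. S < norm (rough_T Omega (F n) (X /\<^sub>R \<epsilon> n))} \<le> ennreal (A / S powr p) * (9 * Q)" for n
  proof -
    have "emeasure lborel {X. S < norm (rough_T Omega (F n) (X /\<^sub>R \<epsilon> n))}
      = (\<integral>\<^sup>+X. indicator {x. S < norm (rough_T Omega (F n) x)} (X /\<^sub>R \<epsilon> n) \<partial>lborel)"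
      by (rule emeasure_eq_nn_integral, measurable) (auto simp: indicator_def)
    also have "\<dots> = ennreal ((\<epsilon> n)\<^sup>2) * emeasure lborel {x. S < norm (rough_T Omega (F n) x)}"
      by (subst nn_integral_scale_vec2[OF _ \<epsilon>0]) auto
    also have "\<dots> \<le> ennreal ((\<epsilon> n)\<^sup>2) * (ennreal (A / S powr p) * (\<integral>\<^sup>+x. ennreal (norm (F n x) powr p) \<partial>lborel))"
    proof (rule mult_left_mono)
      have "emeasure lborel {x. S < norm (rough_T Omega (F n) x)} \<le> ennreal (A / S powr p) * ennreal (LINT x|lborel. norm (F n x) powr p)"
        using W[OF Ftest S, of n] A by (simp only: ennreal_mult[symmetric] divide_nonneg_nonneg powr_ge_zero Bochner_Integration.integral_nonneg)
      also have "\<dots> \<le> ennreal (A / S powr p) * (\<integral>\<^sup>+x. ennreal (norm (F n x) powr p) \<partial>lborel)"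
        by (intro mult_left_mono ennreal_lebesgue_integral_le) auto
      finally show "emeasure lborel {x. S < norm (rough_T Omega (F n) x)} \<le> ennreal (A / S powr p) * (\<integral>\<^sup>+x. ennreal (norm (F n x) powr p) \<partial>lborel)" .
    qed simp
    also have "\<dots> = ennreal (A / S powr p) * (ennreal ((\<epsilon> n)\<^sup>2) * (\<integral>\<^sup>+x. ennreal (norm (F n x) powr p) \<partial>lborel))"
      by (rule mult.left_commute)
    also have "\<dots> \<le> ennreal (A / S powr p) * (9 * Q)" by (intro mult_left_mono Fnorm) simp
    finally show ?thesis .
  qed
  \<comment> \<open>The measure of the part of the unit square where the approximation is off by
    more than \<open>S\<close>. It tends to 0 since pointwise convergence implies convergence in
    measure on a set of finite measure.\<close>
  define \<delta> where "\<delta> n = emeasure lborel {X::real^2. X $ 1 \<in> U \<and> X $ 2 \<in> U \<and> S < norm (d n X)}" for n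
  have \<delta>lim: "\<delta> \<longlonglongrightarrow> 0"
  proof -
    have "(\<lambda>n. \<integral>\<^sup>+X. indicator {X::real^2. X $ 1 \<in> U \<and> X $ 2 \<in> U \<and> S < norm (d n X)} X \<partial>lborel) \<longlonglongrightarrow> integral\<^sup>N (lborel :: (real^2) measure) (\<lambda>X. 0)"
    proof (rule nn_integral_dominated_convergence[where w="\<lambda>X. indicator {X. X $ 1 \<in> U \<and> X $ 2 \<in> U} X"])
      have "(\<integral>\<^sup>+X. indicator {X::real^2. X $ 1 \<in> U \<and> X $ 2 \<in> U} X \<partial>lborel) = (\<integral>\<^sup>+a. \<integral>\<^sup>+b. indicator U a * indicator U b \<partial>lborel \<partial>lborel)"
        by (subst nn_integral_pt) (auto simp: indicator_def intro!: nn_integral_cong)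
      also have "\<dots> = 1" by (subst nn_integral_cmult) (auto simp: U_def)
      finally show "(\<integral>\<^sup>+X. indicator {X::real^2. X $ 1 \<in> U \<and> X $ 2 \<in> U} X \<partial>lborel) < \<infinity>" by simp
      show "AE X in lborel. (\<lambda>n. indicator {X::real^2. X $ 1 \<in> U \<and> X $ 2 \<in> U \<and> S < norm (d n X)} X :: ennreal) \<longlonglongrightarrow> 0"
      proof (rule AE_I2)
        fix X :: "real^2"
        have "eventually (\<lambda>n. norm (d n X) < S) sequentially"
          using tendsto_norm_zero[OF dlim[of X]] S by (simp add: order_tendsto_iff)
        then have "eventually (\<lambda>n. indicator {X::real^2. X $ 1 \<in> U \<and> X $ 2 \<in> U \<and> S < norm (d n X)} X = (0::ennreal)) sequentially"
          by (rule eventually_mono) auto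
        then show "(\<lambda>n. indicator {X::real^2. X $ 1 \<in> U \<and> X $ 2 \<in> U \<and> S < norm (d n X)} X :: ennreal) \<longlonglongrightarrow> 0"
          by (rule tendsto_eventually)
      qed
    qed (auto simp: indicator_def)
    then show ?thesis by (simp add: \<delta>_def[abs_def])
  qed
  have step: "emeasure lborel {y \<in> U. s < norm (Tq y)} \<le> ennreal (A / S powr p) * (9 * Q) + \<delta> n" for n
  proof -
    have "{X::real^2. X $ 1 \<in> U \<and> X $ 2 \<in> U \<and> s < norm (Tq (real (Suc n) * X $ 1))}
      \<subseteq> {X. S < norm (rough_T Omega (F n) (X /\<^sub>R \<epsilon> n))} \<union> {X. X $ 1 \<in> U \<and> X $ 2 \<in> U \<and> S < norm (d n X)}" (is "?L \<subseteq> ?R1 \<union> ?R2")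
    proof
      fix X assume X: "X \<in> ?L"
      have "2 * S = exp (- 4) * s" by (simp add: S_def)
      also have "\<dots> < exp (- 4) * norm (Tq (real (Suc n) * X $ 1))" using X by simp
      also have "\<dots> \<le> norm (bump X) * norm (Tq (real (Suc n) * X $ 1))"
        using X bump_ge[of X] by (intro mult_right_mono) (auto simp: U_def)
      also have "\<dots> = norm (bump X * (ph n X * Tq (real (Suc n) * X $ 1)))" by (simp add: norm_mult ph_def)
      also have "\<dots> = norm (rough_T Omega (F n) (X /\<^sub>R \<epsilon> n) - d n X)" by (simp add: d_def)
      also have "\<dots> \<le> norm (rough_T Omega (F n) (X /\<^sub>R \<epsilon> n)) + norm (d n X)" by (rule norm_triangle_ineq4)
      finally show "X \<in> ?R1 \<union> ?R2" using X by auto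
    qed
    then have "emeasure lborel ?L \<le> emeasure lborel (?R1 \<union> ?R2)" by (rule emeasure_mono) measurable
    also have "\<dots> \<le> emeasure lborel ?R1 + emeasure lborel ?R2" by (rule emeasure_subadditive) measurable
    also have "\<dots> \<le> ennreal (A / S powr p) * (9 * Q) + \<delta> n" unfolding \<delta>_def by (intro add_mono first order_refl)
    finally show ?thesis unfolding meas1 .
  qed
  have "(\<lambda>n. ennreal (A / S powr p) * (9 * Q) + \<delta> n) \<longlonglongrightarrow> ennreal (A / S powr p) * (9 * Q) + 0"
    by (intro tendsto_add tendsto_const \<delta>lim)
  then have "emeasure lborel {y \<in> U. s < norm (Tq y)} \<le> ennreal (A / S powr p) * (9 * Q) + 0"
    by (rule LIMSEQ_le_const) (use step in auto)
  then show ?thesis by (simp add: Tq_def Q_def q_def U_def S_def tt_def)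
qed

end

section \<open>Rudin-Shapiro polynomials and the Dirichlet kernel\<close>

text \<open>The signs of the coefficients of z^n in the pair P_k, Q_k with P_(k+1) = P_k + z^(2^k)
  Q_k and Q_(k+1) = P_k - z^(2^k) Q_k. They are meaningful for \<open>n < 2 ^ k\<close>.\<close>

fun rudin_shapiro :: "nat \<Rightarrow> nat \<Rightarrow> real \<times> real" where
  "rudin_shapiro 0 n = (1, 1)"
| "rudin_shapiro (Suc k) n =
     (if n < 2 ^ k then (fst (rudin_shapiro k n), fst (rudin_shapiro k n))
      else (snd (rudin_shapiro k (n - 2 ^ k)), - snd (rudin_shapiro k (n - 2 ^ k))))"

lemma rudin_shapiro_abs: "\<bar>fst (rudin_shapiro k n)\<bar> = 1" "\<bar>snd (rudin_shapiro k n)\<bar> = 1"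
  by (induction k arbitrary: n) auto

lemma sum_lessThan_add:
  fixes f :: "nat \<Rightarrow> 'a::comm_monoid_add"
  shows "(\<Sum>n<m + l. f n) = (\<Sum>n<m. f n) + (\<Sum>n<l. f (m + n))"
  by (induction l) (auto simp: add.assoc)

lemma rudin_shapiro_step:
  fixes z :: complex
  shows "(\<Sum>n<2 ^ Suc k. of_real (fst (rudin_shapiro (Suc k) n)) * z ^ n)
      = (\<Sum>n<2 ^ k. of_real (fst (rudin_shapiro k n)) * z ^ n) + z ^ (2 ^ k) * (\<Sum>n<2 ^ k. of_real (snd (rudin_shapiro k n)) * z ^ n)"
    and "(\<Sum>n<2 ^ Suc k. of_real (snd (rudin_shapiro (Suc k) n)) * z ^ n)
      = (\<Sum>n<2 ^ k. of_real (fst (rudin_shapiro k n)) * z ^ n) - z ^ (2 ^ k) * (\<Sum>n<2 ^ k. of_real (snd (rudin_shapiro k n)) * z ^ n)"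
  by (simp_all add: mult_2 sum_lessThan_add power_add sum_distrib_left sum_negf[symmetric] mult_ac)

text \<open>By the parallelogram law each step of the recursion doubles |P|^2 + |Q|^2 on the unit
  circle.\<close>

lemma rudin_shapiro_norm:
  fixes z :: complex
  assumes "norm z = 1"
  shows "(norm (\<Sum>n<2 ^ k. of_real (fst (rudin_shapiro k n)) * z ^ n))\<^sup>2
       + (norm (\<Sum>n<2 ^ k. of_real (snd (rudin_shapiro k n)) * z ^ n))\<^sup>2 = 2 ^ Suc k"
proof (induction k)
  case (Suc k)
  have par: "(norm (u + v))\<^sup>2 + (norm (u - v))\<^sup>2 = 2 * ((norm u)\<^sup>2 + (norm v)\<^sup>2)" for u v :: complex
    by (simp add: power2_norm_eq_inner inner_simps inner_commute)
  show ?case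
    unfolding rudin_shapiro_step par using Suc.IH assms by (simp add: norm_mult norm_power)
qed simp

text \<open>At z = 1 the recursion maps (P, Q) to (P + Q, P - Q). Two steps double both entries, so
  P = Q persists at the even levels and Q vanishes at the odd ones.\<close>

lemma rudin_shapiro_sum_zero:
  "(\<Sum>n<2 ^ (2 * i + 1). snd (rudin_shapiro (2 * i + 1) n)) = 0"
proof -
  define P where "P k = (\<Sum>n<2 ^ k. complex_of_real (fst (rudin_shapiro k n)) * 1 ^ n)" for k
  define Q where "Q k = (\<Sum>n<2 ^ k. complex_of_real (snd (rudin_shapiro k n)) * 1 ^ n)" for k
  have step: "P (Suc k) = P k + Q k" "Q (Suc k) = P k - Q k" for k
    using rudin_shapiro_step[of k 1] unfolding P_def[symmetric] Q_def[symmetric] by simp_all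
  have "P (2 * i) = Q (2 * i)"
  proof (induction i)
    case 0
    show ?case by (simp add: P_def Q_def)
  next
    case (Suc i)
    then show ?case using step[of "Suc (2 * i)"] step[of "2 * i"] by simp
  qed
  then have "Q (2 * i + 1) = 0" using step[of "2 * i"] by simp
  then have "complex_of_real (\<Sum>n<2 ^ (2 * i + 1). snd (rudin_shapiro (2 * i + 1) n)) = 0"
    unfolding Q_def by simp
  then show ?thesis by (simp only: of_real_eq_0_iff)
qed

section \<open>Exponentials of period one, the Dirichlet kernel and the flat polynomial\<close>

definition unit_exp :: "nat \<Rightarrow> real \<Rightarrow> complex" where
  "unit_exp k y = cis (- (2 * pi * (real k * y)))"

lemma unit_exp_measurable [measurable]: "unit_exp k \<in> borel_measurable borel"
  unfolding unit_exp_def[abs_def] by (intro borel_measurable_continuous_onI continuous_intros)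

lemma unit_exp_power: "unit_exp k y = unit_exp 1 y ^ k"
  unfolding unit_exp_def Complex.DeMoivre by (rule arg_cong[of _ _ cis]) simp

lemma norm_unit_exp [simp]: "norm (unit_exp k y) = 1"
  by (simp add: unit_exp_def)

lemma integral_cis_unit:
  shows "integrable lborel (\<lambda>y. indicator {0..<1} y *\<^sub>R cis (2 * pi * of_int m * y))" (is ?A)
    and "(LINT y|lborel. indicator {0..<1} y *\<^sub>R cis (2 * pi * of_int m * y)) = (if m = 0 then 1 else 0)" (is ?B)
proof -
  have 1: "set_integrable lborel {0..1} (\<lambda>a. cis (2 * pi * of_int m * a))"
    unfolding set_integrable_def by (intro borel_integrable_compact) (auto intro!: continuous_intros)
  have "((\<lambda>a. cis (2 * pi * of_int m * a)) has_integral (if m = 0 then 1 else 0)) {0..1}"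
  proof (cases "m = 0")
    case True
    then show ?thesis using has_integral_const_real[of "1::complex" 0 1] by simp
  next
    case False
    define s where "s = 2 * pi * real_of_int m"
    have s: "s \<noteq> 0" using False by (simp add: s_def)
    have "((\<lambda>a. cis (s * a)) has_integral (cis (s * 1) / (\<i> * of_real s) - cis (s * 0) / (\<i> * of_real s))) {0..1}"
    proof (rule fundamental_theorem_of_calculus)
      fix a
      from has_vector_derivative_mult_right[OF has_vector_derivative_cis_mult[of s a "{0..1}"], of "1 / (\<i> * of_real s)"]
      show "((\<lambda>a. cis (s * a) / (\<i> * of_real s)) has_vector_derivative cis (s * a)) (at a within {0..1})"
        using s by simp
    qed simp
    moreover have "cis s = 1" unfolding s_def by (rule cis_multiple_2pi) simp
    ultimately show ?thesis using False by (simp add: s_def)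
  qed
  then have 2: "(LINT a:{0..1}|lborel. cis (2 * pi * of_int m * a)) = (if m = 0 then 1 else 0)"
    using set_borel_integral_eq_integral(2)[OF 1] by (simp add: integral_unique)
  have ae: "AE a in lborel. indicator {0..<1} a *\<^sub>R cis (2 * pi * of_int m * a) = indicator {0..1} a *\<^sub>R cis (2 * pi * of_int m * a)"
    using AE_lborel_singleton[of 1] by eventually_elim (auto simp: indicator_def)
  have m: "(\<lambda>a. cis (2 * pi * of_int m * a)) \<in> borel_measurable borel"
    by (intro borel_measurable_continuous_onI continuous_intros)
  show ?A using 1[unfolded set_integrable_def] m by (subst integrable_cong_AE[OF _ _ ae]) auto
  show ?B using 2[unfolded set_lebesgue_integral_def] m by (subst integral_cong_AE[OF _ _ ae]) auto
qed

lemma unit_parseval: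
  "(LINT y|lborel. indicator {0..<1} y * (norm (\<Sum>k<N. c k * unit_exp k y))\<^sup>2) = (\<Sum>k<N. (norm (c k))\<^sup>2)"
proof -
  define h where "h k l y = (c k * cnj (c l)) * (indicator {0..<1} y *\<^sub>R cis (2 * pi * of_int (int l - int k) * y))" for k l and y :: real
  have hint: "integrable lborel (h k l)" for k l
    unfolding h_def by (intro integrable_mult_right integral_cis_unit)
  have expand: "complex_of_real (indicator {0..<1} y * (norm (\<Sum>k<N. c k * unit_exp k y))\<^sup>2) = (\<Sum>k<N. \<Sum>l<N. h k l y)" for y
  proof -
    have e: "(c k * unit_exp k y) * cnj (c l * unit_exp l y) = (c k * cnj (c l)) * cis (2 * pi * of_int (int l - int k) * y)" for k l
    proof -
      have "unit_exp k y * cnj (unit_exp l y) = cis (2 * pi * of_int (int l - int k) * y)"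
        unfolding unit_exp_def cis_cnj cis_mult by (simp add: algebra_simps)
      then show ?thesis by (simp add: mult_ac)
    qed
    have *: "complex_of_real ((norm (\<Sum>k<N. c k * unit_exp k y))\<^sup>2) = (\<Sum>k<N. \<Sum>l<N. (c k * unit_exp k y) * cnj (c l * unit_exp l y))"
      by (simp only: complex_norm_square cnj_sum sum_product)
    show ?thesis
    proof (cases "y \<in> {0..<1}")
      case True
      then show ?thesis using * unfolding e h_def by simp
    next
      case False
      then show ?thesis by (simp add: h_def)
    qed
  qed
  have "complex_of_real (LINT y|lborel. indicator {0..<1} y * (norm (\<Sum>k<N. c k * unit_exp k y))\<^sup>2)
     = (LINT y|lborel. (\<Sum>k<N. \<Sum>l<N. h k l y))"
    unfolding integral_complex_of_real[symmetric] expand ..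
  also have "\<dots> = (\<Sum>k<N. LINT y|lborel. (\<Sum>l<N. h k l y))"
    by (rule Bochner_Integration.integral_sum) (intro Bochner_Integration.integrable_sum hint)
  also have "\<dots> = (\<Sum>k<N. \<Sum>l<N. LINT y|lborel. h k l y)"
    by (intro sum.cong refl Bochner_Integration.integral_sum hint)
  also have "\<dots> = (\<Sum>k<N. \<Sum>l<N. (c k * cnj (c l)) * (if int l - int k = 0 then 1 else 0))"
    unfolding h_def integral_mult_right_zero integral_cis_unit(2) ..
  also have "\<dots> = (\<Sum>k<N. of_real ((norm (c k))\<^sup>2))"
  proof (rule sum.cong[OF refl])
    fix k assume k: "k \<in> {..<N}"
    have "(\<Sum>l<N. (c k * cnj (c l)) * (if int l - int k = 0 then 1 else 0)) = (\<Sum>l<N. if k = l then c k * cnj (c l) else 0)"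
      by (intro sum.cong refl) simp
    also have "\<dots> = c k * cnj (c k)" using k by simp
    finally show "(\<Sum>l<N. (c k * cnj (c l)) * (if int l - int k = 0 then 1 else 0)) = of_real ((norm (c k))\<^sup>2)"
      unfolding complex_norm_square .
  qed
  also have "\<dots> = complex_of_real (\<Sum>k<N. (norm (c k))\<^sup>2)" by simp
  finally show ?thesis by (simp only: of_real_eq_iff)
qed

definition dirichlet :: "nat \<Rightarrow> real \<Rightarrow> complex" where
  "dirichlet N y = (\<Sum>k<N. unit_exp k y)"

lemma dirichlet_measurable [measurable]: "dirichlet N \<in> borel_measurable borel"
  unfolding dirichlet_def[abs_def] by measurable

lemma dirichlet_le: "norm (dirichlet N y) \<le> real N"
  unfolding dirichlet_def by (rule order_trans[OF norm_sum]) simp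

text \<open>The difference \<open>sin x - x / 2\<close> increases as long as the cosine is at least
  1/2, that is up to pi/3; from there on \<open>sin x\<close> is at least \<open>sqrt 3 / 2\<close>,
  which exceeds pi/4.\<close>

lemma sin_ge_half: 
  assumes "0 \<le> x" "x \<le> pi / 2"
  shows "x / 2 \<le> sin x"
proof (cases "x \<le> pi / 3")
  case True
  have "sin 0 - 0 / 2 \<le> sin x - x / 2"
  proof (rule DERIV_nonneg_imp_nondecreasing[OF assms(1)])
    fix t assume t: "0 \<le> t" "t \<le> x"
    have "((\<lambda>x. sin x - x / 2) has_real_derivative (cos t - 1 / 2)) (at t)"
      by (auto intro!: derivative_eq_intros)
    moreover have "cos (pi / 3) \<le> cos t" using t True by (intro cos_monotone_0_pi_le) auto
    then have "0 \<le> cos t - 1 / 2" by (simp add: cos_60)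
    ultimately show "\<exists>y. ((\<lambda>x. sin x - x / 2) has_real_derivative y) (at t) \<and> 0 \<le> y" by blast
  qed
  then show ?thesis by simp
next
  case False
  have "sin (pi / 3) \<le> sin x" using False assms by (intro sin_monotone_2pi_le) auto
  moreover have "pi / 4 \<le> sin (pi / 3)"
  proof -
    have "(17 / 10)\<^sup>2 \<le> (3::real)" by (simp add: power2_eq_square)
    then have "17 / 10 \<le> sqrt 3" by (rule real_le_rsqrt)
    moreover have "pi < 3.4" using pi_approx by simp
    ultimately show ?thesis by (simp add: sin_60)
  qed
  ultimately show ?thesis using assms by linarith
qed

text \<open>A geometric sum whose numerator is at most 2 and whose denominator has modulus
  \<open>2 * sin (pi * y)\<close>, hence at least \<open>pi * y\<close>.\<close>

lemma dirichlet_decay: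
  assumes y: "0 < y" "y \<le> 1 / 2"
  shows "norm (dirichlet N y) \<le> 1 / y"
proof -
  define z where "z = unit_exp 1 y"
  have "1 - z = 2 * \<i> * of_real (sin (pi * y)) * cis (- (pi * y))"
  proof -
    have zz: "z = cis (- (pi * y)) * cis (- (pi * y))" by (simp add: z_def unit_exp_def cis_mult mult.assoc)
    have o: "1 = cis (pi * y) * cis (- (pi * y))" by (simp add: cis_mult)
    have "1 - z = (cis (pi * y) - cis (- (pi * y))) * cis (- (pi * y))"
      by (simp add: zz left_diff_distrib cis_mult)
    also have "cis (pi * y) - cis (- (pi * y)) = 2 * \<i> * of_real (sin (pi * y))"
      by (simp add: complex_eq_iff)
    finally show ?thesis .
  qed
  then have n: "norm (1 - z) = 2 * \<bar>sin (pi * y)\<bar>" by (simp add: norm_mult)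
  have "pi * y \<le> pi * (1 / 2)" using y by (intro mult_left_mono) auto
  then have "pi * y / 2 \<le> sin (pi * y)" using y by (intro sin_ge_half) auto
  then have n2: "pi * y \<le> norm (1 - z)" unfolding n by simp
  have py: "0 < pi * y" using y by simp
  then have z1: "z \<noteq> 1" using n2 by auto
  have "dirichlet N y = (\<Sum>k<N. z ^ k)"
    unfolding dirichlet_def z_def by (intro sum.cong refl unit_exp_power)
  then have "(1 - z) * dirichlet N y = 1 - z ^ N" by (simp add: one_diff_power_eq)
  then have "norm (1 - z) * norm (dirichlet N y) = norm (1 - z ^ N)" by (metis norm_mult)
  also have "\<dots> \<le> 2" using norm_triangle_ineq4[of 1 "z ^ N"] by (simp add: norm_power z_def)
  finally have "norm (1 - z) * norm (dirichlet N y) \<le> 2" .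
  moreover have "pi * y * norm (dirichlet N y) \<le> norm (1 - z) * norm (dirichlet N y)"
    using n2 by (intro mult_right_mono) auto
  moreover have "2 * (y * norm (dirichlet N y)) \<le> pi * (y * norm (dirichlet N y))"
    using pi_gt3 y by (intro mult_right_mono) auto
  ultimately have "y * norm (dirichlet N y) \<le> 1" by (simp add: mult.assoc)
  then show ?thesis using y by (simp add: field_simps)
qed

lemma dirichlet_reflect: "norm (dirichlet N (1 - y)) = norm (dirichlet N y)"
proof -
  have "unit_exp k (1 - y) = cnj (unit_exp k y)" for k
  proof -
    have "unit_exp k (1 - y) = cis (2 * pi * of_int (- int k)) * cis (2 * pi * (real k * y))"
      unfolding unit_exp_def cis_mult by (simp add: algebra_simps)
    moreover have "cis (2 * pi * of_int (- int k)) = 1" by (rule cis_multiple_2pi) simp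
    ultimately show ?thesis by (simp add: unit_exp_def cis_cnj)
  qed
  then have "dirichlet N (1 - y) = cnj (dirichlet N y)" by (simp add: dirichlet_def)
  then show ?thesis by simp
qed

lemma dirichlet_L1:
  assumes N: "1 \<le> N"
  shows "(\<integral>\<^sup>+y. indicator {0..<1} y * ennreal (norm (dirichlet N y)) \<partial>lborel) \<le> ennreal (2 + 2 * ln (real N))"
proof -
  \<comment> \<open>The trivial bound up to \<open>1 / real N\<close> and the decay
    \<open>1 / y\<close> afterwards. Together with its mirror image \<open>b (1 - y)\<close> it
    dominates the kernel on the whole period, and each has integral
    \<open>1 + ln (real N)\<close>.\<close>
  define b where "b y = indicator {0..1 / real N} y * real N + indicator {1 / real N..1} y / y" for y
  have N0: "0 < 1 / real N" "1 / real N \<le> 1" using N by auto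
  note inv = integral_inverse_interval[OF N0]
  have i1: "integrable lborel (\<lambda>y. indicator {0..1 / real N} y * real N)"
    by (intro integrable_mult_left integrable_real_indicator) (auto simp: emeasure_lborel_Icc_eq)
  have bi: "integrable lborel b" unfolding b_def[abs_def] by (rule Bochner_Integration.integrable_add[OF i1 inv(1)])
  have "(LINT y|lborel. b y) = (LINT y|lborel. indicator {0..1 / real N} y * real N) + ln (1 / (1 / real N))"
    unfolding b_def by (subst Bochner_Integration.integral_add[OF i1 inv(1)]) (simp only: inv(2))
  also have "\<dots> = 1 + ln (real N)" using N by simp
  finally have bI: "(LINT y|lborel. b y) = 1 + ln (real N)" .
  have b0: "0 \<le> b y" for y
  proof (cases "y \<in> {1 / real N..1}")
    case True
    then have "0 < y" using N0(1) by (meson atLeastAtMost_iff less_le_trans)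
    then show ?thesis by (simp add: b_def)
  qed (simp add: b_def)
  have bi': "integrable lborel (\<lambda>y. b (1 - y))" "(LINT y|lborel. b (1 - y)) = 1 + ln (real N)"
    using lborel_integrable_real_affine[OF bi, of "-1" 1] lborel_integral_real_affine[of "-1" b 1] bI by simp_all
  have half: "norm (dirichlet N y) \<le> b y" if "0 \<le> y" "y \<le> 1 / 2" for y
  proof (cases "y \<le> 1 / real N")
    case True
    then have "real N \<le> b y" using that N0 by (auto simp: b_def indicator_def)
    then show ?thesis using dirichlet_le[of N y] by linarith
  next
    case False
    then have "0 < y" using N0 by linarith
    then have "1 / y \<le> b y" using that False by (simp add: b_def)
    then show ?thesis using dirichlet_decay[OF \<open>0 < y\<close> that(2), of N] by linarith
  qed
  have "(\<integral>\<^sup>+y. indicator {0..<1} y * ennreal (norm (dirichlet N y)) \<partial>lborel) \<le> (\<integral>\<^sup>+y. ennreal (b y + b (1 - y)) \<partial>lborel)"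
  proof (rule nn_integral_mono)
    fix y :: real
    have "norm (dirichlet N y) \<le> b y + b (1 - y)" if "0 \<le> y" "y < 1"
    proof (cases "y \<le> 1 / 2")
      case True
      then show ?thesis using half[of y] that b0[of "1 - y"] by simp
    next
      case False
      then show ?thesis using half[of "1 - y"] that b0[of y] by (simp add: dirichlet_reflect)
    qed
    then show "indicator {0..<1} y * ennreal (norm (dirichlet N y)) \<le> ennreal (b y + b (1 - y))"
      by (cases "y \<in> {0..<1}") (auto intro: ennreal_leI)
  qed
  also have "\<dots> = ennreal (LINT y|lborel. b y + b (1 - y))"
    using bi bi' b0 by (intro nn_integral_eq_integral) auto
  also have "(LINT y|lborel. b y + b (1 - y)) = 2 + 2 * ln (real N)"
    using bi bi' bI by simp
  finally show ?thesis .
qed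

text \<open>All phases stay within pi/3, where the cosine is at least 1/2, so the terms add up
  without cancellation.\<close>

lemma dirichlet_ge:
  assumes "0 \<le> y" "y \<le> 1 / (6 * real N)"
  shows "real N / 2 \<le> norm (dirichlet N y)"
proof (cases "N = 0")
  case False
  have "real N / 2 = (\<Sum>k<N. 1 / 2)" by simp
  also have "\<dots> \<le> (\<Sum>k<N. Re (unit_exp k y))"
  proof (rule sum_mono)
    fix k assume k: "k \<in> {..<N}"
    have "real k * y \<le> real N * (1 / (6 * real N))" using k assms by (intro mult_mono) auto
    then have "real k * y \<le> 1 / 6" using False by simp
    then have "2 * pi * (real k * y) \<le> 2 * pi * (1 / 6)" by (intro mult_left_mono) auto
    then have "cos (pi / 3) \<le> cos (2 * pi * (real k * y))" using assms by (intro cos_monotone_0_pi_le) auto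
    then show "1 / 2 \<le> Re (unit_exp k y)" by (simp add: unit_exp_def cos_60)
  qed
  also have "\<dots> = Re (dirichlet N y)" by (simp add: dirichlet_def)
  also have "\<dots> \<le> norm (dirichlet N y)" by (rule complex_Re_le_cmod)
  finally show ?thesis .
qed simp

definition rs_poly :: "nat \<Rightarrow> real \<Rightarrow> complex" where
  "rs_poly K y = (\<Sum>k<2 ^ K. of_real (snd (rudin_shapiro K k)) * unit_exp k y)"

lemma rs_poly_measurable [measurable]: "rs_poly K \<in> borel_measurable borel"
  unfolding rs_poly_def[abs_def] by measurable

lemma rs_poly_bound: "(norm (rs_poly K y))\<^sup>2 \<le> 2 * 2 ^ K"
proof -
  have eq: "rs_poly K y = (\<Sum>n<2 ^ K. of_real (snd (rudin_shapiro K n)) * unit_exp 1 y ^ n)"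
    unfolding rs_poly_def by (intro sum.cong refl) (metis unit_exp_power)
  have "0 \<le> (norm (\<Sum>n<2 ^ K. of_real (fst (rudin_shapiro K n)) * unit_exp 1 y ^ n))\<^sup>2" by simp
  then show ?thesis
    using rudin_shapiro_norm[of "unit_exp 1 y" K, OF norm_unit_exp] unfolding eq power_Suc by linarith
qed

text \<open>The square has mean \<open>2 ^ K\<close> and maximum at most \<open>2 * 2 ^ K\<close>,
  so it cannot concentrate on a small set. Splitting at half the mean gives
  \<open>1 \<le> 1 / 2 + 2 * measure lborel E\<close>.\<close>

lemma rs_poly_large:
  "1 / 4 \<le> measure lborel {y \<in> {0..<1}. 2 ^ K / 2 \<le> (norm (rs_poly K y))\<^sup>2}"
proof -
  define E where "E = {y \<in> {0..<1}. 2 ^ K / 2 \<le> (norm (rs_poly K y))\<^sup>2}"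
  have [measurable]: "E \<in> sets borel" unfolding E_def by measurable
  have Ei: "integrable lborel (indicat_real E)"
  proof -
    have "emeasure lborel E \<le> emeasure lborel {0..<1::real}" by (rule emeasure_mono) (auto simp: E_def)
    then show ?thesis by (intro integrable_real_indicator) (auto intro: le_less_trans)
  qed
  have Ui: "integrable lborel (indicat_real {0..<1::real})" by (intro integrable_real_indicator) auto
  have le: "indicator {0..<1} y * (norm (rs_poly K y))\<^sup>2 \<le> indicator {0..<1} y * (2 ^ K / 2) + indicator E y * (2 * 2 ^ K)" for y
    using rs_poly_bound[of K y] by (auto simp: E_def indicator_def)
  have ri: "integrable lborel (\<lambda>y. indicator {0..<1} y * (2 ^ K / 2) + indicator E y * (2 * 2 ^ K :: real))"
    using Ei Ui by auto
  have li: "integrable lborel (\<lambda>y. indicator {0..<1} y * (norm (rs_poly K y))\<^sup>2)"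
    by (rule Bochner_Integration.integrable_bound[OF ri]) (auto intro!: AE_I2 order_trans[OF le])
  have "(2::real) ^ K = (LINT y|lborel. indicator {0..<1} y * (norm (rs_poly K y))\<^sup>2)"
    unfolding rs_poly_def unit_parseval by (simp add: rudin_shapiro_abs)
  also have "\<dots> \<le> (LINT y|lborel. indicator {0..<1} y * (2 ^ K / 2) + indicator E y * (2 * 2 ^ K))"
    by (rule integral_mono[OF li ri le])
  also have "\<dots> = 2 ^ K / 2 + measure lborel E * (2 * 2 ^ K)"
    using Ei Ui by simp
  also have "\<dots> = 2 ^ K * (1 / 2 + 2 * measure lborel E)" by (simp add: algebra_simps)
  finally have "2 ^ K * 1 \<le> 2 ^ K * (1 / 2 + 2 * measure lborel E)" by simp
  then have "1 \<le> 1 / 2 + 2 * measure lborel E" by (subst (asm) mult_le_cancel_left_pos) auto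
  then show ?thesis unfolding E_def[symmetric] by simp
qed

context log_slope_kernel
begin

text \<open>Normalised with p-th powers, so that one notion covers weak type (1,1) and, by
  Chebyshev's inequality, the consequence of an L^p bound.\<close>

definition weak_type :: "real \<Rightarrow> real \<Rightarrow> bool" where
  "weak_type p A \<longleftrightarrow> 0 \<le> A \<and> (\<forall>f\<in>test_functions. \<forall>s>0.
     emeasure lborel {x. norm (rough_T Omega f x) > s} \<le> ennreal (A / s powr p * (LINT x|lborel. norm (f x) powr p)))"

lemma weak_type_transference:
  assumes "weak_type p A" "0 < p" "0 < h" "h \<le> 1" "\<And>k. k < N \<Longrightarrow> \<alpha> + real k * h \<in> {0..1}" "0 < s"
    and bound: "(\<integral>\<^sup>+y. indicator {0..<1} y * ennreal (norm (\<Sum>k<N. c k * unit_exp k y) powr p) \<partial>lborel) \<le> ennreal Q" "0 \<le> Q"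
  shows "measure lborel {y \<in> {0..<1}. s < norm (\<Sum>k<N. c k * multiplier (\<alpha> + real k * h) * unit_exp k y)}
    \<le> 9 * A * (2 * exp 4 / s) powr p * Q"
proof -
  have A: "0 \<le> A" using assms(1) by (simp add: weak_type_def)
  have W: "emeasure lborel {x. norm (rough_T Omega f x) > s} \<le> ennreal (A / s powr p * (LINT x|lborel. norm (f x) powr p))"
    if "f \<in> test_functions" "0 < s" for f s
    using assms(1) that by (simp add: weak_type_def)
  let ?E = "{y \<in> {0..<1}. s < norm (\<Sum>k<N. c k * multiplier (\<alpha> + real k * h) * unit_exp k y)}"
  have e: "(2 * exp 4 / s) powr p = 1 / (exp (- 4) * s / 2) powr p"
  proof -
    have "2 * exp 4 / s = inverse (exp (- 4) * s / 2)" by (simp add: exp_minus field_simps)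
    then show ?thesis using assms(6) by (simp add: powr_divide inverse_eq_divide)
  qed
  have "emeasure lborel ?E \<le> ennreal (A / (exp (- 4) * s / 2) powr p) * (9 *
        (\<integral>\<^sup>+y. indicator {0..<1} y * ennreal (norm (\<Sum>k<N. c k * unit_exp k y) powr p) \<partial>lborel))"
    unfolding unit_exp_def by (rule transference[OF assms(3,4,5,2) A assms(6) W])
  also have "\<dots> \<le> ennreal (A / (exp (- 4) * s / 2) powr p) * (9 * ennreal Q)"
    by (intro mult_left_mono bound) auto
  also have "\<dots> = ennreal (9 * A * (2 * exp 4 / s) powr p * Q)"
    using A bound(2) unfolding e by (simp add: ennreal_mult[symmetric] ennreal_numeral[symmetric] mult_ac del: ennreal_numeral)
  finally show ?thesis
    using A bound(2) by (simp add: measure_def enn2real_leI)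
qed

text \<open>The multiplier is applied to \<open>dirichlet N\<close>, whose \<open>L\<^sup>p\<close> norm is small for \<open>p < 2\<close>; the output is
  large on a set of measure bounded from below because of the flatness of \<^term>\<open>rs_poly K\<close>.\<close>

lemma stage_small_p:
  assumes W: "weak_type p A" and p: "1 \<le> p" "p < 2"
    and h: "0 < h" "h \<le> 1" "\<And>k. k < 2 ^ K \<Longrightarrow> \<alpha> + real k * h \<in> {0..1}"
    and m: "\<And>k. k < 2 ^ K \<Longrightarrow> norm (multiplier (\<alpha> + real k * h) - \<kappa> - of_real (a * snd (rudin_shapiro K k))) \<le> a / 2 ^ K"
    and \<kappa>: "norm \<kappa> \<le> B" and a: "0 < a"
    and big: "10 \<le> sqrt (2 ^ K)" "32 * B * (2 + 2 * ln (2 ^ K)) \<le> a * sqrt (2 ^ K)"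
  shows "1 / 8 \<le> 9 * A * (8 * exp 4 / (a * sqrt (2 ^ K))) powr p * ((2 ^ K) powr (p - 1) * (2 + 2 * ln (2 ^ K)))"
proof -
  define N :: nat where "N = 2 ^ K"
  define r where "r = sqrt (2 ^ K)"
  have Nr: "real N = 2 ^ K" by (simp add: N_def)
  have r: "10 \<le> r" "r * r = real N" "0 < r" using big(1) by (auto simp: r_def Nr)
  have N1: "1 \<le> N" by (simp add: N_def)
  have B0: "0 \<le> B" using order_trans[OF norm_ge_zero \<kappa>] .
  define l where "l = 2 + 2 * ln (real N)"
  have l0: "0 < l" using N1 by (simp add: l_def add_pos_nonneg)
  define M where "M y = (\<Sum>k<N. 1 * multiplier (\<alpha> + real k * h) * unit_exp k y)" for y
  have [measurable]: "M \<in> borel_measurable borel" unfolding M_def[abs_def] by measurable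
  \<comment> \<open>On \<open>E\<close> the flat polynomial is at least \<open>7 / 10 * r\<close>.
    From \<open>7 / 10 * a * r\<close> the Dirichlet part takes less than \<open>a * r / 4\<close>
    off the set \<open>X\<close>, and the errors at most \<open>a\<close>, hence at most
    \<open>a * r / 10\<close>; more than \<open>a * r / 4\<close> is left.\<close>
  define s where "s = a * r / 4"
  have s: "0 < s" using a r by (simp add: s_def)
  \<comment> \<open>Bounding all but one power of the kernel by \<open>N\<close> reduces the p-th
    moment to the L1 norm. The logarithm lost in this way is absorbed later by a power of
    \<open>N\<close>.\<close>
  have Q: "(\<integral>\<^sup>+y. indicator {0..<1} y * ennreal (norm (\<Sum>k<N. 1 * unit_exp k y) powr p) \<partial>lborel) \<le> ennreal (real N powr (p - 1) * l)"
  proof -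
    have "(\<integral>\<^sup>+y. indicator {0..<1} y * ennreal (norm (dirichlet N y) powr p) \<partial>lborel)
       \<le> (\<integral>\<^sup>+y. ennreal (real N powr (p - 1)) * (indicator {0..<1} y * ennreal (norm (dirichlet N y))) \<partial>lborel)"
    proof (rule nn_integral_mono)
      fix y :: real
      have "norm (dirichlet N y) powr p \<le> real N powr (p - 1) * norm (dirichlet N y)"
      proof (cases "dirichlet N y = 0")
        case False
        have "norm (dirichlet N y) powr p = norm (dirichlet N y) powr (p - 1) * norm (dirichlet N y)"
          using False powr_add[of "norm (dirichlet N y)" "p - 1" 1] by simp
        also have "\<dots> \<le> real N powr (p - 1) * norm (dirichlet N y)"
          using p dirichlet_le by (intro mult_right_mono powr_mono2) auto
        finally show ?thesis .
      qed (use p in simp)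
      then have "ennreal (norm (dirichlet N y) powr p) \<le> ennreal (real N powr (p - 1)) * ennreal (norm (dirichlet N y))"
        by (simp add: ennreal_mult[symmetric] ennreal_leI)
      then show "indicator {0..<1} y * ennreal (norm (dirichlet N y) powr p) \<le> ennreal (real N powr (p - 1)) * (indicator {0..<1} y * ennreal (norm (dirichlet N y)))"
        by (cases "y \<in> {0..<1}") auto
    qed
    also have "\<dots> = ennreal (real N powr (p - 1)) * (\<integral>\<^sup>+y. indicator {0..<1} y * ennreal (norm (dirichlet N y)) \<partial>lborel)"
      by (rule nn_integral_cmult) measurable
    also have "\<dots> \<le> ennreal (real N powr (p - 1)) * ennreal l"
      unfolding l_def by (intro mult_left_mono dirichlet_L1 N1) simp
    also have "\<dots> = ennreal (real N powr (p - 1) * l)" using l0 by (simp add: ennreal_mult)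
    finally show ?thesis by (simp add: dirichlet_def)
  qed
  have up: "measure lborel {y \<in> {0..<1}. s < norm (M y)} \<le> 9 * A * (2 * exp 4 / s) powr p * (real N powr (p - 1) * l)"
    unfolding M_def by (rule weak_type_transference[OF W _ h(1,2) h(3)[folded N_def] s Q]) (use p l0 in auto)
  define E where "E = {y \<in> {0..<1}. 2 ^ K / 2 \<le> (norm (rs_poly K y))\<^sup>2}"
  define X where "X = {y \<in> {0..<1}. a * r / 4 \<le> B * norm (dirichlet N y)}"
  have [measurable]: "E \<in> sets borel" "X \<in> sets borel" unfolding E_def X_def by measurable
  have fin: "emeasure lborel Z < \<infinity>" if "Z \<subseteq> {0..<1::real}" "Z \<in> sets borel" for Z
    using emeasure_mono[of Z "{0..<1}" lborel] that by (auto intro: le_less_trans)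
  \<comment> \<open>\<open>X\<close> is where the \<kappa> part is not negligible. It is small by
    Markov's inequality, the L1 norm of the Dirichlet kernel being logarithmic; this is the purpose
    of the second condition in \<open>big\<close>.\<close>
  have Xm: "measure lborel X \<le> 1 / 8"
  proof -
    have "ennreal (a * r / 4) * emeasure lborel X = (\<integral>\<^sup>+y. ennreal (a * r / 4) * indicator X y \<partial>lborel)"
      by (subst nn_integral_cmult_indicator) auto
    also have "\<dots> \<le> (\<integral>\<^sup>+y. ennreal B * (indicator {0..<1} y * ennreal (norm (dirichlet N y))) \<partial>lborel)"
      using B0 by (intro nn_integral_mono) (auto simp: X_def indicator_def ennreal_mult[symmetric] intro: ennreal_leI)
    also have "\<dots> = ennreal B * (\<integral>\<^sup>+y. indicator {0..<1} y * ennreal (norm (dirichlet N y)) \<partial>lborel)"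
      by (rule nn_integral_cmult) measurable
    also have "\<dots> \<le> ennreal B * ennreal l" unfolding l_def by (intro mult_left_mono dirichlet_L1 N1) simp
    finally have "ennreal (a * r / 4) * emeasure lborel X \<le> ennreal (B * l)" using B0 l0 by (simp add: ennreal_mult)
    moreover have "emeasure lborel X = ennreal (measure lborel X)"
    proof -
      have "X \<subseteq> {0..<1}" by (auto simp: X_def)
      then have "emeasure lborel X < \<infinity>" by (rule fin) simp
      then show ?thesis by (intro emeasure_eq_ennreal_measure) auto
    qed
    ultimately have "a * r / 4 * measure lborel X \<le> B * l"
      using a r B0 l0 by (simp add: ennreal_mult[symmetric] ennreal_le_iff)
    also have "\<dots> \<le> a * r / 4 * (1 / 8)" using big(2) by (simp add: l_def Nr r_def[symmetric])
    finally show ?thesis using a r by (subst (asm) mult_le_cancel_left_pos) auto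
  qed
  have sub: "E \<subseteq> {y \<in> {0..<1}. s < norm (M y)} \<union> X"
  proof
    fix y assume y: "y \<in> E"
    show "y \<in> {y \<in> {0..<1}. s < norm (M y)} \<union> X"
    proof (cases "y \<in> X")
      case False
      have y01: "y \<in> {0..<1}" using y by (simp add: E_def)
      have D: "B * norm (dirichlet N y) < a * r / 4" using False y01 by (auto simp: X_def)
      have R: "7 / 10 * r \<le> norm (rs_poly K y)"
      proof (rule power2_le_imp_le)
        have "(7 / 10 * r)\<^sup>2 = 49 / 100 * real N" using r(2) by (simp add: power2_eq_square)
        also have "\<dots> \<le> 2 ^ K / 2" by (simp add: Nr)
        also have "\<dots> \<le> (norm (rs_poly K y))\<^sup>2" using y by (simp add: E_def)
        finally show "(7 / 10 * r)\<^sup>2 \<le> (norm (rs_poly K y))\<^sup>2" .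
      qed simp
      define err where "err k = multiplier (\<alpha> + real k * h) - \<kappa> - of_real (a * snd (rudin_shapiro K k))" for k
      have "M y = (\<Sum>k<N. \<kappa> * unit_exp k y + of_real a * (of_real (snd (rudin_shapiro K k)) * unit_exp k y) + err k * unit_exp k y)"
        unfolding M_def by (intro sum.cong refl) (simp add: err_def algebra_simps)
      also have "\<dots> = \<kappa> * dirichlet N y + of_real a * rs_poly K y + (\<Sum>k<N. err k * unit_exp k y)"
        by (simp add: sum.distrib sum_distrib_left dirichlet_def rs_poly_def N_def)
      finally have "of_real a * rs_poly K y = M y - \<kappa> * dirichlet N y - (\<Sum>k<N. err k * unit_exp k y)" by simp
      then have "norm (of_real a * rs_poly K y) \<le> norm (M y) + norm (\<kappa> * dirichlet N y) + norm (\<Sum>k<N. err k * unit_exp k y)"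
        using norm_triangle_ineq4[of "M y - \<kappa> * dirichlet N y" "\<Sum>k<N. err k * unit_exp k y"]
          norm_triangle_ineq4[of "M y" "\<kappa> * dirichlet N y"] by simp
      moreover have "norm (of_real a * rs_poly K y) = a * norm (rs_poly K y)" using a by (simp add: norm_mult)
      moreover have "norm (\<kappa> * dirichlet N y) \<le> B * norm (dirichlet N y)"
        unfolding norm_mult by (intro mult_right_mono \<kappa>) simp
      moreover have "norm (\<Sum>k<N. err k * unit_exp k y) \<le> a"
      proof -
        have "norm (\<Sum>k<N. err k * unit_exp k y) \<le> (\<Sum>k<N. a / 2 ^ K)"
          using m unfolding err_def[symmetric] N_def[symmetric]
          by (intro order_trans[OF norm_sum] sum_mono) (auto simp: norm_mult)
        then show ?thesis by (simp add: N_def)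
      qed
      moreover have "a * (7 / 10 * r) \<le> a * norm (rs_poly K y)" using R a by (intro mult_left_mono) auto
      moreover have "a * 10 \<le> a * r" using r a by (intro mult_left_mono) auto
      moreover have "0 < a * r" using a r by simp
      ultimately have "s < norm (M y)" using D unfolding s_def by linarith
      then show ?thesis using y01 by simp
    qed simp
  qed
  have "1 / 4 \<le> measure lborel E" unfolding E_def by (rule rs_poly_large)
  also have "\<dots> \<le> measure lborel ({y \<in> {0..<1}. s < norm (M y)} \<union> X)"
  proof (rule measure_mono_fmeasurable[OF sub])
    have "{y \<in> {0..<1}. s < norm (M y)} \<union> X \<subseteq> {0..<1}" by (auto simp: X_def)
    then have "emeasure lborel ({y \<in> {0..<1}. s < norm (M y)} \<union> X) < \<infinity>" by (rule fin) simp
    then show "{y \<in> {0..<1}. s < norm (M y)} \<union> X \<in> fmeasurable lborel" by (intro fmeasurableI) auto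
  qed simp
  also have "\<dots> \<le> measure lborel {y \<in> {0..<1}. s < norm (M y)} + measure lborel X"
    by (intro measure_Un_le) measurable
  finally have "1 / 8 \<le> measure lborel {y \<in> {0..<1}. s < norm (M y)}" using Xm by linarith
  also note up
  also have "2 * exp 4 / s = 8 * exp 4 / (a * sqrt (2 ^ K))" by (simp add: s_def r_def)
  finally show ?thesis by (simp add: Nr l_def)
qed

text \<open>Here the multiplier is applied to \<^term>\<open>rs_poly K\<close>. The squared signs are one, so the output
  contains \<open>dirichlet N\<close>, which is of size \<open>N\<close> near the origin.\<close>

lemma stage_large_p:
  assumes W: "weak_type p A" and p: "2 < p"
    and h: "0 < h" "h \<le> 1" "\<And>k. k < 2 ^ K \<Longrightarrow> \<alpha> + real k * h \<in> {0..1}"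
    and m: "\<And>k. k < 2 ^ K \<Longrightarrow> norm (multiplier (\<alpha> + real k * h) - \<kappa> - of_real (a * snd (rudin_shapiro K k))) \<le> a / 2 ^ K"
    and \<kappa>: "norm \<kappa> \<le> B" and a: "0 < a"
    and big: "B * sqrt (2 * 2 ^ K) + a < a * 2 ^ K / 4"
  shows "1 / (6 * 2 ^ K) \<le> 9 * A * (8 * exp 4 / (a * 2 ^ K)) powr p * (sqrt (2 * 2 ^ K) powr p)"
proof -
  define N :: nat where "N = 2 ^ K"
  have Nr: "real N = 2 ^ K" by (simp add: N_def)
  have N1: "1 \<le> N" by (simp add: N_def)
  have B0: "0 \<le> B" using order_trans[OF norm_ge_zero \<kappa>] .
  define \<sigma> where "\<sigma> k = complex_of_real (snd (rudin_shapiro K k))" for k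
  have \<sigma>2: "\<sigma> k * \<sigma> k = 1" for k
  proof -
    have "\<bar>snd (rudin_shapiro K k)\<bar> * \<bar>snd (rudin_shapiro K k)\<bar> = 1" by (simp only: rudin_shapiro_abs)
    then have "snd (rudin_shapiro K k) * snd (rudin_shapiro K k) = 1" by (simp only: abs_mult_self_eq)
    then show ?thesis by (simp add: \<sigma>_def of_real_mult[symmetric] del: of_real_mult)
  qed
  have \<sigma>1: "norm (\<sigma> k) = 1" for k by (simp add: \<sigma>_def rudin_shapiro_abs)
  define M where "M y = (\<Sum>k<N. \<sigma> k * multiplier (\<alpha> + real k * h) * unit_exp k y)" for y
  have [measurable]: "M \<in> borel_measurable borel" unfolding M_def[abs_def] by measurable
  \<comment> \<open>Near the origin the Dirichlet part has modulus at least
    \<open>a * real N / 2\<close>, while \<open>big\<close> keeps the flat part and the errors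
    together below \<open>a * real N / 4\<close>.\<close>
  define s where "s = a * real N / 4"
  have s: "0 < s" using a N1 by (simp add: s_def)
  have R: "norm (rs_poly K y) \<le> sqrt (2 * 2 ^ K)" for y
    using rs_poly_bound[of K y] by (intro real_le_rsqrt)
  have RN: "(\<Sum>k<N. \<sigma> k * unit_exp k y) = rs_poly K y" for y by (simp add: \<sigma>_def rs_poly_def N_def)
  have Q: "(\<integral>\<^sup>+y. indicator {0..<1} y * ennreal (norm (\<Sum>k<N. \<sigma> k * unit_exp k y) powr p) \<partial>lborel) \<le> ennreal (sqrt (2 * 2 ^ K) powr p)"
  proof -
    have "(\<integral>\<^sup>+y. indicator {0..<1} y * ennreal (norm (rs_poly K y) powr p) \<partial>lborel)
       \<le> (\<integral>\<^sup>+y. ennreal (sqrt (2 * 2 ^ K) powr p) * indicator {0..<1::real} y \<partial>lborel)"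
      using p R by (intro nn_integral_mono) (auto simp: indicator_def intro!: ennreal_leI powr_mono2)
    also have "\<dots> = ennreal (sqrt (2 * 2 ^ K) powr p)" by (subst nn_integral_cmult_indicator) auto
    finally show ?thesis unfolding RN .
  qed
  have up: "measure lborel {y \<in> {0..<1}. s < norm (M y)} \<le> 9 * A * (2 * exp 4 / s) powr p * (sqrt (2 * 2 ^ K) powr p)"
    unfolding M_def by (rule weak_type_transference[OF W _ h(1,2) h(3)[folded N_def] s Q]) (use p in auto)
  have sub: "{0..<1 / (6 * real N)} \<subseteq> {y \<in> {0..<1}. s < norm (M y)}"
  proof
    fix y assume y: "y \<in> {0..<1 / (6 * real N)}"
    have "1 / (6 * real N) \<le> 1" using N1 by simp
    then have y01: "y \<in> {0..<1}" using y by auto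
    have D: "real N / 2 \<le> norm (dirichlet N y)" using y by (intro dirichlet_ge) auto
    define err where "err k = multiplier (\<alpha> + real k * h) - \<kappa> - of_real (a * snd (rudin_shapiro K k))" for k
    have "M y = (\<Sum>k<N. \<kappa> * (\<sigma> k * unit_exp k y) + of_real a * unit_exp k y + err k * (\<sigma> k * unit_exp k y))"
      unfolding M_def
    proof (intro sum.cong refl)
      fix k
      have "\<sigma> k * multiplier (\<alpha> + real k * h) = \<kappa> * \<sigma> k + of_real a * (\<sigma> k * \<sigma> k) + err k * \<sigma> k"
        by (simp add: err_def \<sigma>_def algebra_simps)
      then show "\<sigma> k * multiplier (\<alpha> + real k * h) * unit_exp k y = \<kappa> * (\<sigma> k * unit_exp k y) + of_real a * unit_exp k y + err k * (\<sigma> k * unit_exp k y)"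
        unfolding \<sigma>2 by (simp add: distrib_right mult.assoc)
    qed
    also have "\<dots> = \<kappa> * rs_poly K y + of_real a * dirichlet N y + (\<Sum>k<N. err k * (\<sigma> k * unit_exp k y))"
      by (simp add: sum.distrib sum_distrib_left[symmetric] dirichlet_def RN)
    finally have "of_real a * dirichlet N y = M y - \<kappa> * rs_poly K y - (\<Sum>k<N. err k * (\<sigma> k * unit_exp k y))" by simp
    then have "norm (of_real a * dirichlet N y) \<le> norm (M y) + norm (\<kappa> * rs_poly K y) + norm (\<Sum>k<N. err k * (\<sigma> k * unit_exp k y))"
      using norm_triangle_ineq4[of "M y - \<kappa> * rs_poly K y" "\<Sum>k<N. err k * (\<sigma> k * unit_exp k y)"]
        norm_triangle_ineq4[of "M y" "\<kappa> * rs_poly K y"] by simp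
    moreover have "norm (of_real a * dirichlet N y) = a * norm (dirichlet N y)" using a by (simp add: norm_mult)
    moreover have "norm (\<kappa> * rs_poly K y) \<le> B * sqrt (2 * 2 ^ K)"
      unfolding norm_mult by (intro mult_mono \<kappa> R B0) simp
    moreover have "norm (\<Sum>k<N. err k * (\<sigma> k * unit_exp k y)) \<le> a"
    proof -
      have "norm (\<Sum>k<N. err k * (\<sigma> k * unit_exp k y)) \<le> (\<Sum>k<N. a / 2 ^ K)"
        using m unfolding err_def[symmetric] N_def[symmetric]
        by (intro order_trans[OF norm_sum] sum_mono) (auto simp: norm_mult \<sigma>1)
      then show ?thesis by (simp add: N_def)
    qed
    moreover have "a * (real N / 2) \<le> a * norm (dirichlet N y)" using D a by (intro mult_left_mono) auto
    ultimately have "s < norm (M y)" using big unfolding s_def Nr by linarith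
    then show "y \<in> {y \<in> {0..<1}. s < norm (M y)}" using y01 by simp
  qed
  have "1 / (6 * real N) = measure lborel {0..<1 / (6 * real N)}" by simp
  also have "\<dots> \<le> measure lborel {y \<in> {0..<1}. s < norm (M y)}"
  proof (rule measure_mono_fmeasurable[OF sub])
    have "emeasure lborel {y \<in> {0..<1}. s < norm (M y)} \<le> emeasure lborel {0..<1::real}" by (rule emeasure_mono) auto
    then show "{y \<in> {0..<1}. s < norm (M y)} \<in> fmeasurable lborel"
      by (auto simp: fmeasurable_def intro: le_less_trans)
  qed simp
  also note up
  also have "2 * exp 4 / s = 8 * exp 4 / (a * 2 ^ K)" by (simp add: s_def Nr)
  finally show ?thesis by (simp add: Nr)
qed

end

text \<open>Applied with \<open>c = ln 2\<close>, where \<open>exp (real j * c)\<close> is 2^j and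
  \<open>exp ((2 * real j ^ 2 + 1) * c)\<close> is the number of spikes. Every claim says that a
  quadratic exponent beats a linear one; the first three serve \<open>p < 2\<close>, the last two
  \<open>p > 2\<close>.\<close>

lemma stage_asymptotics:
  fixes c B C \<delta> p :: real
  assumes c: "0 < c" and \<delta>: "0 < \<delta>"
  shows "eventually (\<lambda>j::nat. 10 \<le> exp ((2 * real j ^ 2 + 1) * c / 2)) at_top"
    and "eventually (\<lambda>j::nat. B * (2 + 2 * ((2 * real j ^ 2 + 1) * c)) \<le> exp (- (real j * c) + (2 * real j ^ 2 + 1) * c / 2)) at_top"
    and "eventually (\<lambda>j::nat. C * (exp (p * (real j * c) - \<delta> * ((2 * real j ^ 2 + 1) * c)) * (2 + 2 * ((2 * real j ^ 2 + 1) * c))) < 1) at_top"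
    and "eventually (\<lambda>j::nat. B * exp ((2 * real j ^ 2 + 1) * c / 2) + exp (- (real j * c)) < exp (- (real j * c) + (2 * real j ^ 2 + 1) * c) / 4) at_top"
    and "eventually (\<lambda>j::nat. C * exp (p * (real j * c) - \<delta> * ((2 * real j ^ 2 + 1) * c)) < 1) at_top"
  using c \<delta> by real_asymp+

context log_slope_kernel
begin

text \<open>The number \<open>\<kappa>\<close> may vary with the stage as long as it is bounded by
  \<open>B\<close>. The permitted error is the amplitude divided by the number of frequencies, so
  that the sum over all of them is still at most the amplitude.\<close>

definition stage_multiplier :: "nat \<Rightarrow> real \<Rightarrow> bool" where
  "stage_multiplier j B \<longleftrightarrow> (\<exists>\<alpha> h \<kappa>. 0 < h \<and> h \<le> 1 \<and> norm \<kappa> \<le> B \<and>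
     (\<forall>k<2 ^ (2 * j\<^sup>2 + 1). \<alpha> + real k * h \<in> {0..1} \<and>
        norm (multiplier (\<alpha> + real k * h) - \<kappa> - of_real ((1 / 2) ^ j * snd (rudin_shapiro (2 * j\<^sup>2 + 1) k)))
          \<le> (1 / 2) ^ j / 2 ^ (2 * j\<^sup>2 + 1)))"

lemma not_weak_type:
  assumes stages: "\<And>j. 1 \<le> j \<Longrightarrow> stage_multiplier j B" and p: "1 \<le> p" "p \<noteq> 2"
  shows "\<not> weak_type p A"
proof
  assume W: "weak_type p A"
  then have A: "0 \<le> A" by (simp add: weak_type_def)
  define c where "c = ln (2::real)"
  have c: "0 < c" by (simp add: c_def)
  define u where "u j = (2 * real j ^ 2 + 1) * c" for j :: nat
  \<comment> \<open>With N = 2^K both regimes lead to the same power: 2^(j p) N^(-p/2) N^(p-1) for p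
    < 2 and N 2^(j p) N^(-p) N^(p/2) for p > 2 are both 2^(j p) N^(-\<delta>).\<close>
  define \<delta> where "\<delta> = \<bar>p / 2 - 1\<bar>"
  have \<delta>: "0 < \<delta>" using p by (simp add: \<delta>_def)
  have pow: "(2::real) ^ (2 * j\<^sup>2 + 1) = exp (u j)" for j
  proof -
    have "(2::real) ^ (2 * j\<^sup>2 + 1) = exp (real (2 * j\<^sup>2 + 1) * ln 2)" by (subst exp_of_nat_mult) simp
    then show ?thesis by (simp add: u_def c_def)
  qed
  have sqe: "sqrt (exp (u j)) = exp (u j / 2)" for j
    by (rule real_sqrt_unique) (simp_all add: power2_eq_square exp_add[symmetric])
  have hp: "(1 / 2 :: real) ^ j = exp (- (real j * c))" for j
    using exp_of_nat_mult[of j "- ln 2 :: real"] by (simp add: c_def exp_minus inverse_eq_divide)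
  have eP: "exp t powr p = exp (p * t)" for t by (simp add: powr_def)
  note as = stage_asymptotics[OF c \<delta>, folded u_def]
  define C where "C = 8 * (9 * A * (8 * exp 4) powr p)"
  define C' where "C' = 6 * (9 * A * (8 * exp 4) powr p) * sqrt 2 powr p"
  show False
  proof (cases "p < 2")
    case True
    have "eventually (\<lambda>j::nat. 1 \<le> j \<and> 10 \<le> exp (u j / 2) \<and> (32 * B) * (2 + 2 * u j) \<le> exp (- (real j * c) + u j / 2)
       \<and> C * (exp (p * (real j * c) - \<delta> * u j) * (2 + 2 * u j)) < 1) at_top"
      by (intro eventually_conj as eventually_ge_at_top)
    then obtain j where j: "1 \<le> j" "10 \<le> exp (u j / 2)" "(32 * B) * (2 + 2 * u j) \<le> exp (- (real j * c) + u j / 2)"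
       "C * (exp (p * (real j * c) - \<delta> * u j) * (2 + 2 * u j)) < 1"
      by (auto simp: eventually_sequentially)
    define K where "K = 2 * j\<^sup>2 + 1"
    note e = pow[of j, folded K_def] sqe[of j] ln_exp
    obtain \<alpha> h \<kappa> where h: "0 < h" "h \<le> 1" "norm \<kappa> \<le> B"
      and hk: "\<And>k. k < 2 ^ K \<Longrightarrow> \<alpha> + real k * h \<in> {0..1}"
      and m: "\<And>k. k < 2 ^ K \<Longrightarrow> norm (multiplier (\<alpha> + real k * h) - \<kappa> - of_real ((1 / 2) ^ j * snd (rudin_shapiro K k))) \<le> (1 / 2) ^ j / 2 ^ K"
      using stages[OF j(1)] unfolding stage_multiplier_def K_def by auto
    have "1 / 8 \<le> 9 * A * (8 * exp 4 / ((1 / 2) ^ j * sqrt (2 ^ K))) powr p * ((2 ^ K) powr (p - 1) * (2 + 2 * ln (2 ^ K)))"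
    proof (rule stage_small_p[OF W p(1) True h(1,2) hk m h(3)])
      show "10 \<le> sqrt (2 ^ K)" using j(2) by (simp only: e)
      show "32 * B * (2 + 2 * ln (2 ^ K)) \<le> (1 / 2) ^ j * sqrt (2 ^ K)"
        using j(3) by (simp only: e hp exp_add)
    qed auto
    also have "(8 * exp 4 / ((1 / 2) ^ j * sqrt (2 ^ K))) powr p = (8 * exp 4) powr p * exp (p * (real j * c) - p * (u j / 2))"
    proof -
      have "8 * exp 4 / ((1 / 2) ^ j * sqrt (2 ^ K)) = (8 * exp 4) * exp (real j * c - u j / 2)"
      proof -
        have "exp (- (real j * c)) * exp (u j / 2) = exp (- (real j * c - u j / 2))" by (simp add: exp_add[symmetric])
        then show ?thesis unfolding e hp by (simp only: exp_minus divide_inverse inverse_inverse_eq)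
      qed
      then show ?thesis by (simp add: powr_mult eP algebra_simps)
    qed
    also have "(2 ^ K) powr (p - 1) = exp ((p - 1) * u j)" unfolding e by (simp add: powr_def)
    finally have "1 \<le> C * ((exp (p * (real j * c) - p * (u j / 2)) * exp ((p - 1) * u j)) * (2 + 2 * u j))"
      unfolding C_def e by (simp add: mult_ac)
    also have "exp (p * (real j * c) - p * (u j / 2)) * exp ((p - 1) * u j) = exp (p * (real j * c) - \<delta> * u j)"
      unfolding exp_add[symmetric] using True by (simp add: \<delta>_def abs_if algebra_simps)
    finally show False using j(4) by simp
  next
    case False
    then have p2: "2 < p" using p by simp
    have "eventually (\<lambda>j::nat. 1 \<le> j \<and> (B * sqrt 2) * exp (u j / 2) + exp (- (real j * c)) < exp (- (real j * c) + u j) / 4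
       \<and> C' * exp (p * (real j * c) - \<delta> * u j) < 1) at_top"
      by (intro eventually_conj as eventually_ge_at_top)
    then obtain j where j: "1 \<le> j" "(B * sqrt 2) * exp (u j / 2) + exp (- (real j * c)) < exp (- (real j * c) + u j) / 4"
       "C' * exp (p * (real j * c) - \<delta> * u j) < 1"
      by (auto simp: eventually_sequentially)
    define K where "K = 2 * j\<^sup>2 + 1"
    note e = pow[of j, folded K_def] sqe[of j] ln_exp
    obtain \<alpha> h \<kappa> where h: "0 < h" "h \<le> 1" "norm \<kappa> \<le> B"
      and hk: "\<And>k. k < 2 ^ K \<Longrightarrow> \<alpha> + real k * h \<in> {0..1}"
      and m: "\<And>k. k < 2 ^ K \<Longrightarrow> norm (multiplier (\<alpha> + real k * h) - \<kappa> - of_real ((1 / 2) ^ j * snd (rudin_shapiro K k))) \<le> (1 / 2) ^ j / 2 ^ K"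
      using stages[OF j(1)] unfolding stage_multiplier_def K_def by auto
    have sq2: "sqrt (2 * 2 ^ K) = sqrt 2 * exp (u j / 2)" by (simp only: real_sqrt_mult e)
    have "1 / (6 * 2 ^ K) \<le> 9 * A * (8 * exp 4 / ((1 / 2) ^ j * 2 ^ K)) powr p * (sqrt (2 * 2 ^ K) powr p)"
    proof (rule stage_large_p[OF W p2 h(1,2) hk m h(3)])
      show "B * sqrt (2 * 2 ^ K) + (1 / 2) ^ j < (1 / 2) ^ j * 2 ^ K / 4"
        using j(2) by (simp only: real_sqrt_mult e hp exp_add mult.assoc)
    qed auto
    also have "(8 * exp 4 / ((1 / 2) ^ j * 2 ^ K)) powr p = (8 * exp 4) powr p * exp (p * (real j * c) - p * u j)"
    proof -
      have "8 * exp 4 / ((1 / 2) ^ j * 2 ^ K) = (8 * exp 4) * exp (real j * c - u j)"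
      proof -
        have "exp (- (real j * c)) * exp (u j) = exp (- (real j * c - u j))" by (simp add: exp_add[symmetric])
        then show ?thesis unfolding e hp by (simp only: exp_minus divide_inverse inverse_inverse_eq)
      qed
      then show ?thesis by (simp add: powr_mult eP algebra_simps)
    qed
    also have "sqrt (2 * 2 ^ K) powr p = sqrt 2 powr p * exp (p * (u j / 2))"
      unfolding sq2 by (simp add: powr_mult powr_def[of "exp _"])
    finally have "1 \<le> (6 * exp (u j)) * (9 * A * ((8 * exp 4) powr p * exp (p * (real j * c) - p * u j)) * (sqrt 2 powr p * exp (p * (u j / 2))))"
      unfolding e by (simp add: field_simps)
    also have "\<dots> = C' * (exp (u j) * exp (p * (real j * c) - p * u j) * exp (p * (u j / 2)))"
      unfolding C'_def by (simp only: mult_ac)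
    also have "exp (u j) * exp (p * (real j * c) - p * u j) * exp (p * (u j / 2)) = exp (p * (real j * c) - \<delta> * u j)"
      unfolding exp_add[symmetric] using p2 by (simp add: \<delta>_def abs_if algebra_simps)
    finally show False using j(3) by simp
  qed
qed

lemma bounded_on_Lp_imp_weak_type:
  assumes "bounded_on_Lp (rough_T Omega) p" and p: "0 < p"
  shows "\<exists>A. weak_type p A"
proof -
  obtain C where C: "\<And>f. f \<in> test_functions \<Longrightarrow> rough_T Omega f \<in> Lp_space p \<and> Lp_norm p (rough_T Omega f) \<le> C * Lp_norm p f"
    using assms unfolding bounded_on_Lp_def by blast
  define A where "A = \<bar>C\<bar> powr p"
  have "emeasure lborel {x. norm (rough_T Omega f x) > s} \<le> ennreal (A / s powr p * (LINT x|lborel. norm (f x) powr p))"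
    if f: "f \<in> test_functions" and s: "0 < s" for f s
  proof -
    have T: "rough_T Omega f \<in> borel_measurable lborel" "integrable lborel (\<lambda>x. norm (rough_T Omega f x) powr p)"
      using C[OF f] by (auto simp: Lp_space_def)
    define I where "I = (LINT x|lborel. norm (rough_T Omega f x) powr p)"
    define J where "J = (LINT x|lborel. norm (f x) powr p)"
    have IJ0: "0 \<le> I" "0 \<le> J" by (auto simp: I_def J_def)
    have "I powr (1 / p) \<le> \<bar>C\<bar> * J powr (1 / p)"
    proof -
      have "I powr (1 / p) \<le> C * J powr (1 / p)" using C[OF f] by (simp add: Lp_norm_def I_def J_def)
      also have "\<dots> \<le> \<bar>C\<bar> * J powr (1 / p)" by (intro mult_right_mono) auto
      finally show ?thesis .
    qed
    then have "(I powr (1 / p)) powr p \<le> (\<bar>C\<bar> * J powr (1 / p)) powr p" using p by (intro powr_mono2) auto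
    then have IJ: "I \<le> A * J" using p IJ0 by (simp add: powr_powr powr_mult A_def)
    have "emeasure lborel {x. norm (rough_T Omega f x) > s} = (\<integral>\<^sup>+x. indicator {x. norm (rough_T Omega f x) > s} x \<partial>lborel)"
      using T(1) by simp
    also have "\<dots> \<le> (\<integral>\<^sup>+x. ennreal (norm (rough_T Omega f x) powr p / s powr p) \<partial>lborel)"
    proof (rule nn_integral_mono)
      fix x
      show "indicator {x. norm (rough_T Omega f x) > s} x \<le> ennreal (norm (rough_T Omega f x) powr p / s powr p)"
      proof (cases "s < norm (rough_T Omega f x)")
        case True
        then have "s powr p \<le> norm (rough_T Omega f x) powr p" using s p by (intro powr_mono2) auto
        then have "1 \<le> norm (rough_T Omega f x) powr p / s powr p" using s by simp
        then have "ennreal 1 \<le> ennreal (norm (rough_T Omega f x) powr p / s powr p)" by (rule ennreal_leI)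
        then show ?thesis using True by simp
      qed simp
    qed
    also have "\<dots> = ennreal (I / s powr p)"
      using T(2) by (subst nn_integral_eq_integral) (auto simp: I_def)
    also have "\<dots> \<le> ennreal (A / s powr p * J)"
      using IJ s by (intro ennreal_leI) (simp add: divide_right_mono)
    finally show ?thesis by (simp add: J_def)
  qed
  then have "weak_type p A" by (simp add: weak_type_def A_def)
  then show ?thesis ..
qed

lemma weak_type_1_1_imp_weak_type:
  assumes "weak_type_1_1 (rough_T Omega)"
  shows "\<exists>A. weak_type 1 A"
proof -
  obtain C where C: "\<And>f s. f \<in> test_functions \<Longrightarrow> 0 < s \<Longrightarrow> emeasure lborel {x. norm (rough_T Omega f x) > s} \<le> ennreal (C / s * Lp_norm 1 f)"
    using assms unfolding weak_type_1_1_def by blast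
  have "emeasure lborel {x. norm (rough_T Omega f x) > s} \<le> ennreal (\<bar>C\<bar> / s powr 1 * (LINT x|lborel. norm (f x) powr 1))"
    if f: "f \<in> test_functions" and s: "0 < s" for f s
  proof -
    have "C / s * Lp_norm 1 f \<le> \<bar>C\<bar> / s powr 1 * (LINT x|lborel. norm (f x) powr 1)"
      using s by (auto simp: Lp_norm_def intro!: mult_right_mono divide_right_mono)
    then show ?thesis using C[OF f s] by (meson ennreal_leI order_trans)
  qed
  then have "weak_type 1 \<bar>C\<bar>" by (simp add: weak_type_def)
  then show ?thesis ..
qed

lemma stage_multiplier_conclusion:
  assumes "\<And>j. 1 \<le> j \<Longrightarrow> stage_multiplier j B"
  shows "\<forall>p>1. bounded_on_Lp (rough_T Omega) p \<longleftrightarrow> p = 2" and "\<not> weak_type_1_1 (rough_T Omega)"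
proof -
  show "\<forall>p>1. bounded_on_Lp (rough_T Omega) p \<longleftrightarrow> p = 2"
  proof (intro allI impI iffI)
    fix p :: real assume p: "1 < p" and b: "bounded_on_Lp (rough_T Omega) p"
    obtain A where "weak_type p A" using bounded_on_Lp_imp_weak_type[OF b] p by auto
    then show "p = 2" using not_weak_type[OF assms, where p=p and A=A] p by auto
  qed (simp add: bounded_on_L2)
  show "\<not> weak_type_1_1 (rough_T Omega)"
    using weak_type_1_1_imp_weak_type not_weak_type[OF assms, where p=1] by auto
qed

end

section \<open>The stages of the density\<close>

text \<open>The antiderivative is continuous at 0 but not differentiable there, so the fundamental
  theorem is used in the form for the interior. Lebesgue integrability follows because
  \<open>- ln\<close> has constant sign on the interval, with \<open>ln 0 = 0\<close>.\<close>

lemma ln_integral: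
  fixes \<delta> :: real
  assumes \<delta>: "0 < \<delta>" "\<delta> \<le> 1"
  shows "integrable lborel (\<lambda>u. indicator {0..\<delta>} u * ln u)"
    and "(LINT u|lborel. indicator {0..\<delta>} u * ln u) = \<delta> * ln \<delta> - \<delta>"
proof -
  have "((\<lambda>u. - ln u) has_integral ((\<delta> - \<delta> * ln \<delta>) - (0 - 0 * ln 0))) {0..\<delta>}"
  proof (rule fundamental_theorem_of_calculus_interior)
    have "continuous_on {0..\<delta>} (\<lambda>x. x * ln x)"
      unfolding continuous_on_eq_continuous_within
    proof
      fix x assume x: "x \<in> {0..\<delta>}"
      show "continuous (at x within {0..\<delta>}) (\<lambda>x. x * ln x)"
      proof (cases "x = 0")
        case True
        have "((\<lambda>x::real. x * ln x) \<longlongrightarrow> 0) (at_right 0)" by real_asymp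
        then have "((\<lambda>x::real. x * ln x) \<longlongrightarrow> 0) (at 0 within {0..\<delta>})"
          using \<delta> by (simp add: at_within_Icc_at_right)
        then show ?thesis using True by (simp add: continuous_within)
      next
        case False
        then show ?thesis using x by (intro continuous_intros) auto
      qed
    qed
    then show "continuous_on {0..\<delta>} (\<lambda>x. x - x * ln x)" by (rule continuous_on_diff[OF continuous_on_id])
    fix x assume "x \<in> {0<..<\<delta>}"
    then show "((\<lambda>x. x - x * ln x) has_vector_derivative - ln x) (at x)"
      by (auto intro!: derivative_eq_intros simp: has_real_derivative_iff_has_vector_derivative[symmetric])
  qed (use \<delta> in simp)
  then have hi: "((\<lambda>u. - ln u) has_integral (\<delta> - \<delta> * ln \<delta>)) {0..\<delta>}" by simp
  have nn: "0 \<le> - ln u" if "u \<in> {0..\<delta>}" for u using that \<delta> by (cases "u = 0") auto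
  have "(\<integral>\<^sup>+u. ennreal (indicator {0..\<delta>} u * (- ln u)) \<partial>lborel) = ennreal (\<delta> - \<delta> * ln \<delta>)"
    by (rule nn_integral_has_integral_lebesgue[OF nn hi])
  moreover have "ln \<delta> \<le> 1" using ln_le_minus_one[of \<delta>] \<delta> by linarith
  ultimately have "has_bochner_integral lborel (\<lambda>u. indicator {0..\<delta>} u * (- ln u)) (\<delta> - \<delta> * ln \<delta>)"
    using nn \<delta> by (intro has_bochner_integral_nn_integral) (auto simp: indicator_def mult_nonneg_nonpos)
  from has_bochner_integral_minus[OF this]
  have hb: "has_bochner_integral lborel (\<lambda>u. indicator {0..\<delta>} u * ln u) (\<delta> * ln \<delta> - \<delta>)" by simp
  show "integrable lborel (\<lambda>u. indicator {0..\<delta>} u * ln u)"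
    and "(LINT u|lborel. indicator {0..\<delta>} u * ln u) = \<delta> * ln \<delta> - \<delta>"
    using hb by (simp_all add: has_bochner_integral_iff)
qed

text \<open>The interval starts at \<open>t\<close>, so \<open>t - \<tau>\<close> is negative on it
  and only \<open>exp_integral_lim (- 1)\<close> occurs. The mean of \<open>- ln\<close> over
  \<open>{0..\<delta>}\<close> is \<open>1 + ln (1 / \<delta>)\<close>, the denominator of
  \<open>stage_coef\<close>.\<close>

lemma mult_kernel_integral:
  assumes \<delta>: "0 < \<delta>" "\<delta> \<le> 1"
  shows "integrable lborel (\<lambda>\<tau>. indicator {t..t + \<delta>} \<tau> *\<^sub>R mult_kernel (t - \<tau>))"
    and "(LINT \<tau>|lborel. indicator {t..t + \<delta>} \<tau> *\<^sub>R mult_kernel (t - \<tau>))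
       = of_real \<delta> * (of_real (1 + ln (1 / \<delta>)) + exp_integral_lim (- 1))"
proof -
  have ii: "integrable lborel (\<lambda>u. indicator {0..\<delta>} u *\<^sub>R exp_integral_lim (- 1))"
    using \<delta> by (intro integrable_scaleR_left integrable_real_indicator) (auto simp: emeasure_lborel_Icc_eq)
  have li: "integrable lborel (\<lambda>u. complex_of_real (indicator {0..\<delta>} u * ln u))"
    using ln_integral(1)[OF \<delta>] by (rule integrable_of_real)
  define F where "F u = indicator {0..\<delta>} u *\<^sub>R exp_integral_lim (- 1) - complex_of_real (indicator {0..\<delta>} u * ln u)" for u
  have Fi: "integrable lborel F" unfolding F_def[abs_def] using ii li by (rule Bochner_Integration.integrable_diff)
  have FI: "(LINT u|lborel. F u) = of_real \<delta> * (of_real (1 + ln (1 / \<delta>)) + exp_integral_lim (- 1))"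
  proof -
    have "(LINT u|lborel. F u) = (LINT u|lborel. indicator {0..\<delta>} u *\<^sub>R exp_integral_lim (- 1)) - (LINT u|lborel. complex_of_real (indicator {0..\<delta>} u * ln u))"
      unfolding F_def by (rule Bochner_Integration.integral_diff[OF ii li])
    also have "(LINT u|lborel. complex_of_real (indicator {0..\<delta>} u * ln u)) = of_real (\<delta> * ln \<delta> - \<delta>)"
      unfolding integral_complex_of_real ln_integral(2)[OF \<delta>] ..
    also have "(LINT u|lborel. indicator {0..\<delta>} u *\<^sub>R exp_integral_lim (- 1)) = of_real \<delta> * exp_integral_lim (- 1)"
      using \<delta> by (subst integral_scaleR_left) (auto simp: scaleR_conv_of_real emeasure_lborel_Icc_eq)
    finally show ?thesis using \<delta> by (simp add: ln_div algebra_simps)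
  qed
  have ae: "AE \<tau> in lborel. indicator {t..t + \<delta>} \<tau> *\<^sub>R mult_kernel (t - \<tau>) = F (- t + 1 * \<tau>)"
    using AE_lborel_singleton[of t]
  proof eventually_elim
    case (elim \<tau>)
    show ?case
    proof (cases "\<tau> \<in> {t..t + \<delta>}")
      case True
      then have "sgn (t - \<tau>) = - 1" "\<bar>t - \<tau>\<bar> = \<tau> - t" using elim by auto
      then show ?thesis using True by (simp add: F_def mult_kernel_def)
    qed (auto simp: F_def indicator_def)
  qed
  have m: "(\<lambda>\<tau>. F (- t + 1 * \<tau>)) \<in> borel_measurable lborel" 
    using borel_measurable_integrable[OF lborel_integrable_real_affine[OF Fi, of 1 "- t"]] by simp
  show "integrable lborel (\<lambda>\<tau>. indicator {t..t + \<delta>} \<tau> *\<^sub>R mult_kernel (t - \<tau>))"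
    using lborel_integrable_real_affine[OF Fi, of 1 "- t"] m by (subst integrable_cong_AE[OF _ _ ae]) auto
  have "(LINT \<tau>|lborel. indicator {t..t + \<delta>} \<tau> *\<^sub>R mult_kernel (t - \<tau>)) = (LINT \<tau>|lborel. F (- t + 1 * \<tau>))"
    using m by (intro integral_cong_AE ae) auto
  also have "\<dots> = (LINT u|lborel. F u)" using lborel_integral_real_affine[of 1 F "- t"] by simp
  finally show "(LINT \<tau>|lborel. indicator {t..t + \<delta>} \<tau> *\<^sub>R mult_kernel (t - \<tau>))
       = of_real \<delta> * (of_real (1 + ln (1 / \<delta>)) + exp_integral_lim (- 1))" unfolding FI .
qed

text \<open>The weight is separated into a constant and a peak supported within distance
  \<open>\<delta>\<close> of 0, whose integral is of order \<open>\<delta>\<close>.\<close>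

lemma log_weight_split:
  assumes "0 < \<delta>"
  shows "log_weight u \<le> ln (1 + 1 / \<delta>) + indicator {- \<delta>..\<delta>} u * (ln \<delta> - ln \<bar>u\<bar>)"
proof (cases "u = 0 \<or> \<delta> < \<bar>u\<bar>")
  case True
  then show ?thesis
  proof
    \<comment> \<open>Here \<open>log_weight 0\<close> and \<open>ln 0\<close> are both 0, so the
      claim reduces to \<open>0 \<le> ln (1 + 1 / \<delta>) + ln \<delta>\<close>.\<close>
    assume "u = 0"
    have "ln (1 + 1 / \<delta>) + ln \<delta> = ln ((1 + 1 / \<delta>) * \<delta>)"     proof -
      have "0 < 1 + 1 / \<delta>" using assms by (intro add_pos_pos) auto
      then show ?thesis using assms by (subst ln_mult) auto
    qed
    also have "(1 + 1 / \<delta>) * \<delta> = 1 + \<delta>" using assms by (simp add: field_simps)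
    finally have "0 \<le> ln (1 + 1 / \<delta>) + ln \<delta>" using assms by simp
    then show ?thesis using \<open>u = 0\<close> assms by (simp add: log_weight_def)
  next
    assume u: "\<delta> < \<bar>u\<bar>"
    then have "1 / \<bar>u\<bar> \<le> 1 / \<delta>" using assms by (intro frac_le) auto
    then have "log_weight u \<le> ln (1 + 1 / \<delta>)"
      unfolding log_weight_def using u assms by (subst ln_le_cancel_iff) (auto intro: add_pos_pos)
    moreover have "u \<notin> {- \<delta>..\<delta>}" using u by auto
    ultimately show ?thesis by simp
  qed
next
  case False
  then have u: "u \<noteq> 0" "\<bar>u\<bar> \<le> \<delta>" by auto
  have "1 + 1 / \<bar>u\<bar> = (\<bar>u\<bar> + 1) / \<bar>u\<bar>" using u by (simp add: add_divide_distrib)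
  also have "\<dots> \<le> (\<delta> + 1) / \<bar>u\<bar>" using u by (intro divide_right_mono) auto
  also have "\<dots> = (1 + 1 / \<delta>) * (\<delta> / \<bar>u\<bar>)" using assms by (simp add: add_divide_distrib distrib_right)
  finally have "1 + 1 / \<bar>u\<bar> \<le> (1 + 1 / \<delta>) * (\<delta> / \<bar>u\<bar>)" .
  moreover have p: "0 < 1 + 1 / \<delta>" using assms by (intro add_pos_pos) auto
  then have "0 < (1 + 1 / \<delta>) * (\<delta> / \<bar>u\<bar>)" using assms u by (intro mult_pos_pos) auto
  moreover have "0 < 1 + 1 / \<bar>u\<bar>" using u by (intro add_pos_pos) auto
  ultimately have "log_weight u \<le> ln ((1 + 1 / \<delta>) * (\<delta> / \<bar>u\<bar>))"
    unfolding log_weight_def by (intro ln_le_cancel_iff[THEN iffD2])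
  also have "\<dots> = ln (1 + 1 / \<delta>) + (ln \<delta> - ln \<bar>u\<bar>)"
    using u assms p by (subst ln_mult) (auto simp: ln_div)
  finally show ?thesis using u by (auto simp: indicator_def abs_le_iff)
qed

text \<open>The peak has total integral \<open>2 * \<delta>\<close> wherever it sits, and the
  constant contributes \<open>\<delta> * ln (1 + 1 / \<delta>)\<close>. The bound is therefore
  uniform in the position of the singularity \<open>t\<close> relative to the interval.\<close>

lemma log_weight_interval:
  assumes \<delta>: "0 < \<delta>" "\<delta> \<le> 1"
  shows "(\<integral>\<^sup>+\<tau>. indicator {x..x + \<delta>} \<tau> * ennreal (log_weight (\<tau> - t)) \<partial>lborel) \<le> ennreal (\<delta> * (3 * (1 + ln (1 / \<delta>))))"
proof -
  define f where "f u = indicator {0<..\<delta>} u * (ln \<delta> - ln u)" for u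
  define q where "q u = f u + f (- u)" for u
  have one: "integrable lborel (\<lambda>u. indicator {0..\<delta>} u * ln \<delta>)"
    by (intro integrable_mult_left integrable_real_indicator) (auto simp: emeasure_lborel_Icc_eq)
  have fi: "integrable lborel f" "(LINT u|lborel. f u) = \<delta>"
  proof -
    define f0 where "f0 u = indicator {0..\<delta>} u * ln \<delta> - indicator {0..\<delta>} u * ln u" for u
    have f0: "integrable lborel f0" "(LINT u|lborel. f0 u) = \<delta>"
      unfolding f0_def using one ln_integral[OF \<delta>] \<delta> by simp_all
    have ae: "AE u in lborel. f u = f0 u"
      using AE_lborel_singleton[of 0] by eventually_elim (auto simp: f_def f0_def indicator_def)
    have m: "f \<in> borel_measurable lborel" "f0 \<in> borel_measurable lborel"
      unfolding f_def[abs_def] f0_def[abs_def] by measurable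
    show "integrable lborel f" using f0(1) by (subst integrable_cong_AE[OF m ae])
    show "(LINT u|lborel. f u) = \<delta>" using f0(2) by (subst integral_cong_AE[OF m ae])
  qed
  have fi': "integrable lborel (\<lambda>u. f (- u))" "(LINT u|lborel. f (- u)) = \<delta>"
    using lborel_integrable_real_affine[OF fi(1), of "-1" 0] lborel_integral_real_affine[of "-1" f 0] fi(2) by simp_all
  have qi: "integrable lborel q" "(LINT u|lborel. q u) = 2 * \<delta>"
    unfolding q_def using fi fi' by simp_all
  have f0: "0 \<le> f u" for u
    by (cases "u \<in> {0<..\<delta>}") (auto simp: f_def)
  have q0: "0 \<le> q u" for u by (simp add: q_def f0)
  have lw: "log_weight u \<le> ln (1 + 1 / \<delta>) + q u" for u
  proof (cases "u = 0")
    case True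
    have "0 \<le> ln (1 + 1 / \<delta>)" using \<delta> by simp
    then show ?thesis using True q0[of 0] by (simp add: log_weight_def)
  next
    case u: False
    have "indicator {- \<delta>..\<delta>} u * (ln \<delta> - ln \<bar>u\<bar>) \<le> q u"
    proof (cases "u \<in> {- \<delta>..\<delta>}")
      case True
      then show ?thesis using u by (cases "0 < u") (auto simp: q_def f_def indicator_def)
    qed (simp add: q0)
    then show ?thesis using log_weight_split[OF \<delta>(1), of u] by linarith
  qed
  have L0: "0 \<le> ln (1 + 1 / \<delta>)" using \<delta> by simp
  have ri: "integrable lborel (\<lambda>\<tau>. indicator {x..x + \<delta>} \<tau> * ln (1 + 1 / \<delta>))"
    by (intro integrable_mult_left integrable_real_indicator) (auto simp: emeasure_lborel_Icc_eq)
  have qs: "integrable lborel (\<lambda>\<tau>. q (\<tau> - t))" "(LINT \<tau>|lborel. q (\<tau> - t)) = 2 * \<delta>"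
    using lborel_integrable_real_affine[OF qi(1), of 1 "- t"] lborel_integral_real_affine[of 1 q "- t"] qi(2) by simp_all
  have "(\<integral>\<^sup>+\<tau>. indicator {x..x + \<delta>} \<tau> * ennreal (log_weight (\<tau> - t)) \<partial>lborel)
     \<le> (\<integral>\<^sup>+\<tau>. ennreal (indicator {x..x + \<delta>} \<tau> * ln (1 + 1 / \<delta>) + q (\<tau> - t)) \<partial>lborel)"
  proof (rule nn_integral_mono)
    fix \<tau>
    show "indicator {x..x + \<delta>} \<tau> * ennreal (log_weight (\<tau> - t)) \<le> ennreal (indicator {x..x + \<delta>} \<tau> * ln (1 + 1 / \<delta>) + q (\<tau> - t))"
      using lw[of "\<tau> - t"] by (cases "\<tau> \<in> {x..x + \<delta>}") (auto intro: ennreal_leI)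
  qed
  also have "\<dots> = ennreal (LINT \<tau>|lborel. indicator {x..x + \<delta>} \<tau> * ln (1 + 1 / \<delta>) + q (\<tau> - t))"
    using ri qs L0 q0 by (intro nn_integral_eq_integral) auto
  also have "(LINT \<tau>|lborel. indicator {x..x + \<delta>} \<tau> * ln (1 + 1 / \<delta>) + q (\<tau> - t)) = \<delta> * ln (1 + 1 / \<delta>) + 2 * \<delta>"
    using ri qs \<delta> by simp
  also have "\<dots> \<le> \<delta> * (3 * (1 + ln (1 / \<delta>)))"
  proof -
    have "1 + 1 / \<delta> \<le> 2 / \<delta>" using \<delta> by (simp add: field_simps)
    then have "ln (1 + 1 / \<delta>) \<le> ln (2 / \<delta>)" using \<delta> by (subst ln_le_cancel_iff) (auto intro: add_pos_pos)
    also have "\<dots> = ln 2 + ln (1 / \<delta>)" using \<delta> by (simp add: ln_div)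
    also have "\<dots> \<le> 1 + ln (1 / \<delta>)" using ln_2_less_1 by simp
    finally have l: "ln (1 + 1 / \<delta>) \<le> 1 + ln (1 / \<delta>)" .
    have "X + 2 \<le> 3 * (1 + L)" if "0 \<le> L" "X \<le> 1 + L" for X :: real and L :: real
      using that by (simp add: algebra_simps)
    moreover have "0 \<le> ln (1 / \<delta>)" using \<delta> by simp
    ultimately have "ln (1 + 1 / \<delta>) + 2 \<le> 3 * (1 + ln (1 / \<delta>))" using l by blast
    from mult_left_mono[OF this, of \<delta>] show ?thesis using \<delta> by (simp add: algebra_simps)
  qed
  finally show ?thesis by (simp add: ennreal_leI)
qed

lemma log_weight_far: "0 < d \<Longrightarrow> d \<le> \<bar>u\<bar> \<Longrightarrow> log_weight u \<le> ln (1 + 1 / d)"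
  unfolding log_weight_def by (subst ln_le_cancel_iff) (auto intro!: add_pos_pos frac_le)

text \<open>The exponent is quadratic in \<open>j\<close> in order that every positive power of \<open>stage_size j\<close> beats \<open>2 ^ j\<close>,
  and odd because the Rudin-Shapiro signs then sum to zero.\<close>

definition stage_size :: "nat \<Rightarrow> nat" where
  "stage_size j = 2 ^ (2 * j\<^sup>2 + 1)"

text \<open>With N = \<open>stage_size j\<close> the whole stage has length N times the gap, that is
  4^-j / (16 N). Relative to the distance 2^-j / 4 to the other stages this is 2^-j / (4 N), the
  accuracy to which their influence is constant over the stage.\<close>

definition stage_gap :: "nat \<Rightarrow> real" where
  "stage_gap j = 1 / (16 * 4 ^ j * (real (stage_size j))\<^sup>2)"

definition stage_node :: "nat \<Rightarrow> nat \<Rightarrow> real" where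
  "stage_node j n = (1 / 2) ^ j + real n * stage_gap j"

definition stage_sign :: "nat \<Rightarrow> nat \<Rightarrow> real" where
  "stage_sign j n = snd (rudin_shapiro (2 * j\<^sup>2 + 1) n)"

text \<open>The mass of a spike of width \<open>d\<close> whose logarithmic effect at its left end
  point is exactly 2^-j, according to \<open>mult_kernel_integral\<close>.\<close>

definition stage_coef :: "nat \<Rightarrow> real \<Rightarrow> real" where
  "stage_coef j d = (1 / 2) ^ j / (1 + ln (1 / d))"

text \<open>The windows accumulate at 0, and each is at a distance of at least a quarter of its own
  left end point from all the others.\<close>

definition stage_window :: "nat \<Rightarrow> real set" where
  "stage_window j = {(1 / 2) ^ j..(1 / 2) ^ j * (9 / 8)}"

text \<open>The logarithmic weight at a quarter of the gap, which bounds the weight on every cell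
  that is not close to the singularity.\<close>

definition stage_log :: "nat \<Rightarrow> real" where
  "stage_log j = ln (1 + 4 / stage_gap j)"

lemma stage_sign_abs: "\<bar>stage_sign j n\<bar> = 1"
  by (simp add: stage_sign_def rudin_shapiro_abs)

lemma stage_sign_sum: "(\<Sum>n<stage_size j. stage_sign j n) = 0"
  unfolding stage_size_def stage_sign_def by (rule rudin_shapiro_sum_zero)

lemma stage_size_ge: "1 \<le> real (stage_size j)"
  unfolding stage_size_def of_nat_power of_nat_numeral by (rule one_le_power) simp

lemma stage_gap_pos: "0 < stage_gap j"
  by (simp add: stage_gap_def stage_size_def)

lemma stage_size_gap: "real (stage_size j) * stage_gap j = (1 / 2) ^ j * ((1 / 2) ^ j / (16 * real (stage_size j)))"
proof -
  have "(4::real) ^ j = 2 ^ j * 2 ^ j" by (simp add: power_mult_distrib[symmetric])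
  then show ?thesis using stage_size_ge[of j] by (simp add: stage_gap_def power2_eq_square power_divide)
qed

lemma stage_size_gap_le: "real (stage_size j) * stage_gap j \<le> (1 / 2) ^ j * (1 / 16)"
  unfolding stage_size_gap
proof (rule mult_left_mono)
  have "(1 / 2) ^ j \<le> (1::real)" by (simp add: power_le_one)
  then show "(1 / 2) ^ j / (16 * real (stage_size j)) \<le> 1 / 16"
    using stage_size_ge[of j] by (intro frac_le) auto
qed simp

lemma stage_gap_le: "stage_gap j \<le> 1 / 16"
proof -
  have "1 * stage_gap j \<le> real (stage_size j) * stage_gap j"
    using stage_size_ge stage_gap_pos[of j] by (intro mult_right_mono) auto
  also have "\<dots> \<le> 1 * (1 / 16)"
    by (rule order_trans[OF stage_size_gap_le]) (simp add: power_le_one)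
  finally show ?thesis by simp
qed

lemma stage_window_unit: "1 \<le> j \<Longrightarrow> stage_window j \<subseteq> {0..1}"
proof -
  assume "1 \<le> j"
  then have "(1 / 2) ^ j \<le> (1 / 2 :: real) ^ 1" by (intro power_decreasing) auto
  then show ?thesis by (auto simp: stage_window_def)
qed

lemma stage_window_order:
  assumes "i < j" "x \<in> stage_window i" "y \<in> stage_window j"
  shows "y + (1 / 2) ^ j * (1 / 4) \<le> x" "y + (1 / 2) ^ i * (1 / 4) \<le> x"
proof -
  have "(1 / 2 :: real) ^ j \<le> (1 / 2) ^ Suc i" using assms(1) by (intro power_decreasing) auto
  then have p: "2 * (1 / 2 :: real) ^ j \<le> (1 / 2) ^ i" by simp
  have q: "(0::real) < (1 / 2) ^ j" by simp
  have "(1 / 2) ^ i \<le> x" "y \<le> (1 / 2) ^ j * (9 / 8)" using assms(2,3) by (auto simp: stage_window_def)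
  then show "y + (1 / 2) ^ j * (1 / 4) \<le> x" "y + (1 / 2) ^ i * (1 / 4) \<le> x" using p q by linarith+
qed

lemma stage_window_disjoint:
  assumes "i \<noteq> j" "x \<in> stage_window i" shows "x \<notin> stage_window j"
proof
  assume x: "x \<in> stage_window j"
  have q: "(0::real) < (1 / 2) ^ k" for k :: nat by simp
  show False
    using stage_window_order(1)[of i j x x] stage_window_order(1)[of j i x x] q[of i] q[of j] assms x
    by (cases "i < j") auto
qed

text \<open>Only the widths are free: \<open>stage_coef j d\<close> tends to 0 with
  \<open>d\<close>, whereas all other quantities in \<open>coef_small\<close> are fixed by
  \<open>j\<close>. The square of the number of cells makes the joint influence of all cells of a
  stage on one node of order 2^-j / N, and not only 2^-j.\<close>

locale bump_stages =
  fixes \<delta> :: "nat \<Rightarrow> real"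
  assumes \<delta>_pos: "1 \<le> j \<Longrightarrow> 0 < \<delta> j"
    and \<delta>_small: "1 \<le> j \<Longrightarrow> \<delta> j \<le> stage_gap j / 4"
    and coef_small: "1 \<le> j \<Longrightarrow>
      8 * (real (stage_size j))\<^sup>2 * stage_coef j (\<delta> j) * (1 + mult_kernel_const + stage_log j) \<le> (1 / 2) ^ j"
begin

definition coef :: "nat \<Rightarrow> real" where
  "coef j = stage_coef j (\<delta> j)"

definition cell :: "nat \<Rightarrow> nat \<Rightarrow> real set" where
  "cell j n = {stage_node j n..stage_node j n + \<delta> j}"

definition stage :: "nat \<Rightarrow> real \<Rightarrow> real" where
  "stage j \<tau> = (\<Sum>n<stage_size j. stage_sign j n * (coef j / \<delta> j) * indicator (cell j n) \<tau>)"

definition density :: "real \<Rightarrow> real" where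
  "density \<tau> = (\<Sum>j. stage (Suc j) \<tau>)"

lemma cell_measurable [measurable]: "cell j n \<in> sets borel"
  by (simp add: cell_def)

lemma stage_measurable [measurable]: "stage j \<in> borel_measurable borel"
  unfolding stage_def[abs_def] by measurable

lemma density_measurable [measurable]: "density \<in> borel_measurable borel"
  unfolding density_def[abs_def] by measurable

lemma \<delta>_le_1: "1 \<le> j \<Longrightarrow> \<delta> j \<le> 1"
  using \<delta>_small[of j] stage_gap_le[of j] by simp

lemma ln_\<delta>_nonneg: "1 \<le> j \<Longrightarrow> 0 \<le> ln (1 / \<delta> j)"
  using \<delta>_le_1[of j] \<delta>_pos[of j] by simp

lemma coef_pos: "1 \<le> j \<Longrightarrow> 0 < coef j"
  unfolding coef_def stage_coef_def using ln_\<delta>_nonneg[of j] by (intro divide_pos_pos add_pos_nonneg) auto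

lemma coef_mult: "1 \<le> j \<Longrightarrow> coef j * (1 + ln (1 / \<delta> j)) = (1 / 2) ^ j"
  unfolding coef_def stage_coef_def using ln_\<delta>_nonneg[of j] by simp

lemma stage_log_nonneg: "0 \<le> stage_log j"
  unfolding stage_log_def using stage_gap_pos[of j] by simp

lemma mult_kernel_const_nonneg: "0 \<le> mult_kernel_const"
  by (simp add: mult_kernel_const_def)

lemma coef_bounds:
  assumes j: "1 \<le> j"
  shows "real (stage_size j) * coef j * (1 + mult_kernel_const + stage_log j) \<le> (1 / 2) ^ j / (8 * real (stage_size j))"
    and "real (stage_size j) * coef j * (1 + mult_kernel_const + stage_log j) \<le> (1 / 2) ^ j / 8"
proof -
  have N: "1 \<le> real (stage_size j)" by (rule stage_size_ge)
  show 1: "real (stage_size j) * coef j * (1 + mult_kernel_const + stage_log j) \<le> (1 / 2) ^ j / (8 * real (stage_size j))"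
    using coef_small[OF j] N by (simp add: pos_le_divide_eq coef_def power2_eq_square mult_ac)
  also have "\<dots> \<le> (1 / 2) ^ j / 8" using N by (intro divide_left_mono) auto
  finally show "real (stage_size j) * coef j * (1 + mult_kernel_const + stage_log j) \<le> (1 / 2) ^ j / 8" .
qed

lemma coef_term_bounds:
  assumes j: "1 \<le> j"
  shows "real (stage_size j) * coef j \<le> (1 / 2) ^ j / 8"
    and "real (stage_size j) * coef j * stage_log j \<le> (1 / 2) ^ j / 8"
    and "real (stage_size j) * coef j * (mult_kernel_const + stage_log j) \<le> (1 / 2) ^ j / (8 * real (stage_size j))"
    and "coef j * mult_kernel_const \<le> (1 / 2) ^ j / (8 * real (stage_size j))"
proof -
  define P where "P = real (stage_size j) * coef j"
  have P0: "0 \<le> P" using coef_pos[OF j] by (simp add: P_def)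
  have PP: "coef j \<le> P" unfolding P_def using coef_pos[OF j] stage_size_ge[of j] mult_right_mono[of 1 "real (stage_size j)" "coef j"] by simp
  have le: "P * x \<le> P * (1 + mult_kernel_const + stage_log j)" if "x \<le> 1 + mult_kernel_const + stage_log j" for x
    using that P0 by (intro mult_left_mono)
  note b = coef_bounds[OF j, folded P_def]
  have l: "0 \<le> stage_log j" "0 \<le> mult_kernel_const" by (rule stage_log_nonneg mult_kernel_const_nonneg)+
  show "real (stage_size j) * coef j \<le> (1 / 2) ^ j / 8" using le[of 1] b(2) l unfolding P_def[symmetric] by simp
  show "real (stage_size j) * coef j * stage_log j \<le> (1 / 2) ^ j / 8" using le[of "stage_log j"] b(2) l unfolding P_def[symmetric] by simp
  show "real (stage_size j) * coef j * (mult_kernel_const + stage_log j) \<le> (1 / 2) ^ j / (8 * real (stage_size j))"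
    using le[of "mult_kernel_const + stage_log j"] b(1) unfolding P_def[symmetric] by simp
  have "coef j * mult_kernel_const \<le> P * mult_kernel_const" using PP l by (intro mult_right_mono)
  then show "coef j * mult_kernel_const \<le> (1 / 2) ^ j / (8 * real (stage_size j))"
    using le[of "mult_kernel_const"] b(1) l by simp
qed

lemma cell_window: "1 \<le> j \<Longrightarrow> n < stage_size j \<Longrightarrow> cell j n \<subseteq> stage_window j"
proof -
  assume j: "1 \<le> j" and n: "n < stage_size j"
  have "real n + 1 \<le> real (stage_size j)" using n by simp
  then have "(real n + 1) * stage_gap j \<le> real (stage_size j) * stage_gap j"
    using stage_gap_pos[of j] by (intro mult_right_mono) auto
  then have "real n * stage_gap j + stage_gap j \<le> (1 / 2) ^ j * (1 / 16)" using stage_size_gap_le[of j] by (simp add: distrib_right)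
  moreover have "0 \<le> real n * stage_gap j" using stage_gap_pos[of j] by simp
  moreover have "\<delta> j \<le> stage_gap j" using \<delta>_small[OF j] stage_gap_pos[of j] by simp
  moreover have "(0::real) < (1 / 2) ^ j" by simp
  ultimately show ?thesis unfolding cell_def stage_node_def stage_window_def by auto
qed

lemma node_distance: "n \<noteq> m \<Longrightarrow> stage_gap j \<le> \<bar>stage_node j n - stage_node j m\<bar>"
proof -
  assume "n \<noteq> m"
  then have "1 \<le> \<bar>real n - real m\<bar>" by linarith
  then have "1 * stage_gap j \<le> \<bar>real n - real m\<bar> * stage_gap j" using stage_gap_pos[of j] by (intro mult_right_mono) auto
  also have "\<dots> = \<bar>stage_node j n - stage_node j m\<bar>"
    using stage_gap_pos[of j] by (simp add: stage_node_def left_diff_distrib[symmetric] abs_mult)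
  finally show ?thesis by simp
qed

lemma cell_disjoint:
  assumes "1 \<le> j" "\<tau> \<in> cell j n" "n \<noteq> m" shows "\<tau> \<notin> cell j m"
proof
  assume "\<tau> \<in> cell j m"
  then have "\<bar>stage_node j n - stage_node j m\<bar> \<le> \<delta> j" using assms(2) unfolding cell_def by auto
  then show False using node_distance[OF assms(3), of j] \<delta>_small[OF assms(1)] stage_gap_pos[of j] by linarith
qed

lemma stage_in_cell:
  assumes "1 \<le> j" "n < stage_size j" "\<tau> \<in> cell j n"
  shows "stage j \<tau> = stage_sign j n * (coef j / \<delta> j)"
proof -
  have "stage j \<tau> = (\<Sum>m<stage_size j. if m = n then stage_sign j n * (coef j / \<delta> j) else 0)"
    unfolding stage_def using assms cell_disjoint[OF assms(1,3)]
    by (intro sum.cong refl) (auto simp: indicator_def)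
  then show ?thesis using assms(2) by simp
qed

lemma stage_outside_cells: "(\<And>n. n < stage_size j \<Longrightarrow> \<tau> \<notin> cell j n) \<Longrightarrow> stage j \<tau> = 0"
  unfolding stage_def by (intro sum.neutral) auto

lemma stage_outside_window: "1 \<le> j \<Longrightarrow> \<tau> \<notin> stage_window j \<Longrightarrow> stage j \<tau> = 0"
  using cell_window[of j] by (intro stage_outside_cells) auto

text \<open>At every point at most one term of the series for the density is nonzero.\<close>

lemma density_lift:
  fixes G :: "real \<Rightarrow> 'a::{t2_space, comm_monoid_add}"
  assumes "G 0 = 0"
  shows "G (density \<tau>) = (\<Sum>j. G (stage (Suc j) \<tau>))"
    and "1 \<le> j \<Longrightarrow> \<tau> \<in> stage_window j \<Longrightarrow> density \<tau> = stage j \<tau>"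
    and "(\<And>j. 1 \<le> j \<Longrightarrow> \<tau> \<notin> stage_window j) \<Longrightarrow> density \<tau> = 0"
proof -
  have in_window: "(\<Sum>i. H (stage (Suc i) \<tau>)) = H (stage j \<tau>)"
    if j: "1 \<le> j" "\<tau> \<in> stage_window j" and H: "H 0 = 0" for H :: "real \<Rightarrow> 'b::{t2_space, comm_monoid_add}" and j
  proof -
    have "(\<Sum>i. H (stage (Suc i) \<tau>)) = (\<Sum>i\<in>{j - 1}. H (stage (Suc i) \<tau>))"
    proof (rule suminf_finite)
      fix i assume "i \<notin> {j - 1}"
      then have "Suc i \<noteq> j" by auto
      then have "\<tau> \<notin> stage_window (Suc i)" using stage_window_disjoint[of j "Suc i" \<tau>] j by auto
      then show "H (stage (Suc i) \<tau>) = 0" using stage_outside_window[of "Suc i"] H by simp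
    qed simp
    then show ?thesis using j by simp
  qed
  have outside: "(\<Sum>i. H (stage (Suc i) \<tau>)) = 0"
    if "\<And>j. 1 \<le> j \<Longrightarrow> \<tau> \<notin> stage_window j" and H: "H 0 = 0" for H :: "real \<Rightarrow> 'b::{t2_space, comm_monoid_add}"
    using stage_outside_window that by simp
  show w: "density \<tau> = stage j \<tau>" if "1 \<le> j" "\<tau> \<in> stage_window j" for j
    using in_window[OF that, of "\<lambda>x. x"] by (simp add: density_def)
  show z: "density \<tau> = 0" if "\<And>j. 1 \<le> j \<Longrightarrow> \<tau> \<notin> stage_window j"
    using outside[OF that, of "\<lambda>x. x"] by (simp add: density_def)
  show "G (density \<tau>) = (\<Sum>j. G (stage (Suc j) \<tau>))"
  proof (cases "\<exists>j\<ge>1. \<tau> \<in> stage_window j")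
    case True
    then obtain j where j: "1 \<le> j" "\<tau> \<in> stage_window j" by auto
    then show ?thesis using in_window[OF j, of G] w[OF j] assms by simp
  next
    case False
    then have n: "\<And>j. 1 \<le> j \<Longrightarrow> \<tau> \<notin> stage_window j" by auto
    then show ?thesis using outside[OF n, of G] z[OF n] assms by simp
  qed
qed

lemma stage_weighted:
  assumes j: "1 \<le> j" and [measurable]: "F \<in> borel_measurable borel"
  shows "(\<integral>\<^sup>+\<tau>. ennreal \<bar>stage j \<tau>\<bar> * F \<tau> \<partial>lborel)
    \<le> (\<Sum>n<stage_size j. ennreal (coef j / \<delta> j) * (\<integral>\<^sup>+\<tau>. indicator (cell j n) \<tau> * F \<tau> \<partial>lborel))"
proof -
  have p: "0 \<le> coef j / \<delta> j" using coef_pos[OF j] \<delta>_pos[OF j] by simp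
  have "(\<integral>\<^sup>+\<tau>. ennreal \<bar>stage j \<tau>\<bar> * F \<tau> \<partial>lborel)
    \<le> (\<integral>\<^sup>+\<tau>. (\<Sum>n<stage_size j. ennreal (coef j / \<delta> j) * (indicator (cell j n) \<tau> * F \<tau>)) \<partial>lborel)"
  proof (rule nn_integral_mono)
    fix \<tau>
    show "ennreal \<bar>stage j \<tau>\<bar> * F \<tau> \<le> (\<Sum>n<stage_size j. ennreal (coef j / \<delta> j) * (indicator (cell j n) \<tau> * F \<tau>))"
    proof (cases "\<exists>n<stage_size j. \<tau> \<in> cell j n")
      case True
      then obtain n where n: "n < stage_size j" "\<tau> \<in> cell j n" by auto
      have "\<bar>stage j \<tau>\<bar> = coef j / \<delta> j"
        unfolding stage_in_cell[OF j n] abs_mult stage_sign_abs using coef_pos[OF j] \<delta>_pos[OF j] by simp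
      then have "ennreal \<bar>stage j \<tau>\<bar> * F \<tau> = ennreal (coef j / \<delta> j) * (indicator (cell j n) \<tau> * F \<tau>)" using n by simp
      also have "\<dots> \<le> (\<Sum>n<stage_size j. ennreal (coef j / \<delta> j) * (indicator (cell j n) \<tau> * F \<tau>))"
        using n by (intro member_le_sum) auto
      finally show ?thesis .
    next
      case False
      then have "stage j \<tau> = 0" by (intro stage_outside_cells) auto
      then show ?thesis by simp
    qed
  qed
  also have "\<dots> = (\<Sum>n<stage_size j. \<integral>\<^sup>+\<tau>. ennreal (coef j / \<delta> j) * (indicator (cell j n) \<tau> * F \<tau>) \<partial>lborel)"
    by (rule nn_integral_sum) measurable
  also have "\<dots> = (\<Sum>n<stage_size j. ennreal (coef j / \<delta> j) * (\<integral>\<^sup>+\<tau>. indicator (cell j n) \<tau> * F \<tau> \<partial>lborel))"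
    by (intro sum.cong refl nn_integral_cmult) measurable
  finally show ?thesis .
qed

lemma cell_mass: "1 \<le> j \<Longrightarrow> emeasure lborel (cell j n) = ennreal (\<delta> j)"
  using \<delta>_pos[of j] by (simp add: cell_def)

lemma stage_mass:
  assumes j: "1 \<le> j"
  shows "(\<integral>\<^sup>+\<tau>. ennreal \<bar>stage j \<tau>\<bar> \<partial>lborel) \<le> ennreal ((1 / 2) ^ j)"
proof -
  have "(\<integral>\<^sup>+\<tau>. ennreal \<bar>stage j \<tau>\<bar> \<partial>lborel)
    \<le> (\<Sum>n<stage_size j. ennreal (coef j / \<delta> j) * (\<integral>\<^sup>+\<tau>. indicator (cell j n) \<tau> \<partial>lborel))"
    using stage_weighted[OF j, of "\<lambda>_. 1"] by simp
  also have "\<dots> = (\<Sum>n<stage_size j. ennreal (coef j))"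
    using \<delta>_pos[OF j] coef_pos[OF j] by (intro sum.cong refl) (simp add: cell_mass[OF j] ennreal_mult[symmetric])
  also have "\<dots> = ennreal (real (stage_size j) * coef j)"
    using coef_pos[OF j] by (simp add: sum_ennreal ennreal_of_nat_eq_real_of_nat[symmetric] ennreal_mult)
  also have "\<dots> \<le> ennreal ((1 / 2) ^ j)"
  proof (rule ennreal_leI)
    have "(0::real) \<le> (1 / 2) ^ j" by simp
    then show "real (stage_size j) * coef j \<le> (1 / 2) ^ j" using coef_term_bounds(1)[OF j] by linarith
  qed
  finally show ?thesis .
qed

text \<open>Nodes are a gap apart and cells at most a quarter of it wide, so at most one cell comes
  within a quarter gap of \<open>t\<close>. That cell costs \<open>3 * (1 / 2) ^ j\<close> whatever
  its width, because of the normalisation of its mass. The others cost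
  \<open>coef j * stage_log j\<close> each, which \<open>coef_small\<close> makes negligible even in
  total.\<close>

lemma stage_log_mass:
  assumes j: "1 \<le> j"
  shows "(\<integral>\<^sup>+\<tau>. ennreal \<bar>stage j \<tau>\<bar> * ennreal (log_weight (\<tau> - t)) \<partial>lborel) \<le> ennreal (4 * (1 / 2) ^ j)"
proof -
  have p: "0 < \<delta> j" "0 < coef j" "\<delta> j \<le> 1" using \<delta>_pos[OF j] coef_pos[OF j] \<delta>_le_1[OF j] by auto
  have gap: "0 < stage_gap j" by (rule stage_gap_pos)
  define near where "near n \<longleftrightarrow> (\<exists>\<tau>\<in>cell j n. \<bar>\<tau> - t\<bar> < stage_gap j / 4)" for n
  have near1: "n = m" if "near n" "near m" for n m
  proof (rule ccontr)
    assume "n \<noteq> m"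
    from node_distance[OF this, of j] have "stage_gap j \<le> \<bar>stage_node j n - stage_node j m\<bar>" .
    moreover obtain x y where "x \<in> cell j n" "\<bar>x - t\<bar> < stage_gap j / 4" "y \<in> cell j m" "\<bar>y - t\<bar> < stage_gap j / 4"
      using \<open>near n\<close> \<open>near m\<close> by (auto simp: near_def)
    ultimately show False using \<delta>_small[OF j] gap unfolding cell_def atLeastAtMost_iff by linarith
  qed
  have cell_term: "ennreal (coef j / \<delta> j) * (\<integral>\<^sup>+\<tau>. indicator (cell j n) \<tau> * ennreal (log_weight (\<tau> - t)) \<partial>lborel)
     \<le> ennreal (coef j * stage_log j + (if near n then 3 * (1 / 2) ^ j else 0))" for n
  proof (cases "near n")
    case True
    have "ennreal (coef j / \<delta> j) * (\<integral>\<^sup>+\<tau>. indicator (cell j n) \<tau> * ennreal (log_weight (\<tau> - t)) \<partial>lborel)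
       \<le> ennreal (coef j / \<delta> j) * ennreal (\<delta> j * (3 * (1 + ln (1 / \<delta> j))))"
      unfolding cell_def by (intro mult_left_mono log_weight_interval p) auto
    also have "\<dots> = ennreal (coef j / \<delta> j * (\<delta> j * (3 * (1 + ln (1 / \<delta> j)))))"
      using p ln_\<delta>_nonneg[OF j] by (intro ennreal_mult[symmetric]) auto
    also have "coef j / \<delta> j * (\<delta> j * (3 * (1 + ln (1 / \<delta> j)))) = 3 * (coef j * (1 + ln (1 / \<delta> j)))" using p by simp
    also have "\<dots> \<le> coef j * stage_log j + 3 * (1 / 2) ^ j"
      unfolding coef_mult[OF j] using p stage_log_nonneg[of j] by simp
    finally show ?thesis using True by (simp add: ennreal_leI)
  next
    case False
    have "(\<integral>\<^sup>+\<tau>. indicator (cell j n) \<tau> * ennreal (log_weight (\<tau> - t)) \<partial>lborel) \<le> (\<integral>\<^sup>+\<tau>. ennreal (stage_log j) * indicator (cell j n) \<tau> \<partial>lborel)"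
    proof (rule nn_integral_mono)
      fix \<tau>
      show "indicator (cell j n) \<tau> * ennreal (log_weight (\<tau> - t)) \<le> ennreal (stage_log j) * indicator (cell j n) \<tau>"
      proof (cases "\<tau> \<in> cell j n")
        case True
        then have "stage_gap j / 4 \<le> \<bar>\<tau> - t\<bar>" using False by (auto simp: near_def)
        then have "log_weight (\<tau> - t) \<le> ln (1 + 1 / (stage_gap j / 4))" using gap by (intro log_weight_far) auto
        then show ?thesis using True by (simp add: stage_log_def ennreal_leI)
      qed simp
    qed
    also have "\<dots> = ennreal (stage_log j) * ennreal (\<delta> j)"
      by (subst nn_integral_cmult_indicator) (auto simp: cell_mass[OF j])
    finally have "ennreal (coef j / \<delta> j) * (\<integral>\<^sup>+\<tau>. indicator (cell j n) \<tau> * ennreal (log_weight (\<tau> - t)) \<partial>lborel)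
       \<le> ennreal (coef j / \<delta> j) * (ennreal (stage_log j) * ennreal (\<delta> j))"
      by (intro mult_left_mono) auto
    also have "\<dots> = ennreal (coef j * stage_log j)"
      using p stage_log_nonneg[of j] by (simp add: ennreal_mult[symmetric])
    finally show ?thesis using False by simp
  qed
  have "(\<integral>\<^sup>+\<tau>. ennreal \<bar>stage j \<tau>\<bar> * ennreal (log_weight (\<tau> - t)) \<partial>lborel)
    \<le> (\<Sum>n<stage_size j. ennreal (coef j / \<delta> j) * (\<integral>\<^sup>+\<tau>. indicator (cell j n) \<tau> * ennreal (log_weight (\<tau> - t)) \<partial>lborel))"
    by (rule stage_weighted[OF j]) measurable
  also have "\<dots> \<le> (\<Sum>n<stage_size j. ennreal (coef j * stage_log j + (if near n then 3 * (1 / 2) ^ j else 0)))"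
    by (intro sum_mono cell_term)
  also have "\<dots> = ennreal (\<Sum>n<stage_size j. coef j * stage_log j + (if near n then 3 * (1 / 2) ^ j else 0))"
    using p stage_log_nonneg[of j] by (intro sum_ennreal) auto
  also have "(\<Sum>n<stage_size j. coef j * stage_log j + (if near n then 3 * (1 / 2) ^ j else 0)) \<le> 4 * (1 / 2) ^ j"
  proof -
    have "(\<Sum>n<stage_size j. if near n then 3 * (1 / 2) ^ j else 0) \<le> (3 * (1 / 2) ^ j :: real)"
    proof (cases "\<exists>m<stage_size j. near m")
      case True
      then obtain m where m: "m < stage_size j" "near m" by auto
      have "(\<Sum>n<stage_size j. if near n then 3 * (1 / 2) ^ j else 0) = (\<Sum>n<stage_size j. if n = m then 3 * (1 / 2) ^ j else (0::real))"
        using near1 m by (intro sum.cong refl) auto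
      then show ?thesis using m by simp
    next
      case False
      then have "(\<Sum>n<stage_size j. if near n then 3 * (1 / 2) ^ j else 0) = (0::real)" by (intro sum.neutral) auto
      then show ?thesis by simp
    qed
    moreover have "(\<Sum>n<stage_size j. coef j * stage_log j) \<le> (1 / 2) ^ j / 8"
      using coef_term_bounds(2)[OF j] by (simp add: mult_ac)
    moreover have "(0::real) \<le> (1 / 2) ^ j" by simp
    ultimately show ?thesis unfolding sum.distrib by linarith
  qed
  finally show ?thesis by (simp add: ennreal_leI)
qed

lemma suminf_geometric_half: "(\<Sum>j. ennreal (c * (1 / 2) ^ Suc j)) = ennreal c" if "0 \<le> c"
proof -
  have "(\<lambda>j. (1 / 2 :: real) ^ Suc j) sums 1" by (rule power_half_series)
  then have "(\<lambda>j. c * (1 / 2) ^ Suc j) sums (c * 1)" by (rule sums_mult)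
  then show ?thesis using that by (intro suminf_ennreal_eq) auto
qed

lemma density_mass:
  "(\<integral>\<^sup>+\<tau>. ennreal \<bar>density \<tau>\<bar> \<partial>lborel) \<le> 1"
  "(\<integral>\<^sup>+\<tau>. ennreal \<bar>density \<tau>\<bar> * ennreal (log_weight (\<tau> - t)) \<partial>lborel) \<le> ennreal 4"
proof -
  have "(\<integral>\<^sup>+\<tau>. ennreal \<bar>density \<tau>\<bar> \<partial>lborel) = (\<Sum>j. \<integral>\<^sup>+\<tau>. ennreal \<bar>stage (Suc j) \<tau>\<bar> \<partial>lborel)"
    by (subst density_lift(1)[of "\<lambda>x. ennreal \<bar>x\<bar>"]) (auto intro!: nn_integral_suminf)
  also have "\<dots> \<le> (\<Sum>j. ennreal (1 * (1 / 2) ^ Suc j))"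
    unfolding mult_1_left by (intro suminf_le summableI stage_mass) simp
  also have "\<dots> = 1" by (subst suminf_geometric_half) auto
  finally show "(\<integral>\<^sup>+\<tau>. ennreal \<bar>density \<tau>\<bar> \<partial>lborel) \<le> 1" .
  have "(\<integral>\<^sup>+\<tau>. ennreal \<bar>density \<tau>\<bar> * ennreal (log_weight (\<tau> - t)) \<partial>lborel)
      = (\<integral>\<^sup>+\<tau>. (\<Sum>j. ennreal \<bar>stage (Suc j) \<tau>\<bar> * ennreal (log_weight (\<tau> - t))) \<partial>lborel)"
    by (intro nn_integral_cong density_lift(1)) simp
  also have "\<dots> = (\<Sum>j. \<integral>\<^sup>+\<tau>. ennreal \<bar>stage (Suc j) \<tau>\<bar> * ennreal (log_weight (\<tau> - t)) \<partial>lborel)"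
    by (rule nn_integral_suminf) measurable
  also have "\<dots> \<le> (\<Sum>j. ennreal (4 * (1 / 2) ^ Suc j))"
    by (intro suminf_le summableI stage_log_mass) simp
  also have "\<dots> = ennreal 4" by (subst suminf_geometric_half) auto
  finally show "(\<integral>\<^sup>+\<tau>. ennreal \<bar>density \<tau>\<bar> * ennreal (log_weight (\<tau> - t)) \<partial>lborel) \<le> ennreal 4" .
qed

lemma density_integrable: "integrable lborel density"
  using density_mass(1) by (intro integrableI_bounded) (auto intro: le_less_trans)

lemma stage_integrable: "1 \<le> j \<Longrightarrow> integrable lborel (stage j)"
  using stage_mass[of j] by (intro integrableI_bounded) (auto intro: le_less_trans)

text \<open>All cells carry the same mass up to sign, so the integral is a multiple of the sum of
  the Rudin-Shapiro signs, which is zero.\<close>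

lemma stage_integral:
  assumes j: "1 \<le> j"
  shows "(LINT \<tau>|lborel. stage j \<tau>) = 0"
proof -
  have i: "integrable lborel (\<lambda>\<tau>. stage_sign j n * (coef j / \<delta> j) * indicator (cell j n) \<tau>)" for n
    using cell_mass[OF j] by (intro integrable_mult_right integrable_real_indicator) auto
  have "(LINT \<tau>|lborel. stage j \<tau>) = (\<Sum>n<stage_size j. LINT \<tau>|lborel. stage_sign j n * (coef j / \<delta> j) * indicator (cell j n) \<tau>)"
    unfolding stage_def by (rule Bochner_Integration.integral_sum) (rule i)
  also have "\<dots> = (\<Sum>n<stage_size j. stage_sign j n * coef j)"
    using \<delta>_pos[OF j] by (intro sum.cong refl) (simp add: measure_def cell_mass[OF j])
  also have "\<dots> = 0" unfolding sum_distrib_right[symmetric] stage_sign_sum by simp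
  finally show ?thesis .
qed

lemma density_integral: "(LINT \<tau>|lborel. density \<tau>) = 0"
proof -
  have "(LINT \<tau>|lborel. (\<Sum>j. stage (Suc j) \<tau>)) = (\<Sum>j. LINT \<tau>|lborel. stage (Suc j) \<tau>)"
  proof (rule integral_suminf)
    show "integrable lborel (stage (Suc j))" for j by (rule stage_integrable) simp
    show "AE \<tau> in lborel. summable (\<lambda>j. norm (stage (Suc j) \<tau>))"
    proof (rule AE_I2)
      fix \<tau>
      show "summable (\<lambda>j. norm (stage (Suc j) \<tau>))"
      proof (cases "\<exists>j\<ge>1. \<tau> \<in> stage_window j")
        case True
        then obtain j where j: "1 \<le> j" "\<tau> \<in> stage_window j" by auto
        show ?thesis
        proof (rule summable_finite[of "{j - 1}"])
          fix i assume "i \<notin> {j - 1}"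
          then have "\<tau> \<notin> stage_window (Suc i)" using stage_window_disjoint[of j "Suc i" \<tau>] j by auto
          then show "norm (stage (Suc i) \<tau>) = 0" using stage_outside_window[of "Suc i"] by simp
        qed simp
      next
        case False
        then have "norm (stage (Suc i) \<tau>) = 0" for i using stage_outside_window[of "Suc i"] by auto
        then show ?thesis by simp
      qed
    qed
    show "summable (\<lambda>j. LINT \<tau>|lborel. norm (stage (Suc j) \<tau>))"
    proof (rule summable_comparison_test')
      show "summable (\<lambda>j. (1 / 2 :: real) ^ Suc j)" using power_half_series by (rule sums_summable)
      fix j
      have "ennreal (LINT \<tau>|lborel. norm (stage (Suc j) \<tau>)) = (\<integral>\<^sup>+\<tau>. ennreal \<bar>stage (Suc j) \<tau>\<bar> \<partial>lborel)"
        using stage_integrable[of "Suc j"] by (subst nn_integral_eq_integral) auto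
      also have "\<dots> \<le> ennreal ((1 / 2) ^ Suc j)" by (rule stage_mass) simp
      finally show "norm (LINT \<tau>|lborel. norm (stage (Suc j) \<tau>)) \<le> (1 / 2) ^ Suc j"
        by (subst (asm) ennreal_le_iff) auto
    qed
  qed
  then show ?thesis by (simp add: density_def stage_integral)
qed

lemma density_support: "\<tau> \<notin> {0..1} \<Longrightarrow> density \<tau> = 0"
proof (rule density_lift(3)[of "\<lambda>x. x"])
  fix j :: nat assume "\<tau> \<notin> {0..1}" "1 \<le> j"
  then show "\<tau> \<notin> stage_window j" using stage_window_unit[of j] by blast
qed simp

lemma density_log_integrable: "integrable lborel (\<lambda>\<tau>. \<bar>density \<tau>\<bar> * log_weight (\<tau> - t))"
  and density_log_bound: "(LINT \<tau>|lborel. \<bar>density \<tau>\<bar> * log_weight (\<tau> - t)) \<le> 4"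
proof -
  have e: "(\<integral>\<^sup>+\<tau>. ennreal (\<bar>density \<tau>\<bar> * log_weight (\<tau> - t)) \<partial>lborel) \<le> ennreal 4"
    using density_mass(2)[of t] by (simp add: ennreal_mult log_weight_nonneg)
  show i: "integrable lborel (\<lambda>\<tau>. \<bar>density \<tau>\<bar> * log_weight (\<tau> - t))"
    using e by (intro integrableI_nonneg) (auto simp: log_weight_nonneg intro: le_less_trans)
  have "ennreal (LINT \<tau>|lborel. \<bar>density \<tau>\<bar> * log_weight (\<tau> - t)) \<le> ennreal 4"
    using e nn_integral_eq_integral[OF i] by (simp add: log_weight_nonneg)
  then show "(LINT \<tau>|lborel. \<bar>density \<tau>\<bar> * log_weight (\<tau> - t)) \<le> 4"
    by (subst (asm) ennreal_le_iff) auto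
qed

text \<open>The 4 is the sum over all stages of the bounds \<open>4 * (1 / 2) ^ j\<close> in
  \<open>stage_log_mass\<close>.\<close>

sublocale log_slope_kernel density 4
  by unfold_locales (auto intro: density_integrable density_support density_integral density_log_integrable density_log_bound)

end

section \<open>The multiplier at the nodes\<close>

lemma ln_diff_bound:
  fixes x y d :: real
  assumes "0 < d" "d \<le> x" "d \<le> y"
  shows "\<bar>ln x - ln y\<bar> \<le> \<bar>x - y\<bar> / d"
proof -
  have *: "ln x - ln y \<le> \<bar>x - y\<bar> / d" if "0 < d" "d \<le> x" "d \<le> y" for x y :: real
  proof -
    have "ln x - ln y = ln (x / y)" using that by (simp add: ln_div)
    also have "\<dots> \<le> x / y - 1" using that by (intro ln_le_minus_one) auto
    also have "\<dots> = (x - y) / y" using that by (simp add: diff_divide_distrib)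
    also have "\<dots> \<le> \<bar>x - y\<bar> / y" using that by (intro divide_right_mono) auto
    also have "\<dots> \<le> \<bar>x - y\<bar> / d" using that by (intro divide_left_mono) auto
    finally show ?thesis .
  qed
  show ?thesis using *[of x y] *[of y x] assms by (auto simp: abs_le_iff abs_minus_commute)
qed

context bump_stages
begin

lemma node_in_window: "1 \<le> j \<Longrightarrow> n < stage_size j \<Longrightarrow> stage_node j n \<in> stage_window j"
  using cell_window[of j n] \<delta>_pos[of j] by (auto simp: cell_def)

lemma node_in_unit: "1 \<le> j \<Longrightarrow> n < stage_size j \<Longrightarrow> stage_node j n \<in> {0..1}"
  using node_in_window stage_window_unit by blast

lemma density_split:
  assumes j: "1 \<le> j"
  shows "indicator (stage_window j) \<tau> * density \<tau> = stage j \<tau>"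
  using density_lift(2)[of "\<lambda>x. x" j \<tau>] stage_outside_window[of j \<tau>] j by (auto simp: indicator_def)

text \<open>The cell at the node gives the signed amplitude exactly, plus the small term
  \<open>coef j * exp_integral_lim (- 1)\<close> up to sign. The other cells are at least a quarter
  gap away, so each contributes at most \<open>coef j * (mult_kernel_const + stage_log j)\<close>.
  By \<open>coef_small\<close> both errors are at most 2^-j / (8 N).\<close>

lemma own_cell_integral:
  assumes j: "1 \<le> j" and n: "n < stage_size j"
  shows "norm ((LINT \<tau>|lborel. indicator (stage_window j) \<tau> *\<^sub>R (density \<tau> *\<^sub>R mult_kernel (stage_node j n - \<tau>)))
      - of_real ((1 / 2) ^ j * stage_sign j n)) \<le> (1 / 2) ^ j / (4 * real (stage_size j))"
proof -
  define t where "t = stage_node j n"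
  define A where "A = exp_integral_lim (- 1)"
  define N where "N = stage_size j"
  have d: "0 < \<delta> j" "\<delta> j \<le> 1" "0 < coef j" using \<delta>_pos[OF j] \<delta>_le_1[OF j] coef_pos[OF j] by auto
  have AM: "norm A \<le> mult_kernel_const" by (simp add: A_def mult_kernel_const_def)
  define E where "E = mult_kernel_const + stage_log j"
  have E0: "0 \<le> E" using mult_kernel_const_nonneg stage_log_nonneg[of j] by (simp add: E_def)
  define k where "k m \<tau> = indicator (cell j m) \<tau> *\<^sub>R mult_kernel (t - \<tau>)" for m \<tau>
  have [measurable]: "k m \<in> borel_measurable borel" for m unfolding k_def[abs_def] by measurable
  have cell_int: "integrable lborel (\<lambda>\<tau>. indicator (cell j m) \<tau> * E)" for m
    using cell_mass[OF j] by (intro integrable_mult_left integrable_real_indicator) auto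
  have kb: "norm (k m \<tau>) \<le> indicator (cell j m) \<tau> * E" if m: "m < N" "m \<noteq> n" for m \<tau>
  proof (cases "\<tau> \<in> cell j m")
    case True
    have "stage_gap j \<le> \<bar>stage_node j n - stage_node j m\<bar>" using node_distance[of n m j] m by simp
    then have far: "stage_gap j / 4 \<le> \<bar>t - \<tau>\<bar>"
      using True \<delta>_small[OF j] stage_gap_pos[of j] unfolding t_def cell_def atLeastAtMost_iff by linarith
    have ne: "t - \<tau> \<noteq> 0" using far stage_gap_pos[of j] by auto
    have "\<tau> \<in> {0..1}" using cell_window[OF j, of m] stage_window_unit[OF j] True m(1) unfolding N_def by blast
    then have le1: "\<bar>t - \<tau>\<bar> \<le> 1" using node_in_unit[OF j n] by (auto simp: t_def)
    have "log_weight (t - \<tau>) \<le> ln (1 + 1 / (stage_gap j / 4))"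
      using far stage_gap_pos[of j] by (intro log_weight_far) auto
    then have "norm (mult_kernel (t - \<tau>)) \<le> E"
      using mult_kernel_bound[OF ne le1] by (simp add: E_def stage_log_def)
    then show ?thesis using True by (simp add: k_def)
  qed (simp add: k_def)
  have kn: "integrable lborel (k n)" "(LINT \<tau>|lborel. k n \<tau>) = of_real (\<delta> j) * (of_real (1 + ln (1 / \<delta> j)) + A)"
    using mult_kernel_integral[OF d(1,2), of t] unfolding k_def[abs_def] cell_def t_def[symmetric] A_def by auto
  have ki: "integrable lborel (k m)" if m: "m < N" for m
  proof (cases "m = n")
    case False
    show ?thesis
      by (rule Bochner_Integration.integrable_bound[OF cell_int[of m]])
         (auto intro!: AE_I2 order_trans[OF kb[OF m False]])
  qed (simp add: kn)
  have kI: "norm (LINT \<tau>|lborel. k m \<tau>) \<le> \<delta> j * E" if m: "m < N" "m \<noteq> n" for m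
  proof -
    have "norm (LINT \<tau>|lborel. k m \<tau>) \<le> (LINT \<tau>|lborel. indicator (cell j m) \<tau> * E)"
      by (rule lebesgue_integral_norm_bound[OF ki[OF m(1)] cell_int kb[OF m]])
    also have "\<dots> = \<delta> j * E" using d by (simp add: measure_def cell_mass[OF j])
    finally show ?thesis .
  qed
  have "indicator (stage_window j) \<tau> *\<^sub>R (density \<tau> *\<^sub>R mult_kernel (t - \<tau>))
     = (\<Sum>m<N. (stage_sign j m * (coef j / \<delta> j)) *\<^sub>R k m \<tau>)" for \<tau>
  proof -
    have "indicator (stage_window j) \<tau> *\<^sub>R (density \<tau> *\<^sub>R mult_kernel (t - \<tau>)) = stage j \<tau> *\<^sub>R mult_kernel (t - \<tau>)"
      unfolding scaleR_scaleR density_split[OF j] ..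
    also have "\<dots> = (\<Sum>m<N. (stage_sign j m * (coef j / \<delta> j)) *\<^sub>R k m \<tau>)"
      unfolding stage_def scaleR_sum_left N_def k_def scaleR_scaleR ..
    finally show ?thesis .
  qed
  then have "(LINT \<tau>|lborel. indicator (stage_window j) \<tau> *\<^sub>R (density \<tau> *\<^sub>R mult_kernel (t - \<tau>)))
     = (LINT \<tau>|lborel. (\<Sum>m<N. (stage_sign j m * (coef j / \<delta> j)) *\<^sub>R k m \<tau>))" by simp
  also have "\<dots> = (\<Sum>m<N. LINT \<tau>|lborel. (stage_sign j m * (coef j / \<delta> j)) *\<^sub>R k m \<tau>)"
    by (rule Bochner_Integration.integral_sum) (use ki in \<open>auto intro!: integrable_scaleR_right\<close>)
  also have "\<dots> = (\<Sum>m<N. (stage_sign j m * (coef j / \<delta> j)) *\<^sub>R (LINT \<tau>|lborel. k m \<tau>))"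
    by (simp only: integral_scaleR_right)
  also have "\<dots> = (stage_sign j n * (coef j / \<delta> j)) *\<^sub>R (LINT \<tau>|lborel. k n \<tau>)
     + (\<Sum>m\<in>{..<N} - {n}. (stage_sign j m * (coef j / \<delta> j)) *\<^sub>R (LINT \<tau>|lborel. k m \<tau>))"
    using n by (intro sum.remove) (auto simp: N_def)
  also have "(stage_sign j n * (coef j / \<delta> j)) *\<^sub>R (LINT \<tau>|lborel. k n \<tau>)
     = of_real ((1 / 2) ^ j * stage_sign j n) + of_real (stage_sign j n * coef j) * A"
  proof -
    have "(stage_sign j n * (coef j / \<delta> j)) *\<^sub>R (LINT \<tau>|lborel. k n \<tau>)
      = of_real (stage_sign j n * (coef j / \<delta> j) * \<delta> j) * (of_real (1 + ln (1 / \<delta> j)) + A)"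
      unfolding kn(2) scaleR_conv_of_real by simp
    also have "stage_sign j n * (coef j / \<delta> j) * \<delta> j = stage_sign j n * coef j" using d by simp
    also have "of_real (stage_sign j n * coef j) * (of_real (1 + ln (1 / \<delta> j)) + A)
      = of_real (stage_sign j n * (coef j * (1 + ln (1 / \<delta> j)))) + of_real (stage_sign j n * coef j) * A"
    proof -
      have "of_real (x * y) * (of_real l + A) = of_real (x * (y * l)) + of_real (x * y) * A" for x y l :: real
        by (simp add: algebra_simps)
      then show ?thesis .
    qed
    finally show ?thesis unfolding coef_mult[OF j] by (simp only: mult.commute)
  qed
  finally have "(LINT \<tau>|lborel. indicator (stage_window j) \<tau> *\<^sub>R (density \<tau> *\<^sub>R mult_kernel (t - \<tau>)))
      - of_real ((1 / 2) ^ j * stage_sign j n)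
     = of_real (stage_sign j n * coef j) * A + (\<Sum>m\<in>{..<N} - {n}. (stage_sign j m * (coef j / \<delta> j)) *\<^sub>R (LINT \<tau>|lborel. k m \<tau>))"
    by simp
  also have "norm \<dots> \<le> coef j * mult_kernel_const + real N * (coef j * E)"
  proof (intro order_trans[OF norm_triangle_ineq] add_mono)
    have "norm (of_real (stage_sign j n * coef j) * A) = coef j * norm A"
      using d stage_sign_abs[of j n] by (simp add: norm_mult)
    also have "\<dots> \<le> coef j * mult_kernel_const" using d AM by (intro mult_left_mono) auto
    finally show "norm (of_real (stage_sign j n * coef j) * A) \<le> coef j * mult_kernel_const" .
    have "norm (\<Sum>m\<in>{..<N} - {n}. (stage_sign j m * (coef j / \<delta> j)) *\<^sub>R (LINT \<tau>|lborel. k m \<tau>)) \<le> (\<Sum>m\<in>{..<N} - {n}. coef j * E)"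
    proof (rule order_trans[OF norm_sum], rule sum_mono)
      fix m assume m: "m \<in> {..<N} - {n}"
      have "norm ((stage_sign j m * (coef j / \<delta> j)) *\<^sub>R (LINT \<tau>|lborel. k m \<tau>)) = (coef j / \<delta> j) * norm (LINT \<tau>|lborel. k m \<tau>)"
        using d stage_sign_abs[of j m] by (simp add: abs_mult)
      also have "\<dots> \<le> (coef j / \<delta> j) * (\<delta> j * E)" using d m by (intro mult_left_mono kI) auto
      also have "\<dots> = coef j * E" using d by simp
      finally show "norm ((stage_sign j m * (coef j / \<delta> j)) *\<^sub>R (LINT \<tau>|lborel. k m \<tau>)) \<le> coef j * E" .
    qed
    also have "\<dots> \<le> (\<Sum>m<N. coef j * E)" using d E0 by (intro sum_mono2) auto
    also have "\<dots> = real N * (coef j * E)" by simp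
    finally show "norm (\<Sum>m\<in>{..<N} - {n}. (stage_sign j m * (coef j / \<delta> j)) *\<^sub>R (LINT \<tau>|lborel. k m \<tau>)) \<le> real N * (coef j * E)" .
  qed
  also have "\<dots> \<le> (1 / 2) ^ j / (8 * real N) + (1 / 2) ^ j / (8 * real N)"
    using coef_term_bounds(3,4)[OF j] unfolding N_def E_def by (intro add_mono) (simp_all add: mult.assoc)
  also have "\<dots> = (1 / 2) ^ j / (4 * real N)" by simp
  finally show ?thesis by (simp only: t_def N_def)
qed

text \<open>The node and the left end of the window lie on the same side of \<tau>, so the constants
  in \<open>mult_kernel\<close> cancel and a difference of logarithms remains. Both arguments are at
  least a quarter of 2^-j, and they differ by at most the length of the stage.\<close>

lemma outer_kernel_difference:
  assumes j: "1 \<le> j" and n: "n < stage_size j" and \<tau>: "\<tau> \<notin> stage_window j" "density \<tau> \<noteq> 0"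
  shows "norm (mult_kernel (stage_node j n - \<tau>) - mult_kernel ((1 / 2) ^ j - \<tau>)) \<le> (1 / 2) ^ j / (4 * real (stage_size j))"
proof -
  define t where "t = stage_node j n"
  define b where "b = (1 / 2 :: real) ^ j"
  have b0: "0 < b" by (simp add: b_def)
  obtain i where i: "1 \<le> i" "\<tau> \<in> stage_window i" using \<tau>(2) density_lift(3)[of "\<lambda>x. x" \<tau>] by auto
  have tw: "t \<in> stage_window j" unfolding t_def by (rule node_in_window[OF j n])
  have bw: "b \<in> stage_window j" by (simp add: b_def stage_window_def)
  have ij: "i \<noteq> j" using i \<tau> by auto
  have side: "(x - \<tau> \<ge> b / 4 \<and> i > j) \<or> (\<tau> - x \<ge> b / 4 \<and> i < j)" if "x \<in> stage_window j" for x
  proof (cases "i < j")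
    case True
    then show ?thesis using stage_window_order(1)[OF True i(2) that] by (simp add: b_def)
  next
    case False
    then have "j < i" using ij by simp
    then show ?thesis using stage_window_order(2)[OF \<open>j < i\<close> that i(2)] by (simp add: b_def)
  qed
  have s: "sgn (t - \<tau>) = sgn (b - \<tau>)" "b / 4 \<le> \<bar>t - \<tau>\<bar>" "b / 4 \<le> \<bar>b - \<tau>\<bar>"
    "\<bar>\<bar>t - \<tau>\<bar> - \<bar>b - \<tau>\<bar>\<bar> = \<bar>t - b\<bar>"
    using side[OF tw] side[OF bw] b0 by (auto simp: sgn_if)
  have "norm (mult_kernel (t - \<tau>) - mult_kernel (b - \<tau>)) = \<bar>ln \<bar>t - \<tau>\<bar> - ln \<bar>b - \<tau>\<bar>\<bar>"
    unfolding mult_kernel_def s(1) by (simp add: norm_minus_commute of_real_diff[symmetric] del: of_real_diff)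
  also have "\<dots> \<le> \<bar>t - b\<bar> / (b / 4)" using ln_diff_bound[OF _ s(2,3)] b0 unfolding s(4) by simp
  also have "\<bar>t - b\<bar> = real n * stage_gap j" using stage_gap_pos[of j] by (simp add: t_def b_def stage_node_def abs_mult)
  also have "real n * stage_gap j / (b / 4) \<le> (real (stage_size j) * stage_gap j) / (b / 4)"
    using n b0 stage_gap_pos[of j] by (intro divide_right_mono mult_right_mono) auto
  also have "\<dots> = b / (4 * real (stage_size j))"
    unfolding stage_size_gap b_def[symmetric] using b0 by simp
  finally show ?thesis by (simp only: t_def b_def)
qed

lemma density_abs_integral: "(LINT \<tau>|lborel. \<bar>density \<tau>\<bar>) \<le> 1"
proof -
  have "ennreal (LINT \<tau>|lborel. \<bar>density \<tau>\<bar>) \<le> ennreal 1"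
    using density_mass(1) density_integrable by (subst nn_integral_eq_integral[symmetric]) auto
  then show ?thesis by (subst (asm) ennreal_le_iff) auto
qed

text \<open>The own window gives the signed amplitude. Everything outside it is replaced by its
  value at the left end of the window, which together with \<open>c_g\<close> is the
  \<open>\<kappa>\<close> of the stage. The bound for \<open>\<kappa>\<close> uses only the mass and
  the logarithmic potential of \<open>\<bar>density\<bar>\<close>, hence does not depend on
  \<open>j\<close>.\<close>

lemma stage_multiplier_density:
  assumes j: "1 \<le> j"
  shows "stage_multiplier j (\<bar>c_g\<bar> + (mult_kernel_const + 4))"
proof -
  define b where "b = (1 / 2 :: real) ^ j"
  define W where "W = stage_window j"
  have [measurable]: "W \<in> sets borel" by (simp add: W_def stage_window_def)
  define D where "D t \<tau> = density \<tau> *\<^sub>R mult_kernel (t - \<tau>)" for t \<tau>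
  have Di: "integrable lborel (D t)" if "t \<in> {0..1}" for t
    unfolding D_def by (rule g_mult_kernel_integrable[OF that])
  have N0: "0 < stage_size j" using stage_size_ge[of j] by linarith
  have b01: "b \<in> {0..1}" using node_in_unit[OF j N0] by (simp add: stage_node_def b_def)
  define \<kappa> where "\<kappa> = of_real c_g + (LINT \<tau>|lborel. indicator (- W) \<tau> *\<^sub>R D b \<tau>)"
  have Wi: "integrable lborel (\<lambda>\<tau>. indicator A \<tau> *\<^sub>R D t \<tau>)" if "t \<in> {0..1}" "A \<in> sets borel" for t A
    using that Di by (intro integrable_mult_indicator) auto
  have \<kappa>: "norm \<kappa> \<le> \<bar>c_g\<bar> + (mult_kernel_const + 4)"
  proof -
    have "norm (LINT \<tau>|lborel. indicator (- W) \<tau> *\<^sub>R D b \<tau>) \<le> (LINT \<tau>|lborel. norm (indicator (- W) \<tau> *\<^sub>R D b \<tau>))"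
      by (rule integral_norm_bound)
    also have "\<dots> \<le> (LINT \<tau>|lborel. \<bar>density \<tau>\<bar> * mult_kernel_const + \<bar>density \<tau>\<bar> * 1 * log_weight (\<tau> - b))"
    proof (rule integral_mono_AE[OF _ g_const_log_integrable])
      show "integrable lborel (\<lambda>\<tau>. norm (indicator (- W) \<tau> *\<^sub>R D b \<tau>))" using Wi[OF b01, of "- W"] by (intro integrable_norm) simp
      show "AE \<tau> in lborel. norm (indicator (- W) \<tau> *\<^sub>R D b \<tau>) \<le> \<bar>density \<tau>\<bar> * mult_kernel_const + \<bar>density \<tau>\<bar> * 1 * log_weight (\<tau> - b)"
        using g_mult_kernel_bound[OF b01]
      proof eventually_elim
        case (elim \<tau>)
        have "norm (indicator (- W) \<tau> *\<^sub>R D b \<tau>) \<le> norm (D b \<tau>)" by (simp add: indicator_def)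
        then show ?case using elim unfolding D_def by simp
      qed
    qed
    also have "\<dots> = (LINT \<tau>|lborel. \<bar>density \<tau>\<bar>) * mult_kernel_const + (LINT \<tau>|lborel. \<bar>density \<tau>\<bar> * log_weight (\<tau> - b))"
      using density_integrable density_log_integrable[of b] by simp
    also have "\<dots> \<le> 1 * mult_kernel_const + 4"
      by (intro add_mono mult_right_mono density_abs_integral density_log_bound mult_kernel_const_nonneg)
    finally show ?thesis unfolding \<kappa>_def
      by (intro order_trans[OF norm_triangle_ineq] add_mono) auto
  qed
  have main: "norm (multiplier (stage_node j n) - \<kappa> - of_real (b * stage_sign j n)) \<le> b / real (stage_size j)"
    if n: "n < stage_size j" for n
  proof -
    define t where "t = stage_node j n"
    have t01: "t \<in> {0..1}" unfolding t_def by (rule node_in_unit[OF j n])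
    have "multiplier t = of_real c_g + (LINT \<tau>|lborel. indicator W \<tau> *\<^sub>R D t \<tau> + indicator (- W) \<tau> *\<^sub>R D t \<tau>)"
      unfolding multiplier_def D_def[symmetric]
      by (intro arg_cong2[where f="(+)"] refl Bochner_Integration.integral_cong) (auto simp: indicator_def)
    also have "\<dots> = of_real c_g + ((LINT \<tau>|lborel. indicator W \<tau> *\<^sub>R D t \<tau>) + (LINT \<tau>|lborel. indicator (- W) \<tau> *\<^sub>R D t \<tau>))"
      by (subst Bochner_Integration.integral_add) (use Wi[OF t01] in auto)
    finally have eq: "multiplier t - \<kappa> - of_real (b * stage_sign j n)
      = ((LINT \<tau>|lborel. indicator W \<tau> *\<^sub>R D t \<tau>) - of_real (b * stage_sign j n))
       + (LINT \<tau>|lborel. indicator (- W) \<tau> *\<^sub>R D t \<tau> - indicator (- W) \<tau> *\<^sub>R D b \<tau>)"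
      using Wi[OF t01, of "- W"] Wi[OF b01, of "- W"] by (simp add: \<kappa>_def)
    have 1: "norm ((LINT \<tau>|lborel. indicator W \<tau> *\<^sub>R D t \<tau>) - of_real (b * stage_sign j n)) \<le> b / (4 * real (stage_size j))"
      using own_cell_integral[OF j n] by (simp only: b_def t_def W_def D_def)
    have 2: "norm (LINT \<tau>|lborel. indicator (- W) \<tau> *\<^sub>R D t \<tau> - indicator (- W) \<tau> *\<^sub>R D b \<tau>) \<le> (LINT \<tau>|lborel. \<bar>density \<tau>\<bar> * (b / (4 * real (stage_size j))))"
    proof (rule lebesgue_integral_norm_bound)
      show "integrable lborel (\<lambda>\<tau>. indicator (- W) \<tau> *\<^sub>R D t \<tau> - indicator (- W) \<tau> *\<^sub>R D b \<tau>)"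
        using Wi[OF t01, of "- W"] Wi[OF b01, of "- W"] by auto
      show "integrable lborel (\<lambda>\<tau>. \<bar>density \<tau>\<bar> * (b / (4 * real (stage_size j))))"
        using density_integrable by simp
      fix \<tau>
      show "norm (indicator (- W) \<tau> *\<^sub>R D t \<tau> - indicator (- W) \<tau> *\<^sub>R D b \<tau>) \<le> \<bar>density \<tau>\<bar> * (b / (4 * real (stage_size j)))"
      proof (cases "\<tau> \<in> W \<or> density \<tau> = 0")
        case True
        have "0 \<le> b" by (simp add: b_def)
        then show ?thesis using True by (auto simp: D_def intro!: divide_nonneg_nonneg mult_nonneg_nonneg)
      next
        case False
        have "D t \<tau> - D b \<tau> = density \<tau> *\<^sub>R (mult_kernel (t - \<tau>) - mult_kernel (b - \<tau>))"
          unfolding D_def scaleR_diff_right ..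
        moreover have "norm (mult_kernel (t - \<tau>) - mult_kernel (b - \<tau>)) \<le> b / (4 * real (stage_size j))"
          using outer_kernel_difference[OF j n, of \<tau>] False by (simp add: W_def t_def b_def)
        from mult_left_mono[OF this, of "\<bar>density \<tau>\<bar>"]
        have "\<bar>density \<tau>\<bar> * norm (mult_kernel (t - \<tau>) - mult_kernel (b - \<tau>)) \<le> \<bar>density \<tau>\<bar> * (b / (4 * real (stage_size j)))"
          by simp
        ultimately have "norm (D t \<tau> - D b \<tau>) \<le> \<bar>density \<tau>\<bar> * (b / (4 * real (stage_size j)))"
          by (simp only: norm_scaleR)
        then show ?thesis using False by simp
      qed
    qed
    also have "\<dots> = (LINT \<tau>|lborel. \<bar>density \<tau>\<bar>) * (b / (4 * real (stage_size j)))" by simp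
    also have "\<dots> \<le> 1 * (b / (4 * real (stage_size j)))"
      by (intro mult_right_mono density_abs_integral) (simp add: b_def)
    finally have 2: "norm (LINT \<tau>|lborel. indicator (- W) \<tau> *\<^sub>R D t \<tau> - indicator (- W) \<tau> *\<^sub>R D b \<tau>) \<le> b / (4 * real (stage_size j))" by simp
    have "norm (multiplier t - \<kappa> - of_real (b * stage_sign j n)) \<le> b / (4 * real (stage_size j)) + b / (4 * real (stage_size j))"
      unfolding eq using 1 2 by (intro order_trans[OF norm_triangle_ineq] add_mono)
    also have "\<dots> = b / real (stage_size j) / 2" by simp
    also have "\<dots> \<le> b / real (stage_size j)"
    proof -
      have half: "x / 2 \<le> x" if "0 \<le> x" for x :: real using that by simp
      show ?thesis by (rule half) (simp add: b_def)
    qed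
    finally show ?thesis by (simp only: t_def)
  qed
  have gap1: "stage_gap j \<le> 1" using stage_gap_le[of j] by simp
  show ?thesis
    unfolding stage_multiplier_def
  proof (rule exI[of _ b], rule exI[of _ "stage_gap j"], rule exI[of _ \<kappa>], intro conjI allI impI)
    fix k :: nat assume "k < 2 ^ (2 * j\<^sup>2 + 1)"
    then have k: "k < stage_size j" by (simp add: stage_size_def)
    have node: "b + real k * stage_gap j = stage_node j k" by (simp add: b_def stage_node_def)
    show "b + real k * stage_gap j \<in> {0..1}" unfolding node by (rule node_in_unit[OF j k])
    show "norm (multiplier (b + real k * stage_gap j) - \<kappa> - of_real ((1 / 2) ^ j * snd (rudin_shapiro (2 * j\<^sup>2 + 1) k))) \<le> (1 / 2) ^ j / 2 ^ (2 * j\<^sup>2 + 1)"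
    proof -
      have N: "real (stage_size j) = 2 ^ (2 * j\<^sup>2 + 1)" by (simp only: stage_size_def of_nat_power of_nat_numeral)
      show ?thesis using main[OF k] unfolding node stage_sign_def[symmetric] N[symmetric] by (simp only: b_def)
    qed
  qed (use \<kappa> gap1 stage_gap_pos[of j] in auto)
qed

end

section \<open>Integrals over the circle and the Young function\<close>

lemma cos_pos_octant: "\<theta> \<in> {0..pi / 4} \<Longrightarrow> 0 < cos \<theta>"
proof -
  assume "\<theta> \<in> {0..pi / 4}"
  then have "0 \<le> \<theta>" "\<theta> \<le> pi / 4" by auto
  then show "0 < cos \<theta>" using pi_gt_zero by (intro cos_gt_zero_pi) linarith+
qed

context slope_kernel
begin

text \<open>On the octant the tangent runs through [0, 1] and \<open>1 + tan\<^sup>2\<close> is the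
  inverse square of the cosine. On the rest of the circle the cosine is not positive or the tangent
  is outside [0, 1].\<close>

lemma Omega_circle:
  assumes "\<theta> \<in> {0..<2 * pi}"
  shows "Omega (vector [cos \<theta>, sin \<theta>]) = (g (tan \<theta>) * inverse ((cos \<theta>)\<^sup>2)) * indicator {0..pi / 4} \<theta>"
proof -
  have Om: "Omega (vector [cos \<theta>, sin \<theta>]) = (if 0 < cos \<theta> then (1 + (tan \<theta>)\<^sup>2) * g (tan \<theta>) else 0)"
    by (simp add: Omega_def tan_def)
  consider "\<theta> \<le> pi / 4" | "pi / 4 < \<theta>" "\<theta> < pi / 2" | "pi / 2 \<le> \<theta>" "\<theta> \<le> 3 * pi / 2" | "3 * pi / 2 < \<theta>"
    by linarith
  then show ?thesis
  proof cases
    case 1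
    then have c: "0 < cos \<theta>" using assms by (intro cos_pos_octant) simp
    then show ?thesis using 1 assms tan_sec[of \<theta>] by (simp add: Om power_inverse)
  next
    case 2
    have "tan (pi / 4) < tan \<theta>" using 2 pi_gt_zero by (intro tan_monotone) auto
    then have "g (tan \<theta>) = 0" by (intro g_support) (simp add: tan_45)
    then show ?thesis using 2 by (simp add: Om)
  next
    case 3
    have "0 \<le> cos (\<theta> - pi)" using 3 by (intro cos_ge_zero) auto
    then have "\<not> 0 < cos \<theta>" by simp
    moreover have "\<not> \<theta> \<le> pi / 4" using 3 pi_gt_zero by linarith
    ultimately show ?thesis by (simp add: Om)
  next
    case 4
    have "tan (\<theta> - 2 * pi) < 0" using 4 assms by (intro tan_less_zero) auto
    moreover have "tan (\<theta> - 2 * pi) = tan \<theta>" by (simp add: tan_def sin_diff cos_diff)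
    ultimately have "g (tan \<theta>) = 0" by (intro g_support) simp
    then show ?thesis using 4 pi_gt_zero by (simp add: Om)
  qed
qed

lemma circle_map_measurable:
  "(\<lambda>\<theta>. vector [cos \<theta>, sin \<theta>]) \<in> restrict_space lborel {0..<2 * pi} \<rightarrow>\<^sub>M restrict_space borel unit_circle"
  unfolding pt_def[symmetric]
proof (rule measurable_restrict_space2)
  show "(\<lambda>\<theta>. pt (cos \<theta>) (sin \<theta>)) \<in> space (restrict_space lborel {0..<2 * pi}) \<rightarrow> unit_circle"
    by (simp add: norm_pt)
  have "(\<lambda>\<theta>. pt (cos \<theta>) (sin \<theta>)) \<in> borel_measurable lborel" by measurable
  then show "(\<lambda>\<theta>. pt (cos \<theta>) (sin \<theta>)) \<in> borel_measurable (restrict_space lborel {0..<2 * pi})"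
    by (rule measurable_restrict_space1)
qed

lemma Omega_arc_measurable: "Omega \<in> borel_measurable arc_length"
proof -
  have "Omega \<in> borel_measurable (restrict_space borel unit_circle)"
    by (rule measurable_restrict_space1[OF Omega_measurable])
  then show ?thesis unfolding arc_length_def measurable_distr_eq1 .
qed

lemma tan_substitution:
  shows "\<theta> \<in> {0..pi / 4} \<Longrightarrow> (tan has_real_derivative inverse ((cos \<theta>)\<^sup>2)) (at \<theta>)"
    and "continuous_on {0..pi / 4} (\<lambda>\<theta>. inverse ((cos \<theta>)\<^sup>2))"
proof -
  have c: "cos \<theta> \<noteq> 0" if "\<theta> \<in> {0..pi / 4}" for \<theta>
    using cos_pos_octant[OF that] by simp
  show "\<theta> \<in> {0..pi / 4} \<Longrightarrow> (tan has_real_derivative inverse ((cos \<theta>)\<^sup>2)) (at \<theta>)"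
    using c by (intro DERIV_tan)
  show "continuous_on {0..pi / 4} (\<lambda>\<theta>. inverse ((cos \<theta>)\<^sup>2))"
    using c by (intro continuous_intros) auto
qed

text \<open>The inverse square of the cosine is the derivative of the tangent, so the substitution
  \<tau> = tan \<theta> turns the integral over the circle into that of \<open>g\<close>.\<close>

lemma Omega_arc_integral:
  shows "integrable arc_length Omega" and "(LINT v|arc_length. Omega v) = 0"
proof -
  have gi: "set_integrable lborel {tan 0..tan (pi / 4)} g"
    unfolding set_integrable_def using g_integrable by (intro integrable_mult_indicator) auto
  note sub = integral_substitution[OF gi tan_substitution]
  have *: "indicator {0..<2 * pi} \<theta> *\<^sub>R Omega (vector [cos \<theta>, sin \<theta>]) = (g (tan \<theta>) * inverse ((cos \<theta>)\<^sup>2)) * indicator {0..pi / 4} \<theta>" for \<theta>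
  proof -
    have "\<theta> \<in> {0..pi / 4} \<Longrightarrow> \<theta> \<in> {0..<2 * pi}" using pi_gt_zero by (simp, linarith)
    then show ?thesis using Omega_circle[of \<theta>] by (cases "\<theta> \<in> {0..<2 * pi}") (auto simp: indicator_def)
  qed
  have "integrable (restrict_space lborel {0..<2 * pi}) (\<lambda>\<theta>. Omega (vector [cos \<theta>, sin \<theta>]))"
  proof (subst integrable_restrict_space)
    show "integrable lborel (\<lambda>\<theta>. indicator {0..<2 * pi} \<theta> *\<^sub>R Omega (vector [cos \<theta>, sin \<theta>]))"
      using sub(1) unfolding * set_integrable_def by (simp add: mult.commute)
  qed simp
  then show "integrable arc_length Omega"
    unfolding arc_length_def
    by (subst integrable_distr_eq[OF circle_map_measurable]) (simp_all add: measurable_restrict_space1[OF Omega_measurable])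
  have "(LINT v|arc_length. Omega v) = (LINT \<theta>|restrict_space lborel {0..<2 * pi}. Omega (vector [cos \<theta>, sin \<theta>]))"
    unfolding arc_length_def
    by (rule integral_distr[OF circle_map_measurable]) (simp add: measurable_restrict_space1[OF Omega_measurable])
  also have "\<dots> = (LINT \<theta>|lborel. (g (tan \<theta>) * inverse ((cos \<theta>)\<^sup>2)) * indicator {0..pi / 4} \<theta>)"
    by (subst integral_restrict_space) (simp, simp only: *)
  also have "\<dots> = (LINT \<tau>|lborel. g \<tau> * indicator {tan 0..tan (pi / 4)} \<tau>)"
    using sub(2) by simp
  also have "\<dots> = (LINT \<tau>|lborel. g \<tau>)"
    by (intro Bochner_Integration.integral_cong) (use g_support in \<open>auto simp: indicator_def tan_45\<close>)
  finally show "(LINT v|arc_length. Omega v) = 0" using g_mean by simp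
qed

text \<open>The factor \<open>inverse ((cos \<theta>)\<^sup>2)\<close> lies between 1 and 2 on the
  octant. Inside \<open>G\<close>, whose growth under doubling is not controlled, it is absorbed by
  passing to \<open>H\<close>; as it is at least 1 it may also be inserted as the density that the
  substitution requires.\<close>

lemma Omega_arc_nn_integral_le:
  fixes G H :: "real \<Rightarrow> ennreal"
  assumes [measurable]: "G \<in> borel_measurable borel" "H \<in> borel_measurable borel"
    and "G 0 = 0" and GH: "\<And>x c. 1 \<le> c \<Longrightarrow> c \<le> 2 \<Longrightarrow> G (x * c) \<le> H x"
  shows "(\<integral>\<^sup>+v. G (Omega v) \<partial>arc_length) \<le> (\<integral>\<^sup>+\<tau>. H (g \<tau>) \<partial>lborel)"
proof -
  have "(\<integral>\<^sup>+v. G (Omega v) \<partial>arc_length) = (\<integral>\<^sup>+\<theta>. G (Omega (vector [cos \<theta>, sin \<theta>])) \<partial>restrict_space lborel {0..<2 * pi})"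
    unfolding arc_length_def
    by (rule nn_integral_distr[OF circle_map_measurable])
      (use Omega_measurable in \<open>simp add: measurable_restrict_space1\<close>)
  also have "\<dots> = (\<integral>\<^sup>+\<theta>. G (Omega (vector [cos \<theta>, sin \<theta>])) * indicator {0..<2 * pi} \<theta> \<partial>lborel)"
    by (rule nn_integral_restrict_space) simp
  also have "\<dots> \<le> (\<integral>\<^sup>+\<theta>. H (g (tan \<theta>)) * ennreal (inverse ((cos \<theta>)\<^sup>2)) * indicator {0..pi / 4} \<theta> \<partial>lborel)"
  proof (rule nn_integral_mono)
    fix \<theta> :: real
    show "G (Omega (vector [cos \<theta>, sin \<theta>])) * indicator {0..<2 * pi} \<theta> \<le> H (g (tan \<theta>)) * ennreal (inverse ((cos \<theta>)\<^sup>2)) * indicator {0..pi / 4} \<theta>"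
    proof (cases "\<theta> \<in> {0..pi / 4}")
      case True
      then have c: "0 < cos \<theta>" by (rule cos_pos_octant)
      have \<theta>: "0 \<le> \<theta>" "\<theta> \<le> pi / 4" "\<theta> < pi / 2" "pi / 4 < pi / 2" "- (pi / 2) < \<theta>"
        using True pi_gt_zero by (simp_all, linarith+)
      have r: "\<theta> \<in> {0..<2 * pi}" using \<theta> pi_gt_zero by (simp, linarith)
      have "0 \<le> tan \<theta>" using \<theta> by (intro tan_pos_pi2_le) simp
      have "tan \<theta> \<le> tan (pi / 4)" using \<theta> by (intro tan_mono_le)
      with \<open>0 \<le> tan \<theta>\<close> have "(tan \<theta>)\<^sup>2 \<le> 1" by (simp add: tan_45 power_le_one)
      then have b: "1 \<le> inverse ((cos \<theta>)\<^sup>2)" "inverse ((cos \<theta>)\<^sup>2) \<le> 2"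
        using c tan_sec[of \<theta>] zero_le_power2[of "tan \<theta>"] unfolding power_inverse[symmetric] by (linarith, linarith)
      have "G (Omega (vector [cos \<theta>, sin \<theta>])) \<le> H (g (tan \<theta>)) * 1"
        using GH[OF b] True r by (simp add: Omega_circle)
      also have "\<dots> \<le> H (g (tan \<theta>)) * ennreal (inverse ((cos \<theta>)\<^sup>2))"
        by (intro mult_left_mono) (use b(1) in auto)
      finally show ?thesis using True r by simp
    next
      case False
      then show ?thesis using Omega_circle[of \<theta>] assms(3) by (auto simp: indicator_def)
    qed
  qed
  also have "\<dots> = (\<integral>\<^sup>+\<tau>. H (g \<tau>) * indicator {tan 0..tan (pi / 4)} \<tau> \<partial>lborel)"
    by (rule nn_integral_substitution_aux[OF _ _ tan_substitution, symmetric]) auto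
  also have "\<dots> \<le> (\<integral>\<^sup>+\<tau>. H (g \<tau>) \<partial>lborel)"
    by (intro nn_integral_mono) (simp add: indicator_def)
  finally show ?thesis .
qed

end

lemma young_function_mono:
  assumes "young_function \<Phi>"
  shows "\<Phi> 0 = 0" and "mono_on {0..} \<Phi>"
proof -
  obtain \<phi> where nn: "\<And>u. 0 \<le> u \<Longrightarrow> 0 \<le> \<phi> u" and mono: "mono_on {0..} \<phi>"
    and I: "\<And>t. 0 \<le> t \<Longrightarrow> \<Phi> t = integral {0..t} \<phi>"
    using assms unfolding young_function_def by metis
  show "\<Phi> 0 = 0" using I[of 0] by simp
  have int: "\<phi> integrable_on {0..t}" for t
    by (rule integrable_on_mono_on) (rule mono_on_subset[OF mono], auto)
  show "mono_on {0..} \<Phi>"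
  proof (rule mono_onI)
    fix s t :: real assume "s \<in> {0..}" "s \<le> t"
    then show "\<Phi> s \<le> \<Phi> t"
      using int nn by (simp add: I) (rule integral_subset_le, auto)
  qed
qed

text \<open>Let T = 2 c / d be twice the height of a spike, c being its mass. For small d the
  hypothesis gives \<Phi>(T) \<le> T ln(e + T) / (3 N), whence N d \<Phi>(T) \<le> (2/3) c ln(e +
  T). Since ln T is asymptotic to ln(1/d), the right side tends to (2/3) 2^-j, below the required
  2^-j. The second condition holds because c tends to 0. The factor 2 in T accounts for the inverse
  square of the cosine in \<open>Omega\<close>.\<close>

lemma stage_width_exists:
  fixes \<Phi> :: "real \<Rightarrow> real"
  assumes lim: "filterlim (\<lambda>t. t * ln (exp 1 + t) / \<Phi> t) at_top at_top"
  shows "\<exists>d>0. d \<le> stage_gap j / 4 \<and>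
    8 * (real (stage_size j))\<^sup>2 * stage_coef j d * (1 + mult_kernel_const + stage_log j) \<le> (1 / 2) ^ j \<and>
    real (stage_size j) * (d * \<Phi> (2 * (stage_coef j d / d))) \<le> (1 / 2) ^ j"
proof -
  define a :: real where "a = (1 / 2) ^ j"
  define N where "N = real (stage_size j)"
  define X where "X = 8 * N\<^sup>2 * (1 + mult_kernel_const + stage_log j)"
  define T where "T d = 2 * (stage_coef j d / d)" for d
  have a: "0 < a" by (simp add: a_def)
  have N: "1 \<le> N" unfolding N_def by (rule stage_size_ge)
  have coef: "stage_coef j d = a / (1 + ln (1 / d))" for d by (simp add: stage_coef_def a_def)
  have "((\<lambda>d. X * (a / (1 + ln (1 / d)))) \<longlongrightarrow> 0) (at_right 0)" by real_asymp
  then have 1: "\<forall>\<^sub>F d in at_right 0. X * (a / (1 + ln (1 / d))) < a" using a by (rule order_tendstoD)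
  have "filterlim (\<lambda>d. 2 * (a / (1 + ln (1 / d)) / d)) at_top (at_right 0)" using a by real_asymp
  then have Tt: "filterlim T at_top (at_right 0)" unfolding T_def coef .
  have "\<forall>\<^sub>F t in at_top. 3 * N \<le> t * ln (exp 1 + t) / \<Phi> t \<and> 0 < t"
    using lim filterlim_at_top[of "\<lambda>t. t * ln (exp 1 + t) / \<Phi> t"] by (intro eventually_conj eventually_gt_at_top) blast
  then have 2: "\<forall>\<^sub>F d in at_right 0. 3 * N \<le> T d * ln (exp 1 + T d) / \<Phi> (T d) \<and> 0 < T d"
    using Tt unfolding filterlim_iff by blast
  have "((\<lambda>d. 2 * (a / (1 + ln (1 / d))) * ln (exp 1 + 2 * (a / (1 + ln (1 / d)) / d))) \<longlongrightarrow> 2 * a) (at_right 0)"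
    using a by real_asymp
  then have 3: "\<forall>\<^sub>F d in at_right 0. 2 * stage_coef j d * ln (exp 1 + T d) < 3 * a"
    unfolding T_def coef using a by (intro order_tendstoD(2)) auto
  have 4: "\<forall>\<^sub>F d in at_right 0. d \<in> {0<..<stage_gap j / 4}"
    using stage_gap_pos[of j] by (intro eventually_at_right_real) simp
  have "\<forall>\<^sub>F d in at_right 0. X * (a / (1 + ln (1 / d))) < a \<and> (3 * N \<le> T d * ln (exp 1 + T d) / \<Phi> (T d) \<and> 0 < T d)
      \<and> 2 * stage_coef j d * ln (exp 1 + T d) < 3 * a \<and> d \<in> {0<..<stage_gap j / 4}"
    by (intro eventually_conj 1 2 3 4)
  then obtain d where d: "X * (a / (1 + ln (1 / d))) < a" "3 * N \<le> T d * ln (exp 1 + T d) / \<Phi> (T d)" "0 < T d"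
      "2 * stage_coef j d * ln (exp 1 + T d) < 3 * a" "0 < d" "d < stage_gap j / 4"
    using eventually_happens'[OF trivial_limit_at_right_real] by fastforce
  have pos: "0 < T d * ln (exp 1 + T d)"
    using d(3) add_strict_increasing2[of "T d" 1 "exp 1"] by (intro mult_pos_pos ln_gt_zero) (auto simp: add.commute)
  \<comment> \<open>Division by zero yields 0, so the lower bound \<open>3 * N\<close> on the
    quotient also rules out \<open>\<Phi> (T d) = 0\<close>.\<close>
  have "0 < T d * ln (exp 1 + T d) / \<Phi> (T d)" using d(2) N by linarith
  then have "0 < \<Phi> (T d)" using pos by (simp add: zero_less_divide_iff)
  then have "3 * N * \<Phi> (T d) \<le> T d * ln (exp 1 + T d)" using d(2) by (simp add: pos_le_divide_eq)
  then have "d * (3 * N * \<Phi> (T d)) \<le> d * (T d * ln (exp 1 + T d))" using d(5) by (intro mult_left_mono) auto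
  also have "\<dots> = 2 * stage_coef j d * ln (exp 1 + T d)" using d(5) by (simp add: T_def)
  also have "\<dots> \<le> 3 * a" using d(4) by simp
  finally have "N * (d * \<Phi> (T d)) \<le> a" by (simp add: algebra_simps)
  moreover have "8 * N\<^sup>2 * stage_coef j d * (1 + mult_kernel_const + stage_log j) \<le> a"
  proof -
    have "8 * N\<^sup>2 * stage_coef j d * (1 + mult_kernel_const + stage_log j) = X * (a / (1 + ln (1 / d)))"
      by (simp add: X_def coef)
    then show ?thesis using d(1) by simp
  qed
  ultimately show ?thesis using d(5,6) unfolding N_def T_def a_def by (intro exI[of _ d]) auto
qed

context bump_stages
begin

text \<open>Within a stage the modulus of the density takes the single nonzero value
  \<open>coef j / \<delta> j\<close>, on cells of measure \<open>\<delta> j\<close>. The windows are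
  disjoint, so the modular is the sum of the modulars of the stages, dominated by a geometric
  series.\<close>

lemma density_modular_le:
  fixes G :: "real \<Rightarrow> ennreal"
  assumes [measurable]: "G \<in> borel_measurable borel" and "G 0 = 0" and even: "\<And>x. G \<bar>x\<bar> = G x"
    and le: "\<And>j. 1 \<le> j \<Longrightarrow> of_nat (stage_size j) * (ennreal (\<delta> j) * G (coef j / \<delta> j)) \<le> ennreal ((1 / 2) ^ j)"
  shows "(\<integral>\<^sup>+\<tau>. G (density \<tau>) \<partial>lborel) \<le> 1"
proof -
  have st: "(\<integral>\<^sup>+\<tau>. G (stage j \<tau>) \<partial>lborel) \<le> ennreal ((1 / 2) ^ j)" if j: "1 \<le> j" for j
  proof -
    have "(\<integral>\<^sup>+\<tau>. G (stage j \<tau>) \<partial>lborel) \<le> (\<integral>\<^sup>+\<tau>. (\<Sum>n<stage_size j. G (coef j / \<delta> j) * indicator (cell j n) \<tau>) \<partial>lborel)"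
    proof (rule nn_integral_mono)
      fix \<tau>
      show "G (stage j \<tau>) \<le> (\<Sum>n<stage_size j. G (coef j / \<delta> j) * indicator (cell j n) \<tau>)"
      proof (cases "\<exists>n<stage_size j. \<tau> \<in> cell j n")
        case True
        then obtain n where n: "n < stage_size j" "\<tau> \<in> cell j n" by blast
        have "G (stage j \<tau>) = G \<bar>stage_sign j n * (coef j / \<delta> j)\<bar>" by (simp only: stage_in_cell[OF j n] even)
        also have "\<dots> = G (coef j / \<delta> j)"
          using coef_pos[OF j] \<delta>_pos[OF j] by (simp only: abs_mult stage_sign_abs) simp
        also have "\<dots> = G (coef j / \<delta> j) * indicator (cell j n) \<tau>" using n by simp
        also have "\<dots> \<le> (\<Sum>n<stage_size j. G (coef j / \<delta> j) * indicator (cell j n) \<tau>)"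
          using n(1) by (intro member_le_sum) auto
        finally show ?thesis .
      next
        case False
        then show ?thesis using stage_outside_cells[of j \<tau>] assms(2) by auto
      qed
    qed
    also have "\<dots> = (\<Sum>n<stage_size j. G (coef j / \<delta> j) * ennreal (\<delta> j))"
      by (subst nn_integral_sum) (simp_all add: nn_integral_cmult_indicator cell_mass[OF j])
    also have "\<dots> = of_nat (stage_size j) * (ennreal (\<delta> j) * G (coef j / \<delta> j))" by (simp add: mult.commute)
    finally show ?thesis using le[OF j] by (rule order_trans)
  qed
  have "(\<integral>\<^sup>+\<tau>. G (density \<tau>) \<partial>lborel) = (\<integral>\<^sup>+\<tau>. (\<Sum>j. G (stage (Suc j) \<tau>)) \<partial>lborel)"
    by (simp only: density_lift[where G=G, OF assms(2)])
  also have "\<dots> = (\<Sum>j. \<integral>\<^sup>+\<tau>. G (stage (Suc j) \<tau>) \<partial>lborel)" by (rule nn_integral_suminf) measurable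
  also have "\<dots> \<le> (\<Sum>j. ennreal (1 * (1 / 2) ^ Suc j))"
  proof (rule suminf_le)
    show "(\<integral>\<^sup>+\<tau>. G (stage (Suc j) \<tau>) \<partial>lborel) \<le> ennreal (1 * (1 / 2) ^ Suc j)" for j
      unfolding mult_1 by (rule st) simp
  qed auto
  also have "\<dots> = 1" by (simp only: suminf_geometric_half[OF zero_le_one] ennreal_1)
  finally show ?thesis .
qed

end

theorem theorem2p1:
  fixes \<Phi> :: "real \<Rightarrow> real"
  assumes "young_function \<Phi>"
    and "filterlim (\<lambda>t. t * ln (exp 1 + t) / \<Phi> t) at_top at_top"
  shows "\<exists>\<Omega> \<in> class_\<Phi>L \<Phi>.
           integrable arc_length \<Omega> \<and> (LINT \<theta>|arc_length. \<Omega> \<theta>) = 0 \<and>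
           (\<forall>p>1. bounded_on_Lp (rough_T \<Omega>) p \<longleftrightarrow> p = 2) \<and>
           \<not> weak_type_1_1 (rough_T \<Omega>)"
proof -
  note \<Phi> = young_function_mono[OF assms(1)]
  obtain \<delta> where \<delta>: "\<And>j. 0 < \<delta> j" "\<And>j. \<delta> j \<le> stage_gap j / 4"
      "\<And>j. 8 * (real (stage_size j))\<^sup>2 * stage_coef j (\<delta> j) * (1 + mult_kernel_const + stage_log j) \<le> (1 / 2) ^ j"
      "\<And>j. real (stage_size j) * (\<delta> j * \<Phi> (2 * (stage_coef j (\<delta> j) / \<delta> j))) \<le> (1 / 2) ^ j"
    using stage_width_exists[OF assms(2)] by metis
  interpret bump_stages \<delta>
    by unfold_locales (use \<delta> in auto)
  \<comment> \<open>\<open>\<Phi>\<close> is controlled on nonnegative arguments only.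
    \<open>F\<close> agrees with it there and is monotone, hence measurable, on all reals.\<close>
  define F where "F t = \<Phi> (max 0 t)" for t
  have "mono F"
    unfolding F_def by (intro monoI mono_onD[OF \<Phi>(2)]) auto
  then have [measurable]: "F \<in> borel_measurable borel" by (rule borel_measurable_mono)
  have F: "F \<bar>x\<bar> = \<Phi> \<bar>x\<bar>" for x by (simp add: F_def)
  have nonneg: "0 \<le> \<Phi> t" if "0 \<le> t" for t
    using mono_onD[OF \<Phi>(2), of 0 t] \<Phi>(1) that by simp
  define H where "H x = ennreal (F (2 * \<bar>x\<bar>))" for x
  have "(\<integral>\<^sup>+v. ennreal (\<Phi> \<bar>Omega v\<bar>) \<partial>arc_length) = (\<integral>\<^sup>+v. ennreal (F \<bar>Omega v\<bar>) \<partial>arc_length)"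
    by (simp only: F)
  also have "\<dots> \<le> (\<integral>\<^sup>+\<tau>. H (density \<tau>) \<partial>lborel)"
  proof (rule Omega_arc_nn_integral_le[where G="\<lambda>x. ennreal (F \<bar>x\<bar>)" and H=H])
    show "ennreal (F \<bar>x * c\<bar>) \<le> H x" if "1 \<le> c" "c \<le> 2" for x c :: real
      unfolding H_def using that mult_right_mono[of c 2 "\<bar>x\<bar>"]
      by (intro ennreal_leI monoD[OF \<open>mono F\<close>]) (simp add: abs_mult mult.commute)
    show "(\<lambda>x. ennreal (F \<bar>x\<bar>)) \<in> borel_measurable borel" by measurable
    show "H \<in> borel_measurable borel" unfolding H_def by measurable
  qed (simp_all add: F_def \<Phi>(1))
  also have "\<dots> \<le> 1"
  proof (rule density_modular_le[where G=H])
    show "H \<in> borel_measurable borel" unfolding H_def by measurable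
    fix j :: nat assume j: "1 \<le> j"
    have p: "0 \<le> coef j / \<delta> j" using coef_pos[OF j] \<delta>(1)[of j] by simp
    have "of_nat (stage_size j) * (ennreal (\<delta> j) * H (coef j / \<delta> j))
        = ennreal (real (stage_size j) * (\<delta> j * \<Phi> (2 * (coef j / \<delta> j))))"
      using p nonneg[of "2 * (coef j / \<delta> j)"] \<delta>(1)[of j] coef_pos[OF j]
      by (simp add: H_def F_def ennreal_of_nat_eq_real_of_nat ennreal_mult[symmetric] mult.assoc)
    also have "\<dots> \<le> ennreal ((1 / 2) ^ j)"
      by (intro ennreal_leI) (use \<delta>(4)[of j] in \<open>simp add: coef_def\<close>)
    finally show "of_nat (stage_size j) * (ennreal (\<delta> j) * H (coef j / \<delta> j)) \<le> ennreal ((1 / 2) ^ j)" .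
  qed (simp_all add: H_def F_def \<Phi>(1))
  finally have "(\<integral>\<^sup>+v. ennreal (\<Phi> \<bar>Omega v\<bar>) \<partial>arc_length) < \<infinity>"
    by (rule order.strict_trans1) simp
  then have "Omega \<in> class_\<Phi>L \<Phi>"
    unfolding class_\<Phi>L_def using Omega_arc_measurable by simp
  then show ?thesis
    using Omega_arc_integral stage_multiplier_conclusion[OF stage_multiplier_density] by blast
qed

end
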